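(* Let $k\in\{3,4\}$. For all $m\ge 0$ and $p,q\in[1,\infty]$ which are compatible with the inclusion $W^{k+1,p}(T)\hookrightarrow W^{m,q}(T)$, there holds $$\|v-\Pi_k^Tv\|_{W^{m,q}(T)}\le C\,h_T^{\,k+1-m+\frac2q-\frac2p}\,\|v\|_{W^{k+1,p}(T)}\qquad\text{for all } v\in W^{k+1,p}(T)$$ and all $T\in\mathcal{T}_h$, where $h_T=\mathrm{diam}(T)$ and $C>0$ is a constant independent of $h$, $T\in\mathcal{T}_h$ and $v$.
   Context: $\{\mathcal{T}_h\}$, $h\in(0,1)$, is a quasi-uniform family of triangulations of a bounded domain $\Omega\subset\mathbf{R}^2$ such that every triangle of $\mathcal{T}_h$ has two type I edges. For an edge $e$ with unit normal $n=(n_1,n_2)$ and unit tangent $\tau$, put $\bar n:=(n_1,-n_2)$ and $\partial_{\bar n}v:=\nabla v\cdot\bar n$. The edge $e$ is type I if $\bar n=\pm\tau$ (equivalently, $e$ makes an angle $\pm\pi/4$ with the $x$-axis), and type II otherwise. Let $T$ have vertices $a_1,a_2,a_3$; $e_i$ is the edge not containing $a_i$, $b_i$ the midpoint of $e_i$, $a_{ij}:=\frac12(a_i+a_j)$, $a_{ij\ell}:=\frac13(a_i+a_j+a_\ell)$. Label $T$ so that $e_3$ is its type II edge; below $\bar n$ is taken with respect to $e_3$. Element $S_3^h$: polynomial space $\mathbb{P}_3(T)$ (degree at most 3), degrees of freedom $$\Sigma_T:\quad v(a_i)\ (1\le i\le 3);\quad v(a_{i3})\ (i=1,2);\quad \nabla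 v(a_i)\cdot(a_j-a_i)\ (i=1,2,\ 1\le j\le 3,\ j\ne i);\quad \partial_{\bar n}v(b_3).$$ Element $S_4^h$: polynomial space $\mathbb{P}_4(T)$ (degree at most 4), degrees of freedom $$\Xi_T:\quad v(a_i)\ (1\le i\le 3);\quad v(a_{ii3}),\,v(a_{i33})\ (i=1,2);\quad v(b_3);\quad v(a_{123});$$ $$\nabla v(a_i)\cdot(a_j-a_i)\ (i=1,2,\ 1\le j\le 3,\ j\ne i);\quad \partial_{\bar n}v(a_{112}),\ \partial_{\bar n}v(a_{122}).$$ Both sets are unisolvent. $\Pi_k^Tv\in\mathbb{P}_k(T)$ denotes the interpolant of $v$ associated with $S_k^h$: the unique polynomial in $\mathbb{P}_k(T)$ at which all degrees of freedom of $S_k^h$ on $T$ take the same values as at $v$. *)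

theory Defs
  imports "HOL-Analysis.Analysis" "HOL-Probability.Essential_Supremum"
begin

type_synonym point = "real \<times> real"

definition Lp_space :: "ereal \<Rightarrow> point set \<Rightarrow> (point \<Rightarrow> real) set" where
  "Lp_space p U = {v \<in> borel_measurable (lebesgue_on U).
     if p = \<infinity> then esssup (lebesgue_on U) (\<lambda>x. ereal \<bar>v x\<bar>) < \<infinity>
     else integrable (lebesgue_on U) (\<lambda>x. \<bar>v x\<bar> powr real_of_ereal p)}"

definition Lp_norm :: "ereal \<Rightarrow> point set \<Rightarrow> (point \<Rightarrow> real) \<Rightarrow> real" where
  "Lp_norm p U v =
    (if p = \<infinity> then real_of_ereal (esssup (lebesgue_on U) (\<lambda>x. ereal \<bar>v x\<bar>))
     else (LINT x|lebesgue_on U. \<bar>v x\<bar> powr real_of_ereal p) powr (1 / real_of_ereal p))"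

text \<open>
  \<open>has_partials \<phi> D\<close>: the function \<open>\<phi>\<close> is infinitely differentiable on the whole plane, and
  \<open>D i j\<close> is its partial derivative of order \<open>i\<close> in the first and \<open>j\<close> in the second variable.
  (All \<open>D i j\<close> are Frechet differentiable, hence continuous; they are determined by \<open>\<phi>\<close>.)
\<close>

definition has_partials :: "(point \<Rightarrow> real) \<Rightarrow> (nat \<Rightarrow> nat \<Rightarrow> point \<Rightarrow> real) \<Rightarrow> bool" where
  "has_partials \<phi> D \<longleftrightarrow> D 0 0 = \<phi> \<and>
    (\<forall>i j x. (D i j has_derivative
               (\<lambda>(s, t). s * D (Suc i) j x + t * D i (Suc j) x)) (at x))"

definition locally_integrable :: "point set \<Rightarrow> (point \<Rightarrow> real) \<Rightarrow> bool" where
  "locally_integrable U v \<longleftrightarrow>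
    (\<forall>K. compact K \<and> K \<subseteq> U \<longrightarrow> v absolutely_integrable_on K)"

text \<open>\<open>has_weak_deriv U (i, j) v w\<close>: on \<open>U\<close>, \<open>w\<close> is the weak derivative of \<open>v\<close> of multi-index
  \<open>(i, j)\<close>, tested against smooth functions with compact support in \<open>U\<close>.\<close>

definition has_weak_deriv ::
    "point set \<Rightarrow> nat \<times> nat \<Rightarrow> (point \<Rightarrow> real) \<Rightarrow> (point \<Rightarrow> real) \<Rightarrow> bool" where
  "has_weak_deriv U \<alpha> v w \<longleftrightarrow>
    locally_integrable U v \<and> locally_integrable U w \<and>
    (\<forall>\<phi> D. has_partials \<phi> D \<and> compact (closure {x. \<phi> x \<noteq> 0}) \<and> closure {x. \<phi> x \<noteq> 0} \<subseteq> U \<longrightarrow>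
       (LINT x|lebesgue_on U. v x * D (fst \<alpha>) (snd \<alpha>) x) =
       (-1) ^ (fst \<alpha> + snd \<alpha>) * (LINT x|lebesgue_on U. w x * \<phi> x))"

definition weak_deriv :: "point set \<Rightarrow> nat \<times> nat \<Rightarrow> (point \<Rightarrow> real) \<Rightarrow> point \<Rightarrow> real" where
  "weak_deriv U \<alpha> v = (SOME w. has_weak_deriv U \<alpha> v w)"

definition multi_indices :: "nat \<Rightarrow> (nat \<times> nat) set" where
  "multi_indices k = {(i, j). i + j \<le> k}"

text \<open>The elements of the space are functions on the plane of which only the values on \<open>U\<close>,
  up to null sets, matter.\<close>

definition sobolev_space :: "nat \<Rightarrow> ereal \<Rightarrow> point set \<Rightarrow> (point \<Rightarrow> real) set" where
  "sobolev_space k p U =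
    {v. \<forall>\<alpha>\<in>multi_indices k. \<exists>w. has_weak_deriv U \<alpha> v w \<and> w \<in> Lp_space p U}"

definition sobolev_norm :: "nat \<Rightarrow> ereal \<Rightarrow> point set \<Rightarrow> (point \<Rightarrow> real) \<Rightarrow> real" where
  "sobolev_norm k p U v =
    (if p = \<infinity> then (MAX \<alpha>\<in>multi_indices k. Lp_norm p U (weak_deriv U \<alpha> v))
     else (\<Sum>\<alpha>\<in>multi_indices k. Lp_norm p U (weak_deriv U \<alpha> v) powr real_of_ereal p)
            powr (1 / real_of_ereal p))"

definition sobolev_embedding :: "nat \<Rightarrow> ereal \<Rightarrow> nat \<Rightarrow> ereal \<Rightarrow> point set \<Rightarrow> bool" where
  "sobolev_embedding l p m q U \<longleftrightarrow>
    sobolev_space l p U \<subseteq> sobolev_space m q U \<and>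
    (\<exists>c. \<forall>v\<in>sobolev_space l p U. sobolev_norm m q U v \<le> c * sobolev_norm l p U v)"

definition unit_tangent :: "point \<Rightarrow> point \<Rightarrow> point" where
  "unit_tangent a b = (b - a) /\<^sub>R norm (b - a)"

text \<open>The opposite choice of the unit normal only changes the sign of \<open>nbar\<close>, which affects
  neither the type of the edge nor the interpolants below.\<close>

definition unit_normal :: "point \<Rightarrow> point \<Rightarrow> point" where
  "unit_normal a b = (snd (unit_tangent a b), - fst (unit_tangent a b))"

definition nbar :: "point \<Rightarrow> point \<Rightarrow> point" where
  "nbar a b = (fst (unit_normal a b), - snd (unit_normal a b))"

definition type_I :: "point set \<Rightarrow> bool" where
  "type_I e \<longleftrightarrow> (\<exists>a b. a \<noteq> b \<and> e = closed_segment a b \<and>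
     (nbar a b = unit_tangent a b \<or> nbar a b = - unit_tangent a b))"

text \<open>The predicate \<open>triangulation\<close> of the library demands a finite family of simplices any two
  of which meet in a common face (possibly empty). Triangles are closed sets.\<close>

definition triangulation_of :: "point set \<Rightarrow> point set set \<Rightarrow> bool" where
  "triangulation_of \<Omega> \<T> \<longleftrightarrow>
    triangulation \<T> \<and> (\<forall>T\<in>\<T>. 2 simplex T) \<and> \<Union>\<T> = closure \<Omega>"

definition quasi_uniform :: "(real \<Rightarrow> point set set) \<Rightarrow> bool" where
  "quasi_uniform \<T> \<longleftrightarrow>
    (\<exists>\<sigma> \<rho>. \<sigma> > 0 \<and> \<rho> > 0 \<and>
      (\<forall>h\<in>{0<..<1}. \<forall>T\<in>\<T> h. diameter T \<le> \<sigma> * h \<and> (\<exists>x. cball x (\<rho> * h) \<subseteq> T)))"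

definition two_type_I_edges :: "point set \<Rightarrow> bool" where
  "two_type_I_edges T \<longleftrightarrow> card {e. e edge_of T \<and> type_I e} = 2"

text \<open>Labellings of the vertices for which the edge \<open>e\<^sub>3\<close> opposite to \<open>a\<^sub>3\<close> is of type II.\<close>

definition admissible_labelling :: "point set \<Rightarrow> point \<Rightarrow> point \<Rightarrow> point \<Rightarrow> bool" where
  "admissible_labelling T a1 a2 a3 \<longleftrightarrow>
    T = convex hull {a1, a2, a3} \<and> \<not> collinear {a1, a2, a3} \<and>
    \<not> type_I (closed_segment a1 a2)"

definition poly_space :: "nat \<Rightarrow> (point \<Rightarrow> real) set" where
  "poly_space k = {f. \<exists>c. f = (\<lambda>(x, y). \<Sum>(i, j)\<in>multi_indices k. c i j * x ^ i * y ^ j)}"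

definition C1_on :: "point set \<Rightarrow> (point \<Rightarrow> real) \<Rightarrow> bool" where
  "C1_on T u \<longleftrightarrow> (\<exists>g :: point \<Rightarrow> point. continuous_on T g \<and>
     (\<forall>x\<in>T. (u has_derivative (\<lambda>w. g x \<bullet> w)) (at x within T)))"

text \<open>The degrees of freedom involve values and gradients at points of the boundary of \<open>T\<close>.
  At an element of a Sobolev space they are taken at its representative that is
  continuously differentiable up to the boundary.\<close>

definition C1_representative :: "point set \<Rightarrow> (point \<Rightarrow> real) \<Rightarrow> point \<Rightarrow> real" where
  "C1_representative T v =
    (SOME u. C1_on T u \<and> (AE x in lebesgue_on (interior T). u x = v x))"

text \<open>\<open>dir_deriv T u x w\<close> is \<open>\<nabla>u(x) \<bullet> w\<close>; the derivative is relative to \<open>T\<close> since \<open>x\<close> may lie on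
  the boundary.\<close>

definition dir_deriv :: "point set \<Rightarrow> (point \<Rightarrow> real) \<Rightarrow> point \<Rightarrow> point \<Rightarrow> real" where
  "dir_deriv T u x w = frechet_derivative u (at x within T) w"

definition avg :: "point list \<Rightarrow> point" where
  "avg as = sum_list as /\<^sub>R real (length as)"

definition dofs3 :: "point \<Rightarrow> point \<Rightarrow> point \<Rightarrow> (point \<Rightarrow> real) \<Rightarrow> real list" where
  "dofs3 a1 a2 a3 u =
    (let T = convex hull {a1, a2, a3}; b3 = avg [a1, a2] in
     [u a1, u a2, u a3,
      u (avg [a1, a3]), u (avg [a2, a3]),
      dir_deriv T u a1 (a2 - a1), dir_deriv T u a1 (a3 - a1),
      dir_deriv T u a2 (a1 - a2), dir_deriv T u a2 (a3 - a2),
      dir_deriv T u b3 (nbar a1 a2)])"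

definition dofs4 :: "point \<Rightarrow> point \<Rightarrow> point \<Rightarrow> (point \<Rightarrow> real) \<Rightarrow> real list" where
  "dofs4 a1 a2 a3 u =
    (let T = convex hull {a1, a2, a3}; b3 = avg [a1, a2] in
     [u a1, u a2, u a3,
      u (avg [a1, a1, a3]), u (avg [a2, a2, a3]),
      u (avg [a1, a3, a3]), u (avg [a2, a3, a3]),
      u b3, u (avg [a1, a2, a3]),
      dir_deriv T u a1 (a2 - a1), dir_deriv T u a1 (a3 - a1),
      dir_deriv T u a2 (a1 - a2), dir_deriv T u a2 (a3 - a2),
      dir_deriv T u (avg [a1, a1, a2]) (nbar a1 a2),
      dir_deriv T u (avg [a1, a2, a2]) (nbar a1 a2)])"

text \<open>Meaningful for \<open>k = 3\<close> and \<open>k = 4\<close> only.\<close>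

definition dofs :: "nat \<Rightarrow> point \<Rightarrow> point \<Rightarrow> point \<Rightarrow> (point \<Rightarrow> real) \<Rightarrow> real list" where
  "dofs k = (if k = 3 then dofs3 else dofs4)"

definition interpolant ::
    "nat \<Rightarrow> point \<Rightarrow> point \<Rightarrow> point \<Rightarrow> (point \<Rightarrow> real) \<Rightarrow> point \<Rightarrow> real" where
  "interpolant k a1 a2 a3 v =
    (THE P. P \<in> poly_space k \<and>
       dofs k a1 a2 a3 P =
       dofs k a1 a2 a3 (C1_representative (convex hull {a1, a2, a3}) v))"

end

theory Submission
  imports Defs "HOL-Computational_Algebra.Polynomial"
begin

text \<open>The two type I edges of a triangle are perpendicular, meet at \<open>a\<^sub>3\<close>, and \<open>nbar\<close> is parallel to
  the median through \<open>a\<^sub>3\<close>. So the affine map taking the triangle to the reference triangle takes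
  the degrees of freedom to those of a single reference element, and the interpolation operators are
  affine equivalent. On the reference triangle, write \<open>v = P + w\<close> with a polynomial \<open>P\<close> of degree at
  most \<open>k\<close> such that \<open>w\<close> is bounded by the top order seminorm of \<open>v\<close> (Bramble and Hilbert).
  Interpolation reproduces \<open>P\<close>, and the degrees of freedom of \<open>w\<close> are controlled because functions
  with integrable third derivatives are \<open>C\<^sup>1\<close> up to the boundary. Poincare's inequality and this
  embedding are derived from averaged Taylor formulas on the unit square, whose affine images cover
  the triangle. Scaling back, quasi-uniformity controls the affine maps by powers of the diameter;
  the embedding into \<open>W\<^sup>m\<^sup>,\<^sup>q\<close> is transferred from one fixed triangle, which makes its constant
  uniform.\<close>

subsection \<open>Smooth functions of one variable and orthogonality to tensor products\<close>

text \<open>Elements of the space are known only through integrals against test functions, so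
  pointwise identities are first proved in tested form. Products of one-variable bumps suffice as
  tests, because they converge to indicators of rectangles. Testing the defect of the averaged
  Taylor formula against \<open>p(x) q(y)\<close> leads to the antiderivative of \<open>p\<close>
  minus its mass times a fixed weight, which again has compact support. The kernel of the formula is
  bounded and jumps only on a line, so integrating it against an integrable function gives a bounded
  continuous function. Two derivatives in \<open>L^1\<close> therefore give continuity and three
  give \<open>C^1\<close>, for every exponent, and \<open>k + 1\<close> is at least 4. The formula
  lives on rectangles, hence the parallelograms; the constants found on different ones are compared
  on a small box common to all. The degree of freedom along \<open>nbar\<close> is only proportional
  to its reference counterpart, but the factor is nonzero and leaves the interpolant unchanged.
  Inequalities are used with generous constants, since only independence of the triangle
  matters.\<close>

definition derivs :: "(nat \<Rightarrow> real \<Rightarrow> real) \<Rightarrow> bool" where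
  "derivs B \<longleftrightarrow> (\<forall>i x. (B i has_real_derivative B (Suc i) x) (at x))"

lemma derivsD: "derivs B \<Longrightarrow> (B i has_real_derivative B (Suc i) x) (at x)"
  by (simp add: derivs_def)

lemma derivs_isCont: "derivs B \<Longrightarrow> isCont (B i) x"
  using derivsD DERIV_isCont by blast

lemma derivs_continuous: "derivs B \<Longrightarrow> continuous_on A (B i)"
  using derivs_isCont continuous_at_imp_continuous_on by blast

lemma derivs_measurable: "derivs B \<Longrightarrow> B i \<in> borel_measurable borel"
  using derivs_continuous borel_measurable_continuous_onI by blast

text \<open>With \<open>s = 1/t\<close>, differentiating \<open>p(s) exp(-s)\<close> in
  \<open>t\<close> multiplies by \<open>-s^2\<close> and replaces \<open>p\<close> by
  \<open>p' - p\<close>; hence the recursion \<open>s^2 (p - p')\<close>.\<close>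

fun flat_poly :: "nat \<Rightarrow> real poly" where
  "flat_poly 0 = 1"
| "flat_poly (Suc n) = [:0, 0, 1:] * (flat_poly n - pderiv (flat_poly n))"

text \<open>The index is the order of the derivative; \<open>flat 0\<close> is the classical smooth
  function \<open>exp(-1/t)\<close>, flat at the origin.\<close>

definition flat :: "nat \<Rightarrow> real \<Rightarrow> real" where
  "flat n t = (if t \<le> 0 then 0 else poly (flat_poly n) (1 / t) * exp (- (1 / t)))"

lemma poly_times_exp_tendsto_0:
  fixes p :: "real poly"
  shows "((\<lambda>s. poly p s * exp (- s)) \<longlongrightarrow> 0) at_top"
proof -
  have "((\<lambda>s. \<Sum>i\<le>degree p. coeff p i * (s ^ i / exp s)) \<longlongrightarrow> (\<Sum>i\<le>degree p. coeff p i * 0)) at_top"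
    by (intro tendsto_intros tendsto_power_div_exp_0)
  then show ?thesis
    by (simp add: poly_altdef sum_distrib_right exp_minus divide_inverse mult.assoc)
qed

lemma derivs_flat: "derivs flat"
  unfolding derivs_def
proof (intro allI)
  fix n and t :: real
  consider "t < 0" | "t = 0" | "t > 0" by linarith
  then show "(flat n has_real_derivative flat (Suc n) t) (at t)"
  proof cases
    case 1
    have "((\<lambda>_. 0) has_real_derivative 0) (at t)" by simp
    then have "(flat n has_real_derivative 0) (at t)"
      by (rule has_field_derivative_transform_within_open[of _ _ _ "{..<0}"])
        (use 1 in \<open>auto simp: flat_def\<close>)
    with 1 show ?thesis by (simp add: flat_def)
  next
    case 3
    have "((\<lambda>t. poly (flat_poly n) (1 / t) * exp (- (1 / t))) has_real_derivative flat (Suc n) t) (at t)"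
    proof -
      have inv: "((\<lambda>t. 1 / t) has_real_derivative - (1 / t ^ 2)) (at t)"
        using 3 by (auto intro!: derivative_eq_intros simp: field_simps power2_eq_square)
      have "((\<lambda>t. poly (flat_poly n) (1 / t)) has_real_derivative
          poly (pderiv (flat_poly n)) (1 / t) * - (1 / t ^ 2)) (at t)"
        by (rule DERIV_chain2[OF poly_DERIV inv])
      moreover have "((\<lambda>t. exp (- (1 / t))) has_real_derivative exp (- (1 / t)) * - (- (1 / t ^ 2))) (at t)"
        by (rule DERIV_chain2[OF DERIV_exp DERIV_minus[OF inv]])
      ultimately show ?thesis
        by (rule DERIV_cong[OF DERIV_mult]) (use 3 in \<open>simp add: flat_def field_simps power2_eq_square\<close>)
    qed
    then show ?thesis
      by (rule has_field_derivative_transform_within_open[of _ _ _ "{0<..}"])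
        (use 3 in \<open>auto simp: flat_def\<close>)
  next
    case 2
    \<comment> \<open>At the origin the right difference quotient is \<open>s p(s) exp(-s)\<close>
      with \<open>s = 1/y\<close>; the extra factor \<open>[:0, 1:]\<close> is the division by
      \<open>y\<close>.\<close>
    have "((\<lambda>s. poly ([:0, 1:] * flat_poly n) s * exp (- s)) \<longlongrightarrow> 0) at_top"
      by (rule poly_times_exp_tendsto_0)
    then have "((\<lambda>y. poly ([:0, 1:] * flat_poly n) (inverse y) * exp (- inverse y)) \<longlongrightarrow> 0) (at_right 0)"
      by (rule filterlim_compose[OF _ filterlim_inverse_at_top_right])
    then have "((\<lambda>y. flat n y / y) \<longlongrightarrow> 0) (at_right 0)"
      by (rule Lim_transform_eventually)
        (auto simp: eventually_at_filter flat_def field_simps)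
    moreover have "((\<lambda>y. flat n y / y) \<longlongrightarrow> 0) (at_left 0)"
      by (rule Lim_transform_eventually[OF tendsto_const])
        (auto simp: eventually_at_filter flat_def)
    ultimately have "((\<lambda>y. (flat n y - flat n 0) / (y - 0)) \<longlongrightarrow> 0) (at 0)"
      by (simp add: filterlim_split_at flat_def)
    then show ?thesis
      using 2 by (simp add: has_field_derivative_iff flat_def)
  qed
qed

lemma derivs_affine:
  assumes "derivs B"
  shows "derivs (\<lambda>i x. c ^ i * B i (c * x + d))"
  unfolding derivs_def
proof (intro allI)
  fix i x
  show "((\<lambda>x. c ^ i * B i (c * x + d)) has_real_derivative c ^ Suc i * B (Suc i) (c * x + d)) (at x)"
  proof -
    have "((\<lambda>x. c * x + d) has_real_derivative c) (at x)"
      by (auto intro!: derivative_eq_intros)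
    then have "((\<lambda>x. B i (c * x + d)) has_real_derivative B (Suc i) (c * x + d) * c) (at x)"
      by (rule DERIV_chain2[OF derivsD[OF assms]])
    then show ?thesis
      by (rule DERIV_cong[OF DERIV_cmult]) simp
  qed
qed

text \<open>Leibniz's rule as an explicit sequence: differentiating once gives two sums, and after
  an index shift in one of them Pascal's rule merges their coefficients.\<close>

lemma derivs_mult:
  assumes A: "derivs A" and B: "derivs B"
  shows "derivs (\<lambda>i x. \<Sum>j\<le>i. real (i choose j) * A j x * B (i - j) x)"
  unfolding derivs_def
proof (intro allI)
  fix i x
  have "((\<lambda>x. \<Sum>j\<le>i. real (i choose j) * A j x * B (i - j) x) has_real_derivative
      (\<Sum>j\<le>i. real (i choose j) * (A (Suc j) x * B (i - j) x + A j x * B (Suc (i - j)) x))) (at x)"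
  proof (rule DERIV_sum)
    fix j
    have "((\<lambda>x. real (i choose j) * (A j x * B (i - j) x)) has_real_derivative
        real (i choose j) * (A (Suc j) x * B (i - j) x + B (Suc (i - j)) x * A j x)) (at x)"
      by (intro DERIV_cmult DERIV_mult derivsD A B)
    then show "((\<lambda>x. real (i choose j) * A j x * B (i - j) x) has_real_derivative
        real (i choose j) * (A (Suc j) x * B (i - j) x + A j x * B (Suc (i - j)) x)) (at x)"
      by (simp add: mult.assoc mult.commute[of "A j x"])
  qed
  also have "(\<Sum>j\<le>i. real (i choose j) * (A (Suc j) x * B (i - j) x + A j x * B (Suc (i - j)) x))
     = (\<Sum>j\<le>i. real (i choose j) * A (Suc j) x * B (i - j) x)
       + (\<Sum>j\<le>i. real (i choose j) * A j x * B (Suc i - j) x)"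
    by (simp add: sum.distrib[symmetric] Suc_diff_le distrib_left mult.assoc)
  also have "(\<Sum>j\<le>i. real (i choose j) * A j x * B (Suc i - j) x)
     = A 0 x * B (Suc i) x + (\<Sum>j\<le>i. real (i choose Suc j) * A (Suc j) x * B (i - j) x)"
  proof -
    have "(\<Sum>j\<le>i. real (i choose j) * A j x * B (Suc i - j) x)
        = (\<Sum>j\<le>Suc i. real (i choose j) * A j x * B (Suc i - j) x)"
      by (simp add: binomial_eq_0)
    also have "\<dots> = A 0 x * B (Suc i) x + (\<Sum>j\<le>i. real (i choose Suc j) * A (Suc j) x * B (i - j) x)"
      by (subst sum.atMost_Suc_shift) simp
    finally show ?thesis .
  qed
  also have "(\<Sum>j\<le>i. real (i choose j) * A (Suc j) x * B (i - j) x)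
       + (A 0 x * B (Suc i) x + (\<Sum>j\<le>i. real (i choose Suc j) * A (Suc j) x * B (i - j) x))
     = (\<Sum>j\<le>Suc i. real (Suc i choose j) * A j x * B (Suc i - j) x)"
    unfolding sum.atMost_Suc_shift[of _ i] by (simp add: sum.distrib ring_distribs)
  finally show "((\<lambda>x. \<Sum>j\<le>i. real (i choose j) * A j x * B (i - j) x) has_real_derivative
      (\<Sum>j\<le>Suc i. real (Suc i choose j) * A j x * B (Suc i - j) x)) (at x)" .
qed

text \<open>The factor \<open>c\<close> is a steepness: for \<open>c > 0\<close> the bump vanishes
  off \<open>[a, b]\<close>, and it tends to the indicator of the open interval as \<open>c\<close>
  grows.\<close>

lemma obtain_bump:
  obtains B where "derivs B" "\<And>x. B 0 x = flat 0 (c * (x - a)) * flat 0 (c * (b - x))"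
proof -
  let ?A = "\<lambda>i x. c ^ i * flat i (c * x + - c * a)"
  let ?B = "\<lambda>i x. (- c) ^ i * flat i (- c * x + c * b)"
  let ?C = "\<lambda>i x. \<Sum>j\<le>i. real (i choose j) * ?A j x * ?B (i - j) x"
  have "derivs ?C"
    by (rule derivs_mult[OF derivs_affine[OF derivs_flat] derivs_affine[OF derivs_flat]])
  moreover have "?C 0 x = flat 0 (c * (x - a)) * flat 0 (c * (b - x))" for x
    by (simp add: algebra_simps)
  ultimately show thesis by (rule that)
qed

lemma flat_0_bounds: "0 \<le> flat 0 t" "flat 0 t \<le> 1"
  by (auto simp: flat_def)

lemma flat_0_nonpos: "t \<le> 0 \<Longrightarrow> flat 0 t = 0"
  by (auto simp: flat_def)

lemma flat_0_tendsto:
  assumes "t > 0"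
  shows "(\<lambda>n. flat 0 (real (Suc n) * t)) \<longlonglongrightarrow> 1"
proof -
  have "(\<lambda>n. inverse (real (Suc n)) * (1 / t)) \<longlonglongrightarrow> 0 * (1 / t)"
    by (intro tendsto_intros LIMSEQ_inverse_real_of_nat)
  then have "(\<lambda>n. exp (- (inverse (real (Suc n)) * (1 / t)))) \<longlonglongrightarrow> exp (- 0)"
    by (intro tendsto_intros) simp
  moreover have "flat 0 (real (Suc n) * t) = exp (- (inverse (real (Suc n)) * (1 / t)))" for n
  proof -
    have "0 < real (Suc n) * t" using assms by (intro mult_pos_pos) auto
    then show ?thesis by (simp add: flat_def field_simps del: of_nat_Suc)
  qed
  ultimately show ?thesis by simp
qed

section \<open>Functions that vanish when integrated over boxes or against tensor products\<close>

text \<open>Boxes are closed under intersection and generate the Borel sets, so the vanishing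
  spreads to all Borel sets by Dynkin's argument. The integral over the whole space, needed for
  complements, is a limit over growing boxes.\<close>

lemma AE_zero_if_box_integrals_zero_borel:
  fixes H :: "'a::euclidean_space \<Rightarrow> real"
  assumes H: "integrable lborel H"
    and zero: "\<And>a b. (LINT x:box a b|lborel. H x) = 0"
  shows "AE x in lborel. H x = 0"
proof -
  let ?G = "range (\<lambda>(a, b). box a b :: 'a set)"
  have int: "set_integrable lborel A H" if "A \<in> sets borel" for A
    unfolding set_integrable_def using that by (intro integrable_mult_indicator H) simp
  have total: "(LINT x|lborel. H x) = 0"
  proof -
    have "(\<lambda>n. LINT x:box (- real n *\<^sub>R One) (real n *\<^sub>R One)|lborel. H x) \<longlonglongrightarrow>
        (LINT x:(\<Union>n. box (- real n *\<^sub>R One) (real n *\<^sub>R One))|lborel. H x)"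
    proof (rule set_integral_cont_up)
      show "incseq (\<lambda>n. box (- real n *\<^sub>R One) (real n *\<^sub>R One :: 'a))"
        by (auto simp: incseq_def intro!: subset_box_imp)
    qed (auto intro!: int)
    then show ?thesis
      using zero by (simp add: UN_box_eq_UNIV set_lebesgue_integral_def LIMSEQ_const_iff)
  qed
  have "(LINT x:A|lborel. H x) = 0" if "A \<in> sets borel" for A
  proof -
    have "Int_stable ?G"
      by (auto simp: Int_stable_def box_Int_box)
    moreover have "?G \<subseteq> Pow UNIV" by simp
    moreover have "A \<in> sigma_sets UNIV ?G"
      using that by (simp add: borel_eq_box)
    ultimately show ?thesis
    proof (induction rule: sigma_sets_induct_disjoint[consumes 3, case_names basic empty compl union])
      case (basic A)
      then show ?case using zero by auto
    next
      case empty
      then show ?case by (simp add: set_lebesgue_integral_def)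
    next
      case (compl A)
      then have A: "A \<in> sets borel" by (simp add: borel_eq_box)
      have "(LINT x:A \<union> (UNIV - A)|lborel. H x) = (LINT x:A|lborel. H x) + (LINT x:UNIV - A|lborel. H x)"
        using A by (intro set_integral_Un int) auto
      then show ?case using compl total by (simp add: set_lebesgue_integral_def)
    next
      case (union A)
      then have A: "A i \<in> sets borel" for i by (auto simp: borel_eq_box)
      have "(LINT x:(\<Union>i. A i)|lborel. H x) = (\<Sum>i. (LINT x:A i|lborel. H x))"
        using A union by (intro lebesgue_integral_countable_add int) (auto simp: disjoint_family_on_def)
      then show ?case using union by simp
    qed
  qed
  then show ?thesis
    using H by (intro density_unique_real) (auto simp: set_lebesgue_integral_def)
qed

text \<open>A Borel representative of \<open>H\<close> has the same box integrals, which reduces the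
  Lebesgue measurable case to the Borel case.\<close>

lemma AE_zero_if_box_integrals_zero:
  fixes H :: "'a::euclidean_space \<Rightarrow> real"
  assumes H: "integrable lebesgue H"
    and zero: "\<And>a b. (LINT x:box a b|lebesgue. H x) = 0"
  shows "AE x in lebesgue. H x = 0"
proof -
  obtain H' where H'[measurable]: "H' \<in> borel_measurable lborel" and eq: "AE x in lborel. H x = H' x"
    using completion_ex_borel_measurable_real[of H lborel] H by auto
  have eq': "AE x in lebesgue. H x = H' x"
    using eq by (rule AE_completion)
  have "integrable lebesgue H'"
    using eq' by (intro integrable_cong_AE_imp[OF H]) (auto intro: measurable_completion)
  then have int: "integrable lborel H'"
    by (simp add: integrable_completion)
  have "(LINT x:box a b|lborel. H' x) = 0" for a b
  proof -
    have "(LINT x:box a b|lborel. H' x) = (LINT x:box a b|lebesgue. H' x)"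
      by (simp add: set_lebesgue_integral_def integral_completion)
    also have "\<dots> = (LINT x:box a b|lebesgue. H x)"
      unfolding set_lebesgue_integral_def
    proof (rule integral_cong_AE)
      show "(\<lambda>x. indicator (box a b) x *\<^sub>R H' x) \<in> borel_measurable lebesgue"
        by (rule measurable_completion) measurable
      show "(\<lambda>x. indicator (box a b) x *\<^sub>R H x) \<in> borel_measurable lebesgue"
        by (rule borel_measurable_integrable[OF integrable_mult_indicator[OF _ H]]) simp
      show "AE x in lebesgue. indicat_real (box a b) x *\<^sub>R H' x = indicat_real (box a b) x *\<^sub>R H x"
        using eq' by eventually_elim simp
    qed
    finally show ?thesis using zero by simp
  qed
  then have "AE x in lborel. H' x = 0"
    by (rule AE_zero_if_box_integrals_zero_borel[OF int])
  then have "AE x in lebesgue. H' x = 0"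
    by (rule AE_completion)
  with eq' show ?thesis by eventually_elim simp
qed

lemma integral_lebesgue_on_indicator:
  fixes f :: "'a::euclidean_space \<Rightarrow> real"
  assumes "U \<in> sets lebesgue"
  shows "(LINT x|lebesgue_on U. f x) = (LINT x|lebesgue. indicator U x * f x)"
  using assms by (subst integral_restrict_space) auto

lemma integrable_lebesgue_on_indicator:
  fixes f :: "'a::euclidean_space \<Rightarrow> real"
  assumes "U \<in> sets lebesgue"
  shows "integrable (lebesgue_on U) f \<longleftrightarrow> integrable lebesgue (\<lambda>x. indicator U x * f x)"
  using assms by (subst integrable_restrict_space) auto

lemma open_sets_lebesgue: "open U \<Longrightarrow> U \<in> sets lebesgue"
  by (simp add: borel_open)

lemma borel_measurable_fst_point: "fst \<in> borel_measurable (borel :: point measure)"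
  and borel_measurable_snd_point: "snd \<in> borel_measurable (borel :: point measure)"
  by (intro borel_measurable_continuous_onI continuous_intros)+

lemma borel_measurable_tensor:
  fixes f g :: "real \<Rightarrow> real"
  assumes "f \<in> borel_measurable borel" "g \<in> borel_measurable borel"
  shows "(\<lambda>z::point. f (fst z) * g (snd z)) \<in> borel_measurable borel"
  using assms
  by (intro borel_measurable_times measurable_compose[OF borel_measurable_fst_point]
      measurable_compose[OF borel_measurable_snd_point])

text \<open>The factors come with their whole sequences of derivatives because smoothness is
  expressed by \<open>derivs\<close>; only \<open>B 0\<close> and \<open>C 0\<close> enter the
  integral.\<close>

definition orthogonal_to_tensors :: "point set \<Rightarrow> (point \<Rightarrow> real) \<Rightarrow> bool" where
  "orthogonal_to_tensors U h \<longleftrightarrow>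
    (\<forall>B C a b c d. derivs B \<longrightarrow> derivs C \<longrightarrow> cbox (a, c) (b, d) \<subseteq> U \<longrightarrow>
      (\<forall>x. x \<notin> {a..b} \<longrightarrow> B 0 x = 0) \<longrightarrow> (\<forall>y. y \<notin> {c..d} \<longrightarrow> C 0 y = 0) \<longrightarrow>
      (LINT z|lebesgue_on U. h z * (B 0 (fst z) * C 0 (snd z))) = 0)"

text \<open>As the bumps get steeper, their products converge boundedly to the indicator of the open
  rectangle; the restriction of \<open>h\<close> to the closed rectangle is integrable and
  dominates.\<close>

lemma integral_box_zero_if_orthogonal_to_tensors:
  fixes h :: "point \<Rightarrow> real"
  assumes U: "open U" and li: "locally_integrable U h"
    and orth: "orthogonal_to_tensors U h"
    and sub: "cbox (a, c) (b, d) \<subseteq> U"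
  shows "(LINT z:box (a, c) (b, d)|lebesgue. h z) = 0"
proof -
  have "\<exists>B. derivs B \<and> (\<forall>x. B 0 x = flat 0 (r * (x - a)) * flat 0 (r * (b - x)))" for r a b
    by (rule obtain_bump[of r a b]) blast
  then obtain B where B: "\<And>r a b. derivs (B r a b)"
    "\<And>r a b x. B r a b 0 x = flat 0 (r * (x - a)) * flat 0 (r * (b - x))"
    by metis
  have out: "B (real (Suc n)) a b 0 x = 0" if "x \<notin> {a<..<b}" for n a b x
    using that unfolding B(2)
    by (auto intro!: flat_0_nonpos mult_nonneg_nonpos simp: not_less simp del: of_nat_Suc)
  have out': "B (real (Suc n)) a b 0 x = 0" if "x \<notin> {a..b}" for n a b x
    by (rule out) (use that in auto)
  have bd: "\<bar>B r a b 0 x\<bar> \<le> 1" for r a b x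
    using flat_0_bounds by (auto simp: B(2) abs_mult intro!: mult_le_one)
  have lim: "(\<lambda>n. B (real (Suc n)) a b 0 x) \<longlonglongrightarrow> indicator {a<..<b} x" for a b x
  proof (cases "x \<in> {a<..<b}")
    case True
    then have "(\<lambda>n. flat 0 (real (Suc n) * (x - a)) * flat 0 (real (Suc n) * (b - x))) \<longlonglongrightarrow> 1 * 1"
      by (intro tendsto_mult flat_0_tendsto) auto
    then show ?thesis using True by (simp add: B(2))
  qed (simp add: out del: of_nat_Suc)
  define w where "w = (\<lambda>z. indicator (cbox (a, c) (b, d)) z * h z)"
  define s where "s n z = w z * (B (real (Suc n)) a b 0 (fst z) * B (real (Suc n)) c d 0 (snd z))" for n z
  have w: "integrable lebesgue w"
  proof -
    have "h absolutely_integrable_on cbox (a, c) (b, d)"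
      using li sub compact_cbox unfolding locally_integrable_def by blast
    then show ?thesis by (simp add: w_def set_integrable_def)
  qed
  have [measurable]: "B r a b 0 \<in> borel_measurable borel" for r a b
    by (rule derivs_measurable[OF B(1)])
  have tm: "(\<lambda>z::point. B r a b 0 (fst z) * B r c d 0 (snd z)) \<in> borel_measurable lebesgue" for r a b c d
    by (rule measurable_completion) (simp add: borel_measurable_tensor derivs_measurable B(1))
  have ind: "indicator {a<..<b} (fst z) * indicator {c<..<d} (snd z) = (indicator (box (a, c) (b, d)) z :: real)" for z
    by (cases z) (auto simp: indicator_def mem_box Basis_prod_def)
  have "(\<lambda>n. LINT z|lebesgue. s n z) \<longlonglongrightarrow> (LINT z|lebesgue. indicator (box (a, c) (b, d)) z * w z)"
  proof (rule integral_dominated_convergence[where w="\<lambda>z. \<bar>w z\<bar>"])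
    show "AE z in lebesgue. (\<lambda>n. s n z) \<longlonglongrightarrow> indicator (box (a, c) (b, d)) z * w z"
    proof (rule AE_I2)
      fix z
      have "(\<lambda>n. s n z) \<longlonglongrightarrow> w z * (indicator {a<..<b} (fst z) * indicator {c<..<d} (snd z))"
        unfolding s_def by (intro tendsto_intros lim)
      then show "(\<lambda>n. s n z) \<longlonglongrightarrow> indicator (box (a, c) (b, d)) z * w z"
        by (simp only: ind mult.commute)
    qed
    show "AE z in lebesgue. norm (s n z) \<le> \<bar>w z\<bar>" for n
      using bd by (intro AE_I2) (auto simp: s_def abs_mult intro!: mult_left_le mult_le_one)
  qed (use w tm in \<open>auto simp: s_def[abs_def] intro!: borel_measurable_times borel_measurable_indicator\<close>)
  moreover have "(LINT z|lebesgue. s n z) = 0" for n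
  proof -
    have "(LINT z|lebesgue. s n z)
      = (LINT z|lebesgue_on U. h z * (B (real (Suc n)) a b 0 (fst z) * B (real (Suc n)) c d 0 (snd z)))"
    proof (subst integral_lebesgue_on_indicator[OF open_sets_lebesgue[OF U]], rule Bochner_Integration.integral_cong[OF refl])
      fix z
      show "s n z = indicator U z * (h z * (B (real (Suc n)) a b 0 (fst z) * B (real (Suc n)) c d 0 (snd z)))"
      proof (cases "fst z \<in> {a<..<b} \<and> snd z \<in> {c<..<d}")
        case True
        then have "z \<in> cbox (a, c) (b, d)" by (cases z) auto
        with sub have "z \<in> cbox (a, c) (b, d)" "z \<in> U" by auto
        then show ?thesis by (simp add: s_def w_def)
      next
        case False
        then have "B (real (Suc n)) a b 0 (fst z) = 0 \<or> B (real (Suc n)) c d 0 (snd z) = 0"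
          using out by blast
        then show ?thesis by (auto simp: s_def simp del: of_nat_Suc)
      qed
    qed
    also have "\<dots> = 0"
      using orth[unfolded orthogonal_to_tensors_def, rule_format,
          OF B(1)[of "real (Suc n)" a b] B(1)[of "real (Suc n)" c d] sub out' out'] by simp
    finally show ?thesis .
  qed
  ultimately have "(LINT z|lebesgue. indicator (box (a, c) (b, d)) z * w z) = 0"
    by (simp add: LIMSEQ_const_iff)
  moreover have "indicator (box (a, c) (b, d)) z * w z = indicator (box (a, c) (b, d)) z * h z" for z
    using box_subset_cbox[of "(a, c)" "(b, d)"] by (auto simp: w_def indicator_def)
  ultimately show ?thesis
    by (simp add: set_lebesgue_integral_def)
qed

text \<open>On a closed box inside \<open>U\<close> the function is integrable, and integrals of its
  restriction over arbitrary boxes are again integrals of \<open>h\<close> over boxes in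
  \<open>U\<close>. Countably many closed boxes exhaust \<open>U\<close>, and their frontiers are
  null.\<close>

lemma AE_zero_if_orthogonal_to_tensors:
  fixes h :: "point \<Rightarrow> real"
  assumes U: "open U" and li: "locally_integrable U h"
    and orth: "orthogonal_to_tensors U h"
  shows "AE z in lebesgue_on U. h z = 0"
proof -
  have zero: "(LINT z:box l u|lebesgue. h z) = 0" if "cbox l u \<subseteq> U" for l u
    using integral_box_zero_if_orthogonal_to_tensors[OF U li orth, of "fst l" "snd l" "fst u" "snd u"] that by auto
  have box: "AE z in lebesgue. z \<in> box l u \<longrightarrow> h z = 0" if sub: "cbox l u \<subseteq> U" for l u
  proof -
    have "set_integrable lebesgue (cbox l u) h"
      using li sub compact_cbox unfolding locally_integrable_def by blast
    then have int: "set_integrable lebesgue (box l u) h"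
      by (rule set_integrable_subset) (auto simp: box_subset_cbox)
    have "AE z in lebesgue. indicator (box l u) z * h z = 0"
    proof (rule AE_zero_if_box_integrals_zero)
      show "integrable lebesgue (\<lambda>z. indicator (box l u) z * h z)"
        using int by (simp add: set_integrable_def)
      fix l' u'
      have eq: "(LINT z:box l' u'|lebesgue. indicator (box l u) z * h z) = (LINT z:box l' u' \<inter> box l u|lebesgue. h z)"
        by (simp add: set_lebesgue_integral_def indicator_inter_arith mult.assoc)
      obtain l2 u2 where l2: "box l' u' \<inter> box l u = box l2 u2"
        using box_Int_box[of l' u' l u] by blast
      show "(LINT z:box l' u'|lebesgue. indicator (box l u) z * h z) = 0"
      \<comment> \<open>For an empty open box, \<open>cbox l2 u2\<close> can still be a nonempty
        degenerate box outside \<open>U\<close>, so closures are taken only in the other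
        case.\<close>
      proof (cases "box l2 u2 = {}")
        case True
        then show ?thesis unfolding eq l2 by (simp add: set_lebesgue_integral_def)
      next
        case False
        then have "cbox l2 u2 = closure (box l2 u2)" by (simp add: closure_box)
        also have "\<dots> \<subseteq> cbox l u"
          using l2 box_subset_cbox[of l u] by (intro closure_minimal) auto
        finally show ?thesis unfolding eq l2 using sub zero by blast
      qed
    qed
    then show ?thesis by eventually_elim auto
  qed
  obtain \<D> where \<D>: "countable \<D>" "\<D> \<subseteq> Pow U" "\<And>X. X \<in> \<D> \<Longrightarrow> \<exists>a b. X = cbox a b" "\<Union>\<D> = U"
    using open_countable_Union_open_cbox[OF U] by metis
  have "AE z in lebesgue. \<forall>X\<in>\<D>. z \<in> X \<longrightarrow> h z = 0"
  proof (rule AE_ball_countable'[OF _ \<D>(1)])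
    fix X assume X: "X \<in> \<D>"
    then obtain a b where ab: "X = cbox a b" "cbox a b \<subseteq> U" using \<D> by blast
    have "AE z in lebesgue. z \<notin> cbox a b - box a b"
      using negligible_frontier_interval[of a b] unfolding negligible_iff_null_sets
      by (rule AE_not_in)
    with box[OF ab(2)] show "AE z in lebesgue. z \<in> X \<longrightarrow> h z = 0"
      by eventually_elim (auto simp: ab)
  qed
  then have "AE z in lebesgue. z \<in> U \<longrightarrow> h z = 0"
    by eventually_elim (use \<D>(4) in auto)
  then show ?thesis
    using open_sets_lebesgue[OF U] by (subst AE_restrict_space_iff) auto
qed

subsection \<open>Affine maps of the plane\<close>

definition aff :: "point \<Rightarrow> point \<Rightarrow> point \<Rightarrow> point \<Rightarrow> point" where
  "aff z e f x = z + fst x *\<^sub>R e + snd x *\<^sub>R f"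

definition det2 :: "point \<Rightarrow> point \<Rightarrow> real" where
  "det2 e f = fst e * snd f - snd e * fst f"

lemma fst_aff: "fst (aff z e f x) = fst z + fst x * fst e + snd x * fst f"
  and snd_aff: "snd (aff z e f x) = snd z + fst x * snd e + snd x * snd f"
  by (simp_all add: aff_def)

lemma continuous_on_aff: "continuous_on A (aff z e f)"
  unfolding aff_def by (intro continuous_intros)

lemma aff_borel: "aff z e f \<in> borel_measurable borel"
  by (intro borel_measurable_continuous_onI continuous_on_aff)

text \<open>Cramer's rule. The explicit columns are exported because their size is estimated
  later.\<close>

lemma aff_inverse:
  assumes "det2 e f \<noteq> 0"
  obtains z' e' f' where "\<And>x. aff z' e' f' (aff z e f x) = x" "\<And>x. aff z e f (aff z' e' f' x) = x"
    "e' = (snd f / det2 e f, - snd e / det2 e f)" "f' = (- fst f / det2 e f, fst e / det2 e f)"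
    "det2 e' f' = 1 / det2 e f"
proof -
  define d where "d = det2 e f"
  define e' f' where "e' = (snd f / d, - snd e / d)" and "f' = (- fst f / d, fst e / d)"
  define z' where "z' = - (fst z *\<^sub>R e' + snd z *\<^sub>R f')"
  have d: "d \<noteq> 0" "fst e * snd f - snd e * fst f = d" using assms by (simp_all add: d_def det2_def)
  have "aff z' e' f' (aff z e f x) = x" for x
  proof (rule prod_eqI)
    have "fst (aff z' e' f' (aff z e f x)) = fst x * (fst e * snd f - snd e * fst f) / d"
      by (simp add: fst_aff snd_aff z'_def e'_def f'_def divide_simps) (simp add: algebra_simps)
    then show "fst (aff z' e' f' (aff z e f x)) = fst x" using d by simp
    have "snd (aff z' e' f' (aff z e f x)) = snd x * (fst e * snd f - snd e * fst f) / d"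
      by (simp add: fst_aff snd_aff z'_def e'_def f'_def divide_simps) (simp add: algebra_simps)
    then show "snd (aff z' e' f' (aff z e f x)) = snd x" using d by simp
  qed
  moreover have "aff z e f (aff z' e' f' x) = x" for x
  proof (rule prod_eqI)
    have "fst (aff z e f (aff z' e' f' x)) - fst z = (fst x - fst z) * (fst e * snd f - snd e * fst f) / d"
      by (simp add: fst_aff snd_aff z'_def e'_def f'_def divide_simps) (simp add: algebra_simps)
    then show "fst (aff z e f (aff z' e' f' x)) = fst x" using d by simp
    have "snd (aff z e f (aff z' e' f' x)) - snd z = (snd x - snd z) * (fst e * snd f - snd e * fst f) / d"
      by (simp add: fst_aff snd_aff z'_def e'_def f'_def divide_simps) (simp add: algebra_simps)
    then show "snd (aff z e f (aff z' e' f' x)) = snd x" using d by simp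
  qed
  moreover have "det2 e' f' = (fst e * snd f - snd e * fst f) / (d * d)"
    by (simp add: det2_def e'_def f'_def divide_simps)
  then have "det2 e' f' = 1 / d" using d by simp
  ultimately show thesis
    using that e'_def f'_def unfolding d_def by blast
qed

text \<open>Two one-dimensional substitutions: at fixed \<open>y\<close> the first coordinate
  \<open>X\<close> of the image replaces \<open>x\<close>, which needs \<open>fst e\<close> nonzero;
  at fixed \<open>X\<close> the second coordinate is then affine in \<open>y\<close>.\<close>

lemma nn_integral_aff_aux:
  assumes [measurable]: "g \<in> borel_measurable (borel :: point measure)"
    and det: "det2 e f \<noteq> 0" and e: "fst e \<noteq> 0"
  shows "ennreal \<bar>det2 e f\<bar> * (\<integral>\<^sup>+x. g (aff z e f x) \<partial>lborel) = (\<integral>\<^sup>+x. g x \<partial>lborel)"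
proof -
  \<comment> \<open>On the line with first coordinate \<open>X\<close> the second coordinate is
    \<open>c X + q y\<close>; the two slopes \<open>fst e\<close> and \<open>q\<close> multiply to
    the determinant.\<close>
  define q where "q = det2 e f / fst e"
  define c where "c X = snd z + snd e * (X - fst z) / fst e" for X :: real
  have q: "q \<noteq> 0" using det e by (simp add: q_def)
  have g: "g \<in> borel_measurable (lborel \<Otimes>\<^sub>M lborel)" by (simp add: lborel_prod)
  have g_aff: "(\<lambda>x. g (aff z e f x)) \<in> borel_measurable (lborel \<Otimes>\<^sub>M lborel)"
    using aff_borel[of z e f] by (simp add: lborel_prod)
  have "continuous_on UNIV (\<lambda>x::point. (fst x, c (fst x) + q * snd x))"
    using e unfolding c_def by (intro continuous_intros) auto
  then have "(\<lambda>x::point. (fst x, c (fst x) + q * snd x)) \<in> borel_measurable borel"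
    by (rule borel_measurable_continuous_onI)
  then have gq: "(\<lambda>x. g (fst x, c (fst x) + q * snd x)) \<in> borel_measurable (lborel \<Otimes>\<^sub>M lborel)"
    by (simp add: lborel_prod)
  have gx: "(\<lambda>y. g (x, y)) \<in> borel_measurable borel" for x
    using measurable_compose[OF measurable_Pair1' g[unfolded ]] by (simp add: lborel_prod)
  have sec: "(\<lambda>X. g (X, c X + q * y)) \<in> borel_measurable borel" for y
  proof -
    have "continuous_on UNIV (\<lambda>X. (X, c X + q * y))"
      using e unfolding c_def by (intro continuous_intros) auto
    then have "(\<lambda>X. (X, c X + q * y)) \<in> borel_measurable borel"
      by (rule borel_measurable_continuous_onI)
    then show ?thesis by (rule measurable_compose[OF _ assms(1)])
  qed
  have "ennreal \<bar>fst e\<bar> * (\<integral>\<^sup>+x. g (aff z e f x) \<partial>lborel)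
      = ennreal \<bar>fst e\<bar> * (\<integral>\<^sup>+y. (\<integral>\<^sup>+x. g (aff z e f (x, y)) \<partial>lborel) \<partial>lborel)"
    using lborel_pair.nn_integral_snd[OF g_aff] by (simp add: lborel_prod)
  also have "\<dots> = (\<integral>\<^sup>+y. ennreal \<bar>fst e\<bar> * (\<integral>\<^sup>+x. g (aff z e f (x, y)) \<partial>lborel) \<partial>lborel)"
    using lborel.borel_measurable_nn_integral_fst[OF measurable_pair_swap[OF g_aff]]
    by (intro nn_integral_cmult[symmetric]) simp
  also have "\<dots> = (\<integral>\<^sup>+y. (\<integral>\<^sup>+X. g (X, c X + q * y) \<partial>lborel) \<partial>lborel)"
  proof (rule nn_integral_cong)
    fix y
    have pt: "(fst z + y * fst f + fst e * x, c (fst z + y * fst f + fst e * x) + q * y) = aff z e f (x, y)" for x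
      using e by (intro prod_eqI) (simp_all add: fst_aff snd_aff c_def q_def det2_def field_simps)
    have "(\<integral>\<^sup>+X. g (X, c X + q * y) \<partial>lborel)
        = ennreal \<bar>fst e\<bar> * (\<integral>\<^sup>+x. g (fst z + y * fst f + fst e * x, c (fst z + y * fst f + fst e * x) + q * y) \<partial>lborel)"
      by (rule nn_integral_real_affine[OF sec e])
    then show "ennreal \<bar>fst e\<bar> * (\<integral>\<^sup>+x. g (aff z e f (x, y)) \<partial>lborel) = (\<integral>\<^sup>+X. g (X, c X + q * y) \<partial>lborel)"
      by (simp only: pt)
  qed
  also have "\<dots> = (\<integral>\<^sup>+X. (\<integral>\<^sup>+y. g (X, c X + q * y) \<partial>lborel) \<partial>lborel)"
    using gq by (intro lborel_pair.Fubini') (simp add: case_prod_beta')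
  finally have 1: "ennreal \<bar>fst e\<bar> * (\<integral>\<^sup>+x. g (aff z e f x) \<partial>lborel) = (\<integral>\<^sup>+X. (\<integral>\<^sup>+y. g (X, c X + q * y) \<partial>lborel) \<partial>lborel)" .
  have "ennreal \<bar>q\<bar> * (\<integral>\<^sup>+X. (\<integral>\<^sup>+y. g (X, c X + q * y) \<partial>lborel) \<partial>lborel)
      = (\<integral>\<^sup>+X. ennreal \<bar>q\<bar> * (\<integral>\<^sup>+y. g (X, c X + q * y) \<partial>lborel) \<partial>lborel)"
    using lborel.borel_measurable_nn_integral_fst[OF gq] by (intro nn_integral_cmult[symmetric]) simp
  also have "\<dots> = (\<integral>\<^sup>+X. (\<integral>\<^sup>+y. g (X, y) \<partial>lborel) \<partial>lborel)"
    by (intro nn_integral_cong nn_integral_real_affine[symmetric] gx q)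
  also have "\<dots> = (\<integral>\<^sup>+x. g x \<partial>lborel)"
    using lborel.nn_integral_fst[OF g] by (simp add: lborel_prod)
  finally have "ennreal \<bar>q\<bar> * (ennreal \<bar>fst e\<bar> * (\<integral>\<^sup>+x. g (aff z e f x) \<partial>lborel)) = (\<integral>\<^sup>+x. g x \<partial>lborel)"
    by (simp only: 1)
  moreover have "ennreal \<bar>q\<bar> * ennreal \<bar>fst e\<bar> = ennreal \<bar>det2 e f\<bar>"
    using e by (simp add: ennreal_mult[symmetric] q_def)
  ultimately show ?thesis by (simp add: mult.assoc[symmetric])
qed

text \<open>If \<open>fst e\<close> vanishes then \<open>fst f\<close> does not, and exchanging the
  two variables reduces to the previous case.\<close>

lemma nn_integral_aff:
  assumes g[measurable]: "g \<in> borel_measurable (borel :: point measure)" and det: "det2 e f \<noteq> 0"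
  shows "ennreal \<bar>det2 e f\<bar> * (\<integral>\<^sup>+x. g (aff z e f x) \<partial>lborel) = (\<integral>\<^sup>+x. g x \<partial>lborel)"
proof (cases "fst e = 0")
  case False
  then show ?thesis by (rule nn_integral_aff_aux[OF assms])
next
  case True
  then have f: "fst f \<noteq> 0" and det': "det2 f e \<noteq> 0" "\<bar>det2 f e\<bar> = \<bar>det2 e f\<bar>"
    using det by (auto simp: det2_def mult.commute)
  have m: "(\<lambda>x. g (aff z e f x)) \<in> borel_measurable (lborel \<Otimes>\<^sub>M lborel)" for e f
    using aff_borel[of z e f] by (simp add: lborel_prod)
  have "(\<integral>\<^sup>+x. g (aff z e f x) \<partial>lborel) = (\<integral>\<^sup>+y. (\<integral>\<^sup>+x. g (aff z e f (x, y)) \<partial>lborel) \<partial>lborel)"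
    using lborel_pair.nn_integral_snd[OF m] by (simp add: lborel_prod)
  also have "\<dots> = (\<integral>\<^sup>+y. (\<integral>\<^sup>+x. g (aff z f e (y, x)) \<partial>lborel) \<partial>lborel)"
    by (simp add: aff_def add_ac)
  also have "\<dots> = (\<integral>\<^sup>+x. g (aff z f e x) \<partial>lborel)"
    using lborel.nn_integral_fst[OF m] by (simp add: lborel_prod)
  finally show ?thesis
    using nn_integral_aff_aux[OF g det'(1) f, of z] det'(2) by simp
qed

lemma lborel_aff:
  assumes det: "det2 e f \<noteq> 0"
  shows "lborel = density (distr lborel borel (aff z e f)) (\<lambda>_. ennreal \<bar>det2 e f\<bar>)"
proof (rule measure_eqI)
  fix A :: "point set" assume A: "A \<in> sets lborel"
  then have [measurable]: "A \<in> sets borel" by simp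
  have "emeasure (density (distr lborel borel (aff z e f)) (\<lambda>_. ennreal \<bar>det2 e f\<bar>)) A
      = (\<integral>\<^sup>+x. ennreal \<bar>det2 e f\<bar> * indicator A x \<partial>distr lborel borel (aff z e f))"
    by (subst emeasure_density) auto
  also have "\<dots> = ennreal \<bar>det2 e f\<bar> * (\<integral>\<^sup>+x. indicator A x \<partial>distr lborel borel (aff z e f))"
    by (rule nn_integral_cmult) auto
  also have "(\<integral>\<^sup>+x. indicator A x \<partial>distr lborel borel (aff z e f)) = (\<integral>\<^sup>+x. indicator A (aff z e f x) \<partial>lborel)"
    using aff_borel by (subst nn_integral_distr) auto
  also have "ennreal \<bar>det2 e f\<bar> * \<dots> = (\<integral>\<^sup>+x. indicator A x \<partial>lborel)"
    by (rule nn_integral_aff[OF _ det]) simp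
  finally show "emeasure lborel A = emeasure (density (distr lborel borel (aff z e f)) (\<lambda>_. ennreal \<bar>det2 e f\<bar>)) A"
    using A by simp
qed simp

lemma
  assumes det: "det2 e f \<noteq> 0"
  shows aff_measurable_lebesgue: "aff z e f \<in> lebesgue \<rightarrow>\<^sub>M lebesgue"
    and lebesgue_aff: "lebesgue = density (distr lebesgue lebesgue (aff z e f)) (\<lambda>_. ennreal \<bar>det2 e f\<bar>)"
proof -
  let ?F = "aff z e f"
  have F: "?F \<in> lebesgue \<rightarrow>\<^sub>M borel"
    using aff_borel by (intro measurable_completion) simp
  \<comment> \<open>Agreement of the null sets is what makes the map measurable between the
    completed sigma-algebras.\<close>
  have "emeasure lborel A = 0 \<longleftrightarrow> emeasure (distr lebesgue lborel ?F) A = 0" if A: "A \<in> sets borel" for A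
  proof -
    have "emeasure lborel A = ennreal \<bar>det2 e f\<bar> * emeasure (distr lborel borel ?F) A"
      using A by (subst lborel_aff[OF det]) (simp add: emeasure_density nn_integral_cmult)
    also have "emeasure (distr lborel borel ?F) A = emeasure (distr lebesgue lborel ?F) A"
      using A F aff_borel[of z e f] by (simp add: distr_completion cong: distr_cong)
    finally show ?thesis using det by auto
  qed
  then have eq: "null_sets lborel = null_sets (distr lebesgue lborel ?F)"
    by (auto simp: null_sets_def)
  show "?F \<in> lebesgue \<rightarrow>\<^sub>M lebesgue"
    by (simp add: completion.measurable_completion2 eq F)
  have "lebesgue = completion (density (distr lborel borel ?F) (\<lambda>_. ennreal \<bar>det2 e f\<bar>))"
    by (subst lborel_aff[OF det]) simp
  also have "\<dots> = density (completion (distr lebesgue lborel ?F)) (\<lambda>_. ennreal \<bar>det2 e f\<bar>)"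
    using det aff_borel[of z e f]
    by (auto intro!: always_eventually completion_density_eq simp: distr_completion cong: distr_cong)
  also have "\<dots> = density (distr lebesgue lebesgue ?F) (\<lambda>_. ennreal \<bar>det2 e f\<bar>)"
    by (subst completion.completion_distr_eq) (auto simp: eq F)
  finally show "lebesgue = density (distr lebesgue lebesgue ?F) (\<lambda>_. ennreal \<bar>det2 e f\<bar>)" .
qed

lemma borel_measurable_lebesgue_aff:
  assumes "det2 e f \<noteq> 0" "g \<in> borel_measurable lebesgue"
  shows "(\<lambda>x. g (aff z e f x)) \<in> borel_measurable lebesgue"
  using measurable_compose[OF aff_measurable_lebesgue assms(2)] assms(1) by blast

lemma integrable_lebesgue_aff:
  fixes g :: "point \<Rightarrow> real"
  assumes det: "det2 e f \<noteq> 0" and g: "integrable lebesgue g"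
  shows "integrable lebesgue (\<lambda>x. g (aff z e f x))"
    and "(LINT x|lebesgue. g x) = \<bar>det2 e f\<bar> * (LINT x|lebesgue. g (aff z e f x))"
proof -
  let ?D = "distr lebesgue lebesgue (aff z e f)"
  have m: "g \<in> borel_measurable ?D" using borel_measurable_integrable[OF g] by simp
  have "integrable (density ?D (\<lambda>_. ennreal \<bar>det2 e f\<bar>)) g"
    using g lebesgue_aff[OF det] by metis
  then have "integrable ?D (\<lambda>x. \<bar>det2 e f\<bar> *\<^sub>R g x)"
    using m by (subst (asm) integrable_density) auto
  then have "integrable ?D g" using det by simp
  then show "integrable lebesgue (\<lambda>x. g (aff z e f x))"
    using m aff_measurable_lebesgue[OF det] by (subst (asm) integrable_distr_eq) auto
  have "(LINT x|lebesgue. g x) = (LINT x|density ?D (\<lambda>_. ennreal \<bar>det2 e f\<bar>). g x)"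
    using lebesgue_aff[OF det] by metis
  also have "\<dots> = (LINT x|?D. \<bar>det2 e f\<bar> *\<^sub>R g x)"
    using m by (subst integral_density) auto
  also have "\<dots> = \<bar>det2 e f\<bar> * (LINT x|?D. g x)" by simp
  also have "(LINT x|?D. g x) = (LINT x|lebesgue. g (aff z e f x))"
    using m aff_measurable_lebesgue[OF det] by (subst integral_distr) auto
  finally show "(LINT x|lebesgue. g x) = \<bar>det2 e f\<bar> * (LINT x|lebesgue. g (aff z e f x))" .
qed

lemma AE_lebesgue_aff:
  assumes det: "det2 e f \<noteq> 0" and P: "AE x in lebesgue. P x"
  shows "AE x in lebesgue. P (aff z e f x)"
proof -
  obtain N where N: "N \<in> null_sets lebesgue" "{x. \<not> P x} \<subseteq> N"
    using P by (auto simp: eventually_ae_filter)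
  have "AE x in density (distr lebesgue lebesgue (aff z e f)) (\<lambda>_. ennreal \<bar>det2 e f\<bar>). x \<notin> N"
    using AE_not_in[OF N(1)] lebesgue_aff[OF det] by metis
  then have "AE x in distr lebesgue lebesgue (aff z e f). x \<notin> N"
    using det by (subst (asm) AE_density) auto
  then have "AE x in lebesgue. aff z e f x \<notin> N"
    using N(1) aff_measurable_lebesgue[OF det] sets.compl_sets[of N lebesgue]
    by (subst (asm) AE_distr_iff) (auto simp: set_diff_eq)
  then show ?thesis by eventually_elim (use N in auto)
qed

lemma indicator_vimage_aff: "indicator (aff z e f -` U) x = indicator U (aff z e f x)"
  by (simp add: indicator_def)

lemma vimage_aff_sets_lebesgue:
  assumes "det2 e f \<noteq> 0" "U \<in> sets lebesgue"
  shows "aff z e f -` U \<in> sets lebesgue"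
  using measurable_sets[OF aff_measurable_lebesgue[OF assms(1)] assms(2), of z] by simp

lemma integral_lebesgue_on_aff:
  fixes g :: "point \<Rightarrow> real"
  assumes det: "det2 e f \<noteq> 0" and U: "U \<in> sets lebesgue" and g: "integrable (lebesgue_on U) g"
  shows "integrable (lebesgue_on (aff z e f -` U)) (\<lambda>x. g (aff z e f x))"
    and "(LINT x|lebesgue_on U. g x) = \<bar>det2 e f\<bar> * (LINT x|lebesgue_on (aff z e f -` U). g (aff z e f x))"
proof -
  have V: "aff z e f -` U \<in> sets lebesgue" by (rule vimage_aff_sets_lebesgue[OF det U])
  have g': "integrable lebesgue (\<lambda>x. indicator U x * g x)"
    using g U by (simp add: integrable_lebesgue_on_indicator)
  show "integrable (lebesgue_on (aff z e f -` U)) (\<lambda>x. g (aff z e f x))"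
    using integrable_lebesgue_aff(1)[OF det g', of z] V
    by (simp add: integrable_lebesgue_on_indicator indicator_vimage_aff)
  show "(LINT x|lebesgue_on U. g x) = \<bar>det2 e f\<bar> * (LINT x|lebesgue_on (aff z e f -` U). g (aff z e f x))"
    using integrable_lebesgue_aff(2)[OF det g', of z] U V
    by (simp add: integral_lebesgue_on_indicator indicator_vimage_aff)
qed

lemma AE_lebesgue_on_iff:
  assumes "U \<in> sets lebesgue"
  shows "(AE x in lebesgue_on U. P x) \<longleftrightarrow> (AE x in lebesgue. x \<in> U \<longrightarrow> P x)"
  using assms by (subst AE_restrict_space_iff) auto

lemma AE_lebesgue_on_aff:
  assumes det: "det2 e f \<noteq> 0" and U: "U \<in> sets lebesgue" and P: "AE x in lebesgue_on U. P x"
  shows "AE x in lebesgue_on (aff z e f -` U). P (aff z e f x)"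
  using P AE_lebesgue_aff[OF det, of "\<lambda>x. x \<in> U \<longrightarrow> P x" z] vimage_aff_sets_lebesgue[OF det U, of z] U
  by (simp add: AE_lebesgue_on_iff)

lemma borel_measurable_lebesgue_on_indicator:
  fixes g :: "point \<Rightarrow> real"
  assumes "U \<in> sets lebesgue"
  shows "g \<in> borel_measurable (lebesgue_on U) \<longleftrightarrow> (\<lambda>x. indicator U x * g x) \<in> borel_measurable lebesgue"
  using assms by (subst borel_measurable_restrict_space_iff) auto

lemma borel_measurable_lebesgue_on_aff:
  fixes g :: "point \<Rightarrow> real"
  assumes det: "det2 e f \<noteq> 0" and U: "U \<in> sets lebesgue" and g: "g \<in> borel_measurable (lebesgue_on U)"
  shows "(\<lambda>x. g (aff z e f x)) \<in> borel_measurable (lebesgue_on (aff z e f -` U))"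
  using borel_measurable_lebesgue_aff[OF det, of "\<lambda>x. indicator U x * g x" z] g U
    vimage_aff_sets_lebesgue[OF det U, of z]
  by (simp add: borel_measurable_lebesgue_on_indicator indicator_vimage_aff)

lemma borel_measurable_lebesgue_on_cong_AE:
  fixes g :: "point \<Rightarrow> real"
  assumes U: "U \<in> sets lebesgue" and g: "g \<in> borel_measurable (lebesgue_on U)"
    and eq: "AE x in lebesgue_on U. g x = h x"
  shows "h \<in> borel_measurable (lebesgue_on U)"
proof -
  have "AE x in lebesgue. indicator U x * g x = indicator U x * h x"
    using eq U by (simp add: AE_lebesgue_on_iff) (auto elim!: eventually_mono simp: indicator_def)
  then have "(\<lambda>x. indicator U x * h x) \<in> borel_measurable lebesgue"
    using g U borel_measurable_AE[of "\<lambda>x. indicator U x * g x" "\<lambda>x. indicator U x * h x"]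
    by (simp add: borel_measurable_lebesgue_on_indicator)
  then show ?thesis using U by (simp add: borel_measurable_lebesgue_on_indicator)
qed

subsection \<open>Lebesgue spaces\<close>

lemma Lp_space_measurable: "f \<in> Lp_space p U \<Longrightarrow> f \<in> borel_measurable (lebesgue_on U)"
  by (simp add: Lp_space_def)

lemma exponent_cases:
  assumes "1 \<le> (p::ereal)"
  obtains (infinity) "p = \<infinity>" | (real) r where "p = ereal r" "1 \<le> r"
  using assms by (cases p) auto

lemma Lp_infinity_AE_bound:
  assumes "f \<in> Lp_space \<infinity> U"
  shows "AE x in lebesgue_on U. \<bar>f x\<bar> \<le> Lp_norm \<infinity> U f"
proof -
  let ?E = "esssup (lebesgue_on U) (\<lambda>x. ereal \<bar>f x\<bar>)"
  have "AE x in lebesgue_on U. ereal \<bar>f x\<bar> \<le> ?E" by (rule esssup_AE)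
  moreover have "?E < \<infinity>" using assms by (simp add: Lp_space_def)
  ultimately show ?thesis
    by (cases ?E) (auto simp: Lp_norm_def)
qed

lemma Lp_infinityI:
  assumes "f \<in> borel_measurable (lebesgue_on U)" "AE x in lebesgue_on U. \<bar>f x\<bar> \<le> C" "0 \<le> C"
  shows "f \<in> Lp_space \<infinity> U" "Lp_norm \<infinity> U f \<le> C"
proof -
  have "esssup (lebesgue_on U) (\<lambda>x. ereal \<bar>f x\<bar>) \<le> ereal C"
    using assms by (intro esssup_I) auto
  then show "f \<in> Lp_space \<infinity> U" "Lp_norm \<infinity> U f \<le> C"
    using assms
    by (auto simp: Lp_space_def Lp_norm_def order_le_less_trans)
      (cases "esssup (lebesgue_on U) (\<lambda>x. ereal \<bar>f x\<bar>)"; simp)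
qed

text \<open>In the degenerate cases the essential supremum is infinite, negatively on a space of
  measure 0 and positively for a function that is not measurable; \<open>real_of_ereal\<close> sends
  both to 0. Otherwise it bounds a nonnegative function on a set of positive measure.\<close>

lemma Lp_norm_nonneg: "0 \<le> Lp_norm p U f"
proof (cases "p = \<infinity> \<and> (\<lambda>x. ereal \<bar>f x\<bar>) \<in> borel_measurable (lebesgue_on U)")
  case True
  let ?M = "lebesgue_on U"
  let ?E = "esssup ?M (\<lambda>x. ereal \<bar>f x\<bar>)"
  show ?thesis
  proof (rule ccontr)
    assume "\<not> 0 \<le> Lp_norm p U f"
    then have lt: "real_of_ereal ?E < 0" using True by (simp add: Lp_norm_def)
    then have "?E < 0" by (cases ?E) auto
    have "AE x in ?M. ereal \<bar>f x\<bar> \<le> ?E" by (rule esssup_AE)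
    then have "AE x in ?M. False"
    proof eventually_elim
      case (elim x)
      have "0 \<le> ereal \<bar>f x\<bar>" by simp
      with elim \<open>?E < 0\<close> show False by (meson leD order_trans)
    qed
    then have "emeasure ?M (space ?M) = 0"
      by (metis ae_filter_eq_bot_iff trivial_limit_def)
    then have "?E = - \<infinity>" by (rule esssup_zero_space) (use True in auto)
    then show False using lt by simp
  qed
next
  case False
  then show ?thesis
    by (cases "p = \<infinity>") (auto simp: Lp_norm_def esssup_non_measurable top_ereal_def)
qed

lemma Lp_norm_powr:
  assumes "1 \<le> r"
  shows "Lp_norm (ereal r) U f powr r = (LINT x|lebesgue_on U. \<bar>f x\<bar> powr r)"
  using assms by (simp add: Lp_norm_def powr_powr)

lemma Lp_norm_real_leI:
  assumes "1 \<le> r" "(LINT x|lebesgue_on U. \<bar>f x\<bar> powr r) \<le> C powr r" "0 \<le> C"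
  shows "Lp_norm (ereal r) U f \<le> C"
proof -
  have "(LINT x|lebesgue_on U. \<bar>f x\<bar> powr r) powr (1 / r) \<le> (C powr r) powr (1 / r)"
    using assms by (intro powr_mono2) auto
  then show ?thesis using assms by (simp add: Lp_norm_def powr_powr)
qed

lemma Lp_mono:
  assumes p: "1 \<le> p" and g: "g \<in> Lp_space p U" and f: "f \<in> borel_measurable (lebesgue_on U)"
    and le: "AE x in lebesgue_on U. \<bar>f x\<bar> \<le> c * \<bar>g x\<bar>" and c: "0 \<le> c"
  shows "f \<in> Lp_space p U" "Lp_norm p U f \<le> c * Lp_norm p U g"
proof -
  have "f \<in> Lp_space p U \<and> Lp_norm p U f \<le> c * Lp_norm p U g"
    using p
  proof (cases rule: exponent_cases)
    case infinity
    have "AE x in lebesgue_on U. \<bar>f x\<bar> \<le> c * Lp_norm \<infinity> U g"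
      using le Lp_infinity_AE_bound[OF g[unfolded infinity]]
    proof eventually_elim
      case (elim x)
      then show ?case using mult_left_mono[OF elim(2) c] by linarith
    qed
    then show ?thesis
      using Lp_infinityI[OF f, of "c * Lp_norm \<infinity> U g"] c Lp_norm_nonneg[of \<infinity> U g] infinity by simp
  next
    case (real r)
    have gi: "integrable (lebesgue_on U) (\<lambda>x. \<bar>g x\<bar> powr r)"
      using g real by (simp add: Lp_space_def)
    have le': "AE x in lebesgue_on U. \<bar>f x\<bar> powr r \<le> c powr r * \<bar>g x\<bar> powr r"
      using le
    proof eventually_elim
      case (elim x)
      then have "\<bar>f x\<bar> powr r \<le> (c * \<bar>g x\<bar>) powr r"
        using real by (intro powr_mono2) auto
      then show ?case using c by (simp add: powr_mult)
    qed
    have fi: "integrable (lebesgue_on U) (\<lambda>x. \<bar>f x\<bar> powr r)"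
    proof (rule Bochner_Integration.integrable_bound)
      show "integrable (lebesgue_on U) (\<lambda>x. c powr r * \<bar>g x\<bar> powr r)" using gi by simp
      show "(\<lambda>x. \<bar>f x\<bar> powr r) \<in> borel_measurable (lebesgue_on U)" using f by measurable
      show "AE x in lebesgue_on U. norm (\<bar>f x\<bar> powr r) \<le> norm (c powr r * \<bar>g x\<bar> powr r)"
        using le' by eventually_elim auto
    qed
    have "(LINT x|lebesgue_on U. \<bar>f x\<bar> powr r) \<le> (LINT x|lebesgue_on U. c powr r * \<bar>g x\<bar> powr r)"
      using le' gi fi by (intro integral_mono_AE) auto
    also have "\<dots> = c powr r * Lp_norm p U g powr r"
      using real by (simp add: Lp_norm_powr)
    also have "\<dots> = (c * Lp_norm p U g) powr r"
      using c by (simp add: powr_mult Lp_norm_nonneg)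
    finally have "Lp_norm p U f \<le> c * Lp_norm p U g"
      using real c Lp_norm_nonneg[of p U g] by (auto intro!: Lp_norm_real_leI)
    then show ?thesis using f fi real by (simp add: Lp_space_def)
  qed
  then show "f \<in> Lp_space p U" "Lp_norm p U f \<le> c * Lp_norm p U g" by auto
qed

lemma Lp_cong:
  assumes "1 \<le> p" "open U" "g \<in> Lp_space p U" "AE x in lebesgue_on U. g x = f x"
  shows "f \<in> Lp_space p U" "Lp_norm p U f = Lp_norm p U g"
proof -
  have f: "f \<in> borel_measurable (lebesgue_on U)"
    using assms by (intro borel_measurable_lebesgue_on_cong_AE[of U g f] open_sets_lebesgue Lp_space_measurable)
  have "AE x in lebesgue_on U. \<bar>f x\<bar> \<le> 1 * \<bar>g x\<bar>" "AE x in lebesgue_on U. \<bar>g x\<bar> \<le> 1 * \<bar>f x\<bar>"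
    using assms(4) by (auto elim!: eventually_mono)
  note * = Lp_mono[OF assms(1,3) f this(1)] this(2)
  then show f': "f \<in> Lp_space p U" by simp
  show "Lp_norm p U f = Lp_norm p U g"
    using * Lp_mono[OF assms(1) f' Lp_space_measurable[OF assms(3)] *(3)] by simp
qed

lemma Lp_cmult:
  assumes "1 \<le> p" "f \<in> Lp_space p U"
  shows "(\<lambda>x. c * f x) \<in> Lp_space p U" "Lp_norm p U (\<lambda>x. c * f x) \<le> \<bar>c\<bar> * Lp_norm p U f"
proof -
  have "(\<lambda>x. c * f x) \<in> borel_measurable (lebesgue_on U)"
    using Lp_space_measurable[OF assms(2)] by measurable
  note * = Lp_mono[OF assms this, of "\<bar>c\<bar>"]
  show "(\<lambda>x. c * f x) \<in> Lp_space p U" "Lp_norm p U (\<lambda>x. c * f x) \<le> \<bar>c\<bar> * Lp_norm p U f"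
    using * by (auto simp: abs_mult)
qed

lemma Lp_zero: "(\<lambda>x. 0) \<in> Lp_space p U" "Lp_norm p U (\<lambda>x. 0) = 0"
proof -
  have "(\<lambda>x. 0) \<in> Lp_space p U \<and> Lp_norm p U (\<lambda>x. 0) = 0"
  proof (cases "p = \<infinity>")
    case True
    then show ?thesis
      using Lp_infinityI[of "\<lambda>_. 0" U 0] Lp_norm_nonneg[of \<infinity> U "\<lambda>_. 0"] by simp
  next
    case False
    then show ?thesis by (simp add: Lp_space_def Lp_norm_def)
  qed
  then show "(\<lambda>x. 0) \<in> Lp_space p U" "Lp_norm p U (\<lambda>x. 0) = 0" by auto
qed

lemma powr_add_le:
  fixes a b :: real
  assumes "0 \<le> a" "0 \<le> b" "0 \<le> r"
  shows "(a + b) powr r \<le> 2 powr r * (a powr r + b powr r)"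
proof -
  have "(a + b) powr r \<le> (2 * max a b) powr r"
    using assms by (intro powr_mono2) auto
  also have "\<dots> = 2 powr r * max a b powr r"
    using assms by (simp add: powr_mult)
  also have "max a b powr r \<le> a powr r + b powr r"
    by (auto simp: max_def)
  finally show ?thesis by simp
qed

text \<open>Each summand satisfies \<open>x^r <= x (a + b)^(r - 1)\<close>.\<close>

lemma add_powr_le_powr_add:
  fixes a b :: real
  assumes "0 \<le> a" "0 \<le> b" "1 \<le> r"
  shows "a powr r + b powr r \<le> (a + b) powr r"
proof (cases "a + b = 0")
  case True
  then show ?thesis using assms by (simp add: add_nonneg_eq_0_iff)
next
  case False
  then have s: "a + b > 0" using assms by linarith
  have le: "x powr r \<le> x * (a + b) powr (r - 1)" if "0 \<le> x" "x \<le> a + b" for x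
  proof (cases "x = 0")
    case False
    then have "x powr r = x * x powr (r - 1)"
      using that by (simp add: powr_mult_base)
    also have "\<dots> \<le> x * (a + b) powr (r - 1)"
      using that assms by (intro mult_left_mono powr_mono2) auto
    finally show ?thesis .
  qed simp
  have "a powr r + b powr r \<le> (a + b) * (a + b) powr (r - 1)"
    using le[of a] le[of b] assms by (simp add: distrib_right)
  also have "\<dots> = (a + b) powr r" using s by (simp add: powr_mult_base)
  finally show ?thesis .
qed

text \<open>Constants are immaterial, so a factor 2 is allowed:
  \<open>|f + g|^r <= 2^r (|f|^r + |g|^r)\<close>, and superadditivity of the power recombines the
  two norms.\<close>

lemma Lp_add:
  assumes p: "1 \<le> p" and f: "f \<in> Lp_space p U" and g: "g \<in> Lp_space p U"
  shows "(\<lambda>x. f x + g x) \<in> Lp_space p U"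
    "Lp_norm p U (\<lambda>x. f x + g x) \<le> 2 * (Lp_norm p U f + Lp_norm p U g)"
proof -
  note nn = Lp_norm_nonneg[of p U f] Lp_norm_nonneg[of p U g]
  have m: "(\<lambda>x. f x + g x) \<in> borel_measurable (lebesgue_on U)"
    using f g by (intro borel_measurable_add Lp_space_measurable)
  have "(\<lambda>x. f x + g x) \<in> Lp_space p U \<and>
    Lp_norm p U (\<lambda>x. f x + g x) \<le> 2 * (Lp_norm p U f + Lp_norm p U g)"
    using p
  proof (cases rule: exponent_cases)
    case infinity
    have "AE x in lebesgue_on U. \<bar>f x + g x\<bar> \<le> 2 * (Lp_norm p U f + Lp_norm p U g)"
      using Lp_infinity_AE_bound[OF f[unfolded infinity]] Lp_infinity_AE_bound[OF g[unfolded infinity]]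
      by eventually_elim (use nn infinity in \<open>auto intro: order_trans[OF abs_triangle_ineq]\<close>)
    then show ?thesis
      using Lp_infinityI[OF m, of "2 * (Lp_norm p U f + Lp_norm p U g)"] nn infinity by simp
  next
    case (real r)
    have i: "integrable (lebesgue_on U) (\<lambda>x. \<bar>f x\<bar> powr r)" "integrable (lebesgue_on U) (\<lambda>x. \<bar>g x\<bar> powr r)"
      using f g real by (simp_all add: Lp_space_def)
    let ?h = "\<lambda>x. 2 powr r * (\<bar>f x\<bar> powr r + \<bar>g x\<bar> powr r)"
    have le: "\<bar>f x + g x\<bar> powr r \<le> ?h x" for x
    proof -
      have "\<bar>f x + g x\<bar> powr r \<le> (\<bar>f x\<bar> + \<bar>g x\<bar>) powr r"
        using real by (intro powr_mono2) auto
      also have "\<dots> \<le> ?h x" using real by (intro powr_add_le) auto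
      finally show ?thesis .
    qed
    have fi: "integrable (lebesgue_on U) (\<lambda>x. \<bar>f x + g x\<bar> powr r)"
    proof (rule Bochner_Integration.integrable_bound)
      show "integrable (lebesgue_on U) ?h" using i by simp
      show "(\<lambda>x. \<bar>f x + g x\<bar> powr r) \<in> borel_measurable (lebesgue_on U)" using m by measurable
    qed (use le in \<open>auto intro!: AE_I2\<close>)
    have "(LINT x|lebesgue_on U. \<bar>f x + g x\<bar> powr r) \<le> (LINT x|lebesgue_on U. ?h x)"
      using le i fi by (intro integral_mono) auto
    also have "\<dots> = 2 powr r * (Lp_norm p U f powr r + Lp_norm p U g powr r)"
      using real i by (simp add: Lp_norm_powr)
    also have "\<dots> \<le> 2 powr r * (Lp_norm p U f + Lp_norm p U g) powr r"
      using nn real by (intro mult_left_mono add_powr_le_powr_add) auto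
    also have "\<dots> = (2 * (Lp_norm p U f + Lp_norm p U g)) powr r"
      using nn by (subst powr_mult) auto
    finally have "Lp_norm p U (\<lambda>x. f x + g x) \<le> 2 * (Lp_norm p U f + Lp_norm p U g)"
      using real nn by (auto intro!: Lp_norm_real_leI)
    then show ?thesis using m fi real by (simp add: Lp_space_def)
  qed
  then show "(\<lambda>x. f x + g x) \<in> Lp_space p U"
    "Lp_norm p U (\<lambda>x. f x + g x) \<le> 2 * (Lp_norm p U f + Lp_norm p U g)" by auto
qed

lemma Lp_diff:
  assumes p: "1 \<le> p" and f: "f \<in> Lp_space p U" and g: "g \<in> Lp_space p U"
  shows "(\<lambda>x. f x - g x) \<in> Lp_space p U"
    "Lp_norm p U (\<lambda>x. f x - g x) \<le> 2 * (Lp_norm p U f + Lp_norm p U g)"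
proof -
  define h where "h = (\<lambda>x. - 1 * g x)"
  have h: "h \<in> Lp_space p U" "Lp_norm p U h \<le> Lp_norm p U g"
    using Lp_cmult[OF p g, of "-1"] by (simp_all add: h_def)
  have eq: "(\<lambda>x. f x + h x) = (\<lambda>x. f x - g x)" by (simp add: h_def)
  show "(\<lambda>x. f x - g x) \<in> Lp_space p U"
    using Lp_add(1)[OF p f h(1)] unfolding eq .
  show "Lp_norm p U (\<lambda>x. f x - g x) \<le> 2 * (Lp_norm p U f + Lp_norm p U g)"
    using Lp_add(2)[OF p f h(1)] unfolding eq by (rule order_trans) (use h(2) in simp)
qed

text \<open>Every use of the two-term inequality costs a factor 2.\<close>

lemma Lp_sum:
  assumes p: "1 \<le> p" and "finite A" and "\<And>a. a \<in> A \<Longrightarrow> f a \<in> Lp_space p U"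
  shows "(\<lambda>x. \<Sum>a\<in>A. f a x) \<in> Lp_space p U \<and>
    Lp_norm p U (\<lambda>x. \<Sum>a\<in>A. f a x) \<le> 2 ^ card A * (\<Sum>a\<in>A. Lp_norm p U (f a))"
  using assms(2,3)
proof (induction rule: finite_induct)
  case empty
  then show ?case by (simp add: Lp_zero)
next
  case (insert a A)
  let ?S = "\<lambda>x. \<Sum>a\<in>A. f a x"
  have fa: "f a \<in> Lp_space p U" and S: "?S \<in> Lp_space p U"
    "Lp_norm p U ?S \<le> 2 ^ card A * (\<Sum>a\<in>A. Lp_norm p U (f a))"
    using insert by auto
  have "Lp_norm p U (\<lambda>x. f a x + ?S x) \<le> 2 * (Lp_norm p U (f a) + Lp_norm p U ?S)"
    by (rule Lp_add(2)[OF p fa S(1)])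
  also have "\<dots> \<le> 2 * (2 ^ card A * Lp_norm p U (f a) + 2 ^ card A * (\<Sum>a\<in>A. Lp_norm p U (f a)))"
    using S(2) mult_right_mono[of 1 "2 ^ card A" "Lp_norm p U (f a)"] Lp_norm_nonneg[of p U "f a"]
    by (intro mult_left_mono add_mono) auto
  finally show ?case
    using insert.hyps Lp_add(1)[OF p fa S(1)] by (simp add: algebra_simps)
qed

lemma Lp_subset:
  assumes p: "1 \<le> p" and U: "open U" "open V" "V \<subseteq> U" and f: "f \<in> Lp_space p U"
  shows "f \<in> Lp_space p V" "Lp_norm p V f \<le> Lp_norm p U f"
proof -
  have ind: "indicator V x * f x = indicator V x * (indicator U x * f x)" for x
    using U by (auto simp: indicator_def)
  have m: "f \<in> borel_measurable (lebesgue_on V)"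
    using borel_measurable_times[OF borel_measurable_indicator[OF open_sets_lebesgue[OF U(2)]]
        Lp_space_measurable[OF f, unfolded borel_measurable_lebesgue_on_indicator[OF open_sets_lebesgue[OF U(1)]]]]
    unfolding borel_measurable_lebesgue_on_indicator[OF open_sets_lebesgue[OF U(2)]] ind .
  have "f \<in> Lp_space p V \<and> Lp_norm p V f \<le> Lp_norm p U f"
    using p
  proof (cases rule: exponent_cases)
    case infinity
    have "AE x in lebesgue_on V. \<bar>f x\<bar> \<le> Lp_norm p U f"
      using Lp_infinity_AE_bound[OF f[unfolded infinity]] U infinity open_sets_lebesgue
      by (auto simp: AE_lebesgue_on_iff elim!: eventually_mono)
    then show ?thesis
      using Lp_infinityI[OF m, of "Lp_norm p U f"] Lp_norm_nonneg[of p U f] infinity by simp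
  next
    case (real r)
    have i: "integrable lebesgue (\<lambda>x. indicator U x * \<bar>f x\<bar> powr r)"
      using f real U open_sets_lebesgue[of U] by (simp add: Lp_space_def integrable_lebesgue_on_indicator)
    have ind': "indicator V x * \<bar>f x\<bar> powr r = indicator V x * (indicator U x * \<bar>f x\<bar> powr r)" for x
      using U by (auto simp: indicator_def)
    have iV: "integrable lebesgue (\<lambda>x. indicator V x * \<bar>f x\<bar> powr r)"
      using integrable_mult_indicator[OF open_sets_lebesgue[OF U(2)] i] by (simp add: ind')
    have "(LINT x|lebesgue. indicator V x * \<bar>f x\<bar> powr r) \<le> (LINT x|lebesgue. indicator U x * \<bar>f x\<bar> powr r)"
      using i iV U by (intro integral_mono) (auto simp: indicator_def)
    then have "(LINT x|lebesgue_on V. \<bar>f x\<bar> powr r) \<le> (LINT x|lebesgue_on U. \<bar>f x\<bar> powr r)"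
      using U open_sets_lebesgue by (simp add: integral_lebesgue_on_indicator)
    then have "Lp_norm p V f \<le> Lp_norm p U f"
      using real Lp_norm_nonneg[of p U f] by (auto intro!: Lp_norm_real_leI simp: Lp_norm_powr)
    then show ?thesis
      using iV real m U open_sets_lebesgue[of V] by (simp add: Lp_space_def integrable_lebesgue_on_indicator)
  qed
  then show "f \<in> Lp_space p V" "Lp_norm p V f \<le> Lp_norm p U f" by auto
qed

text \<open>The two pieces may overlap and stick out of \<open>U\<close>. Measurability is glued by
  using the first piece on \<open>V\<close> and the second one off \<open>V\<close>; superadditivity
  of the power keeps the factor 1.\<close>

lemma Lp_cover:
  assumes p: "1 \<le> p" and U: "open U" "open V" "open W" and f: "f \<in> Lp_space p V" "f \<in> Lp_space p W"
    and cover: "AE x in lebesgue_on U. x \<in> V \<union> W"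
  shows "f \<in> Lp_space p U" "Lp_norm p U f \<le> Lp_norm p V f + Lp_norm p W f"
proof -
  note nn = Lp_norm_nonneg[of p V f] Lp_norm_nonneg[of p W f]
  have cover': "AE x in lebesgue. x \<in> U \<longrightarrow> x \<in> V \<or> x \<in> W"
    using cover U open_sets_lebesgue by (auto simp: AE_lebesgue_on_iff)
  have mVW: "(\<lambda>x. indicator V x * f x) \<in> borel_measurable lebesgue" "(\<lambda>x. indicator W x * f x) \<in> borel_measurable lebesgue"
    using f[THEN Lp_space_measurable]
    unfolding borel_measurable_lebesgue_on_indicator[OF open_sets_lebesgue[OF U(2)]]
      borel_measurable_lebesgue_on_indicator[OF open_sets_lebesgue[OF U(3)]] .
  have m: "f \<in> borel_measurable (lebesgue_on U)"
  proof -
    let ?g = "\<lambda>x. indicator U x * (indicator V x * f x + indicator (- V) x * (indicator W x * f x))"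
    have "?g \<in> borel_measurable lebesgue"
    proof -
      have "- V \<in> sets lebesgue"
        using sets.compl_sets[OF open_sets_lebesgue[OF U(2)]] by (simp add: Compl_eq_Diff_UNIV)
      then show ?thesis
        by (rule borel_measurable_times[OF borel_measurable_indicator[OF open_sets_lebesgue[OF U(1)]]
            borel_measurable_add[OF mVW(1) borel_measurable_times[OF borel_measurable_indicator mVW(2)]]])
    qed
    moreover have "AE x in lebesgue. ?g x = indicator U x * f x"
      using cover' by eventually_elim (auto simp: indicator_def)
    ultimately show ?thesis
      unfolding borel_measurable_lebesgue_on_indicator[OF open_sets_lebesgue[OF U(1)]]
      by (rule borel_measurable_AE)
  qed
  have "f \<in> Lp_space p U \<and> Lp_norm p U f \<le> Lp_norm p V f + Lp_norm p W f"
    using p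
  proof (cases rule: exponent_cases)
    case infinity
    have "AE x in lebesgue. x \<in> V \<longrightarrow> \<bar>f x\<bar> \<le> Lp_norm p V f" "AE x in lebesgue. x \<in> W \<longrightarrow> \<bar>f x\<bar> \<le> Lp_norm p W f"
      using Lp_infinity_AE_bound[OF f(1)[unfolded infinity]] Lp_infinity_AE_bound[OF f(2)[unfolded infinity]]
        infinity U open_sets_lebesgue by (auto simp: AE_lebesgue_on_iff)
    with cover' have "AE x in lebesgue. x \<in> U \<longrightarrow> \<bar>f x\<bar> \<le> Lp_norm p V f + Lp_norm p W f"
      by eventually_elim (use nn in auto)
    then have "AE x in lebesgue_on U. \<bar>f x\<bar> \<le> Lp_norm p V f + Lp_norm p W f"
      using U open_sets_lebesgue by (simp add: AE_lebesgue_on_iff)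
    then show ?thesis
      using Lp_infinityI[OF m, of "Lp_norm p V f + Lp_norm p W f"] nn infinity by simp
  next
    case (real r)
    let ?h = "\<lambda>x. indicator V x * \<bar>f x\<bar> powr r + indicator W x * \<bar>f x\<bar> powr r"
    have i: "integrable lebesgue (\<lambda>x. indicator V x * \<bar>f x\<bar> powr r)" "integrable lebesgue (\<lambda>x. indicator W x * \<bar>f x\<bar> powr r)"
      using f real U open_sets_lebesgue by (auto simp: Lp_space_def integrable_lebesgue_on_indicator)
    have le: "AE x in lebesgue. indicator U x * \<bar>f x\<bar> powr r \<le> ?h x"
      using cover' by eventually_elim (auto simp: indicator_def)
    have mU: "(\<lambda>x. indicator U x * \<bar>f x\<bar> powr r) \<in> borel_measurable lebesgue"
    proof -
      have "(\<lambda>x. \<bar>f x\<bar> powr r) \<in> borel_measurable (lebesgue_on U)" using m by measurable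
      then show ?thesis using open_sets_lebesgue[OF U(1)] by (simp add: borel_measurable_lebesgue_on_indicator)
    qed
    have fi: "integrable lebesgue (\<lambda>x. indicator U x * \<bar>f x\<bar> powr r)"
    proof (rule Bochner_Integration.integrable_bound)
      show "integrable lebesgue ?h" using i by simp
      show "AE x in lebesgue. norm (indicator U x * \<bar>f x\<bar> powr r) \<le> norm (?h x)"
        using le by eventually_elim auto
    qed (rule mU)
    have "(LINT x|lebesgue. indicator U x * \<bar>f x\<bar> powr r) \<le> (LINT x|lebesgue. ?h x)"
      using le i fi by (intro integral_mono_AE) auto
    also have "\<dots> = Lp_norm p V f powr r + Lp_norm p W f powr r"
      using i real U open_sets_lebesgue by (simp add: Lp_norm_powr integral_lebesgue_on_indicator)
    also have "\<dots> \<le> (Lp_norm p V f + Lp_norm p W f) powr r"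
      using nn real by (intro add_powr_le_powr_add) auto
    finally have "Lp_norm p U f \<le> Lp_norm p V f + Lp_norm p W f"
      using real nn U open_sets_lebesgue[OF U(1)] by (auto intro!: Lp_norm_real_leI simp: integral_lebesgue_on_indicator)
    then show ?thesis
      using m fi real U open_sets_lebesgue[of U] by (simp add: Lp_space_def integrable_lebesgue_on_indicator)
  qed
  then show "f \<in> Lp_space p U" "Lp_norm p U f \<le> Lp_norm p V f + Lp_norm p W f" by auto
qed

text \<open>At \<open>p = \<infinity>\<close> the conventions
  \<open>real_of_ereal \<infinity> = 0\<close> and \<open>1 / 0 = 0\<close> turn the determinant
  factor into 1, as they should.\<close>

lemma Lp_aff:
  assumes p: "1 \<le> p" and det: "det2 e f \<noteq> 0" and U: "open U" and g: "g \<in> Lp_space p U"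
  shows "(\<lambda>x. g (aff z e f x)) \<in> Lp_space p (aff z e f -` U)"
    "Lp_norm p (aff z e f -` U) (\<lambda>x. g (aff z e f x)) \<le> \<bar>det2 e f\<bar> powr (- (1 / real_of_ereal p)) * Lp_norm p U g"
proof -
  let ?V = "aff z e f -` U" and ?h = "\<lambda>x. g (aff z e f x)"
  have m: "?h \<in> borel_measurable (lebesgue_on ?V)"
    by (intro borel_measurable_lebesgue_on_aff det open_sets_lebesgue U Lp_space_measurable[OF g])
  have "?h \<in> Lp_space p ?V \<and> Lp_norm p ?V ?h \<le> \<bar>det2 e f\<bar> powr (- (1 / real_of_ereal p)) * Lp_norm p U g"
    using p
  proof (cases rule: exponent_cases)
    case infinity
    have "AE x in lebesgue_on ?V. \<bar>?h x\<bar> \<le> Lp_norm p U g"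
      using AE_lebesgue_on_aff[OF det open_sets_lebesgue[OF U] Lp_infinity_AE_bound[OF g[unfolded infinity]], of z]
      by (simp add: infinity)
    then show ?thesis
      using Lp_infinityI[OF m, of "Lp_norm p U g"] Lp_norm_nonneg[of p U g] infinity det by simp
  next
    case (real r)
    have i: "integrable (lebesgue_on U) (\<lambda>x. \<bar>g x\<bar> powr r)"
      using g real by (simp add: Lp_space_def)
    note * = integral_lebesgue_on_aff[OF det open_sets_lebesgue[OF U] i, of z]
    have "(LINT x|lebesgue_on ?V. \<bar>?h x\<bar> powr r) = \<bar>det2 e f\<bar> powr - 1 * Lp_norm p U g powr r"
      using *(2) real det by (simp add: Lp_norm_powr powr_minus field_simps)
    also have "\<bar>det2 e f\<bar> powr - 1 = (\<bar>det2 e f\<bar> powr (- (1 / r))) powr r"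
      using real by (simp add: powr_powr)
    also have "\<dots> * Lp_norm p U g powr r = (\<bar>det2 e f\<bar> powr (- (1 / r)) * Lp_norm p U g) powr r"
      by (simp add: powr_mult Lp_norm_nonneg)
    finally have "Lp_norm p ?V ?h \<le> \<bar>det2 e f\<bar> powr (- (1 / r)) * Lp_norm p U g"
      using real Lp_norm_nonneg[of p U g] by (auto intro!: Lp_norm_real_leI)
    then show ?thesis using m real *(1) by (simp add: Lp_space_def)
  qed
  then show "?h \<in> Lp_space p ?V" "Lp_norm p ?V ?h \<le> \<bar>det2 e f\<bar> powr (- (1 / real_of_ereal p)) * Lp_norm p U g"
    by auto
qed

lemma measure_lebesgue_on: "U \<in> sets lebesgue \<Longrightarrow> emeasure (lebesgue_on U) U = emeasure lebesgue U"
  by (subst emeasure_restrict_space) auto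

lemma Lp_bounded:
  assumes p: "1 \<le> p" and U: "open U" "emeasure lebesgue U \<le> 1"
    and f: "f \<in> borel_measurable (lebesgue_on U)" and le: "AE x in lebesgue_on U. \<bar>f x\<bar> \<le> C" and C: "0 \<le> C"
  shows "f \<in> Lp_space p U" "Lp_norm p U f \<le> C"
proof -
  have em: "emeasure (lebesgue_on U) U \<le> 1"
    using U open_sets_lebesgue by (simp add: measure_lebesgue_on)
  then have fin: "emeasure (lebesgue_on U) (space (lebesgue_on U)) < \<infinity>"
    by (auto intro: order_le_less_trans)
  have "f \<in> Lp_space p U \<and> Lp_norm p U f \<le> C"
    using p
  proof (cases rule: exponent_cases)
    case infinity
    then show ?thesis using Lp_infinityI[OF f le C] by simp
  next
    case (real r)
    interpret finite_measure "lebesgue_on U"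
      by (rule finite_measureI) (use fin in simp)
    have le': "AE x in lebesgue_on U. \<bar>f x\<bar> powr r \<le> C powr r"
      using le by eventually_elim (use real in \<open>auto intro!: powr_mono2\<close>)
    have i: "integrable (lebesgue_on U) (\<lambda>x. \<bar>f x\<bar> powr r)"
    proof (rule integrable_const_bound)
      show "AE x in lebesgue_on U. norm (\<bar>f x\<bar> powr r) \<le> C powr r" using le' by simp
      show "(\<lambda>x. \<bar>f x\<bar> powr r) \<in> borel_measurable (lebesgue_on U)" using f by measurable
    qed
    have "(LINT x|lebesgue_on U. \<bar>f x\<bar> powr r) \<le> (LINT x|lebesgue_on U. C powr r)"
      using i le' by (intro integral_mono_AE) auto
    also have "\<dots> = measure (lebesgue_on U) U * C powr r" by simp
    also have "measure (lebesgue_on U) U \<le> 1"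
      using em unfolding measure_def by (metis enn2real_1 enn2real_mono ennreal_one_less_top)
    then have "measure (lebesgue_on U) U * C powr r \<le> 1 * C powr r"
      by (intro mult_right_mono) auto
    finally have "Lp_norm p U f \<le> C"
      using real C by (auto intro!: Lp_norm_real_leI)
    then show ?thesis using real f i by (simp add: Lp_space_def)
  qed
  then show "f \<in> Lp_space p U" "Lp_norm p U f \<le> C" by auto
qed

text \<open>The pointwise bound \<open>t \<le> N + N\<^sup>1\<^sup>-\<^sup>r t\<^sup>r\<close>, applied with \<open>N\<close> the \<open>L\<^sup>r\<close>-norm, replaces
  Hoelder's inequality.\<close>

lemma le_add_powr:
  fixes t N :: real
  assumes "0 \<le> t" "0 < N" "1 \<le> r"
  shows "t \<le> N + N powr (1 - r) * t powr r"
proof (cases "t \<le> N")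
  case True
  then show ?thesis by (simp add: add_increasing2)
next
  case False
  then have t: "t = t powr (1 - r) * t powr r"
    using assms by (simp add: powr_add[symmetric])
  also have "\<dots> \<le> N powr (1 - r) * t powr r"
    using assms False by (intro mult_right_mono powr_mono2') auto
  finally show ?thesis using assms by linarith
qed

text \<open>After integration each of the two terms of the pointwise bound contributes at most the
  \<open>L^r\<close>-norm, the first one because the total mass is at most 1; hence the factor
  2.\<close>

lemma integral_le_powr:
  fixes f :: "'a \<Rightarrow> real"
  assumes M: "emeasure M (space M) \<le> 1" and r: "1 \<le> r" and f: "f \<in> borel_measurable M"
    and i: "integrable M (\<lambda>x. \<bar>f x\<bar> powr r)"
  shows "integrable M f" "(LINT x|M. \<bar>f x\<bar>) powr r \<le> 2 powr r * (LINT x|M. \<bar>f x\<bar> powr r)"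
proof -
  interpret finite_measure M
    using order_le_less_trans[OF M ennreal_one_less_top] by (intro finite_measureI) (simp add: less_top)
  have M1: "measure M (space M) \<le> 1"
    using M unfolding measure_def by (metis enn2real_1 enn2real_mono ennreal_one_less_top)
  have int: "integrable M f"
  proof (rule Bochner_Integration.integrable_bound)
    show "integrable M (\<lambda>x. 1 + \<bar>f x\<bar> powr r)" using i by simp
    show "AE x in M. norm (f x) \<le> norm (1 + \<bar>f x\<bar> powr r)"
      using le_add_powr[of "\<bar>f _\<bar>" 1 r] r by (intro AE_I2) (auto simp: abs_of_nonneg)
  qed (rule f)
  then show "integrable M f" .
  define I where "I = (LINT x|M. \<bar>f x\<bar> powr r)"
  have I: "0 \<le> I" by (simp add: I_def)
  show "(LINT x|M. \<bar>f x\<bar>) powr r \<le> 2 powr r * I"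
  \<comment> \<open>The pointwise bound requires \<open>N > 0\<close>, so a vanishing norm is
    treated separately.\<close>
  proof (cases "I = 0")
    case True
    then have "AE x in M. \<bar>f x\<bar> powr r = 0"
      using i unfolding I_def by (subst (asm) integral_nonneg_eq_0_iff_AE) auto
    then have "(LINT x|M. \<bar>f x\<bar>) = (LINT x|M. 0)"
      using f by (intro integral_cong_AE) auto
    then show ?thesis using I by simp
  next
    case False
    define N where "N = I powr (1 / r)"
    have N: "0 < N" "N powr r = I" using False I r by (auto simp: N_def powr_powr)
    have "(LINT x|M. \<bar>f x\<bar>) \<le> (LINT x|M. N + N powr (1 - r) * \<bar>f x\<bar> powr r)"
      using int i N r by (intro integral_mono le_add_powr) auto
    also have "\<dots> = N * measure M (space M) + N powr (1 - r) * I"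
      using i by (simp add: I_def)
    also have "N powr (1 - r) * I = N"
    proof -
      have "N powr (1 - r) * N powr r = N powr (1 - r + r)" by (rule powr_add[symmetric])
      then show ?thesis using N by simp
    qed
    also have "N * measure M (space M) + N \<le> 2 * N"
      using N M1 mult_left_mono[of "measure M (space M)" 1 N] by simp
    finally have "(LINT x|M. \<bar>f x\<bar>) powr r \<le> (2 * N) powr r"
      using r by (intro powr_mono2) auto
    then show ?thesis using N by (simp add: powr_mult)
  qed
qed

lemma L1_le_Lp:
  assumes p: "1 \<le> p" and U: "open U" "emeasure lebesgue U \<le> 1" and f: "f \<in> Lp_space p U"
  shows "integrable (lebesgue_on U) f" "(LINT x|lebesgue_on U. \<bar>f x\<bar>) \<le> 2 * Lp_norm p U f"
proof -
  have em: "emeasure (lebesgue_on U) (space (lebesgue_on U)) \<le> 1"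
    using U open_sets_lebesgue by (simp add: measure_lebesgue_on)
  note m = Lp_space_measurable[OF f]
  have "integrable (lebesgue_on U) f \<and> (LINT x|lebesgue_on U. \<bar>f x\<bar>) \<le> 2 * Lp_norm p U f"
    using p
  proof (cases rule: exponent_cases)
    case infinity
    let ?C = "Lp_norm \<infinity> U f"
    have "AE x in lebesgue_on U. \<bar>f x\<bar> \<le> ?C" by (rule Lp_infinity_AE_bound[OF f[unfolded infinity]])
    then have "f \<in> Lp_space (ereal 1) U" "Lp_norm (ereal 1) U f \<le> ?C"
      using U m by (auto intro!: Lp_bounded[of "ereal 1"] Lp_norm_nonneg)
    then have "integrable (lebesgue_on U) (\<lambda>x. \<bar>f x\<bar>)" "(LINT x|lebesgue_on U. \<bar>f x\<bar>) \<le> ?C"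
      by (auto simp: Lp_space_def Lp_norm_def)
    then show ?thesis
      using m infinity Lp_norm_nonneg[of \<infinity> U f] by (auto simp: integrable_abs_iff)
  next
    case (real r)
    have i: "integrable (lebesgue_on U) (\<lambda>x. \<bar>f x\<bar> powr r)" using f real by (simp add: Lp_space_def)
    note * = integral_le_powr[OF em real(2) m i]
    have "(LINT x|lebesgue_on U. \<bar>f x\<bar>) powr r \<le> (2 * Lp_norm p U f) powr r"
      using *(2) real by (simp add: powr_mult Lp_norm_nonneg Lp_norm_powr)
    then have "(LINT x|lebesgue_on U. \<bar>f x\<bar>) \<le> 2 * Lp_norm p U f"
      using powr_less_mono2[of r "2 * Lp_norm p U f" "LINT x|lebesgue_on U. \<bar>f x\<bar>"] real Lp_norm_nonneg[of p U f]
      by (force simp: not_less[symmetric])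
    then show ?thesis using *(1) by simp
  qed
  then show "integrable (lebesgue_on U) f" "(LINT x|lebesgue_on U. \<bar>f x\<bar>) \<le> 2 * Lp_norm p U f" by auto
qed

subsection \<open>Weak derivatives\<close>

text \<open>A test function is represented by its full array of partial derivatives, the function
  itself being \<open>D 0 0\<close>. Differentiating it is then a shift of indices.\<close>

definition test_fun :: "point set \<Rightarrow> (nat \<Rightarrow> nat \<Rightarrow> point \<Rightarrow> real) \<Rightarrow> bool" where
  "test_fun U D \<longleftrightarrow> has_partials (D 0 0) D \<and>
    compact (closure {x. D 0 0 x \<noteq> 0}) \<and> closure {x. D 0 0 x \<noteq> 0} \<subseteq> U"

lemma has_weak_deriv_iff:
  "has_weak_deriv U (i, j) v w \<longleftrightarrow> locally_integrable U v \<and> locally_integrable U w \<and>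
    (\<forall>D. test_fun U D \<longrightarrow>
      (LINT x|lebesgue_on U. v x * D i j x) = (-1) ^ (i + j) * (LINT x|lebesgue_on U. w x * D 0 0 x))"
proof
  assume L: "has_weak_deriv U (i, j) v w"
  note L' = L[unfolded has_weak_deriv_def fst_conv snd_conv]
  show "locally_integrable U v \<and> locally_integrable U w \<and> (\<forall>D. test_fun U D \<longrightarrow>
      (LINT x|lebesgue_on U. v x * D i j x) = (-1) ^ (i + j) * (LINT x|lebesgue_on U. w x * D 0 0 x))"
  proof (intro conjI allI impI)
    fix D assume "test_fun U D"
    then show "(LINT x|lebesgue_on U. v x * D i j x) = (-1) ^ (i + j) * (LINT x|lebesgue_on U. w x * D 0 0 x)"
      unfolding test_fun_def by (rule L'[THEN conjunct2, THEN conjunct2, rule_format])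
  qed (rule L'[THEN conjunct1], rule L'[THEN conjunct2, THEN conjunct1])
next
  assume R: "locally_integrable U v \<and> locally_integrable U w \<and> (\<forall>D. test_fun U D \<longrightarrow>
      (LINT x|lebesgue_on U. v x * D i j x) = (-1) ^ (i + j) * (LINT x|lebesgue_on U. w x * D 0 0 x))"
  show "has_weak_deriv U (i, j) v w"
    unfolding has_weak_deriv_def fst_conv snd_conv
  proof (intro conjI allI impI)
    fix \<phi> D
    assume A: "has_partials \<phi> D \<and> compact (closure {x. \<phi> x \<noteq> 0}) \<and> closure {x. \<phi> x \<noteq> 0} \<subseteq> U"
    have \<phi>: "\<phi> = D 0 0" using A[THEN conjunct1] unfolding has_partials_def by (simp only:)
    show "(LINT x|lebesgue_on U. v x * D i j x) = (-1) ^ (i + j) * (LINT x|lebesgue_on U. w x * \<phi> x)"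
      unfolding \<phi> by (rule R[THEN conjunct2, THEN conjunct2, rule_format]) (use A \<phi> in \<open>simp add: test_fun_def\<close>)
  qed (rule R[THEN conjunct1], rule R[THEN conjunct2, THEN conjunct1])
qed

lemma has_partials_D:
  "has_partials \<phi> D \<Longrightarrow> (D i j has_derivative (\<lambda>(s, t). s * D (Suc i) j x + t * D i (Suc j) x)) (at x)"
  by (rule has_partials_def[THEN iffD1, THEN conjunct2, THEN spec, THEN spec, THEN spec])

lemma has_partials_continuous: "has_partials \<phi> D \<Longrightarrow> continuous_on A (D i j)"
  by (intro continuous_at_imp_continuous_on ballI has_derivative_continuous[OF has_partials_D])

lemma has_partials_shift:
  "has_partials \<phi> D \<Longrightarrow> has_partials (D i j) (\<lambda>a b. D (a + i) (b + j))"
  by (simp add: has_partials_def)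

lemma two_partials_eq:
  assumes "(\<lambda>(s, t). s * a + t * b) = (\<lambda>(s, t). s * c + t * (d::real))"
  shows "a = c" "b = d"
  using fun_cong[OF assms, of "(1, 0)"] fun_cong[OF assms, of "(0, 1)"] by simp_all

text \<open>The Frechet derivative at a point of an open set determines the next partials, so
  equality propagates along \<open>j\<close> and then along \<open>i\<close>. The local form is used
  to show that all derivatives vanish off the support.\<close>

lemma partials_unique_on_open:
  assumes W: "open W" and D: "has_partials \<phi> D" "has_partials \<psi> D'" and eq: "\<And>x. x \<in> W \<Longrightarrow> \<phi> x = \<psi> x"
    and x: "x \<in> W"
  shows "D i j x = D' i j x"
proof -
  have step: "D (Suc i) j x = D' (Suc i) j x \<and> D i (Suc j) x = D' i (Suc j) x"
    if "\<And>x. x \<in> W \<Longrightarrow> D i j x = D' i j x" "x \<in> W" for i j x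
  proof -
    have "(D' i j has_derivative (\<lambda>(s, t). s * D (Suc i) j x + t * D i (Suc j) x)) (at x)"
      using has_derivative_transform_within_open[OF has_partials_D[OF D(1)] W that(2)] that(1) by blast
    from has_derivative_unique[OF this has_partials_D[OF D(2)]] show ?thesis
      using two_partials_eq by metis
  qed
  have 0: "D 0 j x = D' 0 j x" if "x \<in> W" for j x
    using that
  proof (induction j arbitrary: x)
    case 0
    then show ?case using D eq by (simp add: has_partials_def)
  qed (use step in blast)
  show ?thesis using x
    by (induction i arbitrary: x) (use 0 step in blast)+
qed

lemma partials_unique:
  assumes "has_partials \<phi> D" "has_partials \<phi> D'"
  shows "D i j = D' i j"
  using partials_unique_on_open[OF open_UNIV assms] by blast

lemma has_partials_zero: "has_partials (\<lambda>_. 0) (\<lambda>_ _ _. 0)"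
  by (simp add: has_partials_def split_def)

lemma test_fun_zero:
  assumes "test_fun U D" "x \<notin> closure {x. D 0 0 x \<noteq> 0}"
  shows "D i j x = 0"
proof (rule partials_unique_on_open[OF _ _ has_partials_zero])
  show "open (- closure {x. D 0 0 x \<noteq> 0})" by (intro open_Compl closed_closure)
  show "has_partials (D 0 0) D" using assms by (simp add: test_fun_def)
  show "D 0 0 x = 0" if "x \<in> - closure {x. D 0 0 x \<noteq> 0}" for x
    using that closure_subset[of "{x. D 0 0 x \<noteq> 0}"] by blast
qed (use assms in simp)

lemma test_fun_zero': "test_fun U D \<Longrightarrow> x \<notin> U \<Longrightarrow> D i j x = 0"
  using test_fun_zero unfolding test_fun_def by blast

lemma test_fun_shift:
  assumes "test_fun U D"
  shows "test_fun U (\<lambda>a b. D (a + i) (b + j))"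
proof -
  let ?K = "closure {x. D 0 0 x \<noteq> 0}"
  have sub: "closure {x. D i j x \<noteq> 0} \<subseteq> ?K"
    using test_fun_zero[OF assms] by (intro closure_minimal closed_closure) blast
  have K: "compact ?K" "?K \<subseteq> U" "has_partials (D 0 0) D"
    using assms by (auto simp: test_fun_def)
  have "compact (closure {x. D i j x \<noteq> 0})"
    using K sub by (meson bounded_subset closed_closure compact_eq_bounded_closed)
  then show ?thesis
    using has_partials_shift[OF K(3), of i j] order_trans[OF sub K(2)] unfolding test_fun_def by simp
qed

lemma test_fun_subset: "test_fun V D \<Longrightarrow> V \<subseteq> U \<Longrightarrow> test_fun U D"
  by (auto simp: test_fun_def)

text \<open>A derivative of a test function is bounded on the compact support, where
  \<open>v\<close> is integrable, and vanishes elsewhere.\<close>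

lemma integrable_test:
  assumes U: "open U" and v: "locally_integrable U v" and D: "test_fun U D"
  shows "integrable (lebesgue_on U) (\<lambda>x. v x * D i j x)"
proof -
  let ?K = "closure {x. D 0 0 x \<noteq> 0}"
  have K: "compact ?K" "?K \<subseteq> U" "has_partials (D 0 0) D"
    using D by (auto simp: test_fun_def)
  have c: "continuous_on A (D i j)" for A by (rule has_partials_continuous[OF K(3)])
  have "(\<lambda>x. D i j x * v x) absolutely_integrable_on ?K"
  proof (rule absolutely_integrable_bounded_measurable_product[OF bilinear_times])
    show "D i j \<in> borel_measurable (lebesgue_on ?K)"
      using c K(1) by (intro continuous_imp_measurable_on_sets_lebesgue) auto
    show "bounded (D i j ` ?K)"
      using c K(1) by (intro compact_imp_bounded compact_continuous_image)
    show "v absolutely_integrable_on ?K"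
      using v K by (simp add: locally_integrable_def)
  qed (use K in auto)
  then have "integrable lebesgue (\<lambda>x. indicator ?K x *\<^sub>R (D i j x * v x))"
    by (simp add: set_integrable_def)
  also have "(\<lambda>x. indicator ?K x *\<^sub>R (D i j x * v x)) = (\<lambda>x. indicator U x * (v x * D i j x))"
  proof
    fix x
    show "indicator ?K x *\<^sub>R (D i j x * v x) = indicator U x * (v x * D i j x)"
      using test_fun_zero[OF D, of x i j] K(2) by (cases "x \<in> ?K") auto
  qed
  finally show ?thesis
    using open_sets_lebesgue[OF U] by (simp add: integrable_lebesgue_on_indicator)
qed

lemma integral_test_subset:
  assumes "open U" "open V" "V \<subseteq> U" and D: "test_fun V D"
  shows "(LINT x|lebesgue_on U. v x * D i j x) = (LINT x|lebesgue_on V. v x * D i j x)"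
  unfolding integral_lebesgue_on_indicator[OF open_sets_lebesgue[OF assms(1)]]
    integral_lebesgue_on_indicator[OF open_sets_lebesgue[OF assms(2)]]
proof (rule Bochner_Integration.integral_cong[OF refl])
  fix x
  show "indicator U x * (v x * D i j x) = indicator V x * (v x * D i j x)"
    using test_fun_zero'[OF D, of x i j] assms(3) by (cases "x \<in> V") auto
qed

lemma has_partials_tensor:
  assumes B: "derivs B" and C: "derivs C"
  shows "has_partials (\<lambda>z. B 0 (fst z) * C 0 (snd z)) (\<lambda>i j z. B i (fst z) * C j (snd z))"
  unfolding has_partials_def
proof (intro conjI allI)
  fix i j and x :: point
  have 1: "((\<lambda>z. B i (fst z)) has_derivative (\<lambda>h. B (Suc i) (fst x) * fst h)) (at x)"
    by (rule has_derivative_compose[OF has_derivative_fst[OF has_derivative_ident]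
        derivsD[OF B, unfolded has_field_derivative_def]])
  have 2: "((\<lambda>z. C j (snd z)) has_derivative (\<lambda>h. C (Suc j) (snd x) * snd h)) (at x)"
    by (rule has_derivative_compose[OF has_derivative_snd[OF has_derivative_ident]
        derivsD[OF C, unfolded has_field_derivative_def]])
  show "((\<lambda>z. B i (fst z) * C j (snd z)) has_derivative
    (\<lambda>(s, t). s * (B (Suc i) (fst x) * C j (snd x)) + t * (B i (fst x) * C (Suc j) (snd x)))) (at x)"
    by (rule has_derivative_eq_rhs[OF has_derivative_mult[OF 1 2]]) (auto simp: algebra_simps)
qed simp

lemma test_fun_tensor:
  assumes "derivs B" "derivs C" "cbox (a, c) (b, d) \<subseteq> U"
    and "\<And>x. x \<notin> {a..b} \<Longrightarrow> B 0 x = 0" "\<And>y. y \<notin> {c..d} \<Longrightarrow> C 0 y = 0"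
  shows "test_fun U (\<lambda>i j z. B i (fst z) * C j (snd z))"
proof -
  have "{z. B 0 (fst z) * C 0 (snd z) \<noteq> 0} \<subseteq> cbox (a, c) (b, d)"
    using assms(4,5) by (force simp: cbox_Pair_eq)
  then have sub: "closure {z. B 0 (fst z) * C 0 (snd z) \<noteq> 0} \<subseteq> cbox (a, c) (b, d)"
    by (rule closure_minimal) (rule closed_cbox)
  then have "compact (closure {z. B 0 (fst z) * C 0 (snd z) \<noteq> 0})"
    by (meson bounded_cbox bounded_subset closed_closure compact_eq_bounded_closed)
  then show ?thesis
    using has_partials_tensor[OF assms(1,2)] sub assms(3) unfolding test_fun_def by blast
qed

lemma locally_integrable_lin:
  assumes "locally_integrable U v" "locally_integrable U w"
  shows "locally_integrable U (\<lambda>x. a * v x + b * w x)"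
  using assms unfolding locally_integrable_def
  by (auto intro!: set_integral_add(1) set_integrable_mult_right)

lemma locally_integrable_cong:
  assumes U: "open U" and v: "locally_integrable U v" and eq: "AE x in lebesgue_on U. v x = v' x"
  shows "locally_integrable U v'"
  unfolding locally_integrable_def
proof (intro allI impI)
  fix K assume K: "compact K \<and> K \<subseteq> U"
  then have i: "integrable lebesgue (\<lambda>x. indicator K x *\<^sub>R v x)"
    using v by (simp add: locally_integrable_def set_integrable_def)
  have ae: "AE x in lebesgue. indicator K x *\<^sub>R v x = indicator K x *\<^sub>R v' x"
    using eq unfolding AE_lebesgue_on_iff[OF open_sets_lebesgue[OF U]]
    by eventually_elim (use K in \<open>auto simp: indicator_def\<close>)
  have "(\<lambda>x. indicator K x *\<^sub>R v' x) \<in> borel_measurable lebesgue"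
    by (rule borel_measurable_AE[OF borel_measurable_integrable[OF i] ae])
  then show "v' absolutely_integrable_on K"
    unfolding set_integrable_def by (rule integrable_cong_AE_imp[OF i _ ae])
qed

lemma integral_cong_AE_test:
  assumes U: "open U" and v: "locally_integrable U v" and eq: "AE x in lebesgue_on U. v x = v' x"
    and D: "test_fun U D"
  shows "(LINT x|lebesgue_on U. v x * D i j x) = (LINT x|lebesgue_on U. v' x * D i j x)"
proof (rule integral_cong_AE)
  show "(\<lambda>x. v x * D i j x) \<in> borel_measurable (lebesgue_on U)"
    by (rule borel_measurable_integrable[OF integrable_test[OF U v D]])
  show "(\<lambda>x. v' x * D i j x) \<in> borel_measurable (lebesgue_on U)"
    by (rule borel_measurable_integrable[OF integrable_test[OF U locally_integrable_cong[OF U v eq] D]])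
  show "AE x in lebesgue_on U. v x * D i j x = v' x * D i j x"
    using eq by eventually_elim simp
qed

lemma has_weak_deriv_cong:
  assumes U: "open U" and vw: "has_weak_deriv U \<alpha> v w"
    and eq: "AE x in lebesgue_on U. v x = v' x" "AE x in lebesgue_on U. w x = w' x"
  shows "has_weak_deriv U \<alpha> v' w'"
proof -
  obtain i j where \<alpha>: "\<alpha> = (i, j)" by (cases \<alpha>)
  show ?thesis
    using vw locally_integrable_cong[OF U _ eq(1)] locally_integrable_cong[OF U _ eq(2)]
      integral_cong_AE_test[OF U _ eq(1), of _ i j] integral_cong_AE_test[OF U _ eq(2), of _ 0 0]
    unfolding \<alpha> has_weak_deriv_iff by simp
qed

lemma has_weak_deriv_lin:
  assumes U: "open U" and v: "has_weak_deriv U \<alpha> v w" and v': "has_weak_deriv U \<alpha> v' w'"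
  shows "has_weak_deriv U \<alpha> (\<lambda>x. a * v x + b * v' x) (\<lambda>x. a * w x + b * w' x)"
proof -
  obtain i j where \<alpha>: "\<alpha> = (i, j)" by (cases \<alpha>)
  have li: "locally_integrable U v" "locally_integrable U w" "locally_integrable U v'" "locally_integrable U w'"
    using v v' by (auto simp: has_weak_deriv_def)
  have lin: "(LINT x|lebesgue_on U. (a * f x + b * g x) * D i j x)
      = a * (LINT x|lebesgue_on U. f x * D i j x) + b * (LINT x|lebesgue_on U. g x * D i j x)"
    if "locally_integrable U f" "locally_integrable U g" "test_fun U D" for f g D i j
  proof -
    have "(LINT x|lebesgue_on U. (a * f x + b * g x) * D i j x)
        = (LINT x|lebesgue_on U. a * (f x * D i j x) + b * (g x * D i j x))"
      by (simp add: algebra_simps)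
    then show ?thesis using that integrable_test[OF U] by simp
  qed
  show ?thesis
    unfolding \<alpha> has_weak_deriv_iff
  proof (intro conjI allI impI locally_integrable_lin li)
    fix D assume D: "test_fun U D"
    have "(LINT x|lebesgue_on U. v x * D i j x) = (-1) ^ (i + j) * (LINT x|lebesgue_on U. w x * D 0 0 x)"
      "(LINT x|lebesgue_on U. v' x * D i j x) = (-1) ^ (i + j) * (LINT x|lebesgue_on U. w' x * D 0 0 x)"
      using v v' D unfolding \<alpha> has_weak_deriv_iff by blast+
    then show "(LINT x|lebesgue_on U. (a * v x + b * v' x) * D i j x)
        = (-1) ^ (i + j) * (LINT x|lebesgue_on U. (a * w x + b * w' x) * D 0 0 x)"
      unfolding lin[OF li(1,3) D] lin[OF li(2,4) D] by (simp only:) (simp add: algebra_simps)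
  qed
qed

lemma has_weak_deriv_diff:
  assumes U: "open U" and v: "has_weak_deriv U \<alpha> v w" and v': "has_weak_deriv U \<alpha> v' w'"
  shows "has_weak_deriv U \<alpha> (\<lambda>x. v x - v' x) (\<lambda>x. w x - w' x)"
proof -
  have "(\<lambda>x. 1 * f x + - 1 * g x) = (\<lambda>x. f x - g x)" for f g :: "point \<Rightarrow> real" by auto
  then show ?thesis using has_weak_deriv_lin[OF assms, of 1 "-1"] by (simp only:)
qed

text \<open>The difference of two candidates is a weak derivative of the zero function, hence
  orthogonal to all test functions and in particular to tensor products.\<close>

lemma has_weak_deriv_AE_unique:
  assumes U: "open U" and w: "has_weak_deriv U \<alpha> v w" and w': "has_weak_deriv U \<alpha> v w'"
  shows "AE x in lebesgue_on U. w x = w' x"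
proof -
  obtain i j where \<alpha>: "\<alpha> = (i, j)" by (cases \<alpha>)
  have 0: "has_weak_deriv U \<alpha> (\<lambda>x. v x - v x) (\<lambda>x. w x - w' x)"
    by (rule has_weak_deriv_diff[OF U w w'])
  have "AE x in lebesgue_on U. w x - w' x = 0"
  proof (rule AE_zero_if_orthogonal_to_tensors[OF U])
    show "locally_integrable U (\<lambda>x. w x - w' x)" using 0 by (simp add: has_weak_deriv_def)
    show "orthogonal_to_tensors U (\<lambda>x. w x - w' x)"
      unfolding orthogonal_to_tensors_def
    proof (intro allI impI)
      fix B C :: "nat \<Rightarrow> real \<Rightarrow> real" and a b c d :: real
      assume "derivs B" "derivs C" "cbox (a, c) (b, d) \<subseteq> U"
        "\<forall>x. x \<notin> {a..b} \<longrightarrow> B 0 x = 0" "\<forall>y. y \<notin> {c..d} \<longrightarrow> C 0 y = 0"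
      then have "test_fun U (\<lambda>i j z. B i (fst z) * C j (snd z))"
        by (intro test_fun_tensor) auto
      from 0[unfolded \<alpha> has_weak_deriv_iff, THEN conjunct2, THEN conjunct2, rule_format, OF this]
      show "(LINT z|lebesgue_on U. (w z - w' z) * (B 0 (fst z) * C 0 (snd z))) = 0"
        by simp
    qed
  qed
  then show ?thesis by eventually_elim simp
qed

text \<open>\<open>weak_deriv\<close> is an arbitrary choice; by uniqueness it agrees almost
  everywhere with any weak derivative at hand, so norms can be computed from the latter.\<close>

lemma weak_deriv_AE:
  assumes U: "open U" and w: "has_weak_deriv U \<alpha> v w"
  shows "has_weak_deriv U \<alpha> v (weak_deriv U \<alpha> v)" "AE x in lebesgue_on U. w x = weak_deriv U \<alpha> v x"
proof -
  show *: "has_weak_deriv U \<alpha> v (weak_deriv U \<alpha> v)"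
    unfolding weak_deriv_def by (rule someI[of "has_weak_deriv U \<alpha> v", OF w])
  show "AE x in lebesgue_on U. w x = weak_deriv U \<alpha> v x"
    by (rule has_weak_deriv_AE_unique[OF U w *])
qed

lemma weak_deriv_Lp:
  assumes "1 \<le> p" "open U" "has_weak_deriv U \<alpha> v w" "w \<in> Lp_space p U"
  shows "weak_deriv U \<alpha> v \<in> Lp_space p U" "Lp_norm p U (weak_deriv U \<alpha> v) = Lp_norm p U w"
  by (rule Lp_cong[OF assms(1,2,4) weak_deriv_AE(2)[OF assms(2,3)]])+

lemma sobolev_space_weak_deriv:
  assumes "1 \<le> p" "open U" "v \<in> sobolev_space n p U" "i + j \<le> n"
  shows "has_weak_deriv U (i, j) v (weak_deriv U (i, j) v)" "weak_deriv U (i, j) v \<in> Lp_space p U"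
proof -
  obtain w where w: "has_weak_deriv U (i, j) v w" "w \<in> Lp_space p U"
  proof -
    have "(i, j) \<in> multi_indices n" using assms(4) by (simp add: multi_indices_def)
    then show thesis using assms(3) that unfolding sobolev_space_def by blast
  qed
  show "has_weak_deriv U (i, j) v (weak_deriv U (i, j) v)" by (rule weak_deriv_AE(1)[OF assms(2) w(1)])
  show "weak_deriv U (i, j) v \<in> Lp_space p U" by (rule weak_deriv_Lp(1)[OF assms(1,2) w])
qed

lemma sobolev_spaceI:
  assumes "\<And>i j. i + j \<le> n \<Longrightarrow> \<exists>w. has_weak_deriv U (i, j) v w \<and> w \<in> Lp_space p U"
  shows "v \<in> sobolev_space n p U"
  unfolding sobolev_space_def multi_indices_def using assms by blast

lemma has_weak_deriv_self: "locally_integrable U v \<Longrightarrow> has_weak_deriv U (0, 0) v v"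
  by (simp add: has_weak_deriv_iff)

text \<open>Test \<open>v\<close> with derivatives of a test function of order
  \<open>(i, j)\<close>: both hypotheses apply, and the common sign \<open>(-1)^(a + b)\<close>
  cancels.\<close>

lemma has_weak_deriv_shift:
  assumes va: "has_weak_deriv U (a, b) v va" and w: "has_weak_deriv U (a + i, b + j) v w"
  shows "has_weak_deriv U (i, j) va w"
proof -
  have "(LINT x|lebesgue_on U. va x * D i j x) = (-1) ^ (i + j) * (LINT x|lebesgue_on U. w x * D 0 0 x)"
    if D: "test_fun U D" for D
  proof -
    have "(LINT x|lebesgue_on U. v x * D (a + i) (b + j) x) = (-1) ^ (a + b) * (LINT x|lebesgue_on U. va x * D i j x)"
      using va[unfolded has_weak_deriv_iff, THEN conjunct2, THEN conjunct2, rule_format, OF test_fun_shift[OF D, of i j]]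
      by simp
    moreover have "(LINT x|lebesgue_on U. v x * D (a + i) (b + j) x)
        = (-1) ^ (a + i + (b + j)) * (LINT x|lebesgue_on U. w x * D 0 0 x)"
      using w D unfolding has_weak_deriv_iff by blast
    moreover have "(-1 :: real) ^ (a + i + (b + j)) = (-1) ^ (a + b) * (-1) ^ (i + j)"
      by (simp add: power_add)
    ultimately show ?thesis by simp
  qed
  then show ?thesis using va w by (simp add: has_weak_deriv_iff)
qed

lemma has_weak_deriv_trans:
  assumes w: "has_weak_deriv U (i, j) v w" and w': "has_weak_deriv U (k, l) w w'"
  shows "has_weak_deriv U (i + k, j + l) v w'"
proof -
  have "(LINT x|lebesgue_on U. v x * D (i + k) (j + l) x)
      = (-1) ^ (i + k + (j + l)) * (LINT x|lebesgue_on U. w' x * D 0 0 x)"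
    if D: "test_fun U D" for D
  proof -
    have "(LINT x|lebesgue_on U. v x * D (i + k) (j + l) x) = (-1) ^ (i + j) * (LINT x|lebesgue_on U. w x * D k l x)"
      using w[unfolded has_weak_deriv_iff, THEN conjunct2, THEN conjunct2, rule_format, OF test_fun_shift[OF D, of k l]]
      by (simp add: add.commute)
    also have "(LINT x|lebesgue_on U. w x * D k l x) = (-1) ^ (k + l) * (LINT x|lebesgue_on U. w' x * D 0 0 x)"
      using w' D unfolding has_weak_deriv_iff by blast
    finally show ?thesis by (simp add: power_add)
  qed
  then show ?thesis using w w' by (simp add: has_weak_deriv_iff)
qed

lemma has_weak_deriv_subset:
  assumes U: "open U" "open V" "V \<subseteq> U" and w: "has_weak_deriv U \<alpha> v w"
  shows "has_weak_deriv V \<alpha> v w"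
proof -
  obtain i j where \<alpha>: "\<alpha> = (i, j)" by (cases \<alpha>)
  have "locally_integrable V v" "locally_integrable V w"
    using w U(3) by (auto simp: has_weak_deriv_def locally_integrable_def)
  moreover have "(LINT x|lebesgue_on V. v x * D i j x) = (-1) ^ (i + j) * (LINT x|lebesgue_on V. w x * D 0 0 x)"
    if D: "test_fun V D" for D
    using w[unfolded \<alpha> has_weak_deriv_iff, THEN conjunct2, THEN conjunct2, rule_format, OF test_fun_subset[OF D U(3)]]
    unfolding integral_test_subset[OF U D] .
  ultimately show ?thesis by (simp add: \<alpha> has_weak_deriv_iff)
qed

section \<open>Integration by parts: classical derivatives are weak derivatives\<close>

lemma integrable_lborel_compact_support:
  fixes f :: "'a::euclidean_space \<Rightarrow> real"
  assumes "compact K" "continuous_on UNIV f" "\<And>x. x \<notin> K \<Longrightarrow> f x = 0"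
  shows "integrable lborel f"
proof -
  have "integrable lborel (\<lambda>x. indicator K x *\<^sub>R f x)"
    using assms continuous_on_subset by (intro borel_integrable_compact) blast+
  also have "(\<lambda>x. indicator K x *\<^sub>R f x) = f"
    using assms(3) by (auto simp: indicator_def fun_eq_iff)
  finally show ?thesis .
qed

lemma integral_deriv_compact_support_real:
  fixes h :: "real \<Rightarrow> real"
  assumes d: "\<And>x. (h has_real_derivative h' x) (at x)" and c: "continuous_on UNIV h'"
    and z: "\<And>x. M \<le> \<bar>x\<bar> \<Longrightarrow> h x = 0 \<and> h' x = 0" and M: "0 \<le> M"
  shows "(LINT x|lborel. h' x) = 0"
proof -
  have "h' x = h' x * indicator {-M..M} x" for x
    using z[of x] by (cases "M \<le> \<bar>x\<bar>") (auto simp: indicator_def)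
  then have "(LINT x|lborel. h' x) = (LINT x|lborel. h' x * indicator {-M..M} x)" by metis
  also have "\<dots> = h M - h (- M)"
    using M d c by (intro integral_FTC_Icc_real) (auto simp: continuous_on_eq_continuous_at)
  finally show ?thesis using z[of M] z[of "-M"] M by simp
qed

text \<open>Integrate first along the direction of the partial derivative: by the fundamental
  theorem the inner integral is zero on every line.\<close>

lemma integral_partial_compact_support:
  fixes h :: "point \<Rightarrow> real"
  assumes d: "\<And>x. (h has_derivative (\<lambda>(s, t). s * hx x + t * hy x)) (at x)"
    and c: "continuous_on UNIV hx" "continuous_on UNIV hy"
    and K: "compact K" and z: "\<And>x. x \<notin> K \<Longrightarrow> h x = 0 \<and> hx x = 0 \<and> hy x = 0"
  shows "(LINT x|lborel. hx x) = 0" "(LINT x|lborel. hy x) = 0"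
proof -
  obtain M where M: "0 < M" "\<And>x. x \<in> K \<Longrightarrow> norm x < M"
    using compact_imp_bounded[OF K] by (metis bounded_pos_less)
  have out: "x \<notin> K" if "M \<le> \<bar>fst x\<bar> \<or> M \<le> \<bar>snd x\<bar>" for x :: point
    using M(2)[of x] norm_fst_le[of "fst x" "snd x"] norm_snd_le[of "snd x" "fst x"] that by force
  have i: "integrable (lborel \<Otimes>\<^sub>M lborel) hx" "integrable (lborel \<Otimes>\<^sub>M lborel) hy"
    using integrable_lborel_compact_support[OF K c(1)] integrable_lborel_compact_support[OF K c(2)] z
    by (auto simp: lborel_prod)
  have dx: "((\<lambda>x. h (x, y)) has_real_derivative hx (x, y)) (at x)" for x y
  proof -
    have "((\<lambda>x. (x, y)) has_derivative (\<lambda>h. (h, 0))) (at x)"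
      by (intro has_derivative_Pair has_derivative_ident has_derivative_const)
    from has_derivative_compose[OF this d] show ?thesis
      by (simp add: has_field_derivative_def mult_commute_abs)
  qed
  have dy: "((\<lambda>y. h (x, y)) has_real_derivative hy (x, y)) (at y)" for x y
  proof -
    have "((\<lambda>y. (x, y)) has_derivative (\<lambda>h. (0, h))) (at y)"
      by (intro has_derivative_Pair has_derivative_ident has_derivative_const)
    from has_derivative_compose[OF this d] show ?thesis
      by (simp add: has_field_derivative_def mult_commute_abs)
  qed
  have "(LINT x|lborel. hx x) = (LINT y|lborel. (LINT x|lborel. hx (x, y)))"
    using lborel_pair.integral_snd[of "\<lambda>x y. hx (x, y)"] i(1) by (simp add: lborel_prod)
  moreover have "(LINT x|lborel. hx (x, y)) = 0" for y
  proof (rule integral_deriv_compact_support_real[OF dx _ _ less_imp_le[OF M(1)]])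
    show "continuous_on UNIV (\<lambda>x. hx (x, y))"
      by (rule continuous_on_compose2[OF c(1)]) (auto intro!: continuous_intros)
  qed (use z out in auto)
  ultimately show "(LINT x|lborel. hx x) = 0" by simp
  have "(LINT x|lborel. hy x) = (LINT x|lborel. (LINT y|lborel. hy (x, y)))"
    using lborel_pair.integral_fst[of "\<lambda>x y. hy (x, y)"] i(2) by (simp add: lborel_prod)
  moreover have "(LINT y|lborel. hy (x, y)) = 0" for x
  proof (rule integral_deriv_compact_support_real[OF dy _ _ less_imp_le[OF M(1)]])
    show "continuous_on UNIV (\<lambda>y. hy (x, y))"
      by (rule continuous_on_compose2[OF c(2)]) (auto intro!: continuous_intros)
  qed (use z out in auto)
  ultimately show "(LINT x|lborel. hy x) = 0" by simp
qed

lemma locally_integrable_continuous: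
  fixes g :: "point \<Rightarrow> real"
  assumes "continuous_on U g"
  shows "locally_integrable U g"
  unfolding locally_integrable_def set_integrable_def
proof (intro allI impI)
  fix K assume K: "compact K \<and> K \<subseteq> U"
  then have "integrable lborel (\<lambda>x. indicator K x *\<^sub>R g x)"
    using assms continuous_on_subset by (intro borel_integrable_compact) blast+
  then show "integrable lebesgue (\<lambda>x. indicator K x *\<^sub>R g x)"
    by (rule integrable_completion[THEN iffD2, rotated]) (use \<open>integrable lborel _\<close> in auto)
qed

text \<open>The product of \<open>g\<close> with a test function has compact support, so its partial
  derivatives integrate to zero; the product rule turns this into integration by parts.\<close>

lemma has_weak_deriv_classical1:
  fixes g :: "point \<Rightarrow> real"
  assumes U: "open U" and d: "\<And>x. (g has_derivative (\<lambda>(s, t). s * gx x + t * gy x)) (at x)"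
    and c: "continuous_on UNIV gx" "continuous_on UNIV gy"
  shows "has_weak_deriv U (1, 0) g gx" "has_weak_deriv U (0, 1) g gy"
proof -
  have cg: "continuous_on UNIV g"
    by (intro continuous_at_imp_continuous_on ballI has_derivative_continuous[OF d])
  have li: "locally_integrable U g" "locally_integrable U gx" "locally_integrable U gy"
    using cg c continuous_on_subset[OF _ subset_UNIV] by (blast intro: locally_integrable_continuous)+
  have "(LINT x|lebesgue_on U. g x * D 1 0 x) = - (LINT x|lebesgue_on U. gx x * D 0 0 x) \<and>
    (LINT x|lebesgue_on U. g x * D 0 1 x) = - (LINT x|lebesgue_on U. gy x * D 0 0 x)"
    if D: "test_fun U D" for D
  proof -
    have hp: "has_partials (D 0 0) D" and K: "compact (closure {x. D 0 0 x \<noteq> 0})"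
      using D by (auto simp: test_fun_def)
    have cD: "continuous_on UNIV (D i j)" for i j by (rule has_partials_continuous[OF hp])
    have D1: "(D 0 0 has_derivative (\<lambda>(s, t). s * D 1 0 x + t * D 0 1 x)) (at x)" for x
      using has_partials_D[OF hp, of 0 0 x] by simp
    have dm: "((\<lambda>x. g x * D 0 0 x) has_derivative
        (\<lambda>(s, t). s * (gx x * D 0 0 x + g x * D 1 0 x) + t * (gy x * D 0 0 x + g x * D 0 1 x))) (at x)" for x
      by (rule has_derivative_eq_rhs[OF has_derivative_mult[OF d D1]]) (auto simp: algebra_simps)
    have cm: "continuous_on UNIV (\<lambda>x. gx x * D 0 0 x + g x * D 1 0 x)"
      "continuous_on UNIV (\<lambda>x. gy x * D 0 0 x + g x * D 0 1 x)"
      by (intro continuous_intros c cg cD)+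
    have z: "g x * D 0 0 x = 0 \<and> gx x * D 0 0 x + g x * D 1 0 x = 0 \<and> gy x * D 0 0 x + g x * D 0 1 x = 0"
      if "x \<notin> closure {x. D 0 0 x \<noteq> 0}" for x
      using test_fun_zero[OF D that] by simp
    have *: "(LINT x|lborel. gx x * D 0 0 x + g x * D 1 0 x) = 0" "(LINT x|lborel. gy x * D 0 0 x + g x * D 0 1 x) = 0"
      by (rule integral_partial_compact_support(1)[OF dm cm K z], assumption)
        (rule integral_partial_compact_support(2)[OF dm cm K z], assumption)
    \<comment> \<open>Passes from the Borel measure on the plane to the Lebesgue measure on
      \<open>U\<close>; derivatives of the test function vanish off \<open>U\<close>.\<close>
    have conv: "(LINT x|lborel. q x * D i j x + r x * D k l x)
        = (LINT x|lebesgue_on U. q x * D i j x) + (LINT x|lebesgue_on U. r x * D k l x)"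
      if cq: "continuous_on UNIV q" "continuous_on UNIV r" for q r i j k l
    proof -
      have m: "(\<lambda>x. q x * D i j x + r x * D k l x) \<in> borel_measurable borel"
        by (intro borel_measurable_continuous_onI continuous_intros cq cD)
      have li: "locally_integrable U q" "locally_integrable U r"
        using cq continuous_on_subset[OF _ subset_UNIV] by (blast intro: locally_integrable_continuous)+
      have "(LINT x|lborel. q x * D i j x + r x * D k l x) = (LINT x|lebesgue. q x * D i j x + r x * D k l x)"
        using m by (simp add: integral_completion)
      also have "\<dots> = (LINT x|lebesgue. indicator U x * (q x * D i j x + r x * D k l x))"
      proof (rule Bochner_Integration.integral_cong[OF refl])
        fix x show "q x * D i j x + r x * D k l x = indicator U x * (q x * D i j x + r x * D k l x)"
          using test_fun_zero'[OF D, of x] by (cases "x \<in> U") auto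
      qed
      also have "\<dots> = (LINT x|lebesgue_on U. q x * D i j x + r x * D k l x)"
        by (rule integral_lebesgue_on_indicator[OF open_sets_lebesgue[OF U], symmetric])
      also have "\<dots> = (LINT x|lebesgue_on U. q x * D i j x) + (LINT x|lebesgue_on U. r x * D k l x)"
        by (rule Bochner_Integration.integral_add[OF integrable_test[OF U li(1) D] integrable_test[OF U li(2) D]])
      finally show ?thesis .
    qed
    show ?thesis
      using *[unfolded conv[OF c(1) cg] conv[OF c(2) cg]] by auto
  qed
  then show "has_weak_deriv U (1, 0) g gx" "has_weak_deriv U (0, 1) g gy"
    using li by (auto simp: has_weak_deriv_iff)
qed

lemma has_weak_deriv_classical:
  assumes U: "open U" and G: "has_partials g G"
  shows "has_weak_deriv U (i, j) g (G i j)"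
proof -
  have d: "(G i j has_derivative (\<lambda>(s, t). s * G (Suc i) j x + t * G i (Suc j) x)) (at x)" for i j x
    by (rule has_partials_D[OF G])
  have c: "continuous_on A (G i j)" for A i j by (rule has_partials_continuous[OF G])
  have g: "G 0 0 = g" using G by (simp add: has_partials_def)
  note step = has_weak_deriv_classical1[OF U d c c]
  have y: "has_weak_deriv U (0, j) g (G 0 j)" for j
  proof (induction j)
    case 0
    show ?case using has_weak_deriv_self[OF locally_integrable_continuous[OF c]] g by metis
  next
    case (Suc j)
    show ?case using has_weak_deriv_trans[OF Suc step(2)] by simp
  qed
  show ?thesis
  proof (induction i)
    case 0
    show ?case by (rule y)
  next
    case (Suc i)
    show ?case using has_weak_deriv_trans[OF Suc step(1)] by simp
  qed
qed

subsection \<open>Sobolev seminorms under affine maps\<close>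

type_synonym partials = "nat \<Rightarrow> nat \<Rightarrow> point \<Rightarrow> real"

text \<open>Acting on arrays rather than on functions makes directional derivatives commute by
  algebra alone.\<close>

definition dir_partials :: "point \<Rightarrow> partials \<Rightarrow> partials" where
  "dir_partials e D = (\<lambda>i j x. fst e * D (Suc i) j x + snd e * D i (Suc j) x)"

text \<open>The coefficients are chosen before the array, the indices and the point. This uniformity
  lets the formula for test functions be carried over to weak derivatives with the same
  coefficients.\<close>

definition homogeneous :: "nat \<Rightarrow> real \<Rightarrow> (partials \<Rightarrow> partials) \<Rightarrow> bool" where
  "homogeneous N M T \<longleftrightarrow> (\<exists>c. (\<forall>l. \<bar>c l\<bar> \<le> M) \<and>
    (\<forall>D a b x. T D a b x = (\<Sum>l\<le>N. c l * D (a + l) (b + (N - l)) x)))"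

lemma homogeneous_id: "homogeneous 0 1 (\<lambda>D. D)"
  unfolding homogeneous_def by (rule exI[of _ "\<lambda>_. 1"]) simp

lemma homogeneous_dir_partials:
  assumes T: "homogeneous N M T" and e: "\<bar>fst e\<bar> \<le> K" "\<bar>snd e\<bar> \<le> K" and M: "0 \<le> M"
  shows "homogeneous (Suc N) (2 * K * M) (\<lambda>D. dir_partials e (T D))"
proof -
  obtain c where c: "\<And>l. \<bar>c l\<bar> \<le> M" "\<And>D a b x. T D a b x = (\<Sum>l\<le>N. c l * D (a + l) (b + (N - l)) x)"
    using T unfolding homogeneous_def by metis
  \<comment> \<open>There are two ways to reach \<open>l\<close> derivatives in the first variable:
    the new derivative is taken in the first variable, raising \<open>l - 1\<close> to
    \<open>l\<close>, or in the second, keeping \<open>l\<close>.\<close>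
  define c' where "c' l = (if l = 0 then 0 else fst e * c (l - 1)) + (if l \<le> N then snd e * c l else 0)" for l
  have K: "0 \<le> K" using e by linarith
  have b: "\<bar>fst e * c l\<bar> \<le> K * M" "\<bar>snd e * c l\<bar> \<le> K * M" for l
    using e c(1)[of l] K M by (auto simp: abs_mult intro!: mult_mono)
  have "\<bar>c' l\<bar> \<le> 2 * K * M" for l
    using b(1)[of "l - 1"] b(2)[of l] K M unfolding c'_def by (auto intro: order_trans[OF abs_triangle_ineq])
  moreover have "dir_partials e (T D) a b x = (\<Sum>l\<le>Suc N. c' l * D (a + l) (b + (Suc N - l)) x)" for D a b x
  proof -
    have "(\<Sum>l\<le>Suc N. c' l * D (a + l) (b + (Suc N - l)) x)
        = (\<Sum>l\<le>Suc N. (if l = 0 then 0 else fst e * c (l - 1)) * D (a + l) (b + (Suc N - l)) x)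
        + (\<Sum>l\<le>Suc N. (if l \<le> N then snd e * c l else 0) * D (a + l) (b + (Suc N - l)) x)"
      by (simp add: c'_def distrib_right sum.distrib del: sum.atMost_Suc)
    also have "(\<Sum>l\<le>Suc N. (if l = 0 then 0 else fst e * c (l - 1)) * D (a + l) (b + (Suc N - l)) x)
        = (\<Sum>l\<le>N. fst e * c l * D (Suc a + l) (b + (N - l)) x)"
      by (subst sum.atMost_Suc_shift) simp
    also have "(\<Sum>l\<le>Suc N. (if l \<le> N then snd e * c l else 0) * D (a + l) (b + (Suc N - l)) x)
        = (\<Sum>l\<le>N. snd e * c l * D (a + l) (Suc b + (N - l)) x)"
      by (simp add: Suc_diff_le)
    finally show ?thesis
      by (simp add: dir_partials_def c(2) sum_distrib_left mult.assoc)
  qed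
  ultimately show ?thesis unfolding homogeneous_def by blast
qed

lemma homogeneous_dir_partials_power:
  assumes T: "homogeneous N M T" and e: "\<bar>fst e\<bar> \<le> K" "\<bar>snd e\<bar> \<le> K" and M: "0 \<le> M"
  shows "homogeneous (i + N) ((2 * K) ^ i * M) (\<lambda>D. (dir_partials e ^^ i) (T D))"
proof (induction i)
  case 0
  then show ?case using T by simp
next
  case (Suc i)
  have "0 \<le> K" using e by linarith
  then have "homogeneous (Suc (i + N)) (2 * K * ((2 * K) ^ i * M)) (\<lambda>D. dir_partials e ((dir_partials e ^^ i) (T D)))"
    using M by (intro homogeneous_dir_partials Suc e) auto
  then show ?case by (simp add: mult.assoc)
qed

lemma homogeneous_dir_partials2:
  assumes e: "\<bar>fst e\<bar> \<le> K" "\<bar>snd e\<bar> \<le> K" and f: "\<bar>fst f\<bar> \<le> K" "\<bar>snd f\<bar> \<le> K"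
  shows "homogeneous (i + j) ((2 * K) ^ (i + j)) (\<lambda>D. (dir_partials e ^^ i) ((dir_partials f ^^ j) D))"
proof -
  have "0 \<le> K" using e by linarith
  then show ?thesis
    using homogeneous_dir_partials_power[OF homogeneous_dir_partials_power[OF homogeneous_id f, of j] e, of i]
    by (simp add: power_add)
qed

lemma dir_partials_commute: "dir_partials e (dir_partials f D) = dir_partials f (dir_partials e D)"
  by (simp add: dir_partials_def fun_eq_iff algebra_simps)

lemma dir_partials_power_commute:
  "dir_partials f ((dir_partials e ^^ i) D) = (dir_partials e ^^ i) (dir_partials f D)"
  by (induction i) (simp_all add: dir_partials_commute[of f e])

lemma has_partials_dir_partials:
  assumes "has_partials (D 0 0) D"
  shows "has_partials (dir_partials e D 0 0) (dir_partials e D)"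
  unfolding has_partials_def
proof (intro conjI allI)
  fix i j x
  have "((\<lambda>x. fst e * D (Suc i) j x + snd e * D i (Suc j) x) has_derivative
    (\<lambda>h. fst e * (\<lambda>(s, t). s * D (Suc (Suc i)) j x + t * D (Suc i) (Suc j) x) h
       + snd e * (\<lambda>(s, t). s * D (Suc i) (Suc j) x + t * D i (Suc (Suc j)) x) h)) (at x)"
    by (intro has_derivative_add has_derivative_mult_right has_partials_D[OF assms])
  then show "(dir_partials e D i j has_derivative
      (\<lambda>(s, t). s * dir_partials e D (Suc i) j x + t * dir_partials e D i (Suc j) x)) (at x)"
    unfolding dir_partials_def by (rule has_derivative_eq_rhs) (auto simp: algebra_simps)
qed simp

lemma has_partials_dir_partials_power:
  assumes "has_partials (D 0 0) D"
  shows "has_partials ((dir_partials e ^^ i) D 0 0) ((dir_partials e ^^ i) D)"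
  by (induction i) (use assms has_partials_dir_partials in auto)

text \<open>The chain rule: partial derivatives of a composition with the affine map are derivatives
  along \<open>e\<close> and \<open>f\<close>, evaluated at the image point.\<close>

definition aff_partials :: "point \<Rightarrow> point \<Rightarrow> point \<Rightarrow> partials \<Rightarrow> partials" where
  "aff_partials z e f D = (\<lambda>i j x. (dir_partials e ^^ i) ((dir_partials f ^^ j) D) 0 0 (aff z e f x))"

lemma has_derivative_aff: "(aff z e f has_derivative (\<lambda>h. fst h *\<^sub>R e + snd h *\<^sub>R f)) (at x within S)"
  unfolding aff_def by (auto intro!: derivative_eq_intros)

lemma has_partials_aff:
  assumes D: "has_partials (D 0 0) D"
  shows "has_partials (aff_partials z e f D 0 0) (aff_partials z e f D)"
  unfolding has_partials_def
proof (intro conjI allI)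
  fix i j x
  define X where "X = (dir_partials e ^^ i) ((dir_partials f ^^ j) D)"
  have X: "has_partials (X 0 0) X"
    unfolding X_def by (intro has_partials_dir_partials_power D)
  have "((\<lambda>x. X 0 0 (aff z e f x)) has_derivative
      (\<lambda>h. (\<lambda>(s, t). s * X (Suc 0) 0 (aff z e f x) + t * X 0 (Suc 0) (aff z e f x)) (fst h *\<^sub>R e + snd h *\<^sub>R f))) (at x)"
    by (rule has_derivative_compose[OF has_derivative_aff has_partials_D[OF X]])
  moreover have "aff_partials z e f D (Suc i) j x = dir_partials e X 0 0 (aff z e f x)"
    by (simp add: aff_partials_def X_def)
  moreover have "aff_partials z e f D i (Suc j) x = dir_partials f X 0 0 (aff z e f x)"
    by (simp add: aff_partials_def X_def dir_partials_power_commute)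
  moreover have "aff_partials z e f D i j = (\<lambda>x. X 0 0 (aff z e f x))"
    by (simp add: aff_partials_def X_def)
  ultimately show "(aff_partials z e f D i j has_derivative
      (\<lambda>(s, t). s * aff_partials z e f D (Suc i) j x + t * aff_partials z e f D i (Suc j) x)) (at x)"
    by (simp add: dir_partials_def[of _ X] algebra_simps split_def)
qed simp

lemma aff_partials_00: "aff_partials z e f D 0 0 x = D 0 0 (aff z e f x)"
  by (simp add: aff_partials_def)

text \<open>The new support lies in the image of the old one under the inverse map, which is
  compact.\<close>

lemma test_fun_aff:
  assumes D: "test_fun U D" and inv: "\<And>x. aff z' e' f' (aff z e f x) = x" "\<And>x. aff z e f (aff z' e' f' x) = x"
  shows "test_fun (aff z e f -` U) (aff_partials z e f D)"
proof -
  let ?K = "closure {x. D 0 0 x \<noteq> 0}"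
  let ?L = "aff z' e' f' ` ?K"
  have K: "compact ?K" "?K \<subseteq> U" "has_partials (D 0 0) D"
    using D by (auto simp: test_fun_def)
  have L: "compact ?L" by (intro compact_continuous_image continuous_on_aff K)
  have LU: "?L \<subseteq> aff z e f -` U" using K(2) inv(2) by auto
  have "{x. aff_partials z e f D 0 0 x \<noteq> 0} \<subseteq> ?L"
  proof
    fix x assume "x \<in> {x. aff_partials z e f D 0 0 x \<noteq> 0}"
    then have "aff z e f x \<in> ?K" by (intro subsetD[OF closure_subset]) (simp add: aff_partials_00)
    then have "aff z' e' f' (aff z e f x) \<in> ?L" by (rule imageI)
    then show "x \<in> ?L" by (simp only: inv)
  qed
  then have sub: "closure {x. aff_partials z e f D 0 0 x \<noteq> 0} \<subseteq> ?L"
    using L by (intro closure_minimal compact_imp_closed)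
  then have "compact (closure {x. aff_partials z e f D 0 0 x \<noteq> 0})"
    using L by (meson bounded_subset closed_closure compact_eq_bounded_closed)
  then show ?thesis
    unfolding test_fun_def using has_partials_aff[OF K(3)] order_trans[OF sub LU] by blast
qed

lemma open_vimage_aff: "open U \<Longrightarrow> open (aff z e f -` U)"
  by (intro open_vimage continuous_on_aff)

lemma locally_integrable_aff:
  assumes det: "det2 e f \<noteq> 0" and U: "open U" and v: "locally_integrable U v"
  shows "locally_integrable (aff z e f -` U) (\<lambda>x. v (aff z e f x))"
  unfolding locally_integrable_def
proof (intro allI impI)
  fix K assume K: "compact K \<and> K \<subseteq> aff z e f -` U"
  obtain z' e' f' where inv: "\<And>x. aff z' e' f' (aff z e f x) = x" "\<And>x. aff z e f (aff z' e' f' x) = x"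
    using aff_inverse[OF det] by metis
  let ?L = "aff z e f ` K"
  have "compact ?L" "?L \<subseteq> U"
    using K by (auto intro!: compact_continuous_image continuous_on_aff)
  then have i: "integrable lebesgue (\<lambda>x. indicator ?L x *\<^sub>R v x)"
    using v by (simp add: locally_integrable_def set_integrable_def)
  have "indicator ?L (aff z e f x) = (indicator K x :: real)" for x
    using inv(1) by (auto simp: indicator_def) (metis inv(1))
  then show "(\<lambda>x. v (aff z e f x)) absolutely_integrable_on K"
    using integrable_lebesgue_aff(1)[OF det i, of z] by (simp add: set_integrable_def)
qed

text \<open>Here \<open>l\<close> and \<open>i + j - l\<close> are the orders in the two variables, so all derivatives of order
  \<open>i + j\<close> occur.\<close>

lemma has_weak_deriv_aff:
  assumes det: "det2 e f \<noteq> 0" and U: "open U"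
    and K: "\<bar>fst e\<bar> \<le> K" "\<bar>snd e\<bar> \<le> K" "\<bar>fst f\<bar> \<le> K" "\<bar>snd f\<bar> \<le> K"
  shows "\<exists>c. (\<forall>l. \<bar>c l\<bar> \<le> (2 * K) ^ (i + j)) \<and>
    (\<forall>v V. (\<forall>l\<le>i + j. has_weak_deriv U (l, i + j - l) v (V l)) \<longrightarrow>
      has_weak_deriv (aff z e f -` U) (i, j) (\<lambda>x. v (aff z e f x)) (\<lambda>x. \<Sum>l\<le>i + j. c l * V l (aff z e f x))) \<and>
    (\<forall>D x. aff_partials z e f D i j x = (\<Sum>l\<le>i + j. c l * D l (i + j - l) (aff z e f x)))"
proof -
  let ?F = "aff z e f" and ?N = "i + j"
  let ?W = "?F -` U"
  obtain c where c0: "(\<forall>l. \<bar>c l\<bar> \<le> (2 * K) ^ ?N) \<and> (\<forall>D a b x.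
      (dir_partials e ^^ i) ((dir_partials f ^^ j) D) a b x = (\<Sum>l\<le>?N. c l * D (a + l) (b + (?N - l)) x))"
    using homogeneous_dir_partials2[OF K, of i j] unfolding homogeneous_def by (rule exE)
  have c: "\<bar>c l\<bar> \<le> (2 * K) ^ ?N"
    "(dir_partials e ^^ i) ((dir_partials f ^^ j) D) a b x = (\<Sum>l\<le>?N. c l * D (a + l) (b + (?N - l)) x)" for l D a b x
    by (rule c0[THEN conjunct1, THEN spec], rule c0[THEN conjunct2, THEN spec, THEN spec, THEN spec, THEN spec])
  obtain z' e' f' where inv: "\<And>x. aff z' e' f' (?F x) = x" "\<And>x. ?F (aff z' e' f' x) = x"
    using aff_inverse[OF det] by metis
  have W: "open ?W" by (rule open_vimage_aff[OF U])
  have "has_weak_deriv ?W (i, j) (\<lambda>x. v (?F x)) (\<lambda>x. \<Sum>l\<le>?N. c l * V l (?F x))"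
    if V: "\<And>l. l \<le> ?N \<Longrightarrow> has_weak_deriv U (l, ?N - l) v (V l)" for v V
  proof -
    have liv: "locally_integrable U v" using V[of 0] by (simp add: has_weak_deriv_iff)
    have liV: "locally_integrable U (V l)" if "l \<le> ?N" for l using V[OF that] by (simp add: has_weak_deriv_iff)
    have "locally_integrable U (\<lambda>x. \<Sum>l\<in>A. c l * V l x)" if "finite A" "A \<subseteq> {..?N}" for A
      using that
    proof (induction rule: finite_induct)
      case empty
      then show ?case by (simp add: locally_integrable_continuous)
    next
      case (insert l A)
      then have "locally_integrable U (\<lambda>x. c l * V l x + 1 * (\<Sum>l\<in>A. c l * V l x))"
        by (intro locally_integrable_lin liV) auto
      then show ?case using insert by simp
    qed
    then have liS: "locally_integrable U (\<lambda>x. \<Sum>l\<le>?N. c l * V l x)" by simp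
    have "(LINT x|lebesgue_on ?W. v (?F x) * D i j x)
        = (-1) ^ ?N * (LINT x|lebesgue_on ?W. (\<Sum>l\<le>?N. c l * V l (?F x)) * D 0 0 x)"
      if D: "test_fun ?W D" for D
    proof -
      \<comment> \<open>The test function on the preimage is moved to \<open>U\<close> by the
        inverse map. Conversely it is the pullback of \<open>E\<close>, so its derivative expands
        into derivatives of \<open>E\<close> with the coefficients \<open>c\<close>, and these can
        be shifted to \<open>v\<close>.\<close>
      define E where "E = aff_partials z' e' f' D"
      have "aff z' e' f' -` ?W = U" by (simp add: vimage_def inv)
      then have E: "test_fun U E" unfolding E_def using test_fun_aff[OF D inv(2,1)] by simp
      have hpD: "has_partials (D 0 0) D" using D by (simp add: test_fun_def)
      have E00: "E 0 0 x = D 0 0 (aff z' e' f' x)" for x by (simp add: E_def aff_partials_00)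
      have "has_partials (aff_partials z e f E 0 0) (aff_partials z e f E)"
        using E by (intro has_partials_aff) (simp add: test_fun_def)
      moreover have "aff_partials z e f E 0 0 = D 0 0"
        by (simp add: fun_eq_iff aff_partials_00 E00 inv)
      ultimately have "has_partials (D 0 0) (aff_partials z e f E)" by simp
      then have "D i j = aff_partials z e f E i j" by (rule partials_unique[OF hpD])
      then have Dij: "D i j x = (\<Sum>l\<le>?N. c l * E l (?N - l) (?F x))" for x
        by (simp add: aff_partials_def c(2))
      have D00: "D 0 0 x = E 0 0 (?F x)" for x by (simp add: E00 inv)
      note int = integrable_test[OF U _ E]
      have "integrable (lebesgue_on U) (\<lambda>x. \<Sum>l\<le>?N. c l * (v x * E l (?N - l) x))"
        using int[OF liv] by (intro Bochner_Integration.integrable_sum integrable_mult_right)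
      moreover have "(\<lambda>x. \<Sum>l\<le>?N. c l * (v x * E l (?N - l) x)) = (\<lambda>x. v x * (\<Sum>l\<le>?N. c l * E l (?N - l) x))"
        by (auto simp: sum_distrib_left algebra_simps intro!: sum.cong)
      ultimately have i1: "integrable (lebesgue_on U) (\<lambda>x. v x * (\<Sum>l\<le>?N. c l * E l (?N - l) x))" by simp
      have i2: "integrable (lebesgue_on U) (\<lambda>x. (\<Sum>l\<le>?N. c l * V l x) * E 0 0 x)"
        by (rule int[OF liS])
      note Us = open_sets_lebesgue[OF U]
      have "\<bar>det2 e f\<bar> * (LINT x|lebesgue_on ?W. v (?F x) * D i j x)
          = (LINT x|lebesgue_on U. v x * (\<Sum>l\<le>?N. c l * E l (?N - l) x))"
        by (simp add: integral_lebesgue_on_aff(2)[OF det Us i1, of z] Dij)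
      also have "\<dots> = (LINT x|lebesgue_on U. (\<Sum>l\<le>?N. c l * (v x * E l (?N - l) x)))"
        by (rule Bochner_Integration.integral_cong[OF refl]) (simp add: sum_distrib_left mult.left_commute)
      also have "\<dots> = (\<Sum>l\<le>?N. c l * (LINT x|lebesgue_on U. v x * E l (?N - l) x))"
        using int[OF liv] by (subst Bochner_Integration.integral_sum) auto
      also have "\<dots> = (\<Sum>l\<le>?N. c l * ((-1) ^ ?N * (LINT x|lebesgue_on U. V l x * E 0 0 x)))"
      proof (rule sum.cong[OF refl])
        fix l assume "l \<in> {..?N}"
        then have l: "l \<le> ?N" by simp
        from V[OF l, unfolded has_weak_deriv_iff, THEN conjunct2, THEN conjunct2, rule_format, OF E] l
        show "c l * (LINT x|lebesgue_on U. v x * E l (?N - l) x) = c l * ((-1) ^ ?N * (LINT x|lebesgue_on U. V l x * E 0 0 x))"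
          by simp
      qed
      also have "\<dots> = (-1) ^ ?N * (\<Sum>l\<le>?N. c l * (LINT x|lebesgue_on U. V l x * E 0 0 x))"
        by (simp add: sum_distrib_left mult.left_commute)
      also have "(\<Sum>l\<le>?N. c l * (LINT x|lebesgue_on U. V l x * E 0 0 x)) = (LINT x|lebesgue_on U. (\<Sum>l\<le>?N. c l * (V l x * E 0 0 x)))"
        using int[OF liV] by (subst Bochner_Integration.integral_sum) auto
      also have "\<dots> = (LINT x|lebesgue_on U. (\<Sum>l\<le>?N. c l * V l x) * E 0 0 x)"
        by (rule Bochner_Integration.integral_cong[OF refl]) (simp add: sum_distrib_right mult.assoc)
      also have "\<dots> = \<bar>det2 e f\<bar> * (LINT x|lebesgue_on ?W. (\<Sum>l\<le>?N. c l * V l (?F x)) * D 0 0 x)"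
        by (simp add: integral_lebesgue_on_aff(2)[OF det Us i2, of z] D00)
      finally show ?thesis using det by simp
    qed
    then show ?thesis
      using locally_integrable_aff[OF det U liv, of z] locally_integrable_aff[OF det U liS, of z]
      by (simp add: has_weak_deriv_iff)
  qed
  moreover have "aff_partials z e f D i j x = (\<Sum>l\<le>?N. c l * D l (?N - l) (?F x))" for D x
    by (simp add: aff_partials_def c(2))
  ultimately show ?thesis using c(1) by (intro exI[of _ c] conjI allI impI) auto
qed

text \<open>The general rule provides its coefficients only existentially; in order 1 the identity
  for \<open>aff_partials\<close> identifies them.\<close>

lemma has_weak_deriv_aff1:
  assumes det: "det2 e f \<noteq> 0" and U: "open U"
    and V: "has_weak_deriv U (1, 0) v vx" "has_weak_deriv U (0, 1) v vy"
  shows "has_weak_deriv (aff z e f -` U) (1, 0) (\<lambda>x. v (aff z e f x))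
      (\<lambda>x. fst e * vx (aff z e f x) + snd e * vy (aff z e f x))"
    "has_weak_deriv (aff z e f -` U) (0, 1) (\<lambda>x. v (aff z e f x))
      (\<lambda>x. fst f * vx (aff z e f x) + snd f * vy (aff z e f x))"
proof -
  define K where "K = \<bar>fst e\<bar> + \<bar>snd e\<bar> + \<bar>fst f\<bar> + \<bar>snd f\<bar>"
  have K: "\<bar>fst e\<bar> \<le> K" "\<bar>snd e\<bar> \<le> K" "\<bar>fst f\<bar> \<le> K" "\<bar>snd f\<bar> \<le> K" by (auto simp: K_def)
  define V' where "V' l = (if l = 0 then vy else vx)" for l :: nat
  \<comment> \<open>These arrays need not consist of the derivatives of a function: the identity
    holds for arbitrary arrays, and \<open>Dx\<close> isolates \<open>c 1\<close> and
    \<open>d 1\<close>, \<open>Dy\<close> isolates \<open>c 0\<close> and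
    \<open>d 0\<close>.\<close>
  define Dx Dy :: partials where "Dx a b x = (if a = 0 then 0 else 1)" and "Dy a b x = (if b = 0 then 0 else 1)" for a b x
  obtain c where c0: "(\<forall>l. \<bar>c l\<bar> \<le> (2 * K) ^ (1 + 0)) \<and>
    (\<forall>v V. (\<forall>l\<le>1 + 0. has_weak_deriv U (l, 1 + 0 - l) v (V l)) \<longrightarrow>
      has_weak_deriv (aff z e f -` U) (1, 0) (\<lambda>x. v (aff z e f x)) (\<lambda>x. \<Sum>l\<le>1 + 0. c l * V l (aff z e f x))) \<and>
    (\<forall>D x. aff_partials z e f D 1 0 x = (\<Sum>l\<le>1 + 0. c l * D l (1 + 0 - l) (aff z e f x)))"
    using has_weak_deriv_aff[OF det U K, where z = z and i = 1 and j = 0] by (rule exE)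
  note c = c0[THEN conjunct2, THEN conjunct1, THEN spec, THEN spec, THEN mp]
    c0[THEN conjunct2, THEN conjunct2, THEN spec, THEN spec]
  obtain d where d0: "(\<forall>l. \<bar>d l\<bar> \<le> (2 * K) ^ (0 + 1)) \<and>
    (\<forall>v V. (\<forall>l\<le>0 + 1. has_weak_deriv U (l, 0 + 1 - l) v (V l)) \<longrightarrow>
      has_weak_deriv (aff z e f -` U) (0, 1) (\<lambda>x. v (aff z e f x)) (\<lambda>x. \<Sum>l\<le>0 + 1. d l * V l (aff z e f x))) \<and>
    (\<forall>D x. aff_partials z e f D 0 1 x = (\<Sum>l\<le>0 + 1. d l * D l (0 + 1 - l) (aff z e f x)))"
    using has_weak_deriv_aff[OF det U K, where z = z and i = 0 and j = 1] by (rule exE)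
  note d = d0[THEN conjunct2, THEN conjunct1, THEN spec, THEN spec, THEN mp]
    d0[THEN conjunct2, THEN conjunct2, THEN spec, THEN spec]
  have cd: "c 0 = snd e" "c 1 = fst e" "d 0 = snd f" "d 1 = fst f"
    using c(2)[of Dx 0] c(2)[of Dy 0] d(2)[of Dx 0] d(2)[of Dy 0]
    by (simp_all add: aff_partials_def dir_partials_def Dx_def Dy_def)
  have V': "has_weak_deriv U (l, 1 + 0 - l) v (V' l)" "has_weak_deriv U (l, 0 + 1 - l) v (V' l)" if "l \<le> 1" for l
    using that V by (cases l; simp add: V'_def)+
  show "has_weak_deriv (aff z e f -` U) (1, 0) (\<lambda>x. v (aff z e f x))
      (\<lambda>x. fst e * vx (aff z e f x) + snd e * vy (aff z e f x))"
    using c(1)[of v V'] V'(1) cd by (simp add: V'_def add.commute)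
  show "has_weak_deriv (aff z e f -` U) (0, 1) (\<lambda>x. v (aff z e f x))
      (\<lambda>x. fst f * vx (aff z e f x) + snd f * vy (aff z e f x))"
    using d(1)[of v V'] V'(2) cd by (simp add: V'_def add.commute)
qed

section \<open>Norms and seminorms, and how they scale\<close>

text \<open>Collecting a single order makes the quantity scale with one power of the affine map; a
  plain sum is used for all exponents, as only equivalence with the norm matters.\<close>

definition sobolev_seminorm :: "nat \<Rightarrow> ereal \<Rightarrow> point set \<Rightarrow> (point \<Rightarrow> real) \<Rightarrow> real" where
  "sobolev_seminorm n p U v = (\<Sum>l\<le>n. Lp_norm p U (weak_deriv U (l, n - l) v))"

lemma sobolev_seminorm_nonneg: "0 \<le> sobolev_seminorm n p U v"
  by (simp add: sobolev_seminorm_def sum_nonneg Lp_norm_nonneg)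

lemma Lp_norm_le_seminorm: "Lp_norm p U (weak_deriv U (i, j) v) \<le> sobolev_seminorm (i + j) p U v"
  unfolding sobolev_seminorm_def
  using member_le_sum[of i "{..i + j}" "\<lambda>l. Lp_norm p U (weak_deriv U (l, i + j - l) v)"]
  by (simp add: Lp_norm_nonneg)

lemma finite_multi_indices: "finite (multi_indices n)"
  by (rule finite_subset[of _ "{..n} \<times> {..n}"]) (auto simp: multi_indices_def)

lemma multi_indices_nonempty: "multi_indices n \<noteq> {}"
proof -
  have "(0, 0) \<in> multi_indices n" by (simp add: multi_indices_def)
  then show ?thesis by blast
qed

text \<open>Superadditivity of the power, iterated over the set: the \<open>l^r\<close> norm is at
  most the \<open>l^1\<close> norm.\<close>

lemma powr_sum_le_sum:
  fixes f :: "'a \<Rightarrow> real"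
  assumes "finite A" "\<And>a. a \<in> A \<Longrightarrow> 0 \<le> f a" "1 \<le> r"
  shows "(\<Sum>a\<in>A. f a powr r) powr (1 / r) \<le> (\<Sum>a\<in>A. f a)"
proof -
  have "(\<Sum>a\<in>A. f a powr r) \<le> (\<Sum>a\<in>A. f a) powr r"
    using assms(1,2)
  proof (induction rule: finite_induct)
    case (insert a A)
    then have "(\<Sum>a\<in>insert a A. f a powr r) \<le> f a powr r + (\<Sum>a\<in>A. f a) powr r" by simp
    also have "\<dots> \<le> (f a + (\<Sum>a\<in>A. f a)) powr r"
      using insert assms(3) by (intro add_powr_le_powr_add sum_nonneg) auto
    finally show ?case using insert by simp
  qed simp
  then have "(\<Sum>a\<in>A. f a powr r) powr (1 / r) \<le> ((\<Sum>a\<in>A. f a) powr r) powr (1 / r)"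
    using assms(3) by (intro powr_mono2 sum_nonneg) auto
  also have "\<dots> = (\<Sum>a\<in>A. f a)"
    using assms by (simp add: powr_powr sum_nonneg)
  finally show ?thesis .
qed

lemma sobolev_norm_le_sum:
  assumes "1 \<le> p"
  shows "sobolev_norm n p U v \<le> (\<Sum>\<alpha>\<in>multi_indices n. Lp_norm p U (weak_deriv U \<alpha> v))"
  using assms
proof (cases rule: exponent_cases)
  case infinity
  have "Max ((\<lambda>\<alpha>. Lp_norm p U (weak_deriv U \<alpha> v)) ` multi_indices n) \<in> (\<lambda>\<alpha>. Lp_norm p U (weak_deriv U \<alpha> v)) ` multi_indices n"
    using finite_multi_indices multi_indices_nonempty by (intro Max_in) auto
  then obtain \<alpha> where "\<alpha> \<in> multi_indices n" "sobolev_norm n p U v = Lp_norm p U (weak_deriv U \<alpha> v)"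
    using infinity by (auto simp: sobolev_norm_def)
  then show ?thesis
    using member_le_sum[of \<alpha> "multi_indices n" "\<lambda>\<alpha>. Lp_norm p U (weak_deriv U \<alpha> v)"]
    by (simp add: Lp_norm_nonneg finite_multi_indices)
next
  case (real r)
  then show ?thesis
    using powr_sum_le_sum[OF finite_multi_indices, of n "\<lambda>\<alpha>. Lp_norm p U (weak_deriv U \<alpha> v)" r]
    by (simp add: sobolev_norm_def Lp_norm_nonneg)
qed

lemma Lp_norm_le_sobolev_norm:
  assumes "1 \<le> p" "i + j \<le> n"
  shows "Lp_norm p U (weak_deriv U (i, j) v) \<le> sobolev_norm n p U v"
proof -
  have ij: "(i, j) \<in> multi_indices n" using assms(2) by (simp add: multi_indices_def)
  show ?thesis
    using assms(1)
  proof (cases rule: exponent_cases)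
    case infinity
    then show ?thesis
      using ij finite_multi_indices by (auto simp: sobolev_norm_def intro!: Max_ge)
  next
    case (real r)
    let ?f = "\<lambda>\<alpha>. Lp_norm p U (weak_deriv U \<alpha> v)"
    have "?f (i, j) = (?f (i, j) powr r) powr (1 / r)"
      using real by (simp add: powr_powr Lp_norm_nonneg)
    also have "\<dots> \<le> (\<Sum>\<alpha>\<in>multi_indices n. ?f \<alpha> powr r) powr (1 / r)"
      using real member_le_sum[OF ij, of "\<lambda>\<alpha>. ?f \<alpha> powr r"] by (intro powr_mono2) (auto simp: finite_multi_indices)
    finally show ?thesis using real by (simp add: sobolev_norm_def)
  qed
qed

lemma sobolev_norm_nonneg: "1 \<le> p \<Longrightarrow> 0 \<le> sobolev_norm n p U v"
  using Lp_norm_le_sobolev_norm[of p 0 0 n U v] Lp_norm_nonneg[of p U "weak_deriv U (0, 0) v"] by linarith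

lemma sobolev_seminorm_le_norm:
  assumes "1 \<le> p" "l \<le> n"
  shows "sobolev_seminorm l p U v \<le> real (l + 1) * sobolev_norm n p U v"
proof -
  have "sobolev_seminorm l p U v \<le> (\<Sum>i\<le>l. sobolev_norm n p U v)"
    unfolding sobolev_seminorm_def using assms by (intro sum_mono Lp_norm_le_sobolev_norm) auto
  then show ?thesis by simp
qed

lemma sobolev_norm_le_seminorms:
  assumes "1 \<le> p"
  shows "sobolev_norm n p U v \<le> (\<Sum>l\<le>n. sobolev_seminorm l p U v)"
proof -
  have "(\<Sum>\<alpha>\<in>multi_indices n. Lp_norm p U (weak_deriv U \<alpha> v))
      = (\<Sum>(l, i)\<in>(SIGMA l:{..n}. {..l}). Lp_norm p U (weak_deriv U (i, l - i) v))"
    by (rule sum.reindex_bij_witness[of _ "\<lambda>(l, i). (i, l - i)" "\<lambda>(i, j). (i + j, i)"])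
      (auto simp: multi_indices_def)
  also have "\<dots> = (\<Sum>l\<le>n. sobolev_seminorm l p U v)"
    by (simp add: sobolev_seminorm_def sum.Sigma)
  finally show ?thesis using sobolev_norm_le_sum[OF assms, of n U v] by simp
qed

text \<open>The factor \<open>2^(i + j + 1)\<close> comes from adding \<open>i + j + 1\<close>
  functions, \<open>(2 K)^(i + j)\<close> bounds the coefficients of the chain rule, and the
  determinant is that of the change of variables.\<close>

lemma sobolev_aff_deriv:
  assumes p: "1 \<le> p" and det: "det2 e f \<noteq> 0" and U: "open U"
    and K: "\<bar>fst e\<bar> \<le> K" "\<bar>snd e\<bar> \<le> K" "\<bar>fst f\<bar> \<le> K" "\<bar>snd f\<bar> \<le> K"
    and V: "\<And>l. l \<le> i + j \<Longrightarrow> has_weak_deriv U (l, i + j - l) v (V l)" "\<And>l. l \<le> i + j \<Longrightarrow> V l \<in> Lp_space p U"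
  obtains w where "has_weak_deriv (aff z e f -` U) (i, j) (\<lambda>x. v (aff z e f x)) w" "w \<in> Lp_space p (aff z e f -` U)"
    "Lp_norm p (aff z e f -` U) w \<le> 2 ^ (i + j + 1) * (2 * K) ^ (i + j) * \<bar>det2 e f\<bar> powr (- (1 / real_of_ereal p))
      * (\<Sum>l\<le>i + j. Lp_norm p U (V l))"
proof -
  let ?W = "aff z e f -` U" and ?N = "i + j"
  let ?d = "\<bar>det2 e f\<bar> powr (- (1 / real_of_ereal p))"
  obtain c where c0: "(\<forall>l. \<bar>c l\<bar> \<le> (2 * K) ^ ?N) \<and>
    (\<forall>v V. (\<forall>l\<le>?N. has_weak_deriv U (l, ?N - l) v (V l)) \<longrightarrow>
      has_weak_deriv ?W (i, j) (\<lambda>x. v (aff z e f x)) (\<lambda>x. \<Sum>l\<le>?N. c l * V l (aff z e f x))) \<and>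
    (\<forall>D x. aff_partials z e f D i j x = (\<Sum>l\<le>?N. c l * D l (?N - l) (aff z e f x)))"
    using has_weak_deriv_aff[OF det U K, where z = z and i = i and j = j] by (rule exE)
  have c: "\<bar>c l\<bar> \<le> (2 * K) ^ ?N"
    "has_weak_deriv ?W (i, j) (\<lambda>x. v (aff z e f x)) (\<lambda>x. \<Sum>l\<le>?N. c l * V l (aff z e f x))" for l
    using c0[THEN conjunct1, THEN spec] c0[THEN conjunct2, THEN conjunct1, THEN spec, THEN spec, THEN mp] V(1)
    by blast+
  have VF: "(\<lambda>x. V l (aff z e f x)) \<in> Lp_space p ?W"
    "Lp_norm p ?W (\<lambda>x. V l (aff z e f x)) \<le> ?d * Lp_norm p U (V l)" if "l \<le> ?N" for l
    using Lp_aff[OF p det U V(2)[OF that]] by auto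
  note cVF = Lp_cmult[OF p VF(1)]
  have S: "(\<lambda>x. \<Sum>l\<le>?N. c l * V l (aff z e f x)) \<in> Lp_space p ?W \<and>
      Lp_norm p ?W (\<lambda>x. \<Sum>l\<le>?N. c l * V l (aff z e f x))
        \<le> 2 ^ card {..?N} * (\<Sum>l\<le>?N. Lp_norm p ?W (\<lambda>x. c l * V l (aff z e f x)))"
    using cVF by (intro Lp_sum[OF p]) auto
  have "(\<Sum>l\<le>?N. Lp_norm p ?W (\<lambda>x. c l * V l (aff z e f x))) \<le> (\<Sum>l\<le>?N. (2 * K) ^ ?N * (?d * Lp_norm p U (V l)))"
  proof (rule sum_mono)
    fix l assume "l \<in> {..?N}"
    then have l: "l \<le> ?N" by simp
    have "Lp_norm p ?W (\<lambda>x. c l * V l (aff z e f x)) \<le> \<bar>c l\<bar> * Lp_norm p ?W (\<lambda>x. V l (aff z e f x))"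
      by (rule cVF(2)[OF l])
    also have "\<dots> \<le> (2 * K) ^ ?N * (?d * Lp_norm p U (V l))"
      using c(1)[of l] VF(2)[OF l] Lp_norm_nonneg by (intro mult_mono) (auto intro: order_trans[OF abs_ge_zero])
    finally show "Lp_norm p ?W (\<lambda>x. c l * V l (aff z e f x)) \<le> (2 * K) ^ ?N * (?d * Lp_norm p U (V l))" .
  qed
  also have "\<dots> = (2 * K) ^ ?N * ?d * (\<Sum>l\<le>?N. Lp_norm p U (V l))"
    by (simp add: sum_distrib_left mult.assoc)
  finally have "2 ^ card {..?N} * (\<Sum>l\<le>?N. Lp_norm p ?W (\<lambda>x. c l * V l (aff z e f x)))
      \<le> 2 ^ (?N + 1) * ((2 * K) ^ ?N * ?d * (\<Sum>l\<le>?N. Lp_norm p U (V l)))"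
    by simp
  from order_trans[OF S[THEN conjunct2] this] show thesis
    by (intro that[OF c(2) S[THEN conjunct1]]) (simp only: mult.assoc)
qed

lemma sobolev_space_aff:
  assumes p: "1 \<le> p" and det: "det2 e f \<noteq> 0" and U: "open U" and v: "v \<in> sobolev_space n p U"
  shows "(\<lambda>x. v (aff z e f x)) \<in> sobolev_space n p (aff z e f -` U)"
proof (rule sobolev_spaceI)
  fix i j assume ij: "i + j \<le> n"
  define K where "K = \<bar>fst e\<bar> + \<bar>snd e\<bar> + \<bar>fst f\<bar> + \<bar>snd f\<bar>"
  have K: "\<bar>fst e\<bar> \<le> K" "\<bar>snd e\<bar> \<le> K" "\<bar>fst f\<bar> \<le> K" "\<bar>snd f\<bar> \<le> K" by (auto simp: K_def)
  note V = sobolev_space_weak_deriv[OF p U v]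
  have "has_weak_deriv U (l, i + j - l) v (weak_deriv U (l, i + j - l) v)"
    "weak_deriv U (l, i + j - l) v \<in> Lp_space p U" if "l \<le> i + j" for l
    using V[of l "i + j - l"] that ij by auto
  note V' = this
  obtain w where "has_weak_deriv (aff z e f -` U) (i, j) (\<lambda>x. v (aff z e f x)) w" "w \<in> Lp_space p (aff z e f -` U)"
    "Lp_norm p (aff z e f -` U) w \<le> 2 ^ (i + j + 1) * (2 * K) ^ (i + j) * \<bar>det2 e f\<bar> powr (- (1 / real_of_ereal p))
      * (\<Sum>l\<le>i + j. Lp_norm p U (weak_deriv U (l, i + j - l) v))"
    by (rule sobolev_aff_deriv[OF p det U K V', where z = z])
  then show "\<exists>w. has_weak_deriv (aff z e f -` U) (i, j) (\<lambda>x. v (aff z e f x)) w \<and> w \<in> Lp_space p (aff z e f -` U)"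
    by blast
qed

text \<open>Each of the \<open>l + 1\<close> derivatives of order \<open>l\<close> is bounded by the
  same multiple of the seminorm, which explains the factor \<open>real (l + 1)\<close>.\<close>

lemma sobolev_seminorm_aff:
  assumes p: "1 \<le> p" and det: "det2 e f \<noteq> 0" and U: "open U" and v: "v \<in> sobolev_space n p U" and l: "l \<le> n"
    and K: "\<bar>fst e\<bar> \<le> K" "\<bar>snd e\<bar> \<le> K" "\<bar>fst f\<bar> \<le> K" "\<bar>snd f\<bar> \<le> K"
  shows "sobolev_seminorm l p (aff z e f -` U) (\<lambda>x. v (aff z e f x))
    \<le> real (l + 1) * 2 ^ (l + 1) * (2 * K) ^ l * \<bar>det2 e f\<bar> powr (- (1 / real_of_ereal p)) * sobolev_seminorm l p U v"
proof -
  let ?W = "aff z e f -` U" and ?v = "\<lambda>x. v (aff z e f x)"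
  let ?C = "2 ^ (l + 1) * (2 * K) ^ l * \<bar>det2 e f\<bar> powr (- (1 / real_of_ereal p)) * sobolev_seminorm l p U v"
  note V = sobolev_space_weak_deriv[OF p U v]
  have "Lp_norm p ?W (weak_deriv ?W (i, l - i) ?v) \<le> ?C" if i: "i \<le> l" for i
  proof -
    have il: "i + (l - i) = l" using i by simp
    have V': "has_weak_deriv U (k, i + (l - i) - k) v (weak_deriv U (k, l - k) v)"
      "weak_deriv U (k, l - k) v \<in> Lp_space p U" if "k \<le> i + (l - i)" for k
      using V[of k "l - k"] that l unfolding il by auto
    obtain w where w: "has_weak_deriv ?W (i, l - i) ?v w" "w \<in> Lp_space p ?W"
      "Lp_norm p ?W w \<le> 2 ^ (i + (l - i) + 1) * (2 * K) ^ (i + (l - i)) * \<bar>det2 e f\<bar> powr (- (1 / real_of_ereal p))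
        * (\<Sum>k\<le>i + (l - i). Lp_norm p U (weak_deriv U (k, l - k) v))"
      by (rule sobolev_aff_deriv[OF p det U K V', where z = z])
    then show ?thesis
      unfolding il weak_deriv_Lp(2)[OF p open_vimage_aff[OF U] w(1,2)] sobolev_seminorm_def by simp
  qed
  then have "sobolev_seminorm l p ?W ?v \<le> (\<Sum>i\<le>l. ?C)"
    unfolding sobolev_seminorm_def[of l p ?W ?v] by (intro sum_mono) auto
  then show ?thesis by (simp add: mult.assoc)
qed

subsection \<open>An averaged Taylor formula on the unit square\<close>

lemma fubini_point:
  fixes g :: "point \<Rightarrow> real"
  assumes g: "integrable lborel g"
  shows "AE x in lborel. integrable lborel (\<lambda>y. g (x, y))"
    "AE y in lborel. integrable lborel (\<lambda>x. g (x, y))"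
    "integrable lborel (\<lambda>x. LINT y|lborel. g (x, y))"
    "integrable lborel (\<lambda>y. LINT x|lborel. g (x, y))"
    "(LINT x|lborel. LINT y|lborel. g (x, y)) = (LINT z|lborel. g z)"
    "(LINT y|lborel. LINT x|lborel. g (x, y)) = (LINT z|lborel. g z)"
proof -
  have g': "integrable (lborel \<Otimes>\<^sub>M lborel) (case_prod (\<lambda>x y. g (x, y)))"
    using g by (simp add: lborel_prod)
  show "AE x in lborel. integrable lborel (\<lambda>y. g (x, y))" by (rule lborel_pair.AE_integrable_fst[OF g'])
  show "AE y in lborel. integrable lborel (\<lambda>x. g (x, y))" by (rule lborel_pair.AE_integrable_snd[OF g'])
  show "integrable lborel (\<lambda>x. LINT y|lborel. g (x, y))" by (rule lborel_pair.integrable_fst[OF g'])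
  show "integrable lborel (\<lambda>y. LINT x|lborel. g (x, y))" by (rule lborel_pair.integrable_snd[OF g'])
  show "(LINT x|lborel. LINT y|lborel. g (x, y)) = (LINT z|lborel. g z)"
    using lborel_pair.integral_fst[OF g'] by (simp add: lborel_prod)
  show "(LINT y|lborel. LINT x|lborel. g (x, y)) = (LINT z|lborel. g z)"
    using lborel_pair.integral_snd[OF g'] by (simp add: lborel_prod)
qed

lemma borel_measurable_section:
  fixes g :: "point \<Rightarrow> real"
  assumes "g \<in> borel_measurable borel"
  shows "(\<lambda>y. g (x, y)) \<in> borel_measurable borel" "(\<lambda>x. g (x, y)) \<in> borel_measurable borel"
proof -
  have "(\<lambda>y. (x, y)) \<in> borel_measurable borel" "(\<lambda>x. (x, y)) \<in> borel_measurable borel"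
    by (intro borel_measurable_continuous_onI continuous_intros)+
  then show "(\<lambda>y. g (x, y)) \<in> borel_measurable borel" "(\<lambda>x. g (x, y)) \<in> borel_measurable borel"
    using measurable_compose[OF _ assms] by blast+
qed

text \<open>Exchanging the coordinates is an affine map of determinant -1, so it preserves null
  sets.\<close>

lemma AE_lborel_swap:
  assumes "AE z in (lborel :: point measure). P z"
  shows "AE z in lborel. P (snd z, fst z)"
proof -
  have "aff 0 (0, 1) (1, 0) z = (snd z, fst z)" for z by (simp add: aff_def)
  then show ?thesis
    using AE_lebesgue_aff[of "(0, 1)" "(1, 0)" P 0] assms
    by (simp add: det2_def AE_completion_iff)
qed

lemma AE_lborel_sections:
  assumes P: "AE z in (lborel :: point measure). P z"
  shows "AE x in lborel. AE y in lborel. P (x, y)" "AE y in lborel. AE x in lborel. P (x, y)"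
proof -
  have "AE z in lborel \<Otimes>\<^sub>M lborel. P z" using P unfolding lborel_prod .
  then show "AE x in lborel. AE y in lborel. P (x, y)" by (rule lborel_pair.AE_pair)
  have "AE z in lborel \<Otimes>\<^sub>M lborel. P (snd z, fst z)" using AE_lborel_swap[OF P] unfolding lborel_prod .
  from lborel_pair.AE_pair[OF this] show "AE y in lborel. AE x in lborel. P (x, y)" by simp
qed

lemma AE_lborel_snd:
  assumes "AE y in lborel. P y"
  shows "AE z in (lborel :: point measure). P (snd z)"
proof -
  obtain N where N: "N \<in> null_sets lborel" "{y. \<not> P y} \<subseteq> N"
    using assms by (auto simp: eventually_ae_filter)
  have [measurable]: "N \<in> sets borel" using N(1) by (auto simp: null_sets_def)
  have "AE x in lborel. AE y in lborel. y \<notin> N" using AE_not_in[OF N(1)] by simp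
  then have "AE x in lborel. AE y in lborel. snd (x, y) \<notin> N" by simp
  moreover have "{z \<in> space (lborel \<Otimes>\<^sub>M lborel :: point measure). snd z \<notin> N} \<in> sets (lborel \<Otimes>\<^sub>M lborel)"
    by measurable
  ultimately have "AE z in (lborel \<Otimes>\<^sub>M lborel :: point measure). snd z \<notin> N"
    by (rule lborel_pair.AE_pair_measure[rotated])
  then have "AE z in (lborel :: point measure). snd z \<notin> N" unfolding lborel_prod .
  then show ?thesis by eventually_elim (use N in auto)
qed

lemma AE_lborel_fst:
  assumes "AE y in lborel. P y"
  shows "AE z in (lborel :: point measure). P (fst z)"
  using AE_lborel_swap[OF AE_lborel_snd[OF assms]] by simp

section \<open>The averaging weight and the kernel of the Taylor formula\<close>

definition bump :: "real \<Rightarrow> real" where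
  "bump x = flat 0 (x - 1 / 4) * flat 0 (3 / 4 - x)"

text \<open>Mass 1 makes the weighted integral a mean value. The support stays away from the ends of
  the unit interval, so that corrections by multiples of \<open>theta\<close> do not destroy compact
  support in the open interval.\<close>

definition theta :: "real \<Rightarrow> real" where
  "theta x = bump x / (LINT t|lborel. bump t)"

definition theta_bound :: real where
  "theta_bound = 1 / (LINT t|lborel. bump t)"

lemma derivs_bump: obtains B where "derivs B" "B 0 = bump"
proof -
  obtain B where B: "derivs B" "\<And>x. B 0 x = flat 0 (1 * (x - 1 / 4)) * flat 0 (1 * (3 / 4 - x))"
    by (rule obtain_bump[of 1 "1 / 4" "3 / 4"]) blast
  then have "B 0 = bump" by (auto simp: bump_def)
  with B(1) show thesis by (rule that)
qed

lemma bump_zero: "x \<notin> {1 / 4..3 / 4} \<Longrightarrow> bump x = 0"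
  by (auto simp: bump_def flat_0_nonpos)

lemma bump_bounds: "0 \<le> bump x" "bump x \<le> 1"
  using flat_0_bounds by (auto simp: bump_def intro!: mult_le_one)

lemma bump_integrable: "integrable lborel bump"
proof -
  obtain B where "derivs B" "B 0 = bump" by (rule derivs_bump)
  then have "continuous_on UNIV bump" using derivs_continuous by metis
  then show ?thesis
    by (rule integrable_lborel_compact_support[of "{1 / 4..3 / 4}", rotated]) (use bump_zero in auto)
qed

lemma bump_integral_pos: "0 < (LINT t|lborel. bump t)"
proof -
  have lower: "exp (- 16) * indicator {3 / 8..5 / 8} x \<le> bump x" for x :: real
  proof (cases "x \<in> {3 / 8..5 / 8}")
    case True
    \<comment> \<open>On the middle quarter of the interval both arguments are at least
      \<open>1/8\<close>, so each factor is at least \<open>exp (- 8)\<close>.\<close>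
    then have "flat 0 (x - 1 / 4) \<ge> exp (- 8)" "flat 0 (3 / 4 - x) \<ge> exp (- 8)"
      by (auto simp: flat_def divide_simps)
    then have "exp (- 8) * exp (- 8) \<le> bump x"
      unfolding bump_def by (intro mult_mono) (auto simp: flat_0_bounds)
    then show ?thesis using True by (simp flip: exp_add)
  qed (simp add: bump_bounds)
  have "(LINT x|lborel. exp (- 16) * indicator {3 / 8..5 / 8} (x::real)) \<le> (LINT t|lborel. bump t)"
    by (intro integral_mono bump_integrable lower) auto
  moreover have "(LINT x|lborel. exp (- 16) * indicator {3 / 8..5 / 8} (x::real)) = (exp (- 16) / 4 :: real)" by simp
  ultimately show ?thesis by (smt (verit) exp_gt_zero divide_pos_pos)
qed

lemma theta_bound_pos: "0 < theta_bound"
  using bump_integral_pos by (simp add: theta_bound_def)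

lemma derivs_theta: obtains T where "derivs T" "T 0 = theta"
proof -
  obtain B where B: "derivs B" "B 0 = bump" by (rule derivs_bump)
  let ?T = "\<lambda>i x. B i x / (LINT t|lborel. bump t)"
  have "derivs ?T"
    using derivsD[OF B(1)] unfolding derivs_def by (intro allI DERIV_cdivide)
  moreover have "?T 0 = theta" using B(2) by (auto simp: theta_def)
  ultimately show thesis by (rule that)
qed

lemma theta_continuous: "continuous_on A theta"
proof -
  obtain T where "derivs T" "T 0 = theta" by (rule derivs_theta)
  then show ?thesis using derivs_continuous by metis
qed

lemma theta_measurable: "theta \<in> borel_measurable borel"
  by (intro borel_measurable_continuous_onI theta_continuous)

lemma theta_zero: "x \<notin> {1 / 4..3 / 4} \<Longrightarrow> theta x = 0"
  using bump_zero by (simp add: theta_def)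

lemma theta_bounds: "0 \<le> theta x" "theta x \<le> theta_bound"
  using bump_bounds[of x] bump_integral_pos by (auto simp: theta_def theta_bound_def divide_right_mono)

lemma theta_integrable: "integrable lborel theta"
  unfolding theta_def using bump_integrable by simp

lemma theta_integral: "(LINT x|lborel. theta x) = 1"
  unfolding theta_def using bump_integral_pos by simp

definition Theta :: "real \<Rightarrow> real" where
  "Theta s = (LINT t|lborel. indicator {..s} t * theta t)"

text \<open>For smooth \<open>f\<close> on the unit interval, \<open>f x\<close> minus the
  \<open>theta\<close>-mean of \<open>f\<close> is the integral over \<open>t\<close> of
  \<open>theta t\<close> times the integral of \<open>f'\<close> from \<open>t\<close> to
  \<open>x\<close>. Exchanging the integrals gives \<open>f' s\<close> the weight
  \<open>Theta s - [x <= s]\<close>.\<close>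

definition kern :: "real \<Rightarrow> real \<Rightarrow> real" where
  "kern x s = Theta s - (if x \<le> s then 1 else 0)"

lemma Theta_bounds: "0 \<le> Theta s" "Theta s \<le> 1"
proof -
  have i: "integrable lborel (\<lambda>t. indicator {..s} t * theta t)"
    using integrable_mult_indicator[OF _ theta_integrable, of "{..s}"] by simp
  show "0 \<le> Theta s" unfolding Theta_def
    by (intro integral_nonneg_AE AE_I2) (simp add: theta_bounds)
  have "Theta s \<le> (LINT t|lborel. theta t)"
    unfolding Theta_def by (intro integral_mono i theta_integrable) (auto simp: indicator_def theta_bounds)
  then show "Theta s \<le> 1" by (simp add: theta_integral)
qed

lemma Theta_measurable: "Theta \<in> borel_measurable borel"
proof -
  have "mono Theta"
  proof (rule monoI)
    fix s t :: real assume "s \<le> t"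
    then show "Theta s \<le> Theta t"
      unfolding Theta_def using integrable_mult_indicator[OF _ theta_integrable, of "{.._}"]
      by (intro integral_mono) (auto simp: indicator_def theta_bounds)
  qed
  then show ?thesis by (rule borel_measurable_mono)
qed

lemma kern_bound: "\<bar>kern x s\<bar> \<le> 1"
  using Theta_bounds[of s] by (auto simp: kern_def)

lemma kern_measurable_pair: "(\<lambda>z. kern (fst z) (snd z)) \<in> borel_measurable (borel \<Otimes>\<^sub>M borel)"
  unfolding kern_def using Theta_measurable by measurable

lemma kern_measurable: "kern x \<in> borel_measurable borel"
  unfolding kern_def using Theta_measurable by measurable

abbreviation unit_square :: "point set" where
  "unit_square \<equiv> box (0, 0) (1, 1)"

lemma mem_unit_square: "z \<in> unit_square \<longleftrightarrow> 0 < fst z \<and> fst z < 1 \<and> 0 < snd z \<and> snd z < 1"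
  by (cases z) (auto simp: mem_box Basis_prod_def)

section \<open>Borel representatives on the unit square\<close>

text \<open>A Borel representative extended by zero has Borel sections, and Fubini's theorem applies
  to it on the whole plane.\<close>

definition square_fun :: "(point \<Rightarrow> real) \<Rightarrow> bool" where
  "square_fun u \<longleftrightarrow> u \<in> borel_measurable borel \<and> integrable lborel u \<and> (\<forall>z. z \<notin> unit_square \<longrightarrow> u z = 0)"

lemma square_funD:
  assumes "square_fun u"
  shows "u \<in> borel_measurable borel" "integrable lborel u" "z \<notin> unit_square \<Longrightarrow> u z = 0"
  using assms unfolding square_fun_def by blast+

lemma obtain_square_fun:
  assumes "integrable (lebesgue_on unit_square) v"
  obtains u where "square_fun u" "AE z in lebesgue_on unit_square. v z = u z"
proof -
  have S: "unit_square \<in> sets lebesgue" by simp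
  have i: "integrable lebesgue (\<lambda>z. indicator unit_square z * v z)"
    using assms by (simp add: integrable_lebesgue_on_indicator)
  obtain g :: "point \<Rightarrow> real" where g: "g \<in> borel_measurable lborel" and eq: "AE z in lborel. indicator unit_square z * v z = g z"
    using completion_ex_borel_measurable_real[of "\<lambda>z. indicator unit_square z * v z" lborel] i by auto
  let ?u = "\<lambda>z. indicator unit_square z * g z"
  have eq': "AE z in lebesgue. indicator unit_square z * v z = ?u z"
    using eq unfolding AE_completion_iff by eventually_elim (auto simp: indicator_def split: if_splits)
  have m: "?u \<in> borel_measurable borel" using g by measurable
  have "integrable lebesgue ?u"
    by (rule integrable_cong_AE_imp[OF i _ eq']) (use m in \<open>auto intro: measurable_completion\<close>)
  then have "integrable lborel ?u" using m by (simp add: integrable_completion)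
  then have "square_fun ?u" using m by (auto simp: square_fun_def)
  moreover have "AE z in lebesgue_on unit_square. v z = ?u z"
    unfolding AE_lebesgue_on_iff[OF S] using eq' by eventually_elim (auto simp: indicator_def)
  ultimately show thesis by (rule that)
qed

lemma integral_unit_square:
  fixes g :: "point \<Rightarrow> real"
  assumes "g \<in> borel_measurable borel" "\<And>z. z \<notin> unit_square \<Longrightarrow> g z = 0"
  shows "(LINT z|lebesgue_on unit_square. g z) = (LINT z|lborel. g z)"
    "integrable lborel g \<Longrightarrow> integrable (lebesgue_on unit_square) g"
proof -
  have g: "(\<lambda>z. indicator unit_square z * g z) = g"
    using assms(2) by (auto simp: indicator_def fun_eq_iff)
  have S: "unit_square \<in> sets lebesgue" by simp
  show "(LINT z|lebesgue_on unit_square. g z) = (LINT z|lborel. g z)"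
    using assms(1) by (simp add: integral_lebesgue_on_indicator[OF S] g integral_completion)
  show "integrable lborel g \<Longrightarrow> integrable (lebesgue_on unit_square) g"
    using assms(1) by (simp add: integrable_lebesgue_on_indicator[OF S] g integrable_completion)
qed

lemma square_fun_locally_integrable:
  assumes "square_fun u" shows "locally_integrable unit_square u"
  unfolding locally_integrable_def set_integrable_def
proof (intro allI impI)
  fix K :: "point set" assume K: "compact K \<and> K \<subseteq> unit_square"
  have "integrable lebesgue u"
    using square_funD[OF assms] by (simp add: integrable_completion)
  then show "integrable lebesgue (\<lambda>z. indicator K z *\<^sub>R u z)"
    using K by (intro integrable_mult_indicator fmeasurableD[OF lmeasurable_compact]) auto
qed

lemma integrable_bounded_mult:
  fixes g k :: "'a \<Rightarrow> real"
  assumes "integrable M g" "k \<in> borel_measurable M" "\<And>x. \<bar>k x\<bar> \<le> C"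
  shows "integrable M (\<lambda>x. k x * g x)"
proof (rule Bochner_Integration.integrable_bound[of _ "\<lambda>x. C * \<bar>g x\<bar>"])
  show "AE x in M. norm (k x * g x) \<le> norm (C * \<bar>g x\<bar>)"
    using assms(3) by (intro AE_I2) (auto simp: abs_mult intro!: mult_right_mono order_trans[OF assms(3)])
qed (use assms in auto)

text \<open>The mean value is the one weighted with \<open>theta\<close>; by construction the antiderivative of
  \<open>B 0 - (\<integral> B 0) theta\<close> has compact support.\<close>

lemma ex_antiderivative:
  assumes B: "derivs B" and z': "\<forall>x. x \<notin> {a..b} \<longrightarrow> B 0 x = 0" and ab: "0 < a" "a \<le> b" "b < 1"
  shows "\<exists>A a' b'. derivs A \<and> 0 < a' \<and> b' < 1 \<and> a' \<le> b' \<and> (\<forall>x. x \<notin> {a'..b'} \<longrightarrow> A 0 x = 0) \<and>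
    (\<forall>x. A 1 x = B 0 x - (LINT t|lborel. B 0 t) * theta x) \<and>
    (\<forall>s\<in>{0..1}. A 0 s = (LINT t|lborel. indicator {..s} t * B 0 t) - (LINT t|lborel. B 0 t) * Theta s)"
proof -
  note z = z'[rule_format]
  define I where "I = (LINT t|lborel. B 0 t)"
  obtain T where T: "derivs T" "T 0 = theta" by (rule derivs_theta)
  define f where "f i x = B i x - I * T i x" for i x
  have df: "derivs f"
    unfolding derivs_def f_def by (intro allI DERIV_diff DERIV_cmult derivsD B T)
  have f0: "f 0 x = B 0 x - I * theta x" for x by (simp only: f_def T(2))
  have Bi: "integrable lborel (B 0)"
    by (rule integrable_lborel_compact_support[of "{a..b}"]) (use z derivs_continuous[OF B] in auto)
  have fi: "integrable lborel (f 0)" unfolding f0[abs_def] using Bi theta_integrable by simp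
  have f_int: "(LINT t|lborel. f 0 t) = 0"
    unfolding f0 using Bi theta_integrable by (simp add: I_def theta_integral)
  \<comment> \<open>The interval must contain the support of \<open>theta\<close> as well; it still
    lies inside the open unit interval.\<close>
  define a' b' where "a' = min a (1 / 4)" and "b' = max b (3 / 4)"
  have fz: "f 0 x = 0" if "x \<notin> {a'..b'}" for x
  proof -
    have "x \<notin> {a..b}" "x \<notin> {1 / 4..3 / 4}" using that by (auto simp: a'_def b'_def)
    then have "B 0 x = 0" "theta x = 0" using z theta_zero by blast+
    then show ?thesis by (simp add: f0)
  qed
  have a'b': "0 < a'" "b' < 1" "a' \<le> b'" using ab by (auto simp: a'_def b'_def)
  obtain F where F: "\<And>x. (F has_vector_derivative f 0 x) (at x)"
    using einterval_antiderivative[of "-\<infinity>" \<infinity> "f 0"] derivs_isCont[OF df] by auto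
  then have F': "(F has_real_derivative f 0 x) (at x)" for x
    by (simp add: has_real_derivative_iff_has_vector_derivative)
  \<comment> \<open>The point 0 lies to the left of the support of \<open>f 0\<close>, so
    subtracting \<open>F 0\<close> makes \<open>A 0\<close> the integral of \<open>f 0\<close> from
    the left.\<close>
  define A where "A i x = (case i of 0 \<Rightarrow> F x - F 0 | Suc i \<Rightarrow> f i x)" for i x
  have A0: "A 0 x = F x - F 0" and A1: "A (Suc i) x = f i x" for i x by (simp_all add: A_def)
  have "derivs A"
    unfolding derivs_def
  proof (intro allI)
    fix i x
    show "(A i has_real_derivative A (Suc i) x) (at x)"
    proof (cases i)
      case 0
      have "((\<lambda>x. F x - F 0) has_real_derivative f 0 x - 0) (at x)"
        by (intro DERIV_diff F' DERIV_const)
      then show ?thesis using 0 by (simp add: A0[abs_def] A1)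
    next
      case (Suc k)
      then show ?thesis using derivsD[OF df, of k x] by (simp add: A1[abs_def])
    qed
  qed
  have ind: "(LINT t|lborel. f 0 t * indicator {0..s} t) = A 0 s" if "0 \<le> s" for s
    unfolding A0 using that F' derivs_isCont[OF df] by (intro integral_FTC_Icc_real) auto
  have ind': "f 0 t * indicator {0..s} t = indicator {..s} t * f 0 t" if "0 \<le> s" for s t
    using fz[of t] a'b' that by (auto simp: indicator_def)
  have As: "A 0 s = (LINT t|lborel. indicator {..s} t * f 0 t)" if "0 \<le> s" for s
    using ind[OF that] ind'[OF that] by simp
  have "A 0 x = 0" if x: "x \<notin> {a'..b'}" for x
  proof (cases "0 \<le> x")
    case True
    show ?thesis
    proof (cases "x < a'")
      case True
      then have Z: "indicator {..x} t * f 0 t = 0" for t using fz[of t] by (auto simp: indicator_def)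
      show ?thesis using As[OF \<open>0 \<le> x\<close>] by (simp only: Z Bochner_Integration.integral_zero)
    next
      case False
      then have "b' < x" using x by auto
      then have Z: "indicator {..x} t * f 0 t = f 0 t" for t using fz[of t] by (auto simp: indicator_def)
      show ?thesis using As[OF \<open>0 \<le> x\<close>] f_int by (simp only: Z)
    qed
  next
    case False
    have "F x = F 0"
    proof (rule DERIV_isconst_end[of x 0 F, symmetric])
      show "continuous_on {x..0} F" by (intro continuous_at_imp_continuous_on ballI DERIV_isCont[OF F'])
      show "(F has_real_derivative 0) (at y)" if "x < y" "y < 0" for y
        using F'[of y] fz[of y] that a'b' by auto
    qed (use False in auto)
    then show ?thesis by (simp add: A0)
  qed
  moreover have "A 1 x = B 0 x - (LINT t|lborel. B 0 t) * theta x" for x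
    using A1[of 0 x] by (simp add: f0 I_def)
  moreover have "A 0 s = (LINT t|lborel. indicator {..s} t * B 0 t) - (LINT t|lborel. B 0 t) * Theta s" if "s \<in> {0..1}" for s
  proof -
    have "A 0 s = (LINT t|lborel. indicator {..s} t * B 0 t - I * (indicator {..s} t * theta t))"
      using As[of s] that by (simp add: f0 algebra_simps)
    also have "\<dots> = (LINT t|lborel. indicator {..s} t * B 0 t) - (LINT t|lborel. I * (indicator {..s} t * theta t))"
      using integrable_mult_indicator[OF _ Bi, of "{..s}"] integrable_mult_indicator[OF _ theta_integrable, of "{..s}"]
      by (intro Bochner_Integration.integral_diff) auto
    finally show ?thesis by (simp add: I_def Theta_def)
  qed
  ultimately show ?thesis
    using \<open>derivs A\<close> a'b' by (intro exI[of _ A] exI[of _ a'] exI[of _ b'] conjI allI impI ballI)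
qed

lemma kern_section:
  assumes u: "square_fun u"
  shows "(\<lambda>z. LINT s|lborel. kern (fst z) s * u (s, snd z)) \<in> borel_measurable borel"
proof -
  have [measurable]: "u \<in> borel_measurable (borel \<Otimes>\<^sub>M borel)"
    using square_funD(1)[OF u] by (simp add: borel_prod)
  note [measurable] = Theta_measurable
  have "(\<lambda>(z, s). kern (fst z) s * u (s, snd z)) \<in> borel_measurable ((borel \<Otimes>\<^sub>M borel) \<Otimes>\<^sub>M lborel)"
    unfolding kern_def by measurable
  then have "(\<lambda>z. LINT s|lborel. kern (fst z) s * u (s, snd z)) \<in> borel_measurable (borel \<Otimes>\<^sub>M borel)"
    by (rule lborel.borel_measurable_lebesgue_integral)
  then show ?thesis by (simp add: borel_prod)
qed

lemma weighted_section:
  assumes u: "square_fun u" and k[measurable]: "k \<in> borel_measurable borel"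
  shows "(\<lambda>y. LINT s|lborel. k s * u (s, y)) \<in> borel_measurable borel"
proof -
  have [measurable]: "u \<in> borel_measurable (borel \<Otimes>\<^sub>M borel)"
    using square_funD(1)[OF u] by (simp add: borel_prod)
  have "(\<lambda>(y, s). k s * u (s, y)) \<in> borel_measurable (borel \<Otimes>\<^sub>M lborel)" by measurable
  then show ?thesis
    by (rule lborel.borel_measurable_lebesgue_integral)
qed

lemma section_zero: "square_fun u \<Longrightarrow> y \<notin> {0<..<1} \<Longrightarrow> u (s, y) = 0"
  "square_fun u \<Longrightarrow> s \<notin> {0<..<1} \<Longrightarrow> u (s, y) = 0"
  by (rule square_funD(3); force simp: mem_unit_square)+

lemma fubini_point_integrable:
  fixes g :: "point \<Rightarrow> real"
  assumes "g \<in> borel_measurable borel" "integrable lborel (\<lambda>x. LINT y|lborel. \<bar>g (x, y)\<bar>)"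
    "AE x in lborel. integrable lborel (\<lambda>y. g (x, y))"
  shows "integrable lborel g"
proof -
  have "integrable (lborel \<Otimes>\<^sub>M lborel) g"
    by (rule lborel_pair.Fubini_integrable) (use assms in \<open>simp_all add: lborel_prod\<close>)
  then show ?thesis by (simp add: lborel_prod)
qed

lemma integrable_tensor:
  fixes f g :: "real \<Rightarrow> real"
  assumes "integrable lborel f" "integrable lborel g"
  shows "integrable lborel (\<lambda>z::point. f (fst z) * g (snd z))"
proof (rule fubini_point_integrable)
  show "(\<lambda>z::point. f (fst z) * g (snd z)) \<in> borel_measurable borel"
    using assms borel_measurable_integrable by (intro borel_measurable_tensor) auto
  have "(LINT y|lborel. \<bar>f (fst (x, y)) * g (snd (x, y))\<bar>) = \<bar>f x\<bar> * (LINT y|lborel. \<bar>g y\<bar>)" for x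
    by (simp add: abs_mult)
  then show "integrable lborel (\<lambda>x. LINT y|lborel. \<bar>f (fst (x, y)) * g (snd (x, y))\<bar>)"
    using assms by simp
  show "AE x in lborel. integrable lborel (\<lambda>y. f (fst (x, y)) * g (snd (x, y)))"
    using assms by simp
qed

section \<open>The averaged Taylor formula and its iteration\<close>

text \<open>Let \<open>H\<close> be the defect of the formula, tested against
  \<open>p x q y\<close>, and let \<open>A 0\<close> be the antiderivative of
  \<open>p - (\<integral> p) theta\<close>. The terms in \<open>u\<close> combine to the integral of
  \<open>u\<close> against \<open>A 1 x q y\<close>, and subtracting the kernel term adds the
  integral of \<open>w\<close> against \<open>A 0 x q y\<close>. The two cancel, since
  \<open>w\<close> is the weak derivative of \<open>u\<close> and \<open>A 0 x q y\<close> is a test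
  function.\<close>

lemma avg_formula_x:
  assumes u: "square_fun u" and w: "square_fun w" and d: "has_weak_deriv unit_square (1, 0) u w"
  shows "AE z in lborel. z \<in> unit_square \<longrightarrow>
    u z = (LINT s|lborel. theta s * u (s, snd z)) + (LINT s|lborel. kern (fst z) s * w (s, snd z))"
proof -
  define Av where "Av y = (LINT s|lborel. theta s * u (s, y))" for y
  define Kw where "Kw z = (LINT s|lborel. kern (fst z) s * w (s, snd z))" for z :: point
  define N where "N y = (LINT s|lborel. \<bar>w (s, y)\<bar>)" for y
  note um = square_funD(1)[OF u] and ui = square_funD(2)[OF u] and wm = square_funD(1)[OF w] and wi = square_funD(2)[OF w]
  have th2: "(\<lambda>z::point. theta (fst z)) \<in> borel_measurable lborel"
    using measurable_compose[OF borel_measurable_fst_point theta_measurable] by simp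
  have "integrable lborel (\<lambda>z. theta (fst z) * u z)"
    using theta_bounds by (intro integrable_bounded_mult[OF ui th2, of theta_bound]) auto
  from fubini_point(4)[OF this] have Avi: "integrable lborel Av"
    unfolding Av_def[abs_def] by simp
  have Avm: "Av \<in> borel_measurable borel"
    unfolding Av_def[abs_def] by (rule weighted_section[OF u theta_measurable])
  have Kwm: "Kw \<in> borel_measurable borel"
    unfolding Kw_def[abs_def] by (rule kern_section[OF w])
  have "integrable lborel (\<lambda>z. \<bar>w z\<bar>)" using wi by simp
  from fubini_point(4)[OF this] have Ni: "integrable lborel N"
    unfolding N_def[abs_def] by simp
  have Kwb: "\<bar>Kw (x, y)\<bar> \<le> N y" if y: "integrable lborel (\<lambda>s. w (s, y))" for x y
  proof -
    have i: "integrable lborel (\<lambda>s. kern x s * w (s, y))"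
      by (rule integrable_bounded_mult[OF y _ kern_bound]) (simp add: kern_measurable)
    have "\<bar>Kw (x, y)\<bar> \<le> (LINT s|lborel. \<bar>kern x s * w (s, y)\<bar>)"
      unfolding Kw_def using integral_abs_bound[of lborel "\<lambda>s. kern x s * w (s, y)"] by simp
    also have "\<dots> \<le> N y"
      unfolding N_def using kern_bound[of x]
      by (intro integral_mono integrable_abs i y) (simp add: abs_mult mult_left_le_one_le)
    finally show ?thesis .
  qed
  \<comment> \<open>\<open>Kw\<close> is in general not integrable on the plane, since the kernel
    need not vanish when \<open>fst z\<close> leaves the unit interval; on the square the row
    integrals \<open>N\<close> dominate it.\<close>
  have KwS: "integrable lborel (\<lambda>z. indicator unit_square z * Kw z)"
  proof (rule Bochner_Integration.integrable_bound)
    show "integrable lborel (\<lambda>z::point. indicator {0..1} (fst z) * N (snd z))"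
      by (rule integrable_tensor[OF _ Ni]) simp
    show "(\<lambda>z. indicator unit_square z * Kw z) \<in> borel_measurable lborel"
      using Kwm by (intro borel_measurable_times borel_measurable_indicator) auto
    show "AE z in lborel. norm (indicator unit_square z * Kw z) \<le> norm (indicator {0..1} (fst z) * N (snd z))"
      using AE_lborel_snd[OF fubini_point(2)[OF wi]]
    proof eventually_elim
      case (elim z)
      have "\<bar>Kw z\<bar> \<le> N (snd z)" using Kwb[OF elim, of "fst z"] by simp
      then show ?case by (auto simp: indicator_def mem_unit_square abs_mult)
    qed
  qed
  define H where "H z = indicator unit_square z * (u z - Av (snd z) - Kw z)" for z
  have Hm: "H \<in> borel_measurable borel"
    unfolding H_def[abs_def] using measurable_compose[OF borel_measurable_snd_point Avm] um Kwm
    by (intro borel_measurable_times borel_measurable_diff borel_measurable_indicator) auto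
  have AvS: "integrable lborel (\<lambda>z. indicator unit_square z * Av (snd z))"
  proof -
    have "integrable lborel (\<lambda>z::point. indicator {0<..<1} (fst z) * (indicator {0<..<1} (snd z) * Av (snd z)))"
      by (rule integrable_tensor[of "indicator {0<..<1}" "\<lambda>y. indicator {0<..<1} y * Av y"])
        (use Avi integrable_mult_indicator[of "{0<..<1}" lborel Av] in auto)
    moreover have "indicator {0<..<1} (fst z) * (indicator {0<..<1} (snd z) * Av (snd z)) = indicator unit_square z * Av (snd z)" for z
      by (auto simp: indicator_def mem_unit_square)
    ultimately show ?thesis by simp
  qed
  have uS: "indicator unit_square z * u z = u z" for z
    using square_funD(3)[OF u, of z] by (auto simp: indicator_def)
  have Hi: "integrable lborel H"
    unfolding H_def[abs_def] right_diff_distrib uS using ui AvS KwS by simp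
  have Hsq: "square_fun H"
    unfolding square_fun_def using Hm Hi by (simp add: H_def)
  have orth: "orthogonal_to_tensors unit_square H"
    unfolding orthogonal_to_tensors_def
  proof (intro allI impI)
    fix B C :: "nat \<Rightarrow> real \<Rightarrow> real" and a b c d :: real
    assume B: "derivs B" and C: "derivs C" and sub: "cbox (a, c) (b, d) \<subseteq> unit_square"
      and Bz: "\<forall>x. x \<notin> {a..b} \<longrightarrow> B 0 x = 0" and Cz: "\<forall>y. y \<notin> {c..d} \<longrightarrow> C 0 y = 0"
    define p q where "p = B 0" and "q = C 0"
    show "(LINT z|lebesgue_on unit_square. H z * (B 0 (fst z) * C 0 (snd z))) = 0"
    \<comment> \<open>If one of the intervals is empty, the corresponding factor vanishes
      identically; otherwise the corners of the rectangle lie in the open square.\<close>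
    proof (cases "a \<le> b \<and> c \<le> d")
      case False
      then have Z: "B 0 (fst z) * C 0 (snd z) = 0" for z :: point
        using Bz Cz by auto
      show ?thesis by (simp only: Z mult_zero_right Bochner_Integration.integral_zero)
    next
      case True
      then have "(a, c) \<in> unit_square" "(b, d) \<in> unit_square" using sub by (auto simp: cbox_Pair_eq)
      then have ab: "0 < a" "b < 1" "0 < c" "d < 1" by (auto simp: mem_unit_square)
      have Bz': "B 0 x = 0" if "x \<notin> {a..b}" for x using Bz that by blast
      have Cz': "C 0 x = 0" if "x \<notin> {c..d}" for x using Cz that by blast
      have ab': "a \<le> b" using True by simp
      define I where "I = (LINT t|lborel. B 0 t)"
      obtain A a' b' where A0: "derivs A" "0 < a'" "b' < 1" "a' \<le> b'" "\<forall>x. x \<notin> {a'..b'} \<longrightarrow> A 0 x = 0"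
        "\<forall>x. A 1 x = B 0 x - (LINT t|lborel. B 0 t) * theta x"
        "\<forall>s\<in>{0..1}. A 0 s = (LINT t|lborel. indicator {..s} t * B 0 t) - (LINT t|lborel. B 0 t) * Theta s"
        using ex_antiderivative[OF B Bz ab(1) ab' ab(2)] by (elim exE conjE) (rule that)
      note A = A0(1-4) A0(5)[rule_format] A0(6)[rule_format] A0(7)[rule_format]
      have cp: "continuous_on S p" and cq: "continuous_on S q" and cA: "continuous_on S (A 0)" for S
        unfolding p_def q_def by (intro derivs_continuous A B C)+
      have pm: "p \<in> borel_measurable borel" and qm: "q \<in> borel_measurable borel" and Am: "A 0 \<in> borel_measurable borel"
        unfolding p_def q_def by (intro derivs_measurable A B C)+
      have pi: "integrable lborel p" and qi: "integrable lborel q"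
        by (rule integrable_lborel_compact_support[of "{a..b}"], simp, rule cp, simp add: p_def Bz',
            rule integrable_lborel_compact_support[of "{c..d}"], simp, rule cq, simp add: q_def Cz')
      have bdd: "\<exists>M. \<forall>x. \<bar>f x\<bar> \<le> M" if "continuous_on UNIV f" "\<And>x. x \<notin> {l..r} \<Longrightarrow> f x = 0" for f :: "real \<Rightarrow> real" and l r
      proof -
        have "bounded (f ` {l..r})"
          using that by (intro compact_imp_bounded compact_continuous_image continuous_on_subset[OF that(1)]) auto
        then obtain M where "\<forall>y\<in>f ` {l..r}. norm y \<le> M" unfolding bounded_iff by blast
        then have M: "\<bar>f x\<bar> \<le> M" if "x \<in> {l..r}" for x using that by auto
        have "\<bar>f x\<bar> \<le> max M 0" for x using M[of x] that(2)[of x] by (cases "x \<in> {l..r}") auto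
        then show ?thesis by blast
      qed
      have "\<exists>M. \<forall>x. \<bar>p x\<bar> \<le> M" unfolding p_def by (rule bdd[OF cp[unfolded p_def] Bz'])
      then obtain Mp where Mp: "\<And>x. \<bar>p x\<bar> \<le> Mp" by blast
      have "\<exists>M. \<forall>x. \<bar>q x\<bar> \<le> M" unfolding q_def by (rule bdd[OF cq[unfolded q_def] Cz'])
      then obtain Mq where Mq: "\<And>x. \<bar>q x\<bar> \<le> Mq" by blast
      have "\<exists>M. \<forall>x. \<bar>A 0 x\<bar> \<le> M" by (rule bdd[OF cA A(5)])
      then obtain MA where MA: "\<And>x. \<bar>A 0 x\<bar> \<le> MA" by blast
      have bt: "integrable lborel (\<lambda>z. (f (fst z) * g (snd z)) * v z)"
        if "integrable lborel v" "f \<in> borel_measurable borel" "g \<in> borel_measurable borel"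
          "\<And>x. \<bar>f x\<bar> \<le> M1" "\<And>x. \<bar>g x\<bar> \<le> M2" for f g and v :: "point \<Rightarrow> real" and M1 M2
        using that borel_measurable_tensor[OF that(2,3)]
        by (intro integrable_bounded_mult[of _ _ _ "M1 * M2"])
          (auto simp: abs_mult intro!: mult_mono intro: order_trans[OF abs_ge_zero])
      have thb: "\<bar>theta x\<bar> \<le> theta_bound" for x using theta_bounds[of x] by simp
      note i1 = bt[OF ui pm qm Mp Mq] and i4 = bt[OF ui theta_measurable qm thb Mq] and i5 = bt[OF wi Am qm MA Mq]
      have S1: "p (fst z) * q (snd z) = 0" if "z \<notin> unit_square" for z
        using that Bz'[of "fst z"] Cz'[of "snd z"] ab by (force simp: p_def q_def mem_unit_square)
      have Aqi: "integrable lborel (\<lambda>y. Av y * q y)"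
        using integrable_bounded_mult[OF Avi _ Mq] qm by (simp add: mult.commute)
      have i2: "integrable lborel (\<lambda>z. p (fst z) * (Av (snd z) * q (snd z)))"
        by (rule integrable_tensor[OF pi Aqi])
      have i3: "integrable lborel (\<lambda>z. (p (fst z) * q (snd z)) * Kw z)"
      proof -
        have Z: "(p (fst z) * q (snd z)) * (indicator unit_square z * Kw z) = (p (fst z) * q (snd z)) * Kw z" for z
          using S1[of z] by (auto simp: indicator_def)
        show ?thesis using bt[OF KwS pm qm Mp Mq] by (simp only: Z)
      qed
      have "(LINT z|lebesgue_on unit_square. H z * (B 0 (fst z) * C 0 (snd z))) = (LINT z|lborel. H z * (p (fst z) * q (snd z)))"
        unfolding p_def[symmetric] q_def[symmetric] using S1
        by (intro integral_unit_square borel_measurable_times[OF Hm borel_measurable_tensor[OF pm qm]]) auto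
      also have "\<dots> = (LINT z|lborel. p (fst z) * q (snd z) * u z - p (fst z) * (Av (snd z) * q (snd z)) - (p (fst z) * q (snd z)) * Kw z)"
      proof (rule Bochner_Integration.integral_cong[OF refl])
        fix z :: point
        show "H z * (p (fst z) * q (snd z)) = p (fst z) * q (snd z) * u z - p (fst z) * (Av (snd z) * q (snd z)) - (p (fst z) * q (snd z)) * Kw z"
          using S1[of z] by (cases "z \<in> unit_square") (auto simp: H_def algebra_simps)
      qed
      also have "\<dots> = (LINT z|lborel. p (fst z) * q (snd z) * u z) - (LINT z|lborel. p (fst z) * (Av (snd z) * q (snd z)))
          - (LINT z|lborel. (p (fst z) * q (snd z)) * Kw z)"
        using i1 i2 i3 by simp
      also have "(LINT z|lborel. p (fst z) * (Av (snd z) * q (snd z))) = I * (LINT y|lborel. Av y * q y)"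
        unfolding fubini_point(6)[OF i2, symmetric] by (simp add: I_def p_def)
      also have "(LINT y|lborel. Av y * q y) = (LINT z|lborel. theta (fst z) * q (snd z) * u z)"
        unfolding fubini_point(6)[OF i4, symmetric] Av_def
        by (intro Bochner_Integration.integral_cong refl) (simp add: mult.assoc mult.left_commute[of _ "q _"] mult.commute[of _ "q _"])
      also have "(LINT z|lborel. (p (fst z) * q (snd z)) * Kw z) = - (LINT z|lborel. A 0 (fst z) * q (snd z) * w z)"
      proof -
        have inner: "(LINT x|lborel. p x * Kw (x, y)) = (LINT s|lborel. - (A 0 s * w (s, y)))"
          if y: "integrable lborel (\<lambda>s. w (s, y))" for y
        proof -
          let ?g = "\<lambda>z. kern (fst z) (snd z) * (p (fst z) * w (snd z, y))"
          have gi: "integrable lborel ?g"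
          proof (rule integrable_bounded_mult[OF integrable_tensor[OF pi y] _ kern_bound])
            show "(\<lambda>z. kern (fst z) (snd z)) \<in> borel_measurable lborel"
              using kern_measurable_pair by (simp add: borel_prod)
          qed
          \<comment> \<open>Integrating the kernel against \<open>p\<close> in its first variable
            produces the antiderivative with reversed sign.\<close>
          have kp: "(LINT x|lborel. kern x s * p x) = - A 0 s" if s: "s \<in> {0..1}" for s
          proof -
            have "(LINT x|lborel. kern x s * p x) = (LINT x|lborel. Theta s * p x - indicator {..s} x * p x)"
              by (intro Bochner_Integration.integral_cong refl) (auto simp: kern_def indicator_def algebra_simps)
            also have "\<dots> = Theta s * I - (LINT x|lborel. indicator {..s} x * p x)"
              using pi integrable_mult_indicator[OF _ pi, of "{..s}"]
              by (subst Bochner_Integration.integral_diff) (auto simp: I_def p_def)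
            finally show ?thesis using A(7)[OF s] by (simp add: I_def p_def)
          qed
          have "(LINT x|lborel. p x * Kw (x, y)) = (LINT x|lborel. LINT s|lborel. ?g (x, s))"
            unfolding Kw_def by (simp add: mult.left_commute)
          also have "\<dots> = (LINT s|lborel. LINT x|lborel. ?g (x, s))"
            by (simp only: fubini_point(5)[OF gi] fubini_point(6)[OF gi])
          also have "\<dots> = (LINT s|lborel. (LINT x|lborel. kern x s * p x) * w (s, y))"
            by (simp add: mult.assoc[symmetric])
          also have "\<dots> = (LINT s|lborel. - (A 0 s * w (s, y)))"
          proof (rule Bochner_Integration.integral_cong[OF refl])
            fix s
            show "(LINT x|lborel. kern x s * p x) * w (s, y) = - (A 0 s * w (s, y))"
              using kp[of s] section_zero(2)[OF w, of s y] by (cases "s \<in> {0..1}") auto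
          qed
          finally show ?thesis .
        qed
        have "(LINT z|lborel. (p (fst z) * q (snd z)) * Kw z) = (LINT y|lborel. LINT x|lborel. p x * q y * Kw (x, y))"
          using fubini_point(6)[OF i3] by simp
        also have "\<dots> = (LINT y|lborel. q y * (LINT x|lborel. p x * Kw (x, y)))"
          by (simp add: mult.assoc mult.left_commute[of _ "q _"])
        also have "\<dots> = (LINT y|lborel. LINT s|lborel. - (A 0 s * q y * w (s, y)))"
        proof (rule integral_cong_AE)
          have "(\<lambda>y. LINT x|lborel. p x * q y * Kw (x, y)) \<in> borel_measurable lborel"
            using borel_measurable_integrable[OF fubini_point(4)[OF i3]] by simp
          then show "(\<lambda>y. q y * (LINT x|lborel. p x * Kw (x, y))) \<in> borel_measurable lborel"
            by (simp add: mult.assoc mult.left_commute[of _ "q _"])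
          show "(\<lambda>y. LINT s|lborel. - (A 0 s * q y * w (s, y))) \<in> borel_measurable lborel"
            using borel_measurable_integrable[OF fubini_point(4)[OF i5]] by simp
          show "AE y in lborel. q y * (LINT x|lborel. p x * Kw (x, y)) = (LINT s|lborel. - (A 0 s * q y * w (s, y)))"
            using fubini_point(2)[OF wi]
          proof eventually_elim
            case (elim y)
            show ?case unfolding inner[OF elim] by (simp add: mult.assoc mult.left_commute[of _ "q _"])
          qed
        qed
        also have "\<dots> = - (LINT z|lborel. A 0 (fst z) * q (snd z) * w z)"
          using fubini_point(6)[OF i5] by simp
        finally show ?thesis .
      qed
      also have "(LINT z|lborel. p (fst z) * q (snd z) * u z) - I * (LINT z|lborel. theta (fst z) * q (snd z) * u z)
          = (LINT z|lborel. u z * (A 1 (fst z) * C 0 (snd z)))"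
      proof -
        have "(LINT z|lborel. u z * (A 1 (fst z) * C 0 (snd z)))
            = (LINT z|lborel. p (fst z) * q (snd z) * u z - I * (theta (fst z) * q (snd z) * u z))"
          by (intro Bochner_Integration.integral_cong refl) (simp add: A(6)[unfolded One_nat_def] p_def q_def I_def algebra_simps)
        then show ?thesis using i1 i4 by simp
      qed
      also have "\<dots> = (LINT z|lebesgue_on unit_square. u z * (A 1 (fst z) * C 0 (snd z)))"
      proof (rule integral_unit_square(1)[symmetric])
        show "(\<lambda>z. u z * (A 1 (fst z) * C 0 (snd z))) \<in> borel_measurable borel"
          by (intro borel_measurable_times[OF um borel_measurable_tensor] derivs_measurable A C)
      qed (simp add: square_funD(3)[OF u])
      \<comment> \<open>Here the hypothesis on the weak derivative enters; the product is an
        admissible test function because \<open>A 0\<close> has compact support in the open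
        interval.\<close>
      also have "\<dots> = - (LINT z|lebesgue_on unit_square. w z * (A 0 (fst z) * C 0 (snd z)))"
      proof -
        have "cbox (a', c) (b', d) \<subseteq> unit_square"
        proof
          fix z :: point assume "z \<in> cbox (a', c) (b', d)"
          then show "z \<in> unit_square" using ab A(2,3) by (cases z) (auto simp: cbox_Pair_eq mem_unit_square)
        qed
        then have "test_fun unit_square (\<lambda>i j z. A i (fst z) * C j (snd z))"
          by (rule test_fun_tensor[OF A(1) C]) (simp_all add: A(5) Cz')
        from d[unfolded has_weak_deriv_iff, THEN conjunct2, THEN conjunct2, rule_format, OF this]
        show ?thesis by simp
      qed
      also have "(LINT z|lebesgue_on unit_square. w z * (A 0 (fst z) * C 0 (snd z))) = (LINT z|lborel. A 0 (fst z) * q (snd z) * w z)"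
      proof -
        have "(LINT z|lebesgue_on unit_square. w z * (A 0 (fst z) * C 0 (snd z))) = (LINT z|lborel. w z * (A 0 (fst z) * C 0 (snd z)))"
        proof (rule integral_unit_square(1))
          show "(\<lambda>z. w z * (A 0 (fst z) * C 0 (snd z))) \<in> borel_measurable borel"
            by (intro borel_measurable_times[OF wm borel_measurable_tensor] derivs_measurable A C)
        qed (simp add: square_funD(3)[OF w])
        then show ?thesis by (simp add: q_def mult_ac)
      qed
      finally show ?thesis by simp
    qed
  qed
  have "AE z in lebesgue_on unit_square. H z = 0"
    by (rule AE_zero_if_orthogonal_to_tensors[OF open_box square_fun_locally_integrable[OF Hsq] orth])
  then have "AE z in lborel. z \<in> unit_square \<longrightarrow> H z = 0"
    by (subst (asm) AE_lebesgue_on_iff) (auto simp: AE_completion_iff)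
  then show ?thesis
    by eventually_elim (auto simp: H_def Av_def Kw_def)
qed

lemma vimage_swap_unit_square: "aff 0 (0, 1) (1, 0) -` unit_square = unit_square"
proof (rule set_eqI)
  fix z show "z \<in> aff 0 (0, 1) (1, 0) -` unit_square \<longleftrightarrow> z \<in> unit_square"
    by (simp add: mem_unit_square fst_aff snd_aff) auto
qed

lemma aff_swap: "aff 0 (0, 1) (1, 0) z = (snd z, fst z)"
  by (simp add: aff_def)

lemma square_fun_swap:
  assumes "square_fun u"
  shows "square_fun (\<lambda>z. u (snd z, fst z))"
proof -
  have m: "(\<lambda>z. u (snd z, fst z)) \<in> borel_measurable borel"
    using measurable_compose[OF aff_borel[of 0 "(0, 1)" "(1, 0)"] square_funD(1)[OF assms]]
    by (simp add: aff_swap)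
  have "integrable lebesgue u" using square_funD(1,2)[OF assms] by (simp add: integrable_completion)
  from integrable_lebesgue_aff(1)[OF _ this, of "(0, 1)" "(1, 0)" 0]
  have "integrable lebesgue (\<lambda>z. u (snd z, fst z))" by (simp add: aff_swap det2_def)
  then have "integrable lborel (\<lambda>z. u (snd z, fst z))" using m by (simp add: integrable_completion)
  then show ?thesis
    unfolding square_fun_def
  proof (intro conjI allI impI m)
    fix z :: point assume "z \<notin> unit_square"
    then have "(snd z, fst z) \<notin> unit_square" by (auto simp: mem_unit_square)
    then show "u (snd z, fst z) = 0" by (rule square_funD(3)[OF assms])
  qed
qed

text \<open>Exchange of the coordinates in the formula for \<open>x\<close>. Both partials are among
  the assumptions because the transformation rule for first derivatives combines them.\<close>

lemma avg_formula_y: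
  assumes u: "square_fun u" and w: "square_fun w"
    and d: "has_weak_deriv unit_square (1, 0) u w0" "has_weak_deriv unit_square (0, 1) u w"
  shows "AE z in lborel. z \<in> unit_square \<longrightarrow>
    u z = (LINT t|lborel. theta t * u (fst z, t)) + (LINT t|lborel. kern (snd z) t * w (fst z, t))"
proof -
  have "has_weak_deriv unit_square (1, 0) (\<lambda>z. u (snd z, fst z)) (\<lambda>z. w (snd z, fst z))"
    using has_weak_deriv_aff1(1)[OF _ open_box d, of "(0, 1)" "(1, 0)" 0]
    by (simp add: vimage_swap_unit_square aff_swap det2_def)
  from AE_lborel_swap[OF avg_formula_x[OF square_fun_swap[OF u] square_fun_swap[OF w] this]]
  show ?thesis by eventually_elim (simp add: mem_unit_square)
qed

lemma integrable_bounded_tensor: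
  fixes v :: "point \<Rightarrow> real"
  assumes "integrable lborel v" "f \<in> borel_measurable borel" "g \<in> borel_measurable borel"
    "\<And>x. \<bar>f x\<bar> \<le> M1" "\<And>x. \<bar>g x\<bar> \<le> M2"
  shows "integrable lborel (\<lambda>z. (f (fst z) * g (snd z)) * v z)"
    "\<bar>LINT z|lborel. (f (fst z) * g (snd z)) * v z\<bar> \<le> M1 * M2 * (LINT z|lborel. \<bar>v z\<bar>)"
proof -
  have b: "\<bar>f x * g y\<bar> \<le> M1 * M2" for x y
    using assms(4)[of x] assms(5)[of y] by (auto simp: abs_mult intro!: mult_mono intro: order_trans[OF abs_ge_zero])
  show i: "integrable lborel (\<lambda>z. (f (fst z) * g (snd z)) * v z)"
    using borel_measurable_tensor[OF assms(2,3)] b by (intro integrable_bounded_mult[OF assms(1)]) auto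
  have "\<bar>LINT z|lborel. (f (fst z) * g (snd z)) * v z\<bar> \<le> (LINT z|lborel. \<bar>(f (fst z) * g (snd z)) * v z\<bar>)"
    by (rule integral_abs_bound)
  also have "\<dots> \<le> (LINT z|lborel. M1 * M2 * \<bar>v z\<bar>)"
    using assms(1) b by (intro integral_mono integrable_abs i) (auto simp: abs_mult intro!: mult_right_mono)
  finally show "\<bar>LINT z|lborel. (f (fst z) * g (snd z)) * v z\<bar> \<le> M1 * M2 * (LINT z|lborel. \<bar>v z\<bar>)" by simp
qed

lemma theta_abs_bound: "\<bar>theta x\<bar> \<le> theta_bound"
  using theta_bounds[of x] by simp

text \<open>The formula in \<open>y\<close>, integrated over a row with weight \<open>k\<close>,
  turns row integrals of \<open>u\<close> into integrals over the square. The weights are quantified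
  inside, so that one null set of rows serves all of them; later the weight depends on the
  point.\<close>

lemma weighted_section_formula:
  assumes u: "square_fun u" and w: "square_fun w"
    and d: "has_weak_deriv unit_square (1, 0) u w0" "has_weak_deriv unit_square (0, 1) u w"
  shows "AE y in lborel. y \<in> {0<..<1} \<longrightarrow> (\<forall>k C. k \<in> borel_measurable borel \<longrightarrow> (\<forall>s. \<bar>k s\<bar> \<le> C) \<longrightarrow>
    (LINT s|lborel. k s * u (s, y)) = (LINT z|lborel. (k (fst z) * theta (snd z)) * u z)
      + (LINT z|lborel. (k (fst z) * kern y (snd z)) * w z))"
  using AE_lborel_sections(2)[OF avg_formula_y[OF assms]]
proof eventually_elim
  case (elim y)
  show ?case
  proof (intro impI allI)
    fix k :: "real \<Rightarrow> real" and C :: real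
    assume y: "y \<in> {0<..<1}" and k: "k \<in> borel_measurable borel" and C': "\<forall>s. \<bar>k s\<bar> \<le> C"
    note C = C'[rule_format]
    note i1 = integrable_bounded_tensor(1)[OF square_funD(2)[OF u] k theta_measurable C theta_abs_bound]
    note i2 = integrable_bounded_tensor(1)[OF square_funD(2)[OF w] k kern_measurable[of y] C kern_bound]
    let ?R = "\<lambda>s. (LINT t|lborel. k s * theta t * u (s, t)) + (LINT t|lborel. k s * kern y t * w (s, t))"
    have "(LINT s|lborel. k s * u (s, y)) = (LINT s|lborel. ?R s)"
    proof (rule integral_cong_AE)
      show "(\<lambda>s. k s * u (s, y)) \<in> borel_measurable lborel"
        using k borel_measurable_section(2)[OF square_funD(1)[OF u]] by simp
      show "?R \<in> borel_measurable lborel"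
        using borel_measurable_integrable[OF fubini_point(3)[OF i1]] borel_measurable_integrable[OF fubini_point(3)[OF i2]]
        by simp
      show "AE s in lborel. k s * u (s, y) = ?R s"
        using elim
      proof eventually_elim
        case (elim s)
        show ?case
        proof (cases "s \<in> {0<..<1}")
          case True
          then have "(s, y) \<in> unit_square" using y by (auto simp: mem_unit_square)
          then have "u (s, y) = (LINT t|lborel. theta t * u (s, t)) + (LINT t|lborel. kern y t * w (s, t))"
            using elim by simp
          then show ?thesis by (simp add: mult.assoc distrib_left)
        next
          case False
          then show ?thesis by (simp add: section_zero(2)[OF u] section_zero(2)[OF w])
        qed
      qed
    qed
    also have "\<dots> = (LINT s|lborel. LINT t|lborel. k s * theta t * u (s, t)) + (LINT s|lborel. LINT t|lborel. k s * kern y t * w (s, t))"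
      using fubini_point(3)[OF i1] fubini_point(3)[OF i2] by simp
    finally show "(LINT s|lborel. k s * u (s, y)) = (LINT z|lborel. (k (fst z) * theta (snd z)) * u z)
      + (LINT z|lborel. (k (fst z) * kern y (snd z)) * w z)"
      using fubini_point(5)[OF i1] fubini_point(5)[OF i2] by simp
  qed
qed

section \<open>Poincare's inequality on the unit square\<close>

lemma emeasure_unit_square: "emeasure lebesgue unit_square = 1"
proof -
  have "emeasure lborel (box (0, 0) (1, 1) :: point set) = (\<Prod>b\<in>Basis. ((1, 1) - (0, 0) :: point) \<bullet> b)"
    by (rule emeasure_lborel_box) (auto simp: Basis_prod_def)
  also have "\<dots> = 1" by (auto simp: Basis_prod_def intro!: prod.neutral)
  finally show ?thesis by simp
qed

text \<open>\<open>f\<close> is constant along the rows of the square, so its norm is that of the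
  row integrals; each of these is controlled by the norm of \<open>w\<close> on the row, as rows
  have length 1. The factor 2 is that of \<open>integral_le_powr\<close>.\<close>

lemma Lp_section_norm:
  assumes p: "1 \<le> p" and w: "square_fun w" and wp: "w \<in> Lp_space p unit_square"
  defines "f \<equiv> \<lambda>z. indicator unit_square z * (LINT s|lborel. \<bar>w (s, snd z)\<bar>)"
  shows "f \<in> Lp_space p unit_square" "Lp_norm p unit_square f \<le> 2 * Lp_norm p unit_square w"
proof -
  define N where "N y = (LINT s|lborel. \<bar>w (s, y)\<bar>)" for y
  have f: "f z = indicator unit_square z * N (snd z)" for z by (simp add: f_def N_def)
  note wm = square_funD(1)[OF w] and wi = square_funD(2)[OF w]
  have Ni: "integrable lborel N"
    using fubini_point(4)[of "\<lambda>z. \<bar>w z\<bar>"] wi unfolding N_def[abs_def] by simp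
  have Nm: "N \<in> borel_measurable borel" using borel_measurable_integrable[OF Ni] by simp
  have N0: "0 \<le> N y" for y unfolding N_def by simp
  have fm: "f \<in> borel_measurable borel"
    unfolding f[abs_def] using measurable_compose[OF borel_measurable_snd_point Nm]
    by (intro borel_measurable_times borel_measurable_indicator) auto
  have fml: "f \<in> borel_measurable (lebesgue_on unit_square)"
    using fm by (intro measurable_restrict_space1 measurable_completion) simp
  have "f \<in> Lp_space p unit_square \<and> Lp_norm p unit_square f \<le> 2 * Lp_norm p unit_square w"
    using p
  proof (cases rule: exponent_cases)
    case infinity
    let ?L = "Lp_norm \<infinity> unit_square w"
    have "AE z in lborel. z \<in> unit_square \<longrightarrow> \<bar>w z\<bar> \<le> ?L"
      using Lp_infinity_AE_bound[OF wp[unfolded infinity]] by (simp add: AE_lebesgue_on_iff AE_completion_iff)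
    from AE_lborel_sections(2)[OF this] have "AE y in lborel. N y \<le> ?L"
      using fubini_point(2)[OF wi]
    proof eventually_elim
      case (elim y)
      have ae: "AE s in lborel. \<bar>w (s, y)\<bar> \<le> indicator {0..1} s * ?L"
        using elim(1)
      proof eventually_elim
        case (elim s)
        show ?case
        proof (cases "(s, y) \<in> unit_square")
          case True
          then show ?thesis using elim by (auto simp: mem_unit_square)
        next
          case False
          then show ?thesis using square_funD(3)[OF w False] by (simp add: Lp_norm_nonneg)
        qed
      qed
      have i: "integrable lborel (\<lambda>s. \<bar>w (s, y)\<bar>)" "integrable lborel (\<lambda>s. indicator {0..1::real} s * ?L)"
        using elim(2) by simp_all
      have "N y \<le> (LINT s|lborel. indicator {0..1::real} s * ?L)"
        unfolding N_def by (rule integral_mono_AE[OF i ae])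
      then show "N y \<le> ?L" by simp
    qed
    then have "AE z in (lborel :: point measure). N (snd z) \<le> ?L" by (rule AE_lborel_snd)
    then have "AE z in lborel. \<bar>f z\<bar> \<le> ?L"
      by eventually_elim (auto simp: f indicator_def N0 Lp_norm_nonneg)
    then have "AE z in lebesgue_on unit_square. \<bar>f z\<bar> \<le> 2 * ?L"
      using Lp_norm_nonneg[of \<infinity> unit_square w]
      by (simp add: AE_lebesgue_on_iff AE_completion_iff) (auto elim!: eventually_mono)
    then show ?thesis
      using Lp_infinityI[OF fml, of "2 * ?L"] Lp_norm_nonneg[of \<infinity> unit_square w] infinity by simp
  next
    case (real r)
    define g where "g z = \<bar>w z\<bar> powr r" for z
    have gm: "g \<in> borel_measurable borel" unfolding g_def[abs_def] using wm by measurable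
    have gz: "g z = 0" if "z \<notin> unit_square" for z using square_funD(3)[OF w that] by (simp add: g_def)
    have gl: "integrable (lebesgue_on unit_square) g"
      using wp real by (simp add: Lp_space_def g_def[abs_def])
    have gz': "indicator unit_square z * g z = g z" for z using gz[of z] by (auto simp: indicator_def)
    have gi: "integrable lborel g"
      using gl gm by (simp add: integrable_lebesgue_on_indicator gz' integrable_completion)
    define J where "J y = (LINT s|lborel. g (s, y))" for y
    have Ji: "integrable lborel J" unfolding J_def[abs_def] by (rule fubini_point(4)[OF gi])
    have NJ: "AE y in lborel. N y powr r \<le> 2 powr r * J y"
      using fubini_point(2)[OF gi]
    proof eventually_elim
      case (elim y)
      let ?M = "restrict_space lborel {0<..<1::real}"
      have e: "emeasure ?M (space ?M) \<le> 1" by (simp add: emeasure_restrict_space)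
      have m: "(\<lambda>s. w (s, y)) \<in> borel_measurable ?M"
        using borel_measurable_section(2)[OF wm] by (intro measurable_restrict_space1) simp
      have ind: "indicator {0<..<1} s * g (s, y) = g (s, y)" "indicator {0<..<1} s * \<bar>w (s, y)\<bar> = \<bar>w (s, y)\<bar>" for s
        using section_zero(2)[OF w, of s y] by (auto simp: indicator_def g_def)
      have i: "integrable ?M (\<lambda>s. \<bar>w (s, y)\<bar> powr r)"
        using elim by (subst integrable_restrict_space) (simp_all add: ind(1)[unfolded g_def] g_def)
      have "(LINT s|?M. \<bar>w (s, y)\<bar>) = N y" "(LINT s|?M. \<bar>w (s, y)\<bar> powr r) = J y"
        by (simp_all add: integral_restrict_space N_def J_def ind ind(1)[unfolded g_def] g_def)
      then show ?case using integral_le_powr(2)[OF e real(2) m i] by simp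
    qed
    have Nri: "integrable lborel (\<lambda>y. indicator {0<..<1} y * N y powr r)"
    proof (rule Bochner_Integration.integrable_bound)
      show "integrable lborel (\<lambda>y. 2 powr r * J y)" using Ji by simp
      show "(\<lambda>y. indicator {0<..<1} y * N y powr r) \<in> borel_measurable lborel" using Nm by measurable
      show "AE y in lborel. norm (indicator {0<..<1} y * N y powr r) \<le> norm (2 powr r * J y)"
        using NJ by eventually_elim (auto simp: indicator_def intro: order_trans[OF _ abs_ge_self])
    qed
    have fr: "\<bar>f z\<bar> powr r = indicator {0<..<1} (fst z) * (indicator {0<..<1} (snd z) * N (snd z) powr r)" for z
      using N0 by (auto simp: f indicator_def mem_unit_square)
    have one: "integrable lborel (indicator {0<..<1::real} :: real \<Rightarrow> real)" by simp
    note fi = integrable_tensor[OF one Nri, folded fr]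
    have frm: "(\<lambda>z. \<bar>f z\<bar> powr r) \<in> borel_measurable borel" using fm by measurable
    have frz: "\<bar>f z\<bar> powr r = 0" if "z \<notin> unit_square" for z using that by (simp add: f)
    have fL: "integrable (lebesgue_on unit_square) (\<lambda>z. \<bar>f z\<bar> powr r)"
      by (rule integral_unit_square(2)[OF frm frz fi])
    have "(LINT z|lebesgue_on unit_square. \<bar>f z\<bar> powr r) = (LINT z|lborel. \<bar>f z\<bar> powr r)"
      by (rule integral_unit_square(1)[OF frm frz])
    also have "\<dots> = (LINT y|lborel. indicator {0<..<1} y * N y powr r)"
      unfolding fr fubini_point(6)[OF integrable_tensor[OF one Nri], symmetric] by simp
    also have "\<dots> \<le> (LINT y|lborel. 2 powr r * J y)"
      using Nri Ji NJ
    proof (intro integral_mono_AE)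
      show "AE y in lborel. indicator {0<..<1} y * N y powr r \<le> 2 powr r * J y"
        using NJ
      proof eventually_elim
        case (elim y)
        have "0 \<le> 2 powr r * J y" by (rule order_trans[OF powr_ge_zero elim])
        then show ?case using elim by (simp add: indicator_def)
      qed
    qed auto
    also have "\<dots> = 2 powr r * (LINT z|lborel. g z)"
      unfolding J_def using fubini_point(6)[OF gi] by simp
    also have "(LINT z|lborel. g z) = Lp_norm p unit_square w powr r"
      using real integral_unit_square(1)[OF gm gz] by (simp add: Lp_norm_powr g_def)
    also have "2 powr r * Lp_norm p unit_square w powr r = (2 * Lp_norm p unit_square w) powr r"
      by (simp add: powr_mult Lp_norm_nonneg)
    finally have "Lp_norm p unit_square f \<le> 2 * Lp_norm p unit_square w"
      using real Lp_norm_nonneg[of p unit_square w] by (auto intro!: Lp_norm_real_leI)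
    then show ?thesis using fml fL real by (simp add: Lp_space_def)
  qed
  then show "f \<in> Lp_space p unit_square" "Lp_norm p unit_square f \<le> 2 * Lp_norm p unit_square w" by auto
qed

lemma L1_square_fun:
  assumes "square_fun u" "AE z in lebesgue_on unit_square. v z = u z" "v \<in> borel_measurable (lebesgue_on unit_square)"
  shows "(LINT z|lborel. \<bar>u z\<bar>) = (LINT z|lebesgue_on unit_square. \<bar>v z\<bar>)"
proof -
  have um: "u \<in> borel_measurable (lebesgue_on unit_square)"
    using square_funD(1)[OF assms(1)] by (intro measurable_restrict_space1 measurable_completion) simp
  have "(LINT z|lebesgue_on unit_square. \<bar>v z\<bar>) = (LINT z|lebesgue_on unit_square. \<bar>u z\<bar>)"
    using assms(2,3) um by (intro integral_cong_AE) (auto elim!: eventually_mono)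
  also have "\<dots> = (LINT z|lborel. \<bar>u z\<bar>)"
    using square_funD(1,3)[OF assms(1)] by (intro integral_unit_square(1)) auto
  finally show ?thesis by simp
qed

text \<open>The deviation from the mean splits into the deviation within a row, governed by the
  \<open>x\<close>-derivative on that row, and the deviation of the row mean, governed by the
  integral of the \<open>y\<close>-derivative over the square.\<close>

lemma poincare_unit_square:
  assumes p: "1 \<le> p" and v: "v \<in> Lp_space p unit_square" "vx \<in> Lp_space p unit_square" "vy \<in> Lp_space p unit_square"
    and d: "has_weak_deriv unit_square (1, 0) v vx" "has_weak_deriv unit_square (0, 1) v vy"
  shows "\<exists>c. (\<lambda>z. v z - c) \<in> Lp_space p unit_square \<and> Lp_norm p unit_square (\<lambda>z. v z - c)
    \<le> 4 * (1 + theta_bound) * (Lp_norm p unit_square vx + Lp_norm p unit_square vy)"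
proof -
  let ?S = unit_square
  have em: "emeasure lebesgue ?S \<le> 1" by (simp only: emeasure_unit_square)
  note int = L1_le_Lp[OF p open_box em]
  obtain u where u: "square_fun u" "AE z in lebesgue_on ?S. v z = u z"
    by (rule obtain_square_fun[OF int(1)[OF v(1)]])
  obtain wx where wx: "square_fun wx" "AE z in lebesgue_on ?S. vx z = wx z"
    by (rule obtain_square_fun[OF int(1)[OF v(2)]])
  obtain wy where wy: "square_fun wy" "AE z in lebesgue_on ?S. vy z = wy z"
    by (rule obtain_square_fun[OF int(1)[OF v(3)]])
  have d': "has_weak_deriv ?S (1, 0) u wx" "has_weak_deriv ?S (0, 1) u wy"
    by (rule has_weak_deriv_cong[OF open_box d(1) u(2) wx(2)], rule has_weak_deriv_cong[OF open_box d(2) u(2) wy(2)])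
  have wxp: "wx \<in> Lp_space p ?S" "Lp_norm p ?S wx = Lp_norm p ?S vx"
    by (rule Lp_cong[OF p open_box v(2) wx(2)])+
  \<comment> \<open>The mean with weight \<open>theta\<close> in both variables: this is the first
    term of the row formula for the weight \<open>theta\<close>.\<close>
  define c where "c = (LINT z|lborel. (theta (fst z) * theta (snd z)) * u z)"
  define D where "D = 2 * theta_bound * Lp_norm p ?S vy"
  define f where "f z = indicator ?S z * (LINT s|lborel. \<bar>wx (s, snd z)\<bar>)" for z
  have D0: "0 \<le> D" using theta_bound_pos by (simp add: D_def Lp_norm_nonneg)
  have fp: "f \<in> Lp_space p ?S" "Lp_norm p ?S f \<le> 2 * Lp_norm p ?S vx"
    unfolding f_def[abs_def] using Lp_section_norm[OF p wx(1) wxp(1)] wxp(2) by auto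
  have Pb: "\<bar>LINT z|lborel. (theta (fst z) * kern y (snd z)) * wy z\<bar> \<le> D" for y
  proof -
    have "\<bar>LINT z|lborel. (theta (fst z) * kern y (snd z)) * wy z\<bar> \<le> theta_bound * 1 * (LINT z|lborel. \<bar>wy z\<bar>)"
      by (rule integrable_bounded_tensor(2)[OF square_funD(2)[OF wy(1)] theta_measurable kern_measurable theta_abs_bound kern_bound])
    also have "\<dots> \<le> theta_bound * 1 * (2 * Lp_norm p ?S vy)"
      using theta_bound_pos int(2)[OF v(3)] L1_square_fun[OF wy Lp_space_measurable[OF v(3)]]
      by (intro mult_left_mono) auto
    finally show ?thesis by (simp add: D_def)
  qed
  have "AE z in lborel. z \<in> ?S \<longrightarrow> \<bar>u z - c\<bar> \<le> D + f z"
    using avg_formula_x[OF u(1) wx(1) d'(1)] AE_lborel_snd[OF weighted_section_formula[OF u(1) wy(1) d']]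
      AE_lborel_snd[OF fubini_point(2)[OF square_funD(2)[OF wx(1)]]]
  proof eventually_elim
    case (elim z)
    show ?case
    proof
      assume z: "z \<in> ?S"
      have "(LINT s|lborel. theta s * u (s, snd z)) = c + (LINT x|lborel. (theta (fst x) * kern (snd z) (snd x)) * wy x)"
        unfolding c_def
        by (rule elim(2)[rule_format, OF _ theta_measurable theta_abs_bound]) (use z in \<open>simp add: mem_unit_square\<close>)
      moreover have "\<bar>LINT s|lborel. kern (fst z) s * wx (s, snd z)\<bar> \<le> f z"
      proof -
        have i: "integrable lborel (\<lambda>s. kern (fst z) s * wx (s, snd z))"
          by (rule integrable_bounded_mult[OF elim(3) _ kern_bound]) (simp add: kern_measurable)
        have "\<bar>LINT s|lborel. kern (fst z) s * wx (s, snd z)\<bar> \<le> (LINT s|lborel. \<bar>kern (fst z) s * wx (s, snd z)\<bar>)"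
          by (rule integral_abs_bound)
        also have "\<dots> \<le> (LINT s|lborel. \<bar>wx (s, snd z)\<bar>)"
          using kern_bound[of "fst z"]
          by (intro integral_mono integrable_abs i elim(3)) (simp add: abs_mult mult_left_le_one_le)
        finally show ?thesis using z by (simp add: f_def)
      qed
      ultimately show "\<bar>u z - c\<bar> \<le> D + f z"
        using elim(1)[rule_format, OF z] Pb[of "snd z"] by linarith
    qed
  qed
  then have "AE z in lebesgue_on ?S. \<bar>u z - c\<bar> \<le> D + f z"
    by (simp add: AE_lebesgue_on_iff AE_completion_iff)
  with u(2) have le: "AE z in lebesgue_on ?S. \<bar>v z - c\<bar> \<le> 1 * \<bar>D + f z\<bar>"
    by eventually_elim auto
  have Dp: "(\<lambda>z. D) \<in> Lp_space p ?S" "Lp_norm p ?S (\<lambda>z. D) \<le> D"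
    using Lp_bounded[OF p open_box em, of "\<lambda>z. D" D] D0 by simp_all
  note g = Lp_add[OF p Dp(1) fp(1)]
  have m: "(\<lambda>z. v z - c) \<in> borel_measurable (lebesgue_on ?S)"
    using Lp_space_measurable[OF v(1)] by simp
  note * = Lp_mono[OF p g(1) m le]
  have "Lp_norm p ?S (\<lambda>z. v z - c) \<le> 2 * (D + 2 * Lp_norm p ?S vx)"
    using *(2) g(2) Dp(2) fp(2) by simp
  also have "\<dots> \<le> 4 * (1 + theta_bound) * (Lp_norm p ?S vx + Lp_norm p ?S vy)"
    using theta_bound_pos Lp_norm_nonneg[of p ?S vx] Lp_norm_nonneg[of p ?S vy]
    by (simp add: D_def algebra_simps)
  finally show ?thesis using *(1) by auto
qed

section \<open>Continuous representatives on the unit square\<close>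

text \<open>Dominated convergence: for a given \<open>z\<close> the kernel may fail to be continuous
  at \<open>z\<close> only for a null set of \<open>s\<close>.\<close>

lemma continuous_on_integral_kernel:
  fixes K :: "point \<Rightarrow> point \<Rightarrow> real"
  assumes f: "integrable lborel f" and m: "\<And>z. K z \<in> borel_measurable borel" and b: "\<And>z s. \<bar>K z s\<bar> \<le> C"
    and c: "\<And>z. AE s in lborel. isCont (\<lambda>z. K z s) z"
  shows "continuous_on UNIV (\<lambda>z. LINT s|lborel. K z s * f s)"
proof (intro continuous_at_imp_continuous_on ballI)
  fix z
  show "isCont (\<lambda>z. LINT s|lborel. K z s * f s) z"
    unfolding continuous_at_sequentially comp_def
  proof (intro allI impI)
    fix X assume X: "X \<longlonglongrightarrow> z"
    show "(\<lambda>n. LINT s|lborel. K (X n) s * f s) \<longlonglongrightarrow> (LINT s|lborel. K z s * f s)"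
    proof (rule integral_dominated_convergence[where w="\<lambda>s. C * \<bar>f s\<bar>"])
      show "AE s in lborel. (\<lambda>n. K (X n) s * f s) \<longlonglongrightarrow> K z s * f s"
        using c[of z]
      proof eventually_elim
        case (elim s)
        then have "(\<lambda>n. K (X n) s) \<longlonglongrightarrow> K z s" using X by (rule isCont_tendsto_compose)
        then show ?case by (intro tendsto_intros)
      qed
      show "AE s in lborel. norm (K (X n) s * f s) \<le> C * \<bar>f s\<bar>" for n
      proof (rule AE_I2)
        fix s show "norm (K (X n) s * f s) \<le> C * \<bar>f s\<bar>"
          using mult_right_mono[OF b[of "X n" s] abs_ge_zero[of "f s"]] by (simp add: abs_mult)
      qed
    qed (use f m borel_measurable_integrable[OF f] in auto)
  qed
qed

lemma isCont_kern: "x \<noteq> s \<Longrightarrow> isCont (\<lambda>x. kern x s) x"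
proof -
  assume x: "x \<noteq> s"
  have "isCont (\<lambda>x. if x \<le> s then 1 else 0 :: real) x"
  proof (cases "x < s")
    case True
    then have "\<forall>\<^sub>F y in nhds x. (if y \<le> s then 1 else 0 :: real) = 1"
      using eventually_nhds_in_open[of "{..<s}" x] by (auto elim!: eventually_mono)
    then show ?thesis by (subst isCont_cong) auto
  next
    case False
    then have "\<forall>\<^sub>F y in nhds x. (if y \<le> s then 1 else 0 :: real) = 0"
      using eventually_nhds_in_open[of "{s<..}" x] x by (auto elim!: eventually_mono)
    then show ?thesis by (subst isCont_cong) auto
  qed
  then show ?thesis unfolding kern_def by (intro continuous_intros)
qed

lemma AE_fst_snd_neq: "AE s in (lborel :: point measure). fst s \<noteq> x \<and> snd s \<noteq> y"
  using AE_lborel_fst[OF AE_lborel_singleton[of x]] AE_lborel_snd[OF AE_lborel_singleton[of y]]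
  by eventually_elim simp

text \<open>Inserting the row formulas for \<open>u\<close> and \<open>ux\<close> into the formula
  in \<open>x\<close> writes \<open>u\<close> as four integrals over the square, of
  \<open>u\<close>, \<open>uy\<close>, \<open>ux\<close> and \<open>uxy\<close> weighted by products
  of \<open>theta\<close> and \<open>kern\<close>. The weights are bounded and continuous off two
  lines, and they are defined on the whole plane, which gives continuity up to the boundary.\<close>

lemma continuous_representative_unit_square:
  assumes int: "integrable (lebesgue_on unit_square) v" "integrable (lebesgue_on unit_square) vx"
      "integrable (lebesgue_on unit_square) vy" "integrable (lebesgue_on unit_square) vxy"
    and d: "has_weak_deriv unit_square (1, 0) v vx" "has_weak_deriv unit_square (0, 1) v vy"
      "has_weak_deriv unit_square (1, 0) vx vxx" "has_weak_deriv unit_square (0, 1) vx vxy"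
  shows "\<exists>g. continuous_on UNIV g \<and> (AE z in lebesgue_on unit_square. v z = g z) \<and>
    (\<forall>z. \<bar>g z\<bar> \<le> (1 + theta_bound)\<^sup>2 * ((LINT z|lebesgue_on unit_square. \<bar>v z\<bar>) + (LINT z|lebesgue_on unit_square. \<bar>vx z\<bar>)
      + (LINT z|lebesgue_on unit_square. \<bar>vy z\<bar>) + (LINT z|lebesgue_on unit_square. \<bar>vxy z\<bar>)))"
proof -
  let ?S = unit_square
  obtain u where u: "square_fun u" "AE z in lebesgue_on ?S. v z = u z" by (rule obtain_square_fun[OF int(1)])
  obtain ux where ux: "square_fun ux" "AE z in lebesgue_on ?S. vx z = ux z" by (rule obtain_square_fun[OF int(2)])
  obtain uy where uy: "square_fun uy" "AE z in lebesgue_on ?S. vy z = uy z" by (rule obtain_square_fun[OF int(3)])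
  obtain uxy where uxy: "square_fun uxy" "AE z in lebesgue_on ?S. vxy z = uxy z" by (rule obtain_square_fun[OF int(4)])
  have d': "has_weak_deriv ?S (1, 0) u ux" "has_weak_deriv ?S (0, 1) u uy"
      "has_weak_deriv ?S (1, 0) ux vxx" "has_weak_deriv ?S (0, 1) ux uxy"
    by (rule has_weak_deriv_cong[OF open_box d(1) u(2) ux(2)], rule has_weak_deriv_cong[OF open_box d(2) u(2) uy(2)],
        rule has_weak_deriv_cong[OF open_box d(3) ux(2)], simp, rule has_weak_deriv_cong[OF open_box d(4) ux(2) uxy(2)])
  define T1 where "T1 z = (LINT s|lborel. (theta (fst s) * theta (snd s)) * u s)" for z :: point
  define T2 where "T2 z = (LINT s|lborel. (theta (fst s) * kern (snd z) (snd s)) * uy s)" for z :: point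
  define T3 where "T3 z = (LINT s|lborel. (kern (fst z) (fst s) * theta (snd s)) * ux s)" for z :: point
  define T4 where "T4 z = (LINT s|lborel. (kern (fst z) (fst s) * kern (snd z) (snd s)) * uxy s)" for z :: point
  define g where "g z = T1 z + T2 z + (T3 z + T4 z)" for z
  have "AE z in lborel. z \<in> ?S \<longrightarrow> u z = g z"
    using avg_formula_x[OF u(1) ux(1) d'(1)] AE_lborel_snd[OF weighted_section_formula[OF u(1) uy(1) d'(1,2)]]
      AE_lborel_snd[OF weighted_section_formula[OF ux(1) uxy(1) d'(3,4)]]
  proof eventually_elim
    case (elim z)
    show ?case
    proof
      assume z: "z \<in> ?S"
      then have y: "snd z \<in> {0<..<1}" by (simp add: mem_unit_square)
      have 1: "(LINT s|lborel. theta s * u (s, snd z)) = T1 z + T2 z"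
        unfolding T1_def T2_def by (rule elim(2)[rule_format, OF y theta_measurable theta_abs_bound])
      have 2: "(LINT s|lborel. kern (fst z) s * ux (s, snd z)) = T3 z + T4 z"
        unfolding T3_def T4_def by (rule elim(3)[rule_format, OF y kern_measurable kern_bound])
      show "u z = g z" using elim(1)[rule_format, OF z] unfolding 1 2 g_def .
    qed
  qed
  then have "AE z in lebesgue_on ?S. u z = g z"
    by (simp add: AE_lebesgue_on_iff AE_completion_iff)
  with u(2) have ae: "AE z in lebesgue_on ?S. v z = g z" by eventually_elim simp
  have k1: "(\<lambda>s::point. k (fst s) * l (snd s)) \<in> borel_measurable borel"
    if "k \<in> borel_measurable borel" "l \<in> borel_measurable borel" for k l :: "real \<Rightarrow> real"
    by (rule borel_measurable_tensor[OF that])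
  have tb: "0 < theta_bound" by (rule theta_bound_pos)
  have bb: "\<bar>a * b\<bar> \<le> A * B" if "\<bar>a\<bar> \<le> A" "\<bar>b\<bar> \<le> B" for a b A B :: real
    using that by (auto simp: abs_mult intro!: mult_mono intro: order_trans[OF abs_ge_zero])
  have cf: "isCont (\<lambda>z. kern (fst z) x) z" if "x \<noteq> fst z" for x and z :: point
    by (rule isCont_o2[OF _ isCont_kern]) (use that in \<open>auto intro!: continuous_intros\<close>)
  have cs: "isCont (\<lambda>z. kern (snd z) x) z" if "x \<noteq> snd z" for x and z :: point
    by (rule isCont_o2[OF _ isCont_kern]) (use that in \<open>auto intro!: continuous_intros\<close>)
  have c1: "continuous_on UNIV T1" unfolding T1_def[abs_def] by simp
  have c2: "continuous_on UNIV T2"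
    unfolding T2_def[abs_def]
  proof (rule continuous_on_integral_kernel[OF square_funD(2)[OF uy(1)] k1[OF theta_measurable kern_measurable] bb[OF theta_abs_bound kern_bound]])
    show "AE s in lborel. isCont (\<lambda>z. theta (fst s) * kern (snd z) (snd s)) z" for z :: point
      using AE_fst_snd_neq[of "fst z" "snd z"] by eventually_elim (intro continuous_intros cs; simp)
  qed
  have c3: "continuous_on UNIV T3"
    unfolding T3_def[abs_def]
  proof (rule continuous_on_integral_kernel[OF square_funD(2)[OF ux(1)] k1[OF kern_measurable theta_measurable] bb[OF kern_bound theta_abs_bound]])
    show "AE s in lborel. isCont (\<lambda>z. kern (fst z) (fst s) * theta (snd s)) z" for z :: point
      using AE_fst_snd_neq[of "fst z" "snd z"] by eventually_elim (intro continuous_intros cf; simp)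
  qed
  have c4: "continuous_on UNIV T4"
    unfolding T4_def[abs_def]
  proof (rule continuous_on_integral_kernel[OF square_funD(2)[OF uxy(1)] k1[OF kern_measurable kern_measurable] bb[OF kern_bound kern_bound]])
    show "AE s in lborel. isCont (\<lambda>z. kern (fst z) (fst s) * kern (snd z) (snd s)) z" for z :: point
      using AE_fst_snd_neq[of "fst z" "snd z"] by eventually_elim (intro continuous_intros cf cs; simp)
  qed
  have cg: "continuous_on UNIV g" unfolding g_def[abs_def] by (intro continuous_intros c1 c2 c3 c4)
  let ?I = "\<lambda>v. LINT z|lebesgue_on ?S. \<bar>v z\<bar>"
  note I = L1_square_fun[OF u borel_measurable_integrable[OF int(1)]] L1_square_fun[OF ux borel_measurable_integrable[OF int(2)]]
    L1_square_fun[OF uy borel_measurable_integrable[OF int(3)]] L1_square_fun[OF uxy borel_measurable_integrable[OF int(4)]]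
  have "\<bar>g z\<bar> \<le> (1 + theta_bound)\<^sup>2 * (?I v + ?I vx + ?I vy + ?I vxy)" for z
  proof -
    have "\<bar>T1 z\<bar> \<le> theta_bound * theta_bound * ?I v" "\<bar>T2 z\<bar> \<le> theta_bound * 1 * ?I vy"
      "\<bar>T3 z\<bar> \<le> 1 * theta_bound * ?I vx" "\<bar>T4 z\<bar> \<le> 1 * 1 * ?I vxy"
      unfolding T1_def T2_def T3_def T4_def I[symmetric]
      by (rule integrable_bounded_tensor(2) square_funD(2)[OF u(1)] square_funD(2)[OF ux(1)] square_funD(2)[OF uy(1)]
          square_funD(2)[OF uxy(1)] theta_measurable kern_measurable theta_abs_bound kern_bound)+
    moreover have "theta_bound * theta_bound * ?I v \<le> (1 + theta_bound)\<^sup>2 * ?I v" "theta_bound * 1 * ?I vy \<le> (1 + theta_bound)\<^sup>2 * ?I vy"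
      "1 * theta_bound * ?I vx \<le> (1 + theta_bound)\<^sup>2 * ?I vx" "1 * 1 * ?I vxy \<le> (1 + theta_bound)\<^sup>2 * ?I vxy"
      using tb by (auto intro!: mult_right_mono simp: power2_eq_square algebra_simps)
    ultimately show ?thesis by (simp add: g_def distrib_left)
  qed
  then show ?thesis using cg ae by blast
qed

subsection \<open>Classical derivatives\<close>

text \<open>The set of disagreement is open, and a nonempty open set is not null.\<close>

lemma AE_eq_imp_eq_on_open:
  fixes f g :: "point \<Rightarrow> real"
  assumes U: "open U" and c: "continuous_on U f" "continuous_on U g"
    and ae: "AE z in lebesgue. z \<in> U \<longrightarrow> f z = g z" and z: "z \<in> U"
  shows "f z = g z"
proof (rule ccontr)
  assume ne: "f z \<noteq> g z"
  let ?W = "U \<inter> (\<lambda>z. f z - g z) -` (- {0})"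
  have "open ?W"
    using U c by (intro continuous_open_preimage continuous_intros) auto
  moreover have "z \<in> ?W" using z ne by simp
  ultimately have "\<not> negligible ?W" using open_not_negligible by blast
  moreover obtain N where N: "N \<in> null_sets lebesgue" "{z. \<not> (z \<in> U \<longrightarrow> f z = g z)} \<subseteq> N"
    using ae by (auto simp: eventually_ae_filter)
  then have "?W \<subseteq> N" by auto
  ultimately show False
    using N(1) negligible_subset[of N ?W] by (simp add: negligible_iff_null_sets)
qed

text \<open>Nearby rows converge pointwise because \<open>g\<close> is continuous inside the square;
  the integrands are dominated by a constant on the unit interval.\<close>

lemma isCont_section_integral:
  fixes k :: "real \<Rightarrow> real \<Rightarrow> real"
  assumes g: "continuous_on unit_square g" and b: "\<And>z. z \<in> unit_square \<Longrightarrow> \<bar>g z\<bar> \<le> M"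
    and u: "square_fun u" "\<And>z. z \<in> unit_square \<Longrightarrow> u z = g z"
    and k: "\<And>x. k x \<in> borel_measurable borel" "\<And>x s. \<bar>k x s\<bar> \<le> C"
    and c: "AE s in lborel. isCont (\<lambda>x. k x s) (fst z)" and z: "z \<in> unit_square"
  shows "isCont (\<lambda>z. LINT s|lborel. k (fst z) s * u (s, snd z)) z"
  unfolding continuous_at_sequentially comp_def
proof (intro allI impI)
  fix X assume X: "X \<longlonglongrightarrow> z"
  have C: "0 \<le> C" using k(2)[of 0 0] by linarith
  have M: "0 \<le> M" using b[OF z] by linarith
  have um: "(\<lambda>s. u (s, y)) \<in> borel_measurable lborel" for y
    using borel_measurable_section(2)[OF square_funD(1)[OF u(1)]] by simp
  have ub: "\<bar>u (s, y)\<bar> \<le> M * indicator {0..1} s" for s y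
  proof (cases "(s, y) \<in> unit_square")
    case True
    then show ?thesis using b[OF True] u(2)[OF True] by (auto simp: mem_unit_square)
  next
    case False
    then show ?thesis using square_funD(3)[OF u(1) False] M by simp
  qed
  show "(\<lambda>n. LINT s|lborel. k (fst (X n)) s * u (s, snd (X n))) \<longlonglongrightarrow> (LINT s|lborel. k (fst z) s * u (s, snd z))"
  proof (rule integral_dominated_convergence[where w="\<lambda>s. C * (M * indicator {0..1} s)"])
    show "AE s in lborel. (\<lambda>n. k (fst (X n)) s * u (s, snd (X n))) \<longlonglongrightarrow> k (fst z) s * u (s, snd z)"
      using c
    proof eventually_elim
      case (elim s)
      have 1: "(\<lambda>n. k (fst (X n)) s) \<longlonglongrightarrow> k (fst z) s"
        by (rule isCont_tendsto_compose[OF elim tendsto_fst[OF X]])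
      have "(\<lambda>n. u (s, snd (X n))) \<longlonglongrightarrow> u (s, snd z)"
      proof (cases "s \<in> {0<..<1}")
        case True
        then have sz: "(s, snd z) \<in> unit_square" using z by (auto simp: mem_unit_square)
        have "isCont g (s, snd z)"
          using g sz unfolding continuous_on_eq_continuous_at[OF open_box] by (rule bspec)
        moreover have lim: "(\<lambda>n. (s, snd (X n))) \<longlonglongrightarrow> (s, snd z)" by (intro tendsto_intros X)
        ultimately have "(\<lambda>n. g (s, snd (X n))) \<longlonglongrightarrow> g (s, snd z)" by (rule isCont_tendsto_compose)
        moreover have "\<forall>\<^sub>F n in sequentially. (s, snd (X n)) \<in> unit_square"
          by (rule topological_tendstoD[OF lim open_box sz])
        then have "\<forall>\<^sub>F n in sequentially. g (s, snd (X n)) = u (s, snd (X n))"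
          by eventually_elim (simp add: u(2))
        ultimately show ?thesis using u(2)[OF sz] by (auto intro: Lim_transform_eventually)
      next
        case False
        then show ?thesis by (simp add: section_zero(2)[OF u(1)])
      qed
      with 1 show ?case by (intro tendsto_mult)
    qed
    show "AE s in lborel. norm (k (fst (X n)) s * u (s, snd (X n))) \<le> C * (M * indicator {0..1} s)" for n
    proof (rule AE_I2)
      fix s
      show "norm (k (fst (X n)) s * u (s, snd (X n))) \<le> C * (M * indicator {0..1} s)"
        using mult_mono[OF k(2)[of "fst (X n)" s] ub[of s "snd (X n)"] C abs_ge_zero] by (simp add: abs_mult)
    qed
  qed (use k um in auto)
qed

text \<open>By continuity the averaged formula holds at every point. Comparing two points of one
  row, the mean drops out and the kernels differ by the indicator of the interval between them,
  which leaves the integral of \<open>g1\<close>.\<close>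

lemma classical_deriv_unit_square:
  assumes g: "continuous_on (cbox (0, 0) (1, 1)) g" "continuous_on (cbox (0, 0) (1, 1)) g1"
    and d: "has_weak_deriv unit_square (1, 0) g g1" and z: "(x, y) \<in> unit_square"
  shows "((\<lambda>x. g (x, y)) has_real_derivative g1 (x, y)) (at x)"
proof -
  have sq: "square_fun (\<lambda>z. indicator unit_square z * f z)" "\<exists>M. \<forall>z\<in>unit_square. \<bar>f z\<bar> \<le> M"
    if f: "continuous_on (cbox (0, 0) (1, 1)) f" for f :: "point \<Rightarrow> real"
  proof -
    have "bounded (f ` cbox (0, 0) (1, 1))" by (intro compact_imp_bounded compact_continuous_image f compact_cbox)
    then obtain M where M: "\<forall>w\<in>f ` cbox (0, 0) (1, 1). norm w \<le> M" unfolding bounded_iff by blast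
    then show "\<exists>M. \<forall>z\<in>unit_square. \<bar>f z\<bar> \<le> M"
      using box_subset_cbox[of "(0, 0) :: point" "(1, 1)"] by (intro exI[of _ M]) auto
    have "integrable lborel (\<lambda>z. indicator (cbox (0, 0) (1, 1)) z *\<^sub>R f z)"
      by (intro borel_integrable_compact compact_cbox f)
    then have "integrable lborel (\<lambda>z. indicator unit_square z *\<^sub>R (indicator (cbox (0, 0) (1, 1)) z *\<^sub>R f z))"
      by (rule integrable_mult_indicator[rotated]) simp
    moreover have Z: "indicator unit_square z *\<^sub>R (indicator (cbox (0, 0) (1, 1)) z *\<^sub>R f z) = indicator unit_square z * f z" for z
      using box_subset_cbox[of "(0, 0) :: point" "(1, 1)"] by (auto simp: indicator_def)
    ultimately have i: "integrable lborel (\<lambda>z. indicator unit_square z * f z)" by (simp only: Z)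
    then show "square_fun (\<lambda>z. indicator unit_square z * f z)"
      unfolding square_fun_def using borel_measurable_integrable[OF i] by simp
  qed
  let ?S = unit_square
  define u where "u = (\<lambda>z. indicator ?S z * g z)"
  define w where "w = (\<lambda>z. indicator ?S z * g1 z)"
  have u: "square_fun u" "\<And>z. z \<in> ?S \<Longrightarrow> u z = g z" and w: "square_fun w" "\<And>z. z \<in> ?S \<Longrightarrow> w z = g1 z"
    using sq(1)[OF g(1)] sq(1)[OF g(2)] by (simp_all add: u_def w_def)
  have S: "?S \<in> sets lebesgue" by simp
  have eq: "AE z in lebesgue_on ?S. g z = u z" "AE z in lebesgue_on ?S. g1 z = w z"
    using u(2) w(2) by (auto simp: AE_lebesgue_on_iff)
  have d': "has_weak_deriv ?S (1, 0) u w" by (rule has_weak_deriv_cong[OF open_box d eq])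
  obtain M where M: "\<And>z. z \<in> ?S \<Longrightarrow> \<bar>g z\<bar> \<le> M" using sq(2)[OF g(1)] by blast
  obtain M1 where M1: "\<And>z. z \<in> ?S \<Longrightarrow> \<bar>g1 z\<bar> \<le> M1" using sq(2)[OF g(2)] by blast
  have cg: "continuous_on ?S g" "continuous_on ?S g1"
    by (rule continuous_on_subset[OF g(1) box_subset_cbox], rule continuous_on_subset[OF g(2) box_subset_cbox])
  let ?A = "\<lambda>z. LINT s|lborel. theta s * u (s, snd z)"
  let ?K = "\<lambda>z. LINT s|lborel. kern (fst z) s * w (s, snd z)"
  have cA: "continuous_on ?S ?A"
  proof (intro continuous_at_imp_continuous_on ballI)
    fix z assume "z \<in> ?S"
    then show "isCont ?A z"
      by (intro isCont_section_integral[of g M u "\<lambda>x. theta" theta_bound])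
        (use cg(1) M u theta_measurable theta_abs_bound in auto)
  qed
  have cK: "continuous_on ?S ?K"
  proof (intro continuous_at_imp_continuous_on ballI)
    fix z assume z: "z \<in> ?S"
    have "AE s in lborel. isCont (\<lambda>x. kern x s) (fst z)"
      using AE_lborel_singleton[of "fst z"] by eventually_elim (auto intro: isCont_kern)
    then show "isCont ?K z"
      using z by (intro isCont_section_integral[of g1 M1 w kern 1])
        (use cg(2) M1 w kern_measurable kern_bound in auto)
  qed
  have "AE z in lebesgue. z \<in> ?S \<longrightarrow> g z = ?A z + ?K z"
    using avg_formula_x[OF u(1) w(1) d'] u(2) by (simp add: AE_completion_iff)
  then have formula: "g z = ?A z + ?K z" if "z \<in> ?S" for z
    by (rule AE_eq_imp_eq_on_open[OF open_box cg(1) continuous_on_add[OF cA cK] _ that])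
  have xy: "0 < x" "x < 1" "0 < y" "y < 1" using z by (auto simp: mem_unit_square)
  \<comment> \<open>An interval around \<open>x\<close> inside the open unit interval; its left end
    is the base point of the comparison.\<close>
  define a b where "a = x / 2" and "b = (x + 1) / 2"
  have ab: "0 < a" "a < x" "x < b" "b < 1" using xy by (auto simp: a_def b_def)
  have inS: "(t, y) \<in> ?S" if "t \<in> {a..b}" for t using that ab xy by (auto simp: mem_unit_square)
  have cgy: "continuous_on {a..b} (\<lambda>t. g1 (t, y))"
    by (rule continuous_on_compose2[OF cg(2)]) (use inS in \<open>auto intro!: continuous_intros\<close>)
  have diff: "g (t, y) - g (a, y) = integral {a..t} (\<lambda>s. g1 (s, y))" if t: "t \<in> {a..b}" for t
  proof -
    have i: "integrable lborel (\<lambda>s. w (s, y))"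
    proof (rule Bochner_Integration.integrable_bound[of _ "\<lambda>s. M1 * indicator {0..1::real} s"])
      show "AE s in lborel. norm (w (s, y)) \<le> norm (M1 * indicator {0..1} s)"
      proof (rule AE_I2)
        fix s show "norm (w (s, y)) \<le> norm (M1 * indicator {0..1} s)"
        proof (cases "(s, y) \<in> ?S")
          case True
          then show ?thesis using M1[OF True] w(2)[OF True] by (auto simp: mem_unit_square)
        qed (simp add: square_funD(3)[OF w(1)])
      qed
    qed (use borel_measurable_section(2)[OF square_funD(1)[OF w(1)]] in auto)
    have ik: "integrable lborel (\<lambda>s. kern t s * w (s, y))" for t
      by (rule integrable_bounded_mult[OF i _ kern_bound]) (simp add: kern_measurable)
    have "a \<in> {a..b}" using ab by simp
    then have "g (t, y) - g (a, y) = ?K (t, y) - ?K (a, y)"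
      using formula[OF inS[OF t]] formula[OF inS] by simp
    also have "\<dots> = (LINT s|lborel. kern t s * w (s, y) - kern a s * w (s, y))"
      using ik by simp
    also have "\<dots> = (LINT s|lborel. indicator {a..t} s *\<^sub>R g1 (s, y))"
    proof (rule integral_cong_AE)
      have "set_integrable lborel {a..t} (\<lambda>s. g1 (s, y))"
        using t by (intro borel_integrable_atLeastAtMost' continuous_on_subset[OF cgy]) auto
      then show "(\<lambda>s. indicator {a..t} s *\<^sub>R g1 (s, y)) \<in> borel_measurable lborel"
        unfolding set_integrable_def by (rule borel_measurable_integrable)
      \<comment> \<open>\<open>kern t s - kern a s\<close> is \<open>[a <= s] - [t <= s]\<close>,
        the indicator of the half-open interval from \<open>a\<close> to \<open>t\<close>; the end
        point \<open>t\<close> is a null set.\<close>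
      show "AE s in lborel. kern t s * w (s, y) - kern a s * w (s, y) = indicator {a..t} s *\<^sub>R g1 (s, y)"
        using AE_lborel_singleton[of t]
      proof eventually_elim
        case (elim s)
        show ?case
        proof (cases "a \<le> s \<and> s < t")
          case True
          then have "(s, y) \<in> ?S" using t by (intro inS) auto
          then show ?thesis using True w(2) by (simp add: kern_def left_diff_distrib)
        next
          case False
          then have "kern t s = kern a s" using elim t by (auto simp: kern_def)
          then show ?thesis using False elim by (auto simp: indicator_def)
        qed
      qed
    qed (use ik in auto)
    also have "\<dots> = integral {a..t} (\<lambda>s. g1 (s, y))"
    proof -
      have "set_integrable lborel {a..t} (\<lambda>s. g1 (s, y))"
        using t by (intro borel_integrable_atLeastAtMost' continuous_on_subset[OF cgy]) auto
      from set_borel_integral_eq_integral(2)[OF this] show ?thesis by (simp add: set_lebesgue_integral_def)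
    qed
    finally show ?thesis .
  qed
  have "((\<lambda>t. integral {a..t} (\<lambda>s. g1 (s, y))) has_real_derivative g1 (x, y)) (at x within {a..b})"
    using ab by (intro integral_has_real_derivative cgy) auto
  then have "((\<lambda>t. g (a, y) + integral {a..t} (\<lambda>s. g1 (s, y))) has_real_derivative 0 + g1 (x, y)) (at x within {a..b})"
    by (intro DERIV_add DERIV_const)
  then have "((\<lambda>t. g (t, y)) has_real_derivative 0 + g1 (x, y)) (at x within {a..b})"
  proof (rule has_field_derivative_transform_within)
    show "0 < (1::real)" "x \<in> {a..b}" using ab by auto
    fix t assume t: "t \<in> {a..b}"
    show "g (a, y) + integral {a..t} (\<lambda>s. g1 (s, y)) = g (t, y)" using diff[OF t] by simp
  qed
  moreover have "at x within {a..b} = at x" using ab by (intro at_within_interior) auto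
  ultimately show ?thesis by simp
qed

text \<open>Rescale a small square around the point, contained in \<open>U\<close>, to the unit
  square; the point becomes its centre.\<close>

lemma classical_partial_x:
  assumes U: "open U" and g: "continuous_on U g" "continuous_on U g1"
    and d: "has_weak_deriv U (1, 0) g g1" "has_weak_deriv U (0, 1) g g2" and z: "(x, y) \<in> U"
  shows "((\<lambda>x. g (x, y)) has_real_derivative g1 (x, y)) (at x)"
proof -
  obtain r where r: "0 < r" "ball (x, y) r \<subseteq> U" using U z open_contains_ball by blast
  \<comment> \<open>Half the side of the square: its points have distance at most
    \<open>2 q = r / 2\<close> from the centre.\<close>
  define q where "q = r / 4"
  have q: "0 < q" using r by (simp add: q_def)
  define F where "F = aff (x - q, y - q) (2 * q, 0) (0, 2 * q)"
  have F: "F z = (x - q + 2 * q * fst z, y - q + 2 * q * snd z)" for z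
    by (simp add: F_def aff_def)
  have FU: "F z \<in> U" if "z \<in> cbox (0, 0) (1, 1)" for z
  proof -
    have b: "0 \<le> fst z" "fst z \<le> 1" "0 \<le> snd z" "snd z \<le> 1" using that by (cases z; auto)+
    have "dist (x, y) (F z) \<le> dist x (fst (F z)) + dist y (snd (F z))"
      unfolding dist_prod_def by (simp add: sqrt_sum_squares_le_sum)
    also have "\<dots> \<le> q + q"
    proof (rule add_mono)
      have h: "\<bar>q - 2 * q * a\<bar> \<le> q" if "0 \<le> a" "a \<le> 1" for a
        using mult_left_mono[OF that(2), of "2 * q"] q that by (auto simp: abs_le_iff)
      show "dist x (fst (F z)) \<le> q" "dist y (snd (F z)) \<le> q"
        using h[OF b(1,2)] h[OF b(3,4)] by (simp_all add: F dist_real_def)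
    qed
    also have "\<dots> < r" using r by (simp add: q_def)
    finally show ?thesis using r(2) by auto
  qed
  have det: "det2 (2 * q, 0) (0, 2 * q) \<noteq> 0" using q by (simp add: det2_def)
  have cF: "continuous_on A F" for A unfolding F_def by (rule continuous_on_aff)
  have c: "continuous_on (cbox (0, 0) (1, 1)) (\<lambda>z. f (F z))" if "continuous_on U f" for f :: "point \<Rightarrow> real"
    using FU by (intro continuous_on_compose2[OF that cF]) auto
  have W: "has_weak_deriv (F -` U) (1, 0) (\<lambda>z. g (F z)) (\<lambda>z. 2 * q * g1 (F z))"
    using has_weak_deriv_aff1(1)[OF det U d, of "(x - q, y - q)"] by (simp add: F_def)
  have oF: "open (F -` U)" unfolding F_def by (rule open_vimage_aff[OF U])
  have sub: "unit_square \<subseteq> F -` U" using FU box_subset_cbox[of "(0, 0) :: point" "(1, 1)"] by auto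
  have dS: "has_weak_deriv unit_square (1, 0) (\<lambda>z. g (F z)) (\<lambda>z. 2 * q * g1 (F z))"
    by (rule has_weak_deriv_subset[OF oF open_box sub W])
  have h: "(1 / 2, 1 / 2) \<in> unit_square" by (simp add: mem_unit_square)
  have "((\<lambda>t. g (F (t, 1 / 2))) has_real_derivative 2 * q * g1 (F (1 / 2, 1 / 2))) (at (1 / 2))"
    by (rule classical_deriv_unit_square[OF c[OF g(1)] _ dS h]) (intro continuous_intros c g)
  then have D: "((\<lambda>t. g (x - q + 2 * q * t, y)) has_real_derivative 2 * q * g1 (x, y)) (at (1 / 2))"
    by (simp add: F)
  have inner: "((\<lambda>t. (t - (x - q)) / (2 * q)) has_real_derivative 1 / (2 * q)) (at x)"
    using q by (auto intro!: derivative_eq_intros)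
  have "(x - (x - q)) / (2 * q) = 1 / 2" using q by simp
  then have "((\<lambda>t. g (x - q + 2 * q * t, y)) has_real_derivative 2 * q * g1 (x, y)) (at ((x - (x - q)) / (2 * q)))"
    using D by (simp only:)
  from DERIV_chain2[OF this inner] show ?thesis using q by simp
qed

text \<open>Both partial derivatives exist, the one in \<open>y\<close> by exchanging coordinates,
  and continuity of that one gives total differentiability.\<close>

lemma classical_derivative:
  assumes U: "open U" and g: "continuous_on U g" "continuous_on U g1" "continuous_on U g2"
    and d: "has_weak_deriv U (1, 0) g g1" "has_weak_deriv U (0, 1) g g2" and z: "z \<in> U"
  shows "(g has_derivative (\<lambda>h. fst h * g1 z + snd h * g2 z)) (at z)"
proof -
  obtain x y where xy: "z = (x, y)" by (cases z)
  have py: "((\<lambda>y. g (x, y)) has_real_derivative g2 (x, y)) (at y)" if z: "(x, y) \<in> U" for x y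
  proof -
    let ?F = "aff 0 (0, 1) (1, 0)"
    have dd: "has_weak_deriv (?F -` U) (1, 0) (\<lambda>z. g (?F z)) (\<lambda>z. g2 (?F z))"
      "has_weak_deriv (?F -` U) (0, 1) (\<lambda>z. g (?F z)) (\<lambda>z. g1 (?F z))"
      using has_weak_deriv_aff1[OF _ U d, of "(0, 1)" "(1, 0)" 0] by (simp_all add: det2_def)
    have c: "continuous_on (?F -` U) (\<lambda>z. f (?F z))" if "continuous_on U f" for f :: "point \<Rightarrow> real"
      by (rule continuous_on_compose2[OF that continuous_on_aff]) auto
    have "(y, x) \<in> ?F -` U" using z by (simp add: aff_swap)
    from classical_partial_x[OF open_vimage_aff[OF U] c[OF g(1)] c[OF g(3)] dd this]
    show ?thesis by (simp add: aff_swap)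
  qed
  obtain A B where AB: "open A" "open B" "x \<in> A" "y \<in> B" "A \<times> B \<subseteq> U"
    using open_prod_elim[OF U, of z] z xy by (metis mem_Sigma_iff)
  obtain e where e: "0 < e" "ball y e \<subseteq> B" using AB open_contains_ball by blast
  let ?Y = "ball y e"
  have "((\<lambda>(x, y). g (x, y)) has_derivative (\<lambda>(tx, ty). tx * g1 z + blinfun_scaleR_left (g2 (x, y)) ty)) (at (x, y) within A \<times> ?Y)"
  proof (rule has_derivative_partialsI)
    show "((\<lambda>x. g (x, y)) has_derivative (\<lambda>tx. tx * g1 z)) (at x within A)"
      using classical_partial_x[OF U g(1,2) d, of x y] z xy
      by (simp add: has_field_derivative_def mult_commute_abs has_derivative_at_withinI)
    show "((\<lambda>y. g (x', y)) has_derivative blinfun_apply (blinfun_scaleR_left (g2 (x', y')))) (at y' within ?Y)"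
      if "x' \<in> A" "y' \<in> ?Y" for x' y'
    proof -
      have "(x', y') \<in> U" using that AB e by auto
      from py[OF this] have "((\<lambda>y. g (x', y)) has_derivative (*) (g2 (x', y'))) (at y' within ?Y)"
        unfolding has_field_derivative_def by (rule has_derivative_at_withinI)
      then show ?thesis by (rule has_derivative_eq_rhs) (simp add: fun_eq_iff mult.commute)
    qed
    show "continuous (at (x, y) within A \<times> ?Y) (\<lambda>(x, y). blinfun_scaleR_left (g2 (x, y)))"
    proof -
      have "isCont g2 (x, y)"
        by (rule continuous_on_interior[OF g(3)]) (use z xy U in \<open>simp add: interior_open\<close>)
      then have "(g2 \<longlongrightarrow> g2 (x, y)) (at (x, y) within A \<times> ?Y)"
        unfolding isCont_def by (rule tendsto_within_subset) simp
      then show ?thesis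
        unfolding continuous_within case_prod_beta' prod.collapse by (rule bounded_linear.tendsto[OF bounded_linear_blinfun_scaleR_left])
    qed
  qed (use e in auto)
  moreover have "at (x, y) within A \<times> ?Y = at (x, y)"
    using AB e by (intro at_within_open open_Times) auto
  ultimately have "((\<lambda>(x, y). g (x, y)) has_derivative (\<lambda>(tx, ty). tx * g1 z + blinfun_scaleR_left (g2 (x, y)) ty)) (at (x, y))"
    by simp
  then show ?thesis
    by (simp add: xy split_def blinfun_scaleR_left.rep_eq mult.commute)
qed

text \<open>Near \<open>z0\<close> the derivative of \<open>g - L\<close> is small on
  \<open>U\<close>. By convexity the mean value inequality gives a small Lipschitz constant there,
  and continuity extends the estimate to the closure.\<close>

lemma has_derivative_closure_convex:
  fixes g :: "point \<Rightarrow> real"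
  assumes U: "open U" "convex U" and c: "continuous_on (closure U) g" "continuous_on (closure U) g1" "continuous_on (closure U) g2"
    and d: "\<And>z. z \<in> U \<Longrightarrow> (g has_derivative (\<lambda>h. fst h * g1 z + snd h * g2 z)) (at z)" and z0: "z0 \<in> closure U"
  shows "(g has_derivative (\<lambda>h. fst h * g1 z0 + snd h * g2 z0)) (at z0 within closure U)"
  unfolding has_derivative_within_alt
proof (intro conjI allI impI)
  define L where "L h = fst h * g1 z0 + snd h * g2 z0" for h :: point
  show bl: "bounded_linear (\<lambda>h. fst h * g1 z0 + snd h * g2 z0)"
    by (intro bounded_linear_add bounded_linear_mult_const bounded_linear_fst bounded_linear_snd)
  have cL: "continuous_on A L" for A unfolding L_def by (intro continuous_intros)
  fix e :: real assume e: "0 < e"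
  obtain d1 where d1: "0 < d1" "\<And>z. z \<in> closure U \<Longrightarrow> dist z z0 < d1 \<Longrightarrow> dist (g1 z) (g1 z0) < e / 2"
    using c(2) z0 e unfolding continuous_on_iff by (meson half_gt_zero)
  obtain d2 where d2: "0 < d2" "\<And>z. z \<in> closure U \<Longrightarrow> dist z z0 < d2 \<Longrightarrow> dist (g2 z) (g2 z0) < e / 2"
    using c(3) z0 e unfolding continuous_on_iff by (meson half_gt_zero)
  define r where "r = min d1 d2"
  have r: "0 < r" using d1 d2 by (simp add: r_def)
  define B where "B = ball z0 r \<inter> U"
  have B: "open B" "convex B" using U by (auto simp: B_def convex_Int)
  have BU: "B \<subseteq> U" by (auto simp: B_def)
  have inB: "\<bar>(g y - L y) - (g x - L x)\<bar> \<le> e * norm (y - x)" if xy: "x \<in> B" "y \<in> B" for x y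
  proof -
    have dd: "((\<lambda>w. g w - L w) has_derivative (\<lambda>h. (fst h * g1 w + snd h * g2 w) - L h)) (at w within B)" if "w \<in> B" for w
    proof (rule has_derivative_diff)
      show "(g has_derivative (\<lambda>h. fst h * g1 w + snd h * g2 w)) (at w within B)"
        using d[of w] that BU by (auto intro: has_derivative_at_withinI)
      show "(L has_derivative L) (at w within B)"
        unfolding L_def[abs_def] by (rule bounded_linear_imp_has_derivative[OF bl])
    qed
    have on: "onorm (\<lambda>h. (fst h * g1 w + snd h * g2 w) - L h) \<le> e" if w: "w \<in> B" for w
    proof (rule onorm_le)
      fix h :: point
      have "w \<in> closure U" "dist w z0 < r" using w closure_subset by (auto simp: B_def dist_commute)
      then have g12: "\<bar>g1 w - g1 z0\<bar> \<le> e / 2" "\<bar>g2 w - g2 z0\<bar> \<le> e / 2"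
        using d1(2)[of w] d2(2)[of w] by (auto simp: r_def dist_real_def)
      have "norm ((fst h * g1 w + snd h * g2 w) - L h) = \<bar>fst h * (g1 w - g1 z0) + snd h * (g2 w - g2 z0)\<bar>"
        by (simp add: L_def algebra_simps)
      also have "\<dots> \<le> \<bar>fst h\<bar> * \<bar>g1 w - g1 z0\<bar> + \<bar>snd h\<bar> * \<bar>g2 w - g2 z0\<bar>"
        by (metis abs_mult abs_triangle_ineq)
      also have "\<dots> \<le> norm h * (e / 2) + norm h * (e / 2)"
        using g12 norm_fst_le[of "fst h" "snd h"] norm_snd_le[of "snd h" "fst h"]
        by (intro add_mono mult_mono) auto
      finally show "norm ((fst h * g1 w + snd h * g2 w) - L h) \<le> e * norm h" by (simp add: algebra_simps)
    qed
    have "norm ((g y - L y) - (g x - L x)) \<le> e * norm (y - x)"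
      by (rule differentiable_bound[OF B(2) dd on xy(2) xy(1)])
    then show ?thesis by simp
  qed
  have inclB: "\<bar>(g y - L y) - (g x - L x)\<bar> \<le> e * norm (y - x)"
    if xy: "x \<in> closure U" "x \<in> ball z0 r" "y \<in> closure U" "y \<in> ball z0 r" for x y
  proof -
    have "ball z0 r \<inter> closure U \<subseteq> closure B" unfolding B_def by (rule open_Int_closure_subset) simp
    then have "x \<in> closure B" "y \<in> closure B" using xy by auto
    then obtain X Y where X: "\<And>n. X n \<in> B" "X \<longlonglongrightarrow> x" and Y: "\<And>n. Y n \<in> B" "Y \<longlonglongrightarrow> y"
      unfolding closure_sequential by metis
    have cgl: "continuous_on (closure U) (\<lambda>z. g z - L z)" by (intro continuous_intros c cL)
    have lim: "(\<lambda>n. g (Z n) - L (Z n)) \<longlonglongrightarrow> g z - L z" if "\<And>n. Z n \<in> B" "Z \<longlonglongrightarrow> z" "z \<in> closure U" for Z z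
      using continuous_on_tendsto_compose[OF cgl that(2,3)] that(1) BU closure_subset by (metis (mono_tags) eventually_sequentiallyI subsetD)
    show ?thesis
    proof (rule LIMSEQ_le)
      show "(\<lambda>n. \<bar>(g (Y n) - L (Y n)) - (g (X n) - L (X n))\<bar>) \<longlonglongrightarrow> \<bar>(g y - L y) - (g x - L x)\<bar>"
        by (intro tendsto_intros lim X Y xy)
      show "(\<lambda>n. e * norm (Y n - X n)) \<longlonglongrightarrow> e * norm (y - x)" by (intro tendsto_intros X Y)
    qed (use inB X(1) Y(1) in blast)
  qed
  have lin: "L (y - z0) = L y - L z0" for y by (simp add: L_def algebra_simps)
  show "\<exists>d>0. \<forall>y\<in>closure U. norm (y - z0) < d \<longrightarrow>
    norm (g y - g z0 - (fst (y - z0) * g1 z0 + snd (y - z0) * g2 z0)) \<le> e * norm (y - z0)"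
  proof (intro exI[of _ r] conjI ballI impI r)
    fix y assume "y \<in> closure U" "norm (y - z0) < r"
    then have "\<bar>(g y - L y) - (g z0 - L z0)\<bar> \<le> e * norm (y - z0)"
      using z0 r by (intro inclB) (auto simp: dist_norm norm_minus_commute)
    then show "norm (g y - g z0 - (fst (y - z0) * g1 z0 + snd (y - z0) * g2 z0)) \<le> e * norm (y - z0)"
      using lin[of y] by (simp add: L_def algebra_simps)
  qed
qed

subsection \<open>The reference triangle\<close>

definition ref_triangle :: "point set" where
  "ref_triangle = {z. 0 < fst z \<and> 0 < snd z \<and> fst z + snd z < 1}"

definition closed_ref_triangle :: "point set" where
  "closed_ref_triangle = {z. 0 \<le> fst z \<and> 0 \<le> snd z \<and> fst z + snd z \<le> 1}"

lemma open_ref_triangle: "open ref_triangle"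
  unfolding ref_triangle_def by (intro open_Collect_conj open_Collect_less continuous_intros)

lemma convex_ref_triangle: "convex ref_triangle"
  unfolding convex_alt ref_triangle_def
proof (clarsimp, intro conjI)
  fix a b c d u :: real
  assume h: "0 < a" "0 < b" "a + b < 1" "0 < c" "0 < d" "c + d < 1" "0 \<le> u" "u \<le> 1"
  have pos: "0 < (1 - u) * p + u * q" if "0 < p" "0 < q" for p q :: real
    using h that by (cases "u = 0") (auto intro!: add_nonneg_pos)
  show "0 < (1 - u) * a + u * c" "0 < (1 - u) * b + u * d" using pos h by auto
  have "0 < (1 - u) * (1 - a - b) + u * (1 - c - d)" using pos h by auto
  then show "(1 - u) * a + u * c + ((1 - u) * b + u * d) < 1" by (simp add: algebra_simps)
qed

lemma closed_closed_ref_triangle: "closed closed_ref_triangle"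
  unfolding closed_ref_triangle_def by (intro closed_Collect_conj closed_Collect_le continuous_intros)

text \<open>Used with the centroid for \<open>w\<close>: points of a closed triangle are approached
  from its interior.\<close>

lemma tendsto_to_barycentre:
  fixes z w :: point
  shows "(\<lambda>n. (1 - 1 / real (Suc n)) *\<^sub>R z + (1 / real (Suc n)) *\<^sub>R w) \<longlonglongrightarrow> z"
proof -
  have "(\<lambda>n. (1 - inverse (real (Suc n))) *\<^sub>R z + inverse (real (Suc n)) *\<^sub>R w) \<longlonglongrightarrow> (1 - 0) *\<^sub>R z + 0 *\<^sub>R w"
    by (intro tendsto_intros LIMSEQ_inverse_real_of_nat)
  then show ?thesis by (simp add: inverse_eq_divide)
qed

lemma in_between:
  assumes "a \<le> p" "p \<le> b" "a < q" "q < (b::real)"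
  shows "a < (1 - 1 / real (Suc n)) * p + (1 / real (Suc n)) * q"
    "(1 - 1 / real (Suc n)) * p + (1 / real (Suc n)) * q < b"
proof -
  define t where "t = 1 / real (Suc n)"
  have t: "0 < t" "t \<le> 1" by (auto simp: t_def)
  have "(1 - t) * p + t * q - a = (1 - t) * (p - a) + t * (q - a)" by (simp add: algebra_simps)
  also have "\<dots> > 0" using assms t by (intro add_nonneg_pos) auto
  finally show "a < (1 - 1 / real (Suc n)) * p + (1 / real (Suc n)) * q" by (simp add: t_def)
  have "b - ((1 - t) * p + t * q) = (1 - t) * (b - p) + t * (b - q)" by (simp add: algebra_simps)
  also have "\<dots> > 0" using assms t by (intro add_nonneg_pos) auto
  finally show "(1 - 1 / real (Suc n)) * p + (1 / real (Suc n)) * q < b" by (simp add: t_def)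
qed

lemma barycentre_third:
  "1 - ((1 - t) * a + t * (1 / 3)) - ((1 - t) * b + t * (1 / 3)) = (1 - t) * (1 - a - b) + t * (1 / 3 :: real)"
  by (simp add: field_simps)

lemma closure_ref_triangle: "closure ref_triangle = closed_ref_triangle"
proof
  show "closure ref_triangle \<subseteq> closed_ref_triangle"
    using closed_closed_ref_triangle by (intro closure_minimal) (auto simp: ref_triangle_def closed_ref_triangle_def)
  show "closed_ref_triangle \<subseteq> closure ref_triangle"
  proof
    fix z assume z: "z \<in> closed_ref_triangle"
    then have b: "0 \<le> fst z" "fst z \<le> 1" "0 \<le> snd z" "snd z \<le> 1" "0 \<le> 1 - fst z - snd z" "1 - fst z - snd z \<le> 1"
      by (auto simp: closed_ref_triangle_def)
    let ?X = "\<lambda>n. (1 - 1 / real (Suc n)) *\<^sub>R z + (1 / real (Suc n)) *\<^sub>R (1 / 3, 1 / 3)"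
    have X: "?X n \<in> ref_triangle" for n
    proof -
      let ?t = "1 / real (Suc n)"
      have f: "fst (?X n) = (1 - ?t) * fst z + ?t * (1 / 3)" and s: "snd (?X n) = (1 - ?t) * snd z + ?t * (1 / 3)" by simp_all
      have r: "1 - fst (?X n) - snd (?X n) = (1 - ?t) * (1 - fst z - snd z) + ?t * (1 / 3)"
        unfolding f s by (rule barycentre_third)
      have h: "0 < (1 / 3 :: real)" "1 / 3 < (1 :: real)" by simp_all
      have "0 < fst (?X n)" "0 < snd (?X n)" "0 < 1 - fst (?X n) - snd (?X n)"
        unfolding r unfolding f s using in_between(1)[OF b(1,2) h] in_between(1)[OF b(3,4) h] in_between(1)[OF b(5,6) h] by blast+
      then show ?thesis unfolding ref_triangle_def mem_Collect_eq by linarith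
    qed
    show "z \<in> closure ref_triangle"
      unfolding closure_sequential
      by (intro exI[of _ ?X] conjI allI tendsto_to_barycentre X)
  qed
qed

lemma emeasure_ref_triangle: "emeasure lebesgue ref_triangle \<le> 1"
proof -
  have "emeasure lebesgue ref_triangle \<le> emeasure lebesgue unit_square"
    by (intro emeasure_mono) (auto simp: ref_triangle_def mem_unit_square)
  then show ?thesis by (simp only: emeasure_unit_square)
qed

text \<open>The three affine images of the unit square that have a vertex of the triangle as a corner
  and are cut out by requiring the other two barycentric coordinates to be less than \<open>1/2\<close>:
  they cover the triangle up to a null set and all contain the medial triangle.\<close>

definition corner :: "point \<Rightarrow> point \<Rightarrow> point \<Rightarrow> point \<Rightarrow> point \<Rightarrow> point \<Rightarrow> bool" where
  "corner z e f z' e' f' \<longleftrightarrow> (\<forall>x. aff z e f (aff z' e' f' x) = x) \<and>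
    unit_square \<subseteq> aff z e f -` ref_triangle \<and> \<bar>det2 e f\<bar> = 1 / 4 \<and> \<bar>det2 e' f'\<bar> = 4 \<and>
    \<bar>fst e\<bar> \<le> 1 \<and> \<bar>snd e\<bar> \<le> 1 \<and> \<bar>fst f\<bar> \<le> 1 \<and> \<bar>snd f\<bar> \<le> 1"

text \<open>Each patch is a preimage of the square under the inverse of the corresponding corner
  map, the form in which norms are transported.\<close>

definition "patch1 = aff 0 (2, 0) (0, 2) -` unit_square"
definition "patch2 = aff (2, 0) (-2, 0) (-2, 2) -` unit_square"
definition "patch3 = aff (2, 0) (-2, 2) (-2, 0) -` unit_square"

lemma mem_patch:
  "z \<in> patch1 \<longleftrightarrow> 0 < fst z \<and> fst z < 1 / 2 \<and> 0 < snd z \<and> snd z < 1 / 2"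
  "z \<in> patch2 \<longleftrightarrow> 0 < 1 - fst z - snd z \<and> 1 - fst z - snd z < 1 / 2 \<and> 0 < snd z \<and> snd z < 1 / 2"
  "z \<in> patch3 \<longleftrightarrow> 0 < 1 - fst z - snd z \<and> 1 - fst z - snd z < 1 / 2 \<and> 0 < fst z \<and> fst z < 1 / 2"
  unfolding patch1_def patch2_def patch3_def vimage_eq mem_unit_square fst_aff snd_aff by auto

lemma corner1: "corner 0 (1 / 2, 0) (0, 1 / 2) 0 (2, 0) (0, 2)"
  by (auto simp: corner_def aff_def ref_triangle_def mem_unit_square det2_def)

lemma corner2: "corner (1, 0) (-1 / 2, 0) (-1 / 2, 1 / 2) (2, 0) (-2, 0) (-2, 2)"
  by (auto simp: corner_def aff_def ref_triangle_def mem_unit_square det2_def field_simps)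

lemma corner3: "corner (0, 1) (0, -1 / 2) (1 / 2, -1 / 2) (2, 0) (-2, 2) (-2, 0)"
  by (auto simp: corner_def aff_def ref_triangle_def mem_unit_square det2_def field_simps)

lemma open_patch: "open patch1" "open patch2" "open patch3"
  unfolding patch1_def patch2_def patch3_def by (intro open_vimage_aff open_box)+

lemma patch_subset: "patch1 \<subseteq> ref_triangle" "patch2 \<subseteq> ref_triangle" "patch3 \<subseteq> ref_triangle"
  by (auto simp: mem_patch ref_triangle_def)

lemma AE_patch_cover: "AE z in lebesgue. z \<in> ref_triangle \<longrightarrow> z \<in> patch1 \<or> z \<in> patch2 \<or> z \<in> patch3"
  unfolding AE_completion_iff using AE_fst_snd_neq[of "1 / 2" "1 / 2"]
  by eventually_elim (auto simp: mem_patch ref_triangle_def)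

lemma inverse_exponent_bounds:
  assumes "1 \<le> (p::ereal)"
  shows "0 \<le> 1 / real_of_ereal p" "1 / real_of_ereal p \<le> 1"
  using assms by (cases rule: exponent_cases; simp)+

section \<open>Poincare's inequality on the reference triangle\<close>

text \<open>Pulling back costs at most 4 because the determinant is \<open>1/4\<close>; combining
  two partials doubles this to 8, and there are two directions, so the constant is
  \<open>4 * (8 + 8) = 64\<close>. The way back has determinant 4 and costs at most 1.\<close>

lemma corner_poincare:
  assumes c: "corner z e f z' e' f'" and p: "1 \<le> p"
    and v: "v \<in> Lp_space p ref_triangle" "vx \<in> Lp_space p ref_triangle" "vy \<in> Lp_space p ref_triangle"
    and d: "has_weak_deriv ref_triangle (1, 0) v vx" "has_weak_deriv ref_triangle (0, 1) v vy"
  shows "\<exists>c. (\<lambda>x. v x - c) \<in> Lp_space p (aff z' e' f' -` unit_square) \<and>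
    Lp_norm p (aff z' e' f' -` unit_square) (\<lambda>x. v x - c)
      \<le> 64 * (1 + theta_bound) * (Lp_norm p ref_triangle vx + Lp_norm p ref_triangle vy)"
proof -
  let ?F = "aff z e f" and ?G = "aff z' e' f'"
  let ?V = "?F -` ref_triangle"
  have inv: "?F (?G x) = x" for x using c unfolding corner_def by blast
  have sub: "unit_square \<subseteq> ?V" and det: "\<bar>det2 e f\<bar> = 1 / 4" "\<bar>det2 e' f'\<bar> = 4"
    and ef: "\<bar>fst e\<bar> \<le> 1" "\<bar>snd e\<bar> \<le> 1" "\<bar>fst f\<bar> \<le> 1" "\<bar>snd f\<bar> \<le> 1"
    using c by (auto simp: corner_def)
  have det0: "det2 e f \<noteq> 0" "det2 e' f' \<noteq> 0" using det by auto
  have oV: "open ?V" by (rule open_vimage_aff[OF open_ref_triangle])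
  define t where "t = 1 / real_of_ereal p"
  have t: "0 \<le> t" "t \<le> 1" using inverse_exponent_bounds[OF p] by (simp_all add: t_def)
  have "(1 / 4 :: real) powr (- t) = 4 powr t" by (simp add: powr_minus powr_divide)
  also have "\<dots> \<le> 4 powr 1" using t by (intro powr_mono) auto
  finally have four: "(1 / 4 :: real) powr (- t) \<le> 4" by simp
  have pull: "(\<lambda>x. w (?F x)) \<in> Lp_space p unit_square" "Lp_norm p unit_square (\<lambda>x. w (?F x)) \<le> 4 * Lp_norm p ref_triangle w"
    if w: "w \<in> Lp_space p ref_triangle" for w
  proof -
    note * = Lp_aff[OF p det0(1) open_ref_triangle w, of z]
    show "(\<lambda>x. w (?F x)) \<in> Lp_space p unit_square" by (rule Lp_subset(1)[OF p oV open_box sub *(1)])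
    have "Lp_norm p unit_square (\<lambda>x. w (?F x)) \<le> Lp_norm p ?V (\<lambda>x. w (?F x))"
      by (rule Lp_subset(2)[OF p oV open_box sub *(1)])
    also have "\<dots> \<le> (1 / 4) powr (- t) * Lp_norm p ref_triangle w" using *(2) by (simp add: det t_def)
    also have "\<dots> \<le> 4 * Lp_norm p ref_triangle w" by (intro mult_right_mono four Lp_norm_nonneg)
    finally show "Lp_norm p unit_square (\<lambda>x. w (?F x)) \<le> 4 * Lp_norm p ref_triangle w" .
  qed
  let ?E = "Lp_norm p ref_triangle vx + Lp_norm p ref_triangle vy"
  have dir: "(\<lambda>x. a * vx (?F x) + b * vy (?F x)) \<in> Lp_space p unit_square \<and>
    Lp_norm p unit_square (\<lambda>x. a * vx (?F x) + b * vy (?F x)) \<le> 8 * ?E"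
    if ab: "\<bar>a\<bar> \<le> 1" "\<bar>b\<bar> \<le> 1" for a b
  proof -
    note x = Lp_cmult[OF p pull(1)[OF v(2)], of a] and y = Lp_cmult[OF p pull(1)[OF v(3)], of b]
    note s = Lp_add[OF p x(1) y(1)]
    have "Lp_norm p unit_square (\<lambda>x. a * vx (?F x)) \<le> 1 * (4 * Lp_norm p ref_triangle vx)"
      using order_trans[OF x(2) mult_mono[OF ab(1) pull(2)[OF v(2)]]] by (simp add: Lp_norm_nonneg)
    moreover have "Lp_norm p unit_square (\<lambda>x. b * vy (?F x)) \<le> 1 * (4 * Lp_norm p ref_triangle vy)"
      using order_trans[OF y(2) mult_mono[OF ab(2) pull(2)[OF v(3)]]] by (simp add: Lp_norm_nonneg)
    ultimately show ?thesis using s by auto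
  qed
  note dS = has_weak_deriv_subset[OF oV open_box sub has_weak_deriv_aff1(1)[OF det0(1) open_ref_triangle d, of z]]
    has_weak_deriv_subset[OF oV open_box sub has_weak_deriv_aff1(2)[OF det0(1) open_ref_triangle d, of z]]
  obtain c where c: "(\<lambda>x. v (?F x) - c) \<in> Lp_space p unit_square"
    "Lp_norm p unit_square (\<lambda>x. v (?F x) - c) \<le> 4 * (1 + theta_bound) *
      (Lp_norm p unit_square (\<lambda>x. fst e * vx (?F x) + snd e * vy (?F x)) + Lp_norm p unit_square (\<lambda>x. fst f * vx (?F x) + snd f * vy (?F x)))"
    using poincare_unit_square[OF p pull(1)[OF v(1)] dir[OF ef(1,2), THEN conjunct1] dir[OF ef(3,4), THEN conjunct1] dS] by blast
  have "Lp_norm p unit_square (\<lambda>x. v (?F x) - c) \<le> 4 * (1 + theta_bound) * (8 * ?E + 8 * ?E)"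
    using theta_bound_pos dir[OF ef(1,2)] dir[OF ef(3,4)]
    by (intro order_trans[OF c(2)] mult_left_mono add_mono) auto
  also have "\<dots> = 64 * (1 + theta_bound) * ?E" by (simp add: algebra_simps)
  finally have b: "Lp_norm p unit_square (\<lambda>x. v (?F x) - c) \<le> 64 * (1 + theta_bound) * ?E" .
  note * = Lp_aff[OF p det0(2) open_box c(1), of z', unfolded inv det]
  have "(4::real) powr (- (1 / real_of_ereal p)) \<le> 4 powr 0"
    using t by (intro powr_mono) (auto simp: t_def)
  then have "4 powr (- (1 / real_of_ereal p)) * Lp_norm p unit_square (\<lambda>x. v (?F x) - c) \<le> 1 * Lp_norm p unit_square (\<lambda>x. v (?F x) - c)"
    by (intro mult_right_mono Lp_norm_nonneg) simp
  then have "Lp_norm p (?G -` unit_square) (\<lambda>x. v x - c) \<le> 64 * (1 + theta_bound) * ?E"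
    using *(2) b by linarith
  then show ?thesis using *(1) by blast
qed

text \<open>A box in the medial triangle, where all three barycentric coordinates lie between
  \<open>3/10\<close> and \<open>2/5\<close>; on it the constants belonging to the three patches are
  compared.\<close>

definition "patch_box = (box (3 / 10, 3 / 10) (7 / 20, 7 / 20) :: point set)"

lemma patch_box_subset: "patch_box \<subseteq> patch1" "patch_box \<subseteq> patch2" "patch_box \<subseteq> patch3"
  by (auto simp: patch_box_def mem_patch mem_box Basis_prod_def)

lemma measure_patch_box: "emeasure lebesgue patch_box = ennreal (1 / 400)" "measure lebesgue patch_box = 1 / 400"
proof -
  have "measure lborel (box (3 / 10, 3 / 10) (7 / 20, 7 / 20) :: point set)
      = (\<Prod>b\<in>Basis. ((7 / 20, 7 / 20) - (3 / 10, 3 / 10) :: point) \<bullet> b)"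
    by (rule measure_lborel_box) (auto simp: Basis_prod_def)
  also have "\<dots> = 1 / 400" by (subst Basis_prod_def, subst prod.union_disjoint) (auto simp: prod.reindex inj_on_def)
  finally show m: "measure lebesgue patch_box = 1 / 400" by (simp add: patch_box_def)
  show "emeasure lebesgue patch_box = ennreal (1 / 400)"
    using m emeasure_eq_ennreal_measure[of lebesgue patch_box] by (simp add: patch_box_def emeasure_lborel_box_eq)
qed

text \<open>The area \<open>1/400\<close> and the factor 2 of \<open>L1_le_Lp\<close> give
  800.\<close>

lemma const_le_Lp_norm_patch_box:
  assumes p: "1 \<le> p" and c: "(\<lambda>x. c) \<in> Lp_space p patch_box"
  shows "\<bar>c\<bar> \<le> 800 * Lp_norm p patch_box (\<lambda>x. c)"
proof -
  have o: "open patch_box" by (simp add: patch_box_def open_box)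
  have "emeasure lebesgue patch_box \<le> 1" unfolding measure_patch_box(1) by simp
  from L1_le_Lp(2)[OF p o this c] show ?thesis
    using open_sets_lebesgue[OF o] by (simp add: measure_restrict_space measure_patch_box(2))
qed

text \<open>On the common box the difference of two local constants is small in norm and therefore
  small as a number, so the constant of the first patch serves on all of them.\<close>

lemma poincare_ref_triangle:
  assumes p: "1 \<le> p"
    and v: "v \<in> Lp_space p ref_triangle" "vx \<in> Lp_space p ref_triangle" "vy \<in> Lp_space p ref_triangle"
    and d: "has_weak_deriv ref_triangle (1, 0) v vx" "has_weak_deriv ref_triangle (0, 1) v vy"
  shows "\<exists>c. Lp_norm p ref_triangle (\<lambda>x. v x - c)
    \<le> 10 ^ 6 * (1 + theta_bound) * (Lp_norm p ref_triangle vx + Lp_norm p ref_triangle vy)"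
proof -
  define E where "E = 64 * (1 + theta_bound) * (Lp_norm p ref_triangle vx + Lp_norm p ref_triangle vy)"
  have E0: "0 \<le> E" using theta_bound_pos by (simp add: E_def Lp_norm_nonneg)
  note cp = corner_poincare[OF _ p v d]
  obtain c1 where c1: "(\<lambda>x. v x - c1) \<in> Lp_space p patch1" "Lp_norm p patch1 (\<lambda>x. v x - c1) \<le> E"
    using cp[OF corner1] unfolding patch1_def E_def by blast
  obtain c2 where c2: "(\<lambda>x. v x - c2) \<in> Lp_space p patch2" "Lp_norm p patch2 (\<lambda>x. v x - c2) \<le> E"
    using cp[OF corner2] unfolding patch2_def E_def by blast
  obtain c3 where c3: "(\<lambda>x. v x - c3) \<in> Lp_space p patch3" "Lp_norm p patch3 (\<lambda>x. v x - c3) \<le> E"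
    using cp[OF corner3] unfolding patch3_def E_def by blast
  have ob: "open patch_box" by (simp add: patch_box_def open_box)
  \<comment> \<open>The constants differ by at most \<open>800 * 4 = 3200\<close> times
    \<open>E\<close>, and \<open>2 * (1 + 3200)\<close> is below 7000.\<close>
  have cmp: "(\<lambda>x. v x - c1) \<in> Lp_space p Q \<and> Lp_norm p Q (\<lambda>x. v x - c1) \<le> 7000 * E"
    if Q: "open Q" "patch_box \<subseteq> Q" "Q \<subseteq> ref_triangle" and ci: "(\<lambda>x. v x - ci) \<in> Lp_space p Q" "Lp_norm p Q (\<lambda>x. v x - ci) \<le> E" for Q ci
  proof -
    note b1 = Lp_subset[OF p open_patch(1) ob patch_box_subset(1) c1(1)] and bi = Lp_subset[OF p Q(1) ob Q(2) ci(1)]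
    note df = Lp_diff[OF p b1(1) bi(1)]
    have eq: "(\<lambda>x. (v x - c1) - (v x - ci)) = (\<lambda>x. ci - c1)" by simp
    have "\<bar>ci - c1\<bar> \<le> 800 * Lp_norm p patch_box (\<lambda>x. ci - c1)"
      using const_le_Lp_norm_patch_box[OF p] df(1) unfolding eq by blast
    also have "Lp_norm p patch_box (\<lambda>x. ci - c1) \<le> 2 * (E + E)"
      using df(2) b1(2) bi(2) c1(2) ci(2) unfolding eq by simp
    finally have cc: "\<bar>ci - c1\<bar> \<le> 3200 * E" by simp
    have em: "emeasure lebesgue Q \<le> 1"
      using emeasure_mono[OF Q(3) open_sets_lebesgue[OF open_ref_triangle]] emeasure_ref_triangle by (rule order_trans)
    have k: "(\<lambda>x. ci - c1) \<in> Lp_space p Q" "Lp_norm p Q (\<lambda>x. ci - c1) \<le> 3200 * E"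
      using Lp_bounded[OF p Q(1) em, of "\<lambda>x. ci - c1" "3200 * E"] cc E0 by simp_all
    note a = Lp_add[OF p ci(1) k(1)]
    have eq2: "(\<lambda>x. (v x - ci) + (ci - c1)) = (\<lambda>x. v x - c1)" by simp
    show ?thesis using a k(2) ci(2) E0 unfolding eq2 by simp
  qed
  note q2 = cmp[OF open_patch(2) patch_box_subset(2) patch_subset(2) c2]
    and q3 = cmp[OF open_patch(3) patch_box_subset(3) patch_subset(3) c3]
  have o12: "open (patch1 \<union> patch2)" using open_patch by (intro open_Un)
  have cov12: "AE x in lebesgue_on (patch1 \<union> patch2). x \<in> patch1 \<union> patch2"
    using AE_lebesgue_on_iff[OF open_sets_lebesgue[OF o12], of "\<lambda>x. x \<in> patch1 \<union> patch2"] by simp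
  note u12 = Lp_cover[OF p o12 open_patch(1,2) c1(1) q2[THEN conjunct1] cov12]
  have cov: "AE x in lebesgue_on ref_triangle. x \<in> (patch1 \<union> patch2) \<union> patch3"
    unfolding AE_lebesgue_on_iff[OF open_sets_lebesgue[OF open_ref_triangle]]
    using AE_patch_cover by eventually_elim auto
  note u = Lp_cover(2)[OF p open_ref_triangle o12 open_patch(3) u12(1) q3[THEN conjunct1] cov]
  have "Lp_norm p ref_triangle (\<lambda>x. v x - c1) \<le> 14001 * E"
    using u u12(2) c1(2) q2[THEN conjunct2] q3[THEN conjunct2] by simp
  \<comment> \<open>\<open>64 * 14001\<close> is below \<open>10 ^ 6\<close>.\<close>
  also have "14001 * E \<le> 10 ^ 6 * (1 + theta_bound) * (Lp_norm p ref_triangle vx + Lp_norm p ref_triangle vy)"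
  proof -
    define s where "s = (1 + theta_bound) * (Lp_norm p ref_triangle vx + Lp_norm p ref_triangle vy)"
    have "0 \<le> s"
      unfolding s_def using theta_bound_pos by (intro mult_nonneg_nonneg add_nonneg_nonneg Lp_norm_nonneg) auto
    moreover have "E = 64 * s" by (simp only: E_def s_def mult.assoc)
    moreover have "10 ^ 6 * (1 + theta_bound) * (Lp_norm p ref_triangle vx + Lp_norm p ref_triangle vy) = 10 ^ 6 * s"
      by (simp only: s_def mult.assoc)
    ultimately show ?thesis by simp
  qed
  finally show ?thesis by blast
qed

section \<open>Continuous representatives on the reference triangle\<close>

lemma Lp_one: "f \<in> Lp_space 1 U \<Longrightarrow> integrable (lebesgue_on U) f" "Lp_norm 1 U f = (LINT x|lebesgue_on U. \<bar>f x\<bar>)"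
proof -
  show "Lp_norm 1 U f = (LINT x|lebesgue_on U. \<bar>f x\<bar>)" by (simp add: Lp_norm_def)
  assume f: "f \<in> Lp_space 1 U"
  then have "integrable (lebesgue_on U) (\<lambda>x. \<bar>f x\<bar>)" by (simp add: Lp_space_def)
  then show "integrable (lebesgue_on U) f"
    using Lp_space_measurable[OF f] integrable_abs_iff by blast
qed

text \<open>Order 2 transforms with the worst factor, \<open>3 * 8 * 4 * 4 = 384\<close>, and order
  1 enters twice, so 1600 is a generous total.\<close>

lemma corner_continuous:
  assumes c: "corner z e f z' e' f'" and v: "v \<in> sobolev_space 2 1 ref_triangle"
  shows "\<exists>g. continuous_on UNIV g \<and> (AE x in lebesgue. x \<in> aff z' e' f' -` unit_square \<longrightarrow> v x = g x) \<and>
    (\<forall>x. \<bar>g x\<bar> \<le> (1 + theta_bound)\<^sup>2 * 1600 * (\<Sum>l\<le>2. sobolev_seminorm l 1 ref_triangle v))"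
proof -
  let ?F = "aff z e f" and ?G = "aff z' e' f'"
  let ?V = "?F -` ref_triangle" and ?S = unit_square
  have inv: "?F (?G x) = x" for x using c unfolding corner_def by blast
  have sub: "unit_square \<subseteq> ?V" and det: "\<bar>det2 e f\<bar> = 1 / 4" "\<bar>det2 e' f'\<bar> = 4"
    and ef: "\<bar>fst e\<bar> \<le> 1" "\<bar>snd e\<bar> \<le> 1" "\<bar>fst f\<bar> \<le> 1" "\<bar>snd f\<bar> \<le> 1"
    using c by (auto simp: corner_def)
  have det0: "det2 e f \<noteq> 0" "det2 e' f' \<noteq> 0" using det by auto
  have oV: "open ?V" by (rule open_vimage_aff[OF open_ref_triangle])
  have one: "(1::ereal) \<le> 1" by simp
  define w where "w = (\<lambda>x. v (?F x))"
  have w: "w \<in> sobolev_space 2 1 ?V"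
    unfolding w_def by (rule sobolev_space_aff[OF one det0(1) open_ref_triangle v])
  define D where "D i j = weak_deriv ?V (i, j) w" for i j
  have D: "has_weak_deriv ?V (i, j) w (D i j)" "D i j \<in> Lp_space 1 ?V" if "i + j \<le> 2" for i j
    unfolding D_def using sobolev_space_weak_deriv[OF one oV w that] by auto
  have DS: "has_weak_deriv ?S (i, j) w (D i j)" "D i j \<in> Lp_space 1 ?S" "Lp_norm 1 ?S (D i j) \<le> sobolev_seminorm (i + j) 1 ?V w"
    if "i + j \<le> 2" for i j
  proof -
    show "has_weak_deriv ?S (i, j) w (D i j)" by (rule has_weak_deriv_subset[OF oV open_box sub D(1)[OF that]])
    show "D i j \<in> Lp_space 1 ?S" by (rule Lp_subset(1)[OF one oV open_box sub D(2)[OF that]])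
    show "Lp_norm 1 ?S (D i j) \<le> sobolev_seminorm (i + j) 1 ?V w"
      using Lp_subset(2)[OF one oV open_box sub D(2)[OF that]] Lp_norm_le_seminorm[of 1 ?V i j w]
      unfolding D_def by linarith
  qed
  have d00: "AE x in lebesgue_on ?S. D 0 0 x = w x"
  proof -
    have "locally_integrable ?S w" using DS(1)[of 0 0] by (simp add: has_weak_deriv_iff)
    from has_weak_deriv_AE_unique[OF open_box DS(1)[of 0 0] has_weak_deriv_self[OF this]] show ?thesis by simp
  qed
  have d1: "has_weak_deriv ?S (1, 0) (D 0 0) (D 1 0)" "has_weak_deriv ?S (0, 1) (D 0 0) (D 0 1)"
    "has_weak_deriv ?S (1, 0) (D 1 0) (D 2 0)" "has_weak_deriv ?S (0, 1) (D 1 0) (D 1 1)"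
    using has_weak_deriv_shift[OF DS(1)[of 0 0], of 1 0 "D 1 0"] has_weak_deriv_shift[OF DS(1)[of 0 0], of 0 1 "D 0 1"]
      has_weak_deriv_shift[OF DS(1)[of 1 0], of 1 0 "D 2 0"] has_weak_deriv_shift[OF DS(1)[of 1 0], of 0 1 "D 1 1"]
      DS(1)[of 1 0] DS(1)[of 0 1] DS(1)[of 2 0] DS(1)[of 1 1]
    by (simp_all add: numeral_2_eq_2)
  note i = Lp_one(1)[OF DS(2)]
  have "\<exists>g. continuous_on UNIV g \<and> (AE z in lebesgue_on ?S. D 0 0 z = g z) \<and>
    (\<forall>z. \<bar>g z\<bar> \<le> (1 + theta_bound)\<^sup>2 * ((LINT z|lebesgue_on ?S. \<bar>D 0 0 z\<bar>) + (LINT z|lebesgue_on ?S. \<bar>D 1 0 z\<bar>)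
      + (LINT z|lebesgue_on ?S. \<bar>D 0 1 z\<bar>) + (LINT z|lebesgue_on ?S. \<bar>D 1 1 z\<bar>)))"
    by (rule continuous_representative_unit_square[OF i i i i d1]) simp_all
  then obtain g where g: "continuous_on UNIV g" "AE x in lebesgue_on ?S. D 0 0 x = g x"
    "\<And>x. \<bar>g x\<bar> \<le> (1 + theta_bound)\<^sup>2 * (Lp_norm 1 ?S (D 0 0) + Lp_norm 1 ?S (D 1 0) + Lp_norm 1 ?S (D 0 1) + Lp_norm 1 ?S (D 1 1))"
    unfolding Lp_one(2) by blast
  have semi: "sobolev_seminorm l 1 ?V w \<le> 384 * sobolev_seminorm l 1 ref_triangle v" if "l \<le> 2" for l
  proof -
    have "sobolev_seminorm l 1 ?V w \<le> real (l + 1) * 2 ^ (l + 1) * (2 * 1) ^ l * \<bar>det2 e f\<bar> powr (- (1 / real_of_ereal 1)) * sobolev_seminorm l 1 ref_triangle v"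
      unfolding w_def by (rule sobolev_seminorm_aff[OF one det0(1) open_ref_triangle v that ef])
    also have "\<dots> \<le> 384 * sobolev_seminorm l 1 ref_triangle v"
    proof (intro mult_right_mono sobolev_seminorm_nonneg)
      have "l = 0 \<or> l = 1 \<or> l = 2" using that by auto
      then show "real (l + 1) * 2 ^ (l + 1) * (2 * 1) ^ l * \<bar>det2 e f\<bar> powr (- (1 / real_of_ereal 1)) \<le> 384"
        by (auto simp: det powr_minus)
    qed
    finally show ?thesis .
  qed
  define T where "T = (\<Sum>l\<le>2. sobolev_seminorm l 1 ref_triangle v)"
  have T: "T = sobolev_seminorm 0 1 ref_triangle v + sobolev_seminorm 1 1 ref_triangle v + sobolev_seminorm 2 1 ref_triangle v"
    by (simp add: T_def numeral_2_eq_2)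
  note nn = sobolev_seminorm_nonneg[of 0 1 ref_triangle v] sobolev_seminorm_nonneg[of 1 1 ref_triangle v] sobolev_seminorm_nonneg[of 2 1 ref_triangle v]
  have "Lp_norm 1 ?S (D 0 0) + Lp_norm 1 ?S (D 1 0) + Lp_norm 1 ?S (D 0 1) + Lp_norm 1 ?S (D 1 1) \<le> 1600 * T"
    using DS(3)[of 0 0] DS(3)[of 1 0] DS(3)[of 0 1] DS(3)[of 1 1] semi[of 0] semi[of 1] semi[of 2] nn
    unfolding T by (simp add: numeral_2_eq_2)
  then have bound: "\<bar>g x\<bar> \<le> (1 + theta_bound)\<^sup>2 * 1600 * T" for x
    using order_trans[OF g(3)[of x] mult_left_mono[of _ "1600 * T" "(1 + theta_bound)\<^sup>2"]] by (simp add: mult.assoc)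
  have "AE x in lebesgue. x \<in> ?S \<longrightarrow> w x = g x"
    using d00 g(2) unfolding AE_lebesgue_on_iff[OF open_sets_lebesgue[OF open_box]]
    by eventually_elim auto
  from AE_lebesgue_aff[OF det0(2) this, of z']
  have "AE x in lebesgue. x \<in> ?G -` ?S \<longrightarrow> v x = g (?G x)"
    by eventually_elim (simp add: w_def inv)
  moreover have "continuous_on UNIV (\<lambda>x. g (?G x))"
    by (rule continuous_on_compose2[OF g(1) continuous_on_aff]) auto
  ultimately show ?thesis using bound unfolding T_def by blast
qed

text \<open>Any two of the local representatives agree on the open medial triangle, which lies in
  all patches, and by continuity on its closure. Two of the closed pieces \<open>C1\<close>,
  \<open>C2\<close>, \<open>C3\<close> meet exactly there, so the three functions glue.\<close>

lemma continuous_representative_ref_triangle: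
  assumes v: "v \<in> sobolev_space 2 1 ref_triangle"
  shows "\<exists>g. continuous_on closed_ref_triangle g \<and> (AE x in lebesgue. x \<in> ref_triangle \<longrightarrow> v x = g x) \<and>
    (\<forall>x. \<bar>g x\<bar> \<le> (1 + theta_bound)\<^sup>2 * 1600 * (\<Sum>l\<le>2. sobolev_seminorm l 1 ref_triangle v))"
proof -
  let ?B = "(1 + theta_bound)\<^sup>2 * 1600 * (\<Sum>l\<le>2. sobolev_seminorm l 1 ref_triangle v)"
  obtain g1 where g1: "continuous_on UNIV g1" "AE x in lebesgue. x \<in> patch1 \<longrightarrow> v x = g1 x" "\<forall>x. \<bar>g1 x\<bar> \<le> ?B"
    using corner_continuous[OF corner1 v] unfolding patch1_def by blast
  obtain g2 where g2: "continuous_on UNIV g2" "AE x in lebesgue. x \<in> patch2 \<longrightarrow> v x = g2 x" "\<forall>x. \<bar>g2 x\<bar> \<le> ?B"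
    using corner_continuous[OF corner2 v] unfolding patch2_def by blast
  obtain g3 where g3: "continuous_on UNIV g3" "AE x in lebesgue. x \<in> patch3 \<longrightarrow> v x = g3 x" "\<forall>x. \<bar>g3 x\<bar> \<le> ?B"
    using corner_continuous[OF corner3 v] unfolding patch3_def by blast
  define M where "M = patch1 \<inter> patch2 \<inter> patch3"
  have oM: "open M" unfolding M_def by (intro open_Int open_patch)
  have eqM: "g x = h x" if g: "continuous_on UNIV g" "AE x in lebesgue. x \<in> P \<longrightarrow> v x = g x"
      and h: "continuous_on UNIV h" "AE x in lebesgue. x \<in> Q \<longrightarrow> v x = h x"
      and P: "M \<subseteq> P" "M \<subseteq> Q" and x: "0 \<le> fst x" "fst x \<le> 1 / 2" "0 \<le> snd x" "snd x \<le> 1 / 2" "0 \<le> 1 - fst x - snd x" "1 - fst x - snd x \<le> 1 / 2"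
    for g h P Q x
  proof -
    have "AE x in lebesgue. x \<in> M \<longrightarrow> g x = h x"
      using g(2) h(2) by eventually_elim (use P in auto)
    then have gh: "g y = h y" if "y \<in> M" for y
      using AE_eq_imp_eq_on_open[OF oM _ _ _ that, of g h] g(1) h(1) continuous_on_subset by blast
    \<comment> \<open>Proper steps from the closed medial triangle towards the centroid stay in the
      open one.\<close>
    let ?X = "\<lambda>n. (1 - 1 / real (Suc n)) *\<^sub>R x + (1 / real (Suc n)) *\<^sub>R (1 / 3, 1 / 3)"
    have X: "?X \<longlonglongrightarrow> x" by (rule tendsto_to_barycentre)
    have XM: "?X n \<in> M" for n
    proof -
      let ?t = "1 / real (Suc n)"
      have f: "fst (?X n) = (1 - ?t) * fst x + ?t * (1 / 3)" and s: "snd (?X n) = (1 - ?t) * snd x + ?t * (1 / 3)" by simp_all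
      have r: "1 - fst (?X n) - snd (?X n) = (1 - ?t) * (1 - fst x - snd x) + ?t * (1 / 3)"
        unfolding f s by (rule barycentre_third)
      have h: "0 < (1 / 3 :: real)" "1 / 3 < (1 / 2 :: real)" by simp_all
      show ?thesis
        unfolding M_def Int_iff mem_patch r unfolding f s
        using in_between[OF x(1,2) h] in_between[OF x(3,4) h] in_between[OF x(5,6) h] by blast
    qed
    have lim: "(\<lambda>n. k (?X n)) \<longlonglongrightarrow> k x" if "continuous_on UNIV k" for k :: "point \<Rightarrow> real"
      by (rule continuous_on_tendsto_compose[OF that X]) auto
    have "(\<lambda>n. h (?X n)) \<longlonglongrightarrow> g x" using lim[OF g(1)] by (simp only: gh[OF XM])
    then show ?thesis using lim[OF h(1)] by (rule LIMSEQ_unique)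
  qed
  have MP: "M \<subseteq> patch1" "M \<subseteq> patch2" "M \<subseteq> patch3" by (auto simp: M_def)
  define C1 C2 C3 where "C1 = closed_ref_triangle \<inter> {x. fst x \<le> 1 / 2 \<and> snd x \<le> 1 / 2}"
    and "C2 = closed_ref_triangle \<inter> {x. 1 - fst x - snd x \<le> 1 / 2 \<and> snd x \<le> 1 / 2}"
    and "C3 = closed_ref_triangle \<inter> {x. 1 - fst x - snd x \<le> 1 / 2 \<and> fst x \<le> 1 / 2}"
  have closed: "closed C1" "closed C2" "closed C3"
    unfolding C1_def C2_def C3_def
    by (intro closed_Int closed_closed_ref_triangle closed_Collect_conj closed_Collect_le continuous_intros)+
  have cover: "closed_ref_triangle = C1 \<union> (C2 \<union> C3)"
    by (auto simp: C1_def C2_def C3_def closed_ref_triangle_def)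
  define g where "g x = (if x \<in> C1 then g1 x else if x \<in> C2 then g2 x else g3 x)" for x
  have e1: "g x = g1 x" if "x \<in> C1" for x using that by (simp add: g_def)
  have e2: "g x = g2 x" if "x \<in> C2" for x
    using that eqM[OF g1(1,2) g2(1,2) MP(1,2), of x] by (auto simp: g_def C1_def C2_def closed_ref_triangle_def)
  have e3: "g x = g3 x" if "x \<in> C3" for x
    using that eqM[OF g1(1,2) g3(1,2) MP(1,3), of x] eqM[OF g2(1,2) g3(1,2) MP(2,3), of x]
    by (auto simp: g_def C1_def C2_def C3_def closed_ref_triangle_def)
  have "continuous_on C1 g" "continuous_on C2 g" "continuous_on C3 g"
    by (rule continuous_on_eq[OF continuous_on_subset[OF g1(1)]], simp, simp add: e1,
        rule continuous_on_eq[OF continuous_on_subset[OF g2(1)]], simp, simp add: e2,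
        rule continuous_on_eq[OF continuous_on_subset[OF g3(1)]], simp, simp add: e3)
  then have "continuous_on closed_ref_triangle g"
    unfolding cover by (intro continuous_on_closed_Un closed closed_Un)
  moreover have "AE x in lebesgue. x \<in> ref_triangle \<longrightarrow> v x = g x"
    using AE_patch_cover g1(2) g2(2) g3(2)
  proof eventually_elim
    case (elim x)
    have "x \<in> C1" if "x \<in> patch1" using that patch_subset by (auto simp: C1_def mem_patch closed_ref_triangle_def)
    moreover have "x \<in> C2" if "x \<in> patch2" using that by (auto simp: C2_def mem_patch closed_ref_triangle_def)
    moreover have "x \<in> C3" if "x \<in> patch3" using that by (auto simp: C3_def mem_patch closed_ref_triangle_def)
    ultimately show ?case using elim e1 e2 e3 by metis
  qed
  moreover have "\<forall>x. \<bar>g x\<bar> \<le> ?B" using g1(3) g2(3) g3(3) by (simp add: g_def)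
  ultimately show ?thesis by blast
qed

subsection \<open>Polynomial approximation\<close>

lemma sobolev_space_mono: "v \<in> sobolev_space n p U \<Longrightarrow> m \<le> n \<Longrightarrow> v \<in> sobolev_space m p U"
  unfolding sobolev_space_def multi_indices_def by fastforce

lemma sobolev_space_ref_L1:
  assumes p: "1 \<le> p" and v: "v \<in> sobolev_space n p ref_triangle"
  shows "v \<in> sobolev_space n 1 ref_triangle"
    "l \<le> n \<Longrightarrow> sobolev_seminorm l 1 ref_triangle v \<le> 2 * sobolev_seminorm l p ref_triangle v"
proof -
  note L = L1_le_Lp[OF p open_ref_triangle emeasure_ref_triangle]
  have in1: "f \<in> Lp_space 1 ref_triangle" if "f \<in> Lp_space p ref_triangle" for f
    using L(1)[OF that] by (simp add: Lp_space_def borel_measurable_integrable)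
  show "v \<in> sobolev_space n 1 ref_triangle"
  proof (rule sobolev_spaceI)
    fix i j assume "i + j \<le> n"
    from sobolev_space_weak_deriv[OF p open_ref_triangle v this]
    show "\<exists>w. has_weak_deriv ref_triangle (i, j) v w \<and> w \<in> Lp_space 1 ref_triangle" using in1 by blast
  qed
  assume l: "l \<le> n"
  show "sobolev_seminorm l 1 ref_triangle v \<le> 2 * sobolev_seminorm l p ref_triangle v"
    unfolding sobolev_seminorm_def sum_distrib_left
  proof (rule sum_mono)
    fix i assume "i \<in> {..l}"
    then have "i + (l - i) \<le> n" using l by simp
    from L(2)[OF sobolev_space_weak_deriv(2)[OF p open_ref_triangle v this]]
    show "Lp_norm 1 ref_triangle (weak_deriv ref_triangle (i, l - i) v) \<le> 2 * Lp_norm p ref_triangle (weak_deriv ref_triangle (i, l - i) v)"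
      unfolding Lp_one(2) .
  qed
qed

lemma sobolev_space_weak_deriv_space:
  assumes p: "1 \<le> p" and U: "open U" and v: "v \<in> sobolev_space n p U" and ab: "a + b + m \<le> n"
  shows "weak_deriv U (a, b) v \<in> sobolev_space m p U"
    "sobolev_seminorm m p U (weak_deriv U (a, b) v) \<le> sobolev_seminorm (a + b + m) p U v"
proof -
  note V = sobolev_space_weak_deriv[OF p U v]
  have sh: "has_weak_deriv U (i, j) (weak_deriv U (a, b) v) (weak_deriv U (a + i, b + j) v)"
    "weak_deriv U (a + i, b + j) v \<in> Lp_space p U" if "i + j \<le> m" for i j
    using has_weak_deriv_shift[OF V(1)[of a b] V(1)[of "a + i" "b + j"]] V(2)[of "a + i" "b + j"] that ab by auto
  show "weak_deriv U (a, b) v \<in> sobolev_space m p U"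
    by (rule sobolev_spaceI) (use sh in blast)
  have "sobolev_seminorm m p U (weak_deriv U (a, b) v) = (\<Sum>i\<le>m. Lp_norm p U (weak_deriv U (a + i, b + (m - i)) v))"
    unfolding sobolev_seminorm_def
    by (intro sum.cong refl weak_deriv_Lp(2)[OF p U sh]) auto
  also have "\<dots> = (\<Sum>i\<in>(+) a ` {..m}. Lp_norm p U (weak_deriv U (i, a + b + m - i) v))"
    by (subst sum.reindex) (auto intro!: sum.cong simp: inj_on_def)
  also have "\<dots> \<le> sobolev_seminorm (a + b + m) p U v"
    unfolding sobolev_seminorm_def by (intro sum_mono2) (auto simp: Lp_norm_nonneg)
  finally show "sobolev_seminorm m p U (weak_deriv U (a, b) v) \<le> sobolev_seminorm (a + b + m) p U v" .
qed

text \<open>The partial derivatives are named because they are evaluated and estimated at boundary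
  points.\<close>

definition C1_ref :: "(point \<Rightarrow> real) \<Rightarrow> (point \<Rightarrow> real) \<Rightarrow> (point \<Rightarrow> real) \<Rightarrow> bool" where
  "C1_ref g g1 g2 \<longleftrightarrow> continuous_on closed_ref_triangle g1 \<and> continuous_on closed_ref_triangle g2 \<and>
    (\<forall>x\<in>closed_ref_triangle. (g has_derivative (\<lambda>h. fst h * g1 x + snd h * g2 x)) (at x within closed_ref_triangle))"

lemma C1_ref_add:
  assumes "C1_ref g g1 g2" "C1_ref h h1 h2"
  shows "C1_ref (\<lambda>x. g x + h x) (\<lambda>x. g1 x + h1 x) (\<lambda>x. g2 x + h2 x)"
  unfolding C1_ref_def
proof (intro conjI ballI)
  show "continuous_on closed_ref_triangle (\<lambda>x. g1 x + h1 x)" "continuous_on closed_ref_triangle (\<lambda>x. g2 x + h2 x)"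
    using assms unfolding C1_ref_def by (auto intro: continuous_on_add)
  fix x assume x: "x \<in> closed_ref_triangle"
  have "((\<lambda>x. g x + h x) has_derivative (\<lambda>k. (fst k * g1 x + snd k * g2 x) + (fst k * h1 x + snd k * h2 x))) (at x within closed_ref_triangle)"
    using assms x unfolding C1_ref_def by (intro has_derivative_add) auto
  then show "((\<lambda>x. g x + h x) has_derivative (\<lambda>k. fst k * (g1 x + h1 x) + snd k * (g2 x + h2 x))) (at x within closed_ref_triangle)"
    by (simp add: algebra_simps)
qed

text \<open>\<open>v\<close> and its first derivatives each have two further derivatives in
  \<open>L^1\<close>, hence continuous representatives. Those of the derivatives are weak
  derivatives of that of \<open>v\<close>; continuity makes them classical, inside the triangle and
  then up to its boundary.\<close>

lemma C1_representative_ref_triangle: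
  assumes v: "v \<in> sobolev_space 3 1 ref_triangle"
  shows "\<exists>g g1 g2. C1_ref g g1 g2 \<and> (AE x in lebesgue. x \<in> ref_triangle \<longrightarrow> v x = g x) \<and>
    (\<forall>x. \<bar>g x\<bar> \<le> (1 + theta_bound)\<^sup>2 * 1600 * (\<Sum>l\<le>3. sobolev_seminorm l 1 ref_triangle v) \<and>
      \<bar>g1 x\<bar> \<le> (1 + theta_bound)\<^sup>2 * 1600 * (\<Sum>l\<le>3. sobolev_seminorm l 1 ref_triangle v) \<and>
      \<bar>g2 x\<bar> \<le> (1 + theta_bound)\<^sup>2 * 1600 * (\<Sum>l\<le>3. sobolev_seminorm l 1 ref_triangle v))"
proof -
  let ?R = ref_triangle
  let ?N = "\<Sum>l\<le>3. sobolev_seminorm l 1 ?R v"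
  have one: "(1::ereal) \<le> 1" by simp
  note V = sobolev_space_weak_deriv[OF one open_ref_triangle v]
  note dx = sobolev_space_weak_deriv_space[OF one open_ref_triangle v, of 1 0]
  note dy = sobolev_space_weak_deriv_space[OF one open_ref_triangle v, of 0 1]
  have N: "?N = sobolev_seminorm 0 1 ?R v + sobolev_seminorm 1 1 ?R v + sobolev_seminorm 2 1 ?R v + sobolev_seminorm 3 1 ?R v"
    by (simp add: numeral_3_eq_3 numeral_2_eq_2)
  have N2: "(\<Sum>l\<le>2. sobolev_seminorm l 1 ?R w) = sobolev_seminorm 0 1 ?R w + sobolev_seminorm 1 1 ?R w + sobolev_seminorm 2 1 ?R w" for w
    by (simp add: numeral_2_eq_2)
  note nn = sobolev_seminorm_nonneg[of 0 1 ?R v] sobolev_seminorm_nonneg[of 3 1 ?R v]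
  have le: "(\<Sum>l\<le>2. sobolev_seminorm l 1 ?R v) \<le> ?N"
    "(\<Sum>l\<le>2. sobolev_seminorm l 1 ?R (weak_deriv ?R (1, 0) v)) \<le> ?N"
    "(\<Sum>l\<le>2. sobolev_seminorm l 1 ?R (weak_deriv ?R (0, 1) v)) \<le> ?N"
    using dx(2)[of 0] dx(2)[of 1] dx(2)[of 2] dy(2)[of 0] dy(2)[of 1] dy(2)[of 2] nn
    unfolding N N2 by (simp_all add: numeral_2_eq_2 numeral_3_eq_3)
  have C: "0 \<le> (1 + theta_bound)\<^sup>2 * 1600" by simp
  obtain g where g: "continuous_on closed_ref_triangle g" "AE x in lebesgue. x \<in> ?R \<longrightarrow> v x = g x"
    "\<forall>x. \<bar>g x\<bar> \<le> (1 + theta_bound)\<^sup>2 * 1600 * (\<Sum>l\<le>2. sobolev_seminorm l 1 ?R v)"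
    using continuous_representative_ref_triangle[OF sobolev_space_mono[OF v, of 2]] by auto
  have d3: "(1::nat) + 0 + 2 \<le> 3" "(0::nat) + 1 + 2 \<le> 3" by simp_all
  obtain g1 where g1: "continuous_on closed_ref_triangle g1" "AE x in lebesgue. x \<in> ?R \<longrightarrow> weak_deriv ?R (1, 0) v x = g1 x"
    "\<forall>x. \<bar>g1 x\<bar> \<le> (1 + theta_bound)\<^sup>2 * 1600 * (\<Sum>l\<le>2. sobolev_seminorm l 1 ?R (weak_deriv ?R (1, 0) v))"
    using continuous_representative_ref_triangle[OF dx(1)[OF d3(1)]] by auto
  obtain g2 where g2: "continuous_on closed_ref_triangle g2" "AE x in lebesgue. x \<in> ?R \<longrightarrow> weak_deriv ?R (0, 1) v x = g2 x"
    "\<forall>x. \<bar>g2 x\<bar> \<le> (1 + theta_bound)\<^sup>2 * 1600 * (\<Sum>l\<le>2. sobolev_seminorm l 1 ?R (weak_deriv ?R (0, 1) v))"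
    using continuous_representative_ref_triangle[OF dy(1)[OF d3(2)]] by auto
  note ae = g(2)[folded AE_lebesgue_on_iff[OF open_sets_lebesgue[OF open_ref_triangle]]]
    g1(2)[folded AE_lebesgue_on_iff[OF open_sets_lebesgue[OF open_ref_triangle]]]
    g2(2)[folded AE_lebesgue_on_iff[OF open_sets_lebesgue[OF open_ref_triangle]]]
  have d: "has_weak_deriv ?R (1, 0) g g1" "has_weak_deriv ?R (0, 1) g g2"
    by (rule has_weak_deriv_cong[OF open_ref_triangle V(1) ae(1) ae(2)], simp,
        rule has_weak_deriv_cong[OF open_ref_triangle V(1) ae(1) ae(3)], simp)
  have sub: "?R \<subseteq> closed_ref_triangle" unfolding closure_ref_triangle[symmetric] by (rule closure_subset)
  note cd = classical_derivative[OF open_ref_triangle continuous_on_subset[OF g(1) sub] continuous_on_subset[OF g1(1) sub]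
      continuous_on_subset[OF g2(1) sub] d]
  have "C1_ref g g1 g2"
    unfolding C1_ref_def
    using has_derivative_closure_convex[OF open_ref_triangle convex_ref_triangle, unfolded closure_ref_triangle, OF g(1) g1(1) g2(1) cd]
      g1(1) g2(1) by blast
  moreover have "\<bar>g x\<bar> \<le> (1 + theta_bound)\<^sup>2 * 1600 * ?N" "\<bar>g1 x\<bar> \<le> (1 + theta_bound)\<^sup>2 * 1600 * ?N"
    "\<bar>g2 x\<bar> \<le> (1 + theta_bound)\<^sup>2 * 1600 * ?N" for x
    using order_trans[OF g(3)[rule_format, of x] mult_left_mono[OF le(1) C]]
      order_trans[OF g1(3)[rule_format, of x] mult_left_mono[OF le(2) C]]
      order_trans[OF g2(3)[rule_format, of x] mult_left_mono[OF le(3) C]] by auto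
  ultimately show ?thesis using g(2) by blast
qed

section \<open>Polynomials on the reference triangle and their derivatives\<close>

definition pow_derivs :: "nat \<Rightarrow> nat \<Rightarrow> real \<Rightarrow> real" where
  "pow_derivs i a t = (if a \<le> i then fact i / fact (i - a) * t ^ (i - a) else 0)"

lemma derivs_pow: "derivs (pow_derivs i)"
  unfolding derivs_def
proof (intro allI)
  fix a and t :: real
  consider "a < i" | "a \<ge> i" by linarith
  then show "(pow_derivs i a has_real_derivative pow_derivs i (Suc a) t) (at t)"
  proof cases
    case 1
    then obtain m where m: "i - a = Suc m" "i - Suc a = m" by (metis Suc_diff_Suc)
    have "((\<lambda>t. fact i / fact (Suc m) * t ^ Suc m) has_real_derivative fact i / fact (Suc m) * (real (Suc m) * t ^ m)) (at t)"
      by (intro DERIV_cmult) (rule DERIV_cong[OF DERIV_power[OF DERIV_ident]], simp)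
    also have "fact i / fact (Suc m) * (real (Suc m) * t ^ m) = fact i / fact m * t ^ m"
      by (simp add: fact_Suc del: of_nat_Suc)
    finally show ?thesis using 1 m by (simp add: pow_derivs_def[abs_def] del: fact_Suc power_Suc)
  next
    case 2
    have "pow_derivs i a = (\<lambda>t. if a = i then fact i else 0)" "pow_derivs i (Suc a) t = 0"
      using 2 by (auto simp: pow_derivs_def fun_eq_iff)
    then show ?thesis by simp
  qed
qed

definition poly_partials :: "nat \<Rightarrow> (nat \<Rightarrow> nat \<Rightarrow> real) \<Rightarrow> partials" where
  "poly_partials k c a b z = (\<Sum>(i, j)\<in>multi_indices k. c i j * (pow_derivs i a (fst z) * pow_derivs j b (snd z)))"

definition poly_fun :: "nat \<Rightarrow> (nat \<Rightarrow> nat \<Rightarrow> real) \<Rightarrow> point \<Rightarrow> real" where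
  "poly_fun k c = (\<lambda>(x, y). \<Sum>(i, j)\<in>multi_indices k. c i j * x ^ i * y ^ j)"

lemma poly_space_iff: "P \<in> poly_space k \<longleftrightarrow> (\<exists>c. P = poly_fun k c)"
  by (simp add: poly_space_def poly_fun_def)

lemma poly_fun_partials: "poly_partials k c 0 0 = poly_fun k c"
  by (simp add: poly_partials_def poly_fun_def pow_derivs_def fun_eq_iff split_def mult.assoc)

lemma has_partials_poly: "has_partials (poly_fun k c) (poly_partials k c)"
  unfolding has_partials_def
proof (intro conjI allI poly_fun_partials)
  fix a b z
  let ?D = "\<lambda>i j a b z. pow_derivs i a (fst z) * pow_derivs j b (snd z)"
  have "((\<lambda>z. c i j * ?D i j a b z) has_derivative
      (\<lambda>h. c i j * (\<lambda>(s, t). s * ?D i j (Suc a) b z + t * ?D i j a (Suc b) z) h)) (at z)" for i j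
    by (intro has_derivative_mult_right has_partials_D[OF has_partials_tensor[OF derivs_pow derivs_pow]])
  then have "((\<lambda>z. \<Sum>q\<in>multi_indices k. c (fst q) (snd q) * ?D (fst q) (snd q) a b z) has_derivative
      (\<lambda>h. \<Sum>q\<in>multi_indices k. c (fst q) (snd q) * (\<lambda>(s, t). s * ?D (fst q) (snd q) (Suc a) b z + t * ?D (fst q) (snd q) a (Suc b) z) h)) (at z)"
    by (intro has_derivative_sum)
  then show "(poly_partials k c a b has_derivative
      (\<lambda>(s, t). s * poly_partials k c (Suc a) b z + t * poly_partials k c a (Suc b) z)) (at z)"
    unfolding poly_partials_def[abs_def] split_def
    by (rule has_derivative_eq_rhs) (simp add: sum_distrib_left sum.distrib fun_eq_iff algebra_simps)
qed

lemma pow_derivs_bound: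
  assumes "0 \<le> t" "t \<le> 1"
  shows "\<bar>pow_derivs i a t\<bar> \<le> fact i"
proof (cases "a \<le> i")
  case True
  have "fact i / fact (i - a) * t ^ (i - a) \<le> (fact i / 1 :: real) * 1"
    using assms by (intro mult_mono divide_left_mono power_le_one) (auto simp: fact_ge_1)
  then show ?thesis using True assms by (simp add: pow_derivs_def)
qed (simp add: pow_derivs_def)

lemma poly_partials_bound:
  assumes c: "\<And>i j. \<bar>c i j\<bar> \<le> M" and z: "z \<in> closed_ref_triangle"
  shows "\<bar>poly_partials k c a b z\<bar> \<le> M * (\<Sum>(i, j)\<in>multi_indices k. fact i * fact j)"
proof -
  have b: "0 \<le> fst z" "fst z \<le> 1" "0 \<le> snd z" "snd z \<le> 1" using z by (auto simp: closed_ref_triangle_def)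
  have M: "0 \<le> M" using c[of 0 0] by linarith
  have "\<bar>poly_partials k c a b z\<bar> \<le> (\<Sum>q\<in>multi_indices k. \<bar>c (fst q) (snd q) * (pow_derivs (fst q) a (fst z) * pow_derivs (snd q) b (snd z))\<bar>)"
    unfolding poly_partials_def split_def by (rule sum_abs)
  also have "\<dots> \<le> (\<Sum>q\<in>multi_indices k. M * (fact (fst q) * fact (snd q)))"
    unfolding abs_mult
    by (intro sum_mono mult_mono c pow_derivs_bound b mult_nonneg_nonneg M) auto
  also have "\<dots> = M * (\<Sum>(i, j)\<in>multi_indices k. fact i * fact j)"
    by (simp add: sum_distrib_left split_def)
  finally show ?thesis .
qed

lemma C1_ref_poly: "C1_ref (poly_fun k c) (poly_partials k c 1 0) (poly_partials k c 0 1)"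
  unfolding C1_ref_def
proof (intro conjI ballI has_partials_continuous[OF has_partials_poly])
  fix x
  have "(poly_fun k c has_derivative (\<lambda>(s, t). s * poly_partials k c 1 0 x + t * poly_partials k c 0 1 x)) (at x)"
    using has_partials_D[OF has_partials_poly[of k c], of 0 0 x] by (simp add: poly_fun_partials)
  then show "(poly_fun k c has_derivative (\<lambda>h. fst h * poly_partials k c 1 0 x + snd h * poly_partials k c 0 1 x)) (at x within closed_ref_triangle)"
    unfolding split_def by (rule has_derivative_at_withinI)
qed

lemma poly_partials_Lp:
  assumes p: "1 \<le> p" and c: "\<And>i j. \<bar>c i j\<bar> \<le> M"
  shows "poly_partials k c a b \<in> Lp_space p ref_triangle"
    "Lp_norm p ref_triangle (poly_partials k c a b) \<le> M * (\<Sum>(i, j)\<in>multi_indices k. fact i * fact j)"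
proof -
  let ?B = "M * (\<Sum>(i, j)\<in>multi_indices k. fact i * fact j)"
  have B: "\<bar>poly_partials k c a b z\<bar> \<le> ?B" if "z \<in> closed_ref_triangle" for z
    by (rule poly_partials_bound[where c = c and M = M and k = k and a = a and b = b, OF c that])
  have m: "poly_partials k c a b \<in> borel_measurable (lebesgue_on ref_triangle)"
    by (rule continuous_imp_measurable_on_sets_lebesgue[OF has_partials_continuous[OF has_partials_poly] open_sets_lebesgue[OF open_ref_triangle]])
  have sub: "ref_triangle \<subseteq> closed_ref_triangle" unfolding closure_ref_triangle[symmetric] by (rule closure_subset)
  have ae: "AE z in lebesgue_on ref_triangle. \<bar>poly_partials k c a b z\<bar> \<le> ?B"
    unfolding AE_lebesgue_on_iff[OF open_sets_lebesgue[OF open_ref_triangle]]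
    using B sub by (intro AE_I2) blast
  have "0 \<le> ?B"
    using B[of "(0, 0)"]
    by (auto simp: closed_ref_triangle_def intro: order_trans[OF abs_ge_zero])
  from Lp_bounded[OF p open_ref_triangle emeasure_ref_triangle m ae this]
  show "poly_partials k c a b \<in> Lp_space p ref_triangle" "Lp_norm p ref_triangle (poly_partials k c a b) \<le> ?B" by auto
qed

text \<open>Coefficients outside the admissible indices do not affect the polynomial and can be set
  to 0, which leaves finitely many to bound.\<close>

lemma ex_coeff_bound:
  "\<exists>c' M. poly_fun k c' = poly_fun k c \<and> poly_partials k c' = poly_partials k c \<and> (\<forall>i j. \<bar>c' i j\<bar> \<le> M)"
proof -
  let ?c' = "\<lambda>i j. if (i, j) \<in> multi_indices k then c i j else 0"
  have "poly_fun k ?c' = poly_fun k c" "poly_partials k ?c' = poly_partials k c"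
    by (auto simp: poly_fun_def poly_partials_def fun_eq_iff split_def intro!: sum.cong)
  moreover have "\<bar>?c' i j\<bar> \<le> (\<Sum>(i, j)\<in>multi_indices k. \<bar>c i j\<bar>)" for i j
    using member_le_sum[of "(i, j)" "multi_indices k" "\<lambda>(i, j). \<bar>c i j\<bar>"] finite_multi_indices
    by (auto intro!: sum_nonneg)
  ultimately show ?thesis by blast
qed

lemma poly_sobolev:
  assumes p: "1 \<le> p"
  shows "poly_fun k c \<in> sobolev_space n p ref_triangle" "poly_partials k c a b \<in> Lp_space p ref_triangle"
    "has_weak_deriv ref_triangle (a, b) (poly_fun k c) (poly_partials k c a b)"
proof -
  obtain c' M where c': "poly_fun k c' = poly_fun k c" "poly_partials k c' = poly_partials k c" "\<And>i j. \<bar>c' i j\<bar> \<le> M"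
    using ex_coeff_bound[of k c] by blast
  have L: "poly_partials k c a b \<in> Lp_space p ref_triangle" for a b
    using poly_partials_Lp(1)[where c = c' and M = M and k = k and a = a and b = b, OF p c'(3)] by (simp only: c'(2))
  have d: "has_weak_deriv ref_triangle (a, b) (poly_fun k c) (poly_partials k c a b)" for a b
    by (rule has_weak_deriv_classical[OF open_ref_triangle has_partials_poly])
  show "poly_fun k c \<in> sobolev_space n p ref_triangle" by (rule sobolev_spaceI) (use L d in blast)
  show "poly_partials k c a b \<in> Lp_space p ref_triangle" by (rule L)
  show "has_weak_deriv ref_triangle (a, b) (poly_fun k c) (poly_partials k c a b)" by (rule d)
qed

lemma sobolev_minus_poly:
  assumes p: "1 \<le> p" and v: "v \<in> sobolev_space n p ref_triangle" and ab: "a + b \<le> n"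
  shows "has_weak_deriv ref_triangle (a, b) (\<lambda>x. v x - poly_fun k c x) (\<lambda>x. weak_deriv ref_triangle (a, b) v x - poly_partials k c a b x)"
    "(\<lambda>x. weak_deriv ref_triangle (a, b) v x - poly_partials k c a b x) \<in> Lp_space p ref_triangle"
    "Lp_norm p ref_triangle (weak_deriv ref_triangle (a, b) (\<lambda>x. v x - poly_fun k c x))
      = Lp_norm p ref_triangle (\<lambda>x. weak_deriv ref_triangle (a, b) v x - poly_partials k c a b x)"
proof -
  note V = sobolev_space_weak_deriv[OF p open_ref_triangle v ab]
  show 1: "has_weak_deriv ref_triangle (a, b) (\<lambda>x. v x - poly_fun k c x) (\<lambda>x. weak_deriv ref_triangle (a, b) v x - poly_partials k c a b x)"
    by (rule has_weak_deriv_diff[OF open_ref_triangle V(1) poly_sobolev(3)[OF p]])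
  show 2: "(\<lambda>x. weak_deriv ref_triangle (a, b) v x - poly_partials k c a b x) \<in> Lp_space p ref_triangle"
    by (rule Lp_diff(1)[OF p V(2) poly_sobolev(2)[OF p]])
  show "Lp_norm p ref_triangle (weak_deriv ref_triangle (a, b) (\<lambda>x. v x - poly_fun k c x))
      = Lp_norm p ref_triangle (\<lambda>x. weak_deriv ref_triangle (a, b) v x - poly_partials k c a b x)"
    by (rule weak_deriv_Lp(2)[OF p open_ref_triangle 1 2])
qed

lemma sobolev_space_minus_poly:
  assumes "1 \<le> p" "v \<in> sobolev_space n p ref_triangle"
  shows "(\<lambda>x. v x - poly_fun k c x) \<in> sobolev_space n p ref_triangle"
  by (rule sobolev_spaceI) (use sobolev_minus_poly(1,2)[OF assms] in blast)

lemma poly_fun_diff: "poly_fun k c x - poly_fun k c' x = poly_fun k (\<lambda>i j. c i j - c' i j) x"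
  "poly_fun k c x + poly_fun k c' x = poly_fun k (\<lambda>i j. c i j + c' i j) x"
  by (simp_all add: poly_fun_def split_def sum_subtractf sum.distrib left_diff_distrib distrib_right)

section \<open>The Bramble-Hilbert lemma\<close>

text \<open>The factorials normalise the polynomial: its derivative of order \<open>m\<close> with
  \<open>a\<close> differentiations in the first variable is the constant
  \<open>c a\<close>.\<close>

definition homogeneous_coeff :: "nat \<Rightarrow> (nat \<Rightarrow> real) \<Rightarrow> nat \<Rightarrow> nat \<Rightarrow> real" where
  "homogeneous_coeff m c i j = (if i + j = m then c i / (fact i * fact j) else 0)"

lemma homogeneous_partials:
  assumes m: "m \<le> k"
  shows "a + b = m \<Longrightarrow> poly_partials k (homogeneous_coeff m c) a b z = c a"
    "m < a + b \<Longrightarrow> poly_partials k (homogeneous_coeff m c) a b z = 0"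
proof -
  assume ab: "a + b = m"
  have "poly_partials k (homogeneous_coeff m c) a b z = (\<Sum>q\<in>multi_indices k. if q = (a, b) then c a else 0)"
    unfolding poly_partials_def split_def
  proof (rule sum.cong[OF refl])
    fix q assume "q \<in> multi_indices k"
    obtain i j where q: "q = (i, j)" by (cases q)
    show "homogeneous_coeff m c (fst q) (snd q) * (pow_derivs (fst q) a (fst z) * pow_derivs (snd q) b (snd z)) = (if q = (a, b) then c a else 0)"
      using ab by (auto simp: q homogeneous_coeff_def pow_derivs_def)
  qed
  also have "\<dots> = c a"
    using ab m finite_multi_indices[of k] by (subst sum.delta) (auto simp: multi_indices_def)
  finally show "poly_partials k (homogeneous_coeff m c) a b z = c a" .
next
  assume "m < a + b"
  then show "poly_partials k (homogeneous_coeff m c) a b z = 0"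
    unfolding poly_partials_def by (intro sum.neutral) (auto simp: homogeneous_coeff_def pow_derivs_def)
qed

text \<open>Downward induction on the order \<open>n - d\<close> from which on all derivatives of \<open>v - P\<close> are
  controlled: Poincare's inequality controls the derivatives of order \<open>m\<close> up to constants, which
  a homogeneous polynomial of degree \<open>m\<close> removes without affecting the higher derivatives.\<close>

lemma bramble_hilbert_aux:
  assumes p: "1 \<le> p" and d: "d \<le> Suc k"
  shows "\<exists>C\<ge>0. \<forall>v\<in>sobolev_space (Suc k) p ref_triangle. \<exists>c. \<forall>a b. Suc k - d \<le> a + b \<longrightarrow> a + b \<le> Suc k \<longrightarrow>
    Lp_norm p ref_triangle (weak_deriv ref_triangle (a, b) (\<lambda>x. v x - poly_fun k c x)) \<le> C * sobolev_seminorm (Suc k) p ref_triangle v"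
  using d
proof (induction d)
  case 0
  have "poly_fun k (\<lambda>_ _. 0) = (\<lambda>x. 0)" by (simp add: poly_fun_def split_def)
  moreover have "Lp_norm p ref_triangle (weak_deriv ref_triangle (a, b) v) \<le> 1 * sobolev_seminorm (Suc k) p ref_triangle v"
    if "Suc k - 0 \<le> a + b" "a + b \<le> Suc k" for v a b
    using Lp_norm_le_seminorm[of p ref_triangle a b v] that by (simp add: le_antisym)
  ultimately show ?case
    by (intro exI[of _ 1] conjI ballI exI[of _ "\<lambda>_ _. 0"] allI impI) auto
next
  case (Suc d)
  let ?R = ref_triangle and ?n = "Suc k"
  define m where "m = ?n - Suc d"
  have m: "?n - d = Suc m" "m \<le> k" using Suc.prems by (auto simp: m_def)
  obtain C where C: "0 \<le> C" "\<And>v. v \<in> sobolev_space ?n p ?R \<Longrightarrow> \<exists>c. \<forall>a b. Suc m \<le> a + b \<longrightarrow> a + b \<le> ?n \<longrightarrow>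
      Lp_norm p ?R (weak_deriv ?R (a, b) (\<lambda>x. v x - poly_fun k c x)) \<le> C * sobolev_seminorm ?n p ?R v"
    using Suc unfolding m(1) by auto
  \<comment> \<open>The first derivatives of a derivative of order \<open>m\<close> have order
    \<open>m + 1\<close>, and each is bounded with the constant \<open>C\<close>; Poincare's
    inequality contributes its factor, and the last summand covers the higher orders.\<close>
  define C' where "C' = 10 ^ 6 * (1 + theta_bound) * (C + C) + C"
  have C': "0 \<le> C'" "C \<le> C'" using C(1) theta_bound_pos by (auto simp: C'_def)
  have "\<exists>c. \<forall>a b. m \<le> a + b \<longrightarrow> a + b \<le> ?n \<longrightarrow>
      Lp_norm p ?R (weak_deriv ?R (a, b) (\<lambda>x. v x - poly_fun k c x)) \<le> C' * sobolev_seminorm ?n p ?R v"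
    if v: "v \<in> sobolev_space ?n p ?R" for v
  proof -
    let ?E = "sobolev_seminorm ?n p ?R v"
    have E: "0 \<le> ?E" by (rule sobolev_seminorm_nonneg)
    obtain c where c: "\<And>a b. Suc m \<le> a + b \<Longrightarrow> a + b \<le> ?n \<Longrightarrow>
        Lp_norm p ?R (weak_deriv ?R (a, b) (\<lambda>x. v x - poly_fun k c x)) \<le> C * ?E"
      using C(2)[OF v] by blast
    define w where "w = (\<lambda>x. v x - poly_fun k c x)"
    have w: "w \<in> sobolev_space ?n p ?R" unfolding w_def by (rule sobolev_space_minus_poly[OF p v])
    note W = sobolev_space_weak_deriv[OF p open_ref_triangle w]
    have "\<exists>e. Lp_norm p ?R (\<lambda>x. weak_deriv ?R (a, m - a) w x - e) \<le> 10 ^ 6 * (1 + theta_bound) * (C * ?E + C * ?E)" if a: "a \<le> m" for a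
    proof -
      let ?b = "m - a"
      have n: "a + ?b \<le> ?n" "Suc a + ?b \<le> ?n" "a + Suc ?b \<le> ?n" using a m by auto
      have dd: "has_weak_deriv ?R (1, 0) (weak_deriv ?R (a, ?b) w) (weak_deriv ?R (Suc a, ?b) w)"
        "has_weak_deriv ?R (0, 1) (weak_deriv ?R (a, ?b) w) (weak_deriv ?R (a, Suc ?b) w)"
        using has_weak_deriv_shift[OF W(1)[OF n(1)], of 1 0] has_weak_deriv_shift[OF W(1)[OF n(1)], of 0 1] W(1)[OF n(2)] W(1)[OF n(3)]
        by simp_all
      obtain e where "Lp_norm p ?R (\<lambda>x. weak_deriv ?R (a, ?b) w x - e)
          \<le> 10 ^ 6 * (1 + theta_bound) * (Lp_norm p ?R (weak_deriv ?R (Suc a, ?b) w) + Lp_norm p ?R (weak_deriv ?R (a, Suc ?b) w))"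
        using poincare_ref_triangle[OF p W(2)[OF n(1)] W(2)[OF n(2)] W(2)[OF n(3)] dd] by blast
      also have "\<dots> \<le> 10 ^ 6 * (1 + theta_bound) * (C * ?E + C * ?E)"
        using c[of "Suc a" ?b] c[of a "Suc ?b"] n a theta_bound_pos
        by (intro mult_left_mono add_mono) (auto simp: w_def)
      finally show ?thesis by blast
    qed
    then obtain e where e: "\<And>a. a \<le> m \<Longrightarrow> Lp_norm p ?R (\<lambda>x. weak_deriv ?R (a, m - a) w x - e a) \<le> 10 ^ 6 * (1 + theta_bound) * (C * ?E + C * ?E)"
      by metis
    let ?h = "homogeneous_coeff m e"
    have eq: "(\<lambda>x. v x - poly_fun k (\<lambda>i j. c i j + ?h i j) x) = (\<lambda>x. w x - poly_fun k ?h x)"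
      by (simp add: w_def poly_fun_diff(2)[symmetric] fun_eq_iff)
    have "Lp_norm p ?R (weak_deriv ?R (a, b) (\<lambda>x. v x - poly_fun k (\<lambda>i j. c i j + ?h i j) x)) \<le> C' * ?E"
      if ab: "m \<le> a + b" "a + b \<le> ?n" for a b
      unfolding eq sobolev_minus_poly(3)[OF p w ab(2)]
    proof (cases "a + b = m")
      case True
      then have b: "b = m - a" "a \<le> m" by auto
      have "Lp_norm p ?R (\<lambda>x. weak_deriv ?R (a, b) w x - poly_partials k ?h a b x) \<le> 10 ^ 6 * (1 + theta_bound) * (C * ?E + C * ?E)"
        using e[OF b(2)] unfolding homogeneous_partials(1)[OF m(2) True] by (simp add: b(1))
      also have "\<dots> \<le> C' * ?E"
        using mult_nonneg_nonneg[OF C(1) E] by (simp add: C'_def algebra_simps)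
      finally show "Lp_norm p ?R (\<lambda>x. weak_deriv ?R (a, b) w x - poly_partials k ?h a b x) \<le> C' * ?E" .
    next
      case False
      then have lt: "m < a + b" using ab by simp
      have "Lp_norm p ?R (\<lambda>x. weak_deriv ?R (a, b) w x - poly_partials k ?h a b x) \<le> C * ?E"
        using c[of a b] lt ab(2) unfolding homogeneous_partials(2)[OF m(2) lt] by (simp add: w_def)
      also have "\<dots> \<le> C' * ?E" by (intro mult_right_mono C' E)
      finally show "Lp_norm p ?R (\<lambda>x. weak_deriv ?R (a, b) w x - poly_partials k ?h a b x) \<le> C' * ?E" .
    qed
    then show ?thesis by blast
  qed
  then show ?case using C'(1) unfolding m_def[symmetric] by blast
qed

lemma bramble_hilbert:
  assumes p: "1 \<le> p"
  shows "\<exists>C\<ge>0. \<forall>v\<in>sobolev_space (Suc k) p ref_triangle. \<exists>c. \<forall>l\<le>Suc k.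
    sobolev_seminorm l p ref_triangle (\<lambda>x. v x - poly_fun k c x) \<le> C * sobolev_seminorm (Suc k) p ref_triangle v"
proof -
  obtain C where C: "0 \<le> C" "\<And>v. v \<in> sobolev_space (Suc k) p ref_triangle \<Longrightarrow> \<exists>c. \<forall>a b. Suc k - Suc k \<le> a + b \<longrightarrow> a + b \<le> Suc k \<longrightarrow>
    Lp_norm p ref_triangle (weak_deriv ref_triangle (a, b) (\<lambda>x. v x - poly_fun k c x)) \<le> C * sobolev_seminorm (Suc k) p ref_triangle v"
    using bramble_hilbert_aux[OF p order_refl, of k] by blast
  have "\<exists>c. \<forall>l\<le>Suc k. sobolev_seminorm l p ref_triangle (\<lambda>x. v x - poly_fun k c x) \<le> (real (k + 2) * C) * sobolev_seminorm (Suc k) p ref_triangle v"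
    if v: "v \<in> sobolev_space (Suc k) p ref_triangle" for v
  proof -
    let ?E = "sobolev_seminorm (Suc k) p ref_triangle v"
    obtain c where c: "\<And>a b. a + b \<le> Suc k \<Longrightarrow>
        Lp_norm p ref_triangle (weak_deriv ref_triangle (a, b) (\<lambda>x. v x - poly_fun k c x)) \<le> C * ?E"
      using C(2)[OF v] by auto
    have "sobolev_seminorm l p ref_triangle (\<lambda>x. v x - poly_fun k c x) \<le> (real (k + 2) * C) * ?E" if l: "l \<le> Suc k" for l
    proof -
      have "sobolev_seminorm l p ref_triangle (\<lambda>x. v x - poly_fun k c x) \<le> (\<Sum>i\<le>l. C * ?E)"
        unfolding sobolev_seminorm_def using l by (intro sum_mono c[unfolded sobolev_seminorm_def]) auto
      also have "\<dots> = real (l + 1) * (C * ?E)" by simp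
      also have "\<dots> \<le> real (k + 2) * (C * ?E)"
        using l C(1) sobolev_seminorm_nonneg[of "Suc k" p ref_triangle v] by (intro mult_right_mono) auto
      finally show ?thesis by (simp add: mult.assoc)
    qed
    then show ?thesis by blast
  qed
  moreover have "0 \<le> real (k + 2) * C" using C(1) by simp
  ultimately show ?thesis by blast
qed

subsection \<open>Interpolation on the reference triangle\<close>

definition dot :: "real list \<Rightarrow> real list \<Rightarrow> real" where
  "dot rs ds = sum_list (map2 (*) rs ds)"

lemma dot_bound:
  assumes "\<forall>r\<in>set rs. \<bar>r\<bar> \<le> B" "0 \<le> B"
  shows "\<bar>dot rs ds\<bar> \<le> B * sum_list (map abs ds)"
  using assms(1)
proof (induction rs arbitrary: ds)
  case Nil
  have "0 \<le> sum_list (map abs ds)" by (rule sum_list_nonneg) auto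
  then show ?case using assms(2) by (simp add: dot_def)
next
  case (Cons r rs)
  show ?case
  proof (cases ds)
    case (Cons d ds')
    have "\<bar>r * d + dot rs ds'\<bar> \<le> \<bar>r * d\<bar> + \<bar>dot rs ds'\<bar>" by (rule abs_triangle_ineq)
    also have "\<dots> \<le> B * \<bar>d\<bar> + B * sum_list (map abs ds')"
      unfolding abs_mult using Cons.prems by (intro add_mono mult_right_mono Cons.IH) auto
    finally show ?thesis using \<open>ds = d # ds'\<close> by (simp add: dot_def distrib_left)
  qed (simp add: dot_def)
qed

text \<open>The vertices are \<open>a1 = (1, 0)\<close>, \<open>a2 = (0, 1)\<close>,
  \<open>a3 = (0, 0)\<close> and the entries follow the order of \<open>dofs3\<close> and
  \<open>dofs4\<close>. The derivative along \<open>nbar\<close> is replaced by the one along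
  \<open>(1/2, 1/2)\<close>, the median from \<open>a3\<close>.\<close>

definition ref_dofs :: "nat \<Rightarrow> (point \<Rightarrow> real) \<Rightarrow> (point \<Rightarrow> real) \<Rightarrow> (point \<Rightarrow> real) \<Rightarrow> real list" where
  "ref_dofs k g g1 g2 =
    (if k = 3 then
      [g (1, 0), g (0, 1), g (0, 0), g (1/2, 0), g (0, 1/2),
       g2 (1, 0) - g1 (1, 0), - g1 (1, 0), g1 (0, 1) - g2 (0, 1), - g2 (0, 1),
       (g1 (1/2, 1/2) + g2 (1/2, 1/2)) / 2]
     else
      [g (1, 0), g (0, 1), g (0, 0), g (2/3, 0), g (0, 2/3), g (1/3, 0), g (0, 1/3),
       g (1/2, 1/2), g (1/3, 1/3),
       g2 (1, 0) - g1 (1, 0), - g1 (1, 0), g1 (0, 1) - g2 (0, 1), - g2 (0, 1),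
       (g1 (2/3, 1/3) + g2 (2/3, 1/3)) / 2, (g1 (1/3, 2/3) + g2 (1/3, 2/3)) / 2])"

text \<open>Row \<open>(i, j)\<close> of the inverse of the matrix of the degrees of freedom in the monomial basis.\<close>

definition inverse_dofs3 :: "real list list list" where
  "inverse_dofs3 =
   [[[0, 0, 1, 0, 0, 0, 0, 0, 0, 0],
     [0, -4, -4, 0, 8, 0, 0, 0, -1, 0],
     [0, 11, 5, 0, -16, 0, 0, 0, 3, 0],
     [0, -6, -2, 0, 8, 0, 0, 0, -2, 0]],
    [[-4, 0, -4, 8, 0, 0, -1, 0, 0, 0],
     [11, 11, 10, -16, -16, 3/2, 1, 3/2, 1, -4],
     [-7, -11, -6, 8, 16, -3/2, 0, -1/2, -2, 4]],
    [[11, 0, 5, -16, 0, 0, 3, 0, 0, 0],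
     [-11, -7, -6, 16, 8, -1/2, -2, -3/2, 0, 4]],
    [[-6, 0, -2, 8, 0, 0, -2, 0, 0, 0]]]"

definition inverse_dofs4 :: "real list list list" where
  "inverse_dofs4 =
   [[[0, 0, 1, 0, 0, 0, 0, 0, 0, 0, 0, 0, 0, 0, 0],
     [0, 13/2, -13/2, 0, -27/2, 0, 27/2, 0, 0, 0, 0, 0, 1, 0, 0],
     [0, -139/4, 29/2, 0, 135/2, 0, -189/4, 0, 0, 0, 0, 0, -11/2, 0, 0],
     [0, 54, -27/2, 0, -189/2, 0, 54, 0, 0, 0, 0, 0, 9, 0, 0],
     [0, -99/4, 9/2, 0, 81/2, 0, -81/4, 0, 0, 0, 0, 0, -9/2, 0, 0]],
    [[13/2, 0, -13/2, -27/2, 0, 27/2, 0, 0, 0, 0, 1, 0, 0, 0, 0],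
     [-43/4, -43/4, 29, 27, 27, -189/4, -189/4, -48, 81, -1/4, -1, -1/4, -1, 9/2, 9/2],
     [-3, 53, -81/2, -27/2, -108, 54, 108, 112, -162, -1, 0, 9/4, 9/2, -9/2, -18],
     [29/4, -169/4, 18, 0, 81, -81/4, -243/4, -64, 81, 5/4, 0, -1, -9/2, 0, 27/2]],
    [[-139/4, 0, 29/2, 135/2, 0, -189/4, 0, 0, 0, 0, -11/2, 0, 0, 0, 0],
     [53, -3, -81/2, -108, -27/2, 108, 54, 112, -162, 9/4, 9/2, -1, 0, -18, -9/2],
     [-73/4, -73/4, 27, 81/2, 81/2, -243/4, -243/4, -112, 162, -7/4, 0, -7/4, 0, 27/2, 27/2]],
    [[54, 0, -27/2, -189/2, 0, 54, 0, 0, 0, 0, 9, 0, 0, 0, 0],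
     [-169/4, 29/4, 18, 81, 0, -243/4, -81/4, -64, 81, -1, -9/2, 5/4, 0, 27/2, 0]],
    [[-99/4, 0, 9/2, 81/2, 0, -81/4, 0, 0, 0, 0, -9/2, 0, 0, 0, 0]]]"

definition interp_coeff :: "nat \<Rightarrow> real list \<Rightarrow> nat \<Rightarrow> nat \<Rightarrow> real" where
  "interp_coeff k ds i j =
    (if i + j \<le> k then dot ((if k = 3 then inverse_dofs3 else inverse_dofs4) ! i ! j) ds else 0)"

lemma sum_multi_indices: "(\<Sum>(i, j)\<in>multi_indices k. f i j) = (\<Sum>i\<le>k. \<Sum>j\<le>k - i. f i j)"
proof -
  have "multi_indices k = (SIGMA i:{..k}. {..k - i})" by (auto simp: multi_indices_def)
  then show ?thesis by (simp add: sum.Sigma)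
qed

lemma pow_derivs_0_1: "pow_derivs i 0 t = t ^ i" "pow_derivs i (Suc 0) t = real i * t ^ (i - Suc 0)"
  by (cases i; simp add: pow_derivs_def)+

lemma poly_fun_eval: "poly_fun k c (x, y) = (\<Sum>i\<le>k. \<Sum>j\<le>k - i. c i j * x ^ i * y ^ j)"
  by (simp add: poly_fun_def sum_multi_indices)

lemma poly_partials_eval:
  "poly_partials k c (Suc 0) 0 (x, y) = (\<Sum>i\<le>k. \<Sum>j\<le>k - i. c i j * (real i * x ^ (i - Suc 0)) * y ^ j)"
  "poly_partials k c 0 (Suc 0) (x, y) = (\<Sum>i\<le>k. \<Sum>j\<le>k - i. c i j * x ^ i * (real j * y ^ (j - Suc 0)))"
  by (simp_all add: poly_partials_def sum_multi_indices pow_derivs_0_1 mult.assoc)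

abbreviation poly_dofs :: "nat \<Rightarrow> (nat \<Rightarrow> nat \<Rightarrow> real) \<Rightarrow> real list" where
  "poly_dofs k c \<equiv> ref_dofs k (poly_fun k c) (poly_partials k c 1 0) (poly_partials k c 0 1)"

lemma atMost_numerals:
  "{..Suc 0} = {0, Suc 0}" "{..2} = {0, Suc 0, 2}" "{..3} = {0, Suc 0, 2, 3}" "{..4::nat} = {0, Suc 0, 2, 3, 4}"
  by auto

lemma poly_dofs_3: "poly_dofs 3 c =
  [c 0 0 + c 1 0 + c 2 0 + c 3 0, c 0 0 + c 0 1 + c 0 2 + c 0 3, c 0 0,
   c 0 0 + c 1 0 / 2 + c 2 0 / 4 + c 3 0 / 8, c 0 0 + c 0 1 / 2 + c 0 2 / 4 + c 0 3 / 8,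
   (c 0 1 + c 1 1 + c 2 1) - (c 1 0 + 2 * c 2 0 + 3 * c 3 0),
   - (c 1 0 + 2 * c 2 0 + 3 * c 3 0),
   (c 1 0 + c 1 1 + c 1 2) - (c 0 1 + 2 * c 0 2 + 3 * c 0 3),
   - (c 0 1 + 2 * c 0 2 + 3 * c 0 3),
   (c 1 0 + c 0 1) / 2 + (c 2 0 + c 1 1 + c 0 2) / 2 + 3 / 8 * (c 3 0 + c 2 1 + c 1 2 + c 0 3)]"
  by (simp add: ref_dofs_def poly_fun_eval poly_partials_eval atMost_numerals power_divide, simp add: field_simps)

lemma poly_dofs_4: "poly_dofs 4 c =
  [c 0 0 + c 1 0 + c 2 0 + c 3 0 + c 4 0, c 0 0 + c 0 1 + c 0 2 + c 0 3 + c 0 4, c 0 0,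
   c 0 0 + 2 / 3 * c 1 0 + 4 / 9 * c 2 0 + 8 / 27 * c 3 0 + 16 / 81 * c 4 0,
   c 0 0 + 2 / 3 * c 0 1 + 4 / 9 * c 0 2 + 8 / 27 * c 0 3 + 16 / 81 * c 0 4,
   c 0 0 + c 1 0 / 3 + c 2 0 / 9 + c 3 0 / 27 + c 4 0 / 81,
   c 0 0 + c 0 1 / 3 + c 0 2 / 9 + c 0 3 / 27 + c 0 4 / 81,
   c 0 0 + (c 1 0 + c 0 1) / 2 + (c 2 0 + c 1 1 + c 0 2) / 4 + (c 3 0 + c 2 1 + c 1 2 + c 0 3) / 8
     + (c 4 0 + c 3 1 + c 2 2 + c 1 3 + c 0 4) / 16,
   c 0 0 + (c 1 0 + c 0 1) / 3 + (c 2 0 + c 1 1 + c 0 2) / 9 + (c 3 0 + c 2 1 + c 1 2 + c 0 3) / 27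
     + (c 4 0 + c 3 1 + c 2 2 + c 1 3 + c 0 4) / 81,
   (c 0 1 + c 1 1 + c 2 1 + c 3 1) - (c 1 0 + 2 * c 2 0 + 3 * c 3 0 + 4 * c 4 0),
   - (c 1 0 + 2 * c 2 0 + 3 * c 3 0 + 4 * c 4 0),
   (c 1 0 + c 1 1 + c 1 2 + c 1 3) - (c 0 1 + 2 * c 0 2 + 3 * c 0 3 + 4 * c 0 4),
   - (c 0 1 + 2 * c 0 2 + 3 * c 0 3 + 4 * c 0 4),
   1 / 2 * c 0 1 + 1 / 3 * c 0 2 + 1 / 6 * c 0 3 + 2 / 27 * c 0 4 + 1 / 2 * c 1 0 + 1 / 2 * c 1 1 + 5 / 18 * c 1 2 + 7 / 54 * c 1 3 + 2 / 3 * c 2 0 + 4 / 9 * c 2 1 + 2 / 9 * c 2 2 + 2 / 3 * c 3 0 + 10 / 27 * c 3 1 + 16 / 27 * c 4 0,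
   1 / 2 * c 0 1 + 2 / 3 * c 0 2 + 2 / 3 * c 0 3 + 16 / 27 * c 0 4 + 1 / 2 * c 1 0 + 1 / 2 * c 1 1 + 4 / 9 * c 1 2 + 10 / 27 * c 1 3 + 1 / 3 * c 2 0 + 5 / 18 * c 2 1 + 2 / 9 * c 2 2 + 1 / 6 * c 3 0 + 7 / 54 * c 3 1 + 2 / 27 * c 4 0]"
  by (simp add: ref_dofs_def poly_fun_eval poly_partials_eval atMost_numerals power_divide, simp add: field_simps)

text \<open>Left inverse: the degrees of freedom determine the coefficients, which is uniqueness.
  Verified on the explicit matrix entries.\<close>

lemma interp_coeff_poly_dofs:
  assumes "k \<in> {3, 4}" "i + j \<le> k"
  shows "c i j = interp_coeff k (poly_dofs k c) i j"
proof -
  have "\<forall>i\<in>{..3}. \<forall>j\<in>{..3 - i}. c i j = interp_coeff 3 (poly_dofs 3 c) i j"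
    unfolding poly_dofs_3 by (simp add: interp_coeff_def inverse_dofs3_def dot_def atMost_numerals field_simps)
  moreover have "\<forall>i\<in>{..4}. \<forall>j\<in>{..4 - i}. c i j = interp_coeff 4 (poly_dofs 4 c) i j"
    unfolding poly_dofs_4 by (simp add: interp_coeff_def inverse_dofs4_def dot_def atMost_numerals field_simps)
  ultimately show ?thesis using assms by auto
qed

lemma poly_dofs_inj:
  assumes "k \<in> {3, 4}" "poly_dofs k c = poly_dofs k c'"
  shows "poly_fun k c = poly_fun k c'"
proof -
  have "c i j = c' i j" if "i + j \<le> k" for i j
    using interp_coeff_poly_dofs[OF assms(1) that] assms(2) by metis
  then show ?thesis by (auto simp: poly_fun_def multi_indices_def fun_eq_iff intro!: sum.cong)
qed

lemma poly_dofs_interp_coeff_3: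
  "poly_dofs 3 (interp_coeff 3 [d0, d1, d2, d3, d4, d5, d6, d7, d8, d9]) = [d0, d1, d2, d3, d4, d5, d6, d7, d8, d9]"
  unfolding poly_dofs_3 by (simp add: interp_coeff_def inverse_dofs3_def dot_def atMost_numerals field_simps)

lemma poly_dofs_interp_coeff_4:
  "poly_dofs 4 (interp_coeff 4 [d0, d1, d2, d3, d4, d5, d6, d7, d8, d9, d10, d11, d12, d13, d14])
    = [d0, d1, d2, d3, d4, d5, d6, d7, d8, d9, d10, d11, d12, d13, d14]"
  unfolding poly_dofs_4 by (simp add: interp_coeff_def inverse_dofs4_def dot_def atMost_numerals field_simps)

text \<open>Right inverse, hence existence of the interpolating polynomial; the identity is verified
  for lists of 10 and of 15 arbitrary numbers.\<close>

lemma poly_dofs_interp_coeff: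
  assumes "k \<in> {3, 4}"
  shows "poly_dofs k (interp_coeff k (ref_dofs k g g1 g2)) = ref_dofs k g g1 g2"
proof -
  have "k = 3 \<or> k = 4" using assms by auto
  then show ?thesis
  proof
    assume k: "k = 3"
    have e: "ref_dofs 3 g g1 g2 = [g (1, 0), g (0, 1), g (0, 0), g (1/2, 0), g (0, 1/2),
       g2 (1, 0) - g1 (1, 0), - g1 (1, 0), g1 (0, 1) - g2 (0, 1), - g2 (0, 1),
       (g1 (1/2, 1/2) + g2 (1/2, 1/2)) / 2]"
      by (simp add: ref_dofs_def)
    show ?thesis unfolding k e by (rule poly_dofs_interp_coeff_3)
  next
    assume k: "k = 4"
    have e: "ref_dofs 4 g g1 g2 = [g (1, 0), g (0, 1), g (0, 0), g (2/3, 0), g (0, 2/3), g (1/3, 0), g (0, 1/3),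
       g (1/2, 1/2), g (1/3, 1/3),
       g2 (1, 0) - g1 (1, 0), - g1 (1, 0), g1 (0, 1) - g2 (0, 1), - g2 (0, 1),
       (g1 (2/3, 1/3) + g2 (2/3, 1/3)) / 2, (g1 (1/3, 2/3) + g2 (1/3, 2/3)) / 2]"
      by (simp add: ref_dofs_def)
    show ?thesis unfolding k e by (rule poly_dofs_interp_coeff_4)
  qed
qed

text \<open>200 exceeds 162, the largest absolute value of an entry of the two inverse
  matrices.\<close>

lemma interp_coeff_bound:
  assumes "k \<in> {3, 4}"
  shows "\<bar>interp_coeff k ds i j\<bar> \<le> 200 * sum_list (map abs ds)"
proof (cases "i + j \<le> k")
  case True
  have "\<forall>i\<in>{..3}. \<forall>j\<in>{..3 - i}. \<forall>r\<in>set (inverse_dofs3 ! i ! j). \<bar>r\<bar> \<le> 200"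
    by (simp add: inverse_dofs3_def atMost_numerals)
  note B3 = this
  have B4: "\<forall>i\<in>{..4}. \<forall>j\<in>{..4 - i}. \<forall>r\<in>set (inverse_dofs4 ! i ! j). \<bar>r\<bar> \<le> 200"
    by (simp add: inverse_dofs4_def atMost_numerals)
  have "\<forall>r\<in>set ((if k = 3 then inverse_dofs3 else inverse_dofs4) ! i ! j). \<bar>r\<bar> \<le> 200"
  proof (cases "k = 3")
    case k: True
    have "i \<in> {..3}" "j \<in> {..3 - i}" using True k by auto
    then show ?thesis unfolding if_P[OF k] using B3 by blast
  next
    case k: False
    then have "i \<in> {..4}" "j \<in> {..4 - i}" using True assms by auto
    then show ?thesis unfolding if_not_P[OF k] using B4 by blast
  qed
  from dot_bound[OF this] show ?thesis using True by (simp add: interp_coeff_def)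
next
  case False
  have "0 \<le> sum_list (map abs ds)" by (rule sum_list_nonneg) auto
  then show ?thesis using False by (simp add: interp_coeff_def)
qed

lemma sum_list_abs_le: "\<forall>x\<in>set xs. \<bar>x\<bar> \<le> (B::real) \<Longrightarrow> sum_list (map abs xs) \<le> real (length xs) * B"
  by (induction xs) (auto simp: algebra_simps intro: add_mono)

text \<open>There are at most 15 entries, each of modulus at most \<open>2 B\<close>.\<close>

lemma ref_dofs_bound:
  assumes "\<forall>x\<in>closed_ref_triangle. \<bar>g x\<bar> \<le> B \<and> \<bar>g1 x\<bar> \<le> B \<and> \<bar>g2 x\<bar> \<le> B"
  shows "sum_list (map abs (ref_dofs k g g1 g2)) \<le> 30 * B"
proof -
  have a: "\<bar>g (s, t)\<bar> \<le> B" "\<bar>g1 (s, t)\<bar> \<le> B" "\<bar>g2 (s, t)\<bar> \<le> B" if "0 \<le> s" "0 \<le> t" "s + t \<le> 1" for s t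
    using assms that by (auto simp: closed_ref_triangle_def)
  have B: "0 \<le> B" using a(1)[of 0 0] by simp
  have a2: "\<bar>g (s, t)\<bar> \<le> 2 * B" "\<bar>g1 (s, t)\<bar> \<le> 2 * B" "\<bar>g2 (s, t)\<bar> \<le> 2 * B"
    "\<bar>(g1 (s, t) + g2 (s, t)) / 2\<bar> \<le> 2 * B" "\<bar>g1 (s, t) - g2 (s, t)\<bar> \<le> 2 * B" "\<bar>g2 (s, t) - g1 (s, t)\<bar> \<le> 2 * B"
    "\<bar>- g1 (s, t)\<bar> \<le> 2 * B" "\<bar>- g2 (s, t)\<bar> \<le> 2 * B"
    if "0 \<le> s \<and> 0 \<le> t \<and> s + t \<le> 1" for s t
  proof -
    have A: "\<bar>g (s, t)\<bar> \<le> B" "\<bar>g1 (s, t)\<bar> \<le> B" "\<bar>g2 (s, t)\<bar> \<le> B" using a[of s t] that by simp_all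
    show "\<bar>g (s, t)\<bar> \<le> 2 * B" "\<bar>g1 (s, t)\<bar> \<le> 2 * B" "\<bar>g2 (s, t)\<bar> \<le> 2 * B"
    "\<bar>(g1 (s, t) + g2 (s, t)) / 2\<bar> \<le> 2 * B" "\<bar>g1 (s, t) - g2 (s, t)\<bar> \<le> 2 * B" "\<bar>g2 (s, t) - g1 (s, t)\<bar> \<le> 2 * B"
    "\<bar>- g1 (s, t)\<bar> \<le> 2 * B" "\<bar>- g2 (s, t)\<bar> \<le> 2 * B"
      using A B by (simp_all add: abs_le_iff)
  qed
  have "\<forall>d\<in>set (ref_dofs k g g1 g2). \<bar>d\<bar> \<le> 2 * B"
    by (cases "k = 3"; simp only: ref_dofs_def simp_thms if_True if_False list.set ball_simps; intro conjI TrueI a2; simp)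
  from sum_list_abs_le[OF this]
  have "sum_list (map abs (ref_dofs k g g1 g2)) \<le> real (length (ref_dofs k g g1 g2)) * (2 * B)" .
  also have "\<dots> \<le> 15 * (2 * B)" using B by (intro mult_right_mono) (auto simp: ref_dofs_def)
  finally show ?thesis by simp
qed

lemma ref_dofs_add:
  "ref_dofs k (\<lambda>x. g x + h x) (\<lambda>x. g1 x + h1 x) (\<lambda>x. g2 x + h2 x) = map2 (+) (ref_dofs k g g1 g2) (ref_dofs k h h1 h2)"
  by (simp add: ref_dofs_def add_divide_distrib)

lemma poly_partials_add:
  "poly_partials k (\<lambda>i j. c i j + c' i j) a b = (\<lambda>x. poly_partials k c a b x + poly_partials k c' a b x)"
  by (simp add: poly_partials_def split_def sum.distrib distrib_right fun_eq_iff)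

lemma sobolev_seminorm_minus_poly:
  assumes p: "1 \<le> p" and v: "v \<in> sobolev_space n p ref_triangle" and l: "l \<le> n" and c: "\<And>i j. \<bar>c i j\<bar> \<le> M"
  shows "sobolev_seminorm l p ref_triangle (\<lambda>x. v x - poly_fun k c x)
    \<le> 2 * (sobolev_seminorm l p ref_triangle v + real (l + 1) * (M * (\<Sum>(i, j)\<in>multi_indices k. fact i * fact j)))"
proof -
  let ?S = "M * (\<Sum>(i, j)\<in>multi_indices k. fact i * fact j)"
  have "Lp_norm p ref_triangle (weak_deriv ref_triangle (i, l - i) (\<lambda>x. v x - poly_fun k c x))
      \<le> 2 * (Lp_norm p ref_triangle (weak_deriv ref_triangle (i, l - i) v) + ?S)" if "i \<in> {..l}" for i
  proof -
    have n: "i + (l - i) \<le> n" using that l by simp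
    note P = poly_partials_Lp[where c = c and M = M and k = k and a = i and b = "l - i", OF p c]
    show ?thesis
      unfolding sobolev_minus_poly(3)[OF p v n]
      using Lp_diff(2)[OF p sobolev_space_weak_deriv(2)[OF p open_ref_triangle v n] P(1)] P(2) by simp
  qed
  then have "sobolev_seminorm l p ref_triangle (\<lambda>x. v x - poly_fun k c x)
    \<le> (\<Sum>i\<le>l. 2 * (Lp_norm p ref_triangle (weak_deriv ref_triangle (i, l - i) v) + ?S))"
    unfolding sobolev_seminorm_def by (intro sum_mono)
  also have "\<dots> = 2 * (sobolev_seminorm l p ref_triangle v + real (l + 1) * ?S)"
    by (simp only: sobolev_seminorm_def sum_distrib_left[symmetric] sum.distrib sum_constant card_atMost of_nat_add of_nat_Suc of_nat_1 Suc_eq_plus1)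
      (simp add: mult.left_commute)
  finally show ?thesis .
qed

text \<open>The interpolating polynomial is found as \<open>c0 + c1\<close>, with \<open>c0\<close>
  from the Bramble-Hilbert lemma and \<open>c1\<close> interpolating the remainder \<open>w\<close>;
  it matches the degrees of freedom by their additivity. The exponent is lowered to 1 only to obtain
  the \<open>C^1\<close> representative of \<open>w\<close>.\<close>

lemma ref_interpolation:
  assumes p: "1 \<le> p" and k: "k \<in> {3, 4}"
  shows "\<exists>C\<ge>0. \<forall>v\<in>sobolev_space (Suc k) p ref_triangle. \<exists>g g1 g2 c. C1_ref g g1 g2 \<and>
    (AE x in lebesgue. x \<in> ref_triangle \<longrightarrow> v x = g x) \<and> poly_dofs k c = ref_dofs k g g1 g2 \<and>
    (\<Sum>l\<le>Suc k. sobolev_seminorm l p ref_triangle (\<lambda>x. v x - poly_fun k c x)) \<le> C * sobolev_seminorm (Suc k) p ref_triangle v"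
proof -
  let ?R = ref_triangle
  obtain C0 where C0: "0 \<le> C0" "\<And>v. v \<in> sobolev_space (Suc k) p ?R \<Longrightarrow> \<exists>c. \<forall>l\<le>Suc k.
    sobolev_seminorm l p ?R (\<lambda>x. v x - poly_fun k c x) \<le> C0 * sobolev_seminorm (Suc k) p ?R v"
    using bramble_hilbert[OF p, of k] by blast
  define S :: real where "S = (\<Sum>(i, j)\<in>multi_indices k. fact i * fact j)"
  \<comment> \<open>200 for the inverse matrix, 30 for the degrees of freedom, the constant of the
    \<open>C^1\<close> embedding, and 8 for four orders with a factor 2 each for comparing
    \<open>L^1\<close> with \<open>L^p\<close>.\<close>
  define K where "K = 200 * (30 * ((1 + theta_bound)^2 * 1600 * (8 * C0)))"
  define C where "C = real (k + 2) * (2 * (C0 + real (k + 2) * (K * S)))"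
  have S: "0 \<le> S" unfolding S_def by (intro sum_nonneg) auto
  have K: "0 \<le> K" using C0(1) theta_bound_pos unfolding K_def by simp
  have C: "0 \<le> C" using S K C0(1) unfolding C_def by simp
  have "\<exists>g g1 g2 c. C1_ref g g1 g2 \<and>
    (AE x in lebesgue. x \<in> ?R \<longrightarrow> v x = g x) \<and> poly_dofs k c = ref_dofs k g g1 g2 \<and>
    (\<Sum>l\<le>Suc k. sobolev_seminorm l p ?R (\<lambda>x. v x - poly_fun k c x)) \<le> C * sobolev_seminorm (Suc k) p ?R v"
    if v: "v \<in> sobolev_space (Suc k) p ?R" for v
  proof -
    define E where "E = sobolev_seminorm (Suc k) p ?R v"
    have E: "0 \<le> E" unfolding E_def by (rule sobolev_seminorm_nonneg)
    obtain c0 where c0: "\<And>l. l \<le> Suc k \<Longrightarrow> sobolev_seminorm l p ?R (\<lambda>x. v x - poly_fun k c0 x) \<le> C0 * E"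
      using C0(2)[OF v] unfolding E_def by blast
    define w where "w = (\<lambda>x. v x - poly_fun k c0 x)"
    have w: "w \<in> sobolev_space (Suc k) p ?R" unfolding w_def by (rule sobolev_space_minus_poly[OF p v])
    have wE: "sobolev_seminorm l p ?R w \<le> C0 * E" if "l \<le> Suc k" for l using c0[OF that] unfolding w_def .
    have k3: "3 \<le> Suc k" using k by auto
    have w3: "w \<in> sobolev_space 3 1 ?R"
      by (rule sobolev_space_mono[OF sobolev_space_ref_L1(1)[OF p w] k3])
    have w1: "(\<Sum>l\<le>3. sobolev_seminorm l 1 ?R w) \<le> (\<Sum>l\<le>3::nat. 2 * (C0 * E))"
    proof (rule sum_mono)
      fix l :: nat assume "l \<in> {..3}"
      then have l: "l \<le> Suc k" using k3 by simp
      show "sobolev_seminorm l 1 ?R w \<le> 2 * (C0 * E)"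
        using sobolev_space_ref_L1(2)[OF p w l] wE[OF l] by linarith
    qed
    have w1': "(\<Sum>l\<le>3::nat. 2 * (C0 * E)) = 8 * C0 * E" by simp
    obtain h h1 h2 where h: "C1_ref h h1 h2" "AE x in lebesgue. x \<in> ?R \<longrightarrow> w x = h x"
      and hb: "\<forall>x\<in>closed_ref_triangle. \<bar>h x\<bar> \<le> (1 + theta_bound)^2 * 1600 * (\<Sum>l\<le>3. sobolev_seminorm l 1 ?R w)
        \<and> \<bar>h1 x\<bar> \<le> (1 + theta_bound)^2 * 1600 * (\<Sum>l\<le>3. sobolev_seminorm l 1 ?R w)
        \<and> \<bar>h2 x\<bar> \<le> (1 + theta_bound)^2 * 1600 * (\<Sum>l\<le>3. sobolev_seminorm l 1 ?R w)"
      using C1_representative_ref_triangle[OF w3] by blast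
    define c1 where "c1 = interp_coeff k (ref_dofs k h h1 h2)"
    have c1: "\<bar>c1 i j\<bar> \<le> K * E" for i j
    proof -
      have "\<bar>c1 i j\<bar> \<le> 200 * sum_list (map abs (ref_dofs k h h1 h2))"
        unfolding c1_def by (rule interp_coeff_bound[OF k])
      also have "\<dots> \<le> 200 * (30 * ((1 + theta_bound)^2 * 1600 * (\<Sum>l\<le>3. sobolev_seminorm l 1 ?R w)))"
        by (intro mult_left_mono ref_dofs_bound hb) auto
      also have "\<dots> \<le> 200 * (30 * ((1 + theta_bound)^2 * 1600 * (8 * C0 * E)))"
        using w1 unfolding w1' by (intro mult_left_mono) auto
      finally show ?thesis by (simp add: K_def mult.assoc)
    qed
    define c where "c = (\<lambda>i j. c1 i j + c0 i j)"
    have eq: "(\<lambda>x. v x - poly_fun k c x) = (\<lambda>x. w x - poly_fun k c1 x)"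
      by (simp add: w_def c_def poly_fun_diff(2)[symmetric] fun_eq_iff)
    have sem: "sobolev_seminorm l p ?R (\<lambda>x. v x - poly_fun k c x) \<le> 2 * (C0 * E + real (k + 2) * (K * E * S))" if l: "l \<le> Suc k" for l
    proof -
      have "sobolev_seminorm l p ?R (\<lambda>x. v x - poly_fun k c x) \<le> 2 * (sobolev_seminorm l p ?R w + real (l + 1) * (K * E * S))"
        unfolding eq S_def by (rule sobolev_seminorm_minus_poly[OF p w l c1])
      also have "\<dots> \<le> 2 * (C0 * E + real (k + 2) * (K * E * S))"
        using l wE[OF l] K E S by (intro mult_left_mono add_mono mult_right_mono mult_nonneg_nonneg) auto
      finally show ?thesis .
    qed
    have "(\<Sum>l\<le>Suc k. sobolev_seminorm l p ?R (\<lambda>x. v x - poly_fun k c x)) \<le> (\<Sum>l\<le>Suc k. 2 * (C0 * E + real (k + 2) * (K * E * S)))"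
      by (rule sum_mono) (use sem in auto)
    also have "\<dots> = C * E"
      by (simp only: sum_constant card_atMost C_def) (simp add: algebra_simps)
    finally have fin: "(\<Sum>l\<le>Suc k. sobolev_seminorm l p ?R (\<lambda>x. v x - poly_fun k c x)) \<le> C * E" .
    have d1: "poly_dofs k c1 = ref_dofs k h h1 h2" unfolding c1_def by (rule poly_dofs_interp_coeff[OF k])
    have fun_c: "poly_fun k c = (\<lambda>x. poly_fun k c1 x + poly_fun k c0 x)"
      by (simp add: c_def poly_fun_diff(2) fun_eq_iff)
    have "poly_dofs k c = map2 (+) (poly_dofs k c1) (poly_dofs k c0)"
      unfolding fun_c unfolding c_def poly_partials_add by (rule ref_dofs_add)
    also have "\<dots> = ref_dofs k (\<lambda>x. h x + poly_fun k c0 x) (\<lambda>x. h1 x + poly_partials k c0 1 0 x) (\<lambda>x. h2 x + poly_partials k c0 0 1 x)"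
      unfolding d1 by (rule ref_dofs_add[symmetric])
    finally have dofs: "poly_dofs k c = \<dots>" .
    have "AE x in lebesgue. x \<in> ?R \<longrightarrow> v x = h x + poly_fun k c0 x"
      using h(2) by (rule AE_mp) (rule AE_I2, auto simp: w_def)
    then show ?thesis
      using C1_ref_add[OF h(1) C1_ref_poly[of k c0]] dofs fin unfolding E_def by blast
  qed
  then show ?thesis using C by blast
qed

subsection \<open>Triangles with two type I edges\<close>

text \<open>\<open>nbar\<close> is the tangent with its two coordinates exchanged, so equality up to
  sign forces equal moduli. The segment determines its end points only up to order.\<close>

lemma abs_type_I:
  assumes "type_I (closed_segment a b)" "a \<noteq> b"
  shows "\<bar>fst (b - a)\<bar> = \<bar>snd (b - a)\<bar>"
proof -
  obtain c d where cd: "c \<noteq> d" "{a, b} = {c, d}" "nbar c d = unit_tangent c d \<or> nbar c d = - unit_tangent c d"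
    using assms(1) unfolding type_I_def closed_segment_eq by blast
  have nz: "norm (d - c) \<noteq> 0" using cd(1) by simp
  have "\<bar>fst (unit_tangent c d)\<bar> = \<bar>snd (unit_tangent c d)\<bar>"
    using cd(3) by (auto simp: nbar_def unit_normal_def prod_eq_iff)
  then have "\<bar>fst (d - c)\<bar> = \<bar>snd (d - c)\<bar>"
    using nz by (simp add: unit_tangent_def abs_mult)
  moreover have "a = c \<and> b = d \<or> a = d \<and> b = c" using cd(2) by (auto simp: doubleton_eq_iff)
  ultimately show ?thesis by auto
qed

text \<open>Faces of a simplex are hulls of subsets of its vertices, and dimension 1 leaves the
  pairs.\<close>

lemma edges_of_triangle:
  fixes a1 a2 a3 :: point
  assumes "\<not> collinear {a1, a2, a3}" "e edge_of (convex hull {a1, a2, a3})"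
  shows "e \<in> {closed_segment a1 a2, closed_segment a1 a3, closed_segment a2 a3}"
proof -
  have d: "a1 \<noteq> a2" "a1 \<noteq> a3" "a2 \<noteq> a3" "\<not> affine_dependent {a1, a2, a3}"
    using assms(1) by (auto simp: collinear_3_eq_affine_dependent)
  obtain c where c: "c \<subseteq> {a1, a2, a3}" "e = convex hull c"
    using assms(2) face_of_convex_hull_affine_independent[OF d(4)] unfolding edge_of_def by blast
  have "\<not> affine_dependent c" using affine_dependent_subset[OF _ c(1)] d(4) by blast
  from aff_dim_affine_independent[OF this] have card: "card c = 2"
    using assms(2) by (simp add: c(2) edge_of_def aff_dim_convex_hull)
  have pair: "c = {x, y}" if "c \<subseteq> {x, y}" "x \<noteq> y" for x y
    using card_seteq[of "{x, y}" c] that card by simp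
  have "\<not> {a1, a2, a3} \<subseteq> c"
  proof
    assume "{a1, a2, a3} \<subseteq> c"
    then have "c = {a1, a2, a3}" using c(1) by blast
    then show False using card d(1-3) by simp
  qed
  then consider "c \<subseteq> {a1, a2}" | "c \<subseteq> {a1, a3}" | "c \<subseteq> {a2, a3}" using c(1) by blast
  then have "c = {a1, a2} \<or> c = {a1, a3} \<or> c = {a2, a3}"
    using pair d(1-3) by cases blast+
  then show ?thesis unfolding c(2) segment_convex_hull by auto
qed

text \<open>The two type I edges meet at \<open>a\<^sub>3\<close> and are perpendicular to each other, and \<open>nbar\<close> is
  parallel to the median through \<open>a\<^sub>3\<close>. Hence all degrees of freedom correspond to those of one
  reference element.\<close>

lemma admissible_geometry:
  assumes two: "two_type_I_edges T" and adm: "admissible_labelling T a1 a2 a3"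
  shows "\<exists>s \<kappa>. \<bar>s\<bar> = 1 \<and> snd (a1 - a3) = s * fst (a1 - a3) \<and> snd (a2 - a3) = - s * fst (a2 - a3) \<and>
    fst (a1 - a3) \<noteq> 0 \<and> fst (a2 - a3) \<noteq> 0 \<and> \<kappa> \<noteq> 0 \<and>
    nbar a1 a2 = (\<kappa> / 2) *\<^sub>R (a1 - a3) + (\<kappa> / 2) *\<^sub>R (a2 - a3)"
proof -
  have T: "T = convex hull {a1, a2, a3}" and nc: "\<not> collinear {a1, a2, a3}" and II: "\<not> type_I (closed_segment a1 a2)"
    using adm by (auto simp: admissible_labelling_def)
  have d: "a1 \<noteq> a2" "a1 \<noteq> a3" "a2 \<noteq> a3" using nc by (auto simp: collinear_3_eq_affine_dependent)
  let ?E = "{e. e edge_of T \<and> type_I e}" and ?S = "{closed_segment a1 a3, closed_segment a2 a3}"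
  have sub: "?E \<subseteq> ?S" using edges_of_triangle[OF nc] II unfolding T by blast
  \<comment> \<open>Exactly two edges are of type I and at most two candidates remain, so both of
    them are.\<close>
  have "card ?S \<le> card ?E"
    using two card_insert_le_m1[of 2 "{closed_segment a2 a3}" "closed_segment a1 a3"] unfolding two_type_I_edges_def by simp
  then have "?E = ?S" using card_seteq[OF _ sub] by simp
  then have I: "type_I (closed_segment a1 a3)" "type_I (closed_segment a2 a3)" by blast+
  define x1 y1 x2 y2 where "x1 = fst (a1 - a3)" and "y1 = snd (a1 - a3)" and "x2 = fst (a2 - a3)" and "y2 = snd (a2 - a3)"
  note xy = x1_def y1_def x2_def y2_def
  have abs: "\<bar>x1\<bar> = \<bar>y1\<bar>" "\<bar>x2\<bar> = \<bar>y2\<bar>"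
    using abs_type_I[OF I(1) d(2)] abs_type_I[OF I(2) d(3)] by (auto simp: xy)
  have v: "a1 - a3 = (x1, y1)" "a2 - a3 = (x2, y2)" by (simp_all add: xy prod_eq_iff)
  have nz: "x1 \<noteq> 0" "x2 \<noteq> 0"
    using abs d by (auto simp: xy prod_eq_iff)
  have ne: "y1 * x2 \<noteq> y2 * x1"
  proof
    assume eq: "y1 * x2 = y2 * x1"
    have "a1 - a3 = (x1 / x2) *\<^sub>R (a2 - a3)"
      using eq nz unfolding v by (simp add: field_simps)
    then have "collinear {a1 - a3, 0, a2 - a3}"
      by (metis collinear_lemma insert_commute)
    then have "collinear {a1, a3, a2}" using collinear_3[of a1 a3 a2] by (simp add: insert_commute)
    then show False using nc by (simp add: insert_commute)
  qed
  define s where "s = y1 / x1"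
  have s: "\<bar>s\<bar> = 1" "y1 = s * x1" using abs nz by (auto simp: s_def)
  have s2: "s = 1 \<or> s = -1" using s(1) by linarith
  \<comment> \<open>Equal slopes would make the two edges parallel, against noncollinearity.\<close>
  have y2: "y2 = - s * x2" using s2 s(2) ne abs(2) by (auto simp: abs_if split: if_splits)
  define n where "n = norm (a2 - a1)"
  have n: "n \<noteq> 0" using d by (simp add: n_def)
  \<comment> \<open>Found by comparing first components: that of \<open>nbar\<close> is
    \<open>(y2 - y1) / n = - s (x1 + x2) / n\<close>. The second components then agree because
    \<open>s^2 = 1\<close>.\<close>
  define \<kappa> where "\<kappa> = - 2 * s / n"
  have a21: "a2 - a1 = (x2 - x1, y2 - y1)" by (simp add: xy prod_eq_iff)
  have nn: "norm (x2 - x1, y2 - y1) = n" by (simp only: n_def a21)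
  have "nbar a1 a2 = ((y2 - y1) / n, (x2 - x1) / n)"
    by (simp add: nbar_def unit_normal_def unit_tangent_def a21 nn divide_inverse mult.commute)
  also have "\<dots> = (\<kappa> / 2) *\<^sub>R (a1 - a3) + (\<kappa> / 2) *\<^sub>R (a2 - a3)"
    unfolding v using s2 n by (elim disjE) (simp_all add: \<kappa>_def s(2) y2 field_simps)
  finally have "nbar a1 a2 = (\<kappa> / 2) *\<^sub>R (a1 - a3) + (\<kappa> / 2) *\<^sub>R (a2 - a3)" .
  moreover have "\<kappa> \<noteq> 0" using s2 n by (auto simp: \<kappa>_def)
  ultimately show ?thesis using s(1) s(2) y2 nz unfolding xy by blast
qed

section \<open>Invariance of the polynomial spaces under affine maps\<close>

lemma poly_fun_in_poly_space: "poly_fun k c \<in> poly_space k"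
  by (auto simp: poly_space_iff)

lemma poly_space_Suc: "P \<in> poly_space k \<Longrightarrow> P \<in> poly_space (Suc k)"
proof -
  assume "P \<in> poly_space k"
  then obtain c where P: "P = poly_fun k c" by (auto simp: poly_space_iff)
  have "P = poly_fun (Suc k) (\<lambda>i j. if i + j \<le> k then c i j else 0)"
    unfolding P poly_fun_def fun_eq_iff split_def
    by (intro allI sum.mono_neutral_cong_left finite_multi_indices) (auto simp: multi_indices_def split: if_splits)
  then show ?thesis by (simp only: poly_fun_in_poly_space)
qed

lemma poly_space_mono: "P \<in> poly_space k \<Longrightarrow> k \<le> l \<Longrightarrow> P \<in> poly_space l"
  by (rotate_tac, induction rule: dec_induct) (auto intro: poly_space_Suc)

lemma poly_space_add: "P \<in> poly_space k \<Longrightarrow> Q \<in> poly_space k \<Longrightarrow> (\<lambda>x. P x + Q x) \<in> poly_space k"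
  by (auto simp: poly_space_iff poly_fun_diff(2) intro: exI)

lemma poly_space_cmult: "P \<in> poly_space k \<Longrightarrow> (\<lambda>x. a * P x) \<in> poly_space k"
proof -
  assume "P \<in> poly_space k"
  then obtain c where P: "P = poly_fun k c" by (auto simp: poly_space_iff)
  have "(\<lambda>x. a * P x) = poly_fun k (\<lambda>i j. a * c i j)"
    by (simp add: P poly_fun_def fun_eq_iff split_def sum_distrib_left mult.assoc)
  then show ?thesis by (simp only: poly_fun_in_poly_space)
qed

lemma poly_space_const: "(\<lambda>x. a) \<in> poly_space k"
proof -
  have "(\<lambda>x. a) = poly_fun 0 (\<lambda>i j. a)" by (simp add: fun_eq_iff poly_fun_eval)
  then have "(\<lambda>x. a) \<in> poly_space 0" by (simp only: poly_fun_in_poly_space)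
  then show ?thesis by (rule poly_space_mono) simp
qed

lemma poly_space_sum: "finite A \<Longrightarrow> (\<And>q. q \<in> A \<Longrightarrow> P q \<in> poly_space k) \<Longrightarrow> (\<lambda>x. \<Sum>q\<in>A. P q x) \<in> poly_space k"
  by (induction rule: finite_induct) (auto intro: poly_space_const poly_space_add)

lemma poly_space_times_coordinate:
  assumes "P \<in> poly_space k"
  shows "(\<lambda>x. fst x * P x) \<in> poly_space (Suc k)" "(\<lambda>x. snd x * P x) \<in> poly_space (Suc k)"
proof -
  obtain c where P: "P = poly_fun k c" using assms by (auto simp: poly_space_iff)
  have "(\<lambda>x. fst x * P x) = poly_fun (Suc k) (\<lambda>i j. case i of 0 \<Rightarrow> 0 | Suc i \<Rightarrow> c i j)"
    by (simp add: P fun_eq_iff poly_fun_eval sum.atMost_Suc_shift sum_distrib_left mult_ac del: sum.atMost_Suc)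
  then show "(\<lambda>x. fst x * P x) \<in> poly_space (Suc k)" by (simp only: poly_fun_in_poly_space)
  let ?c = "\<lambda>i j. case j of 0 \<Rightarrow> 0 | Suc j \<Rightarrow> c i j"
  have "y * P (x, y) = poly_fun (Suc k) ?c (x, y)" for x y
  proof -
    have "y * P (x, y) = (\<Sum>i\<le>k. \<Sum>j\<le>k - i. c i j * x ^ i * y ^ Suc j)"
      by (simp add: P poly_fun_eval sum_distrib_left mult_ac)
    also have "\<dots> = (\<Sum>i\<le>k. \<Sum>j\<le>Suc k - i. ?c i j * x ^ i * y ^ j)"
      by (rule sum.cong[OF refl]) (simp add: Suc_diff_le sum.atMost_Suc_shift del: sum.atMost_Suc)
    also have "\<dots> = poly_fun (Suc k) ?c (x, y)"
      unfolding poly_fun_eval by (subst sum.atMost_Suc) simp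
    finally show ?thesis .
  qed
  then have "(\<lambda>x. snd x * P x) = poly_fun (Suc k) ?c" by (simp add: fun_eq_iff)
  then show "(\<lambda>x. snd x * P x) \<in> poly_space (Suc k)" by (simp only: poly_fun_in_poly_space)
qed

text \<open>Each affine factor raises the degree by at most one.\<close>

lemma poly_space_affine_powers:
  "(\<lambda>x. (fst (aff z e f x)) ^ i * (snd (aff z e f x)) ^ j) \<in> poly_space (i + j)"
proof -
  have aff: "(\<lambda>x. (a + b * fst x + d * snd x) * P x) \<in> poly_space (Suc k)" if P: "P \<in> poly_space k" for a b d P k
  proof -
    have "(\<lambda>x. a * P x + b * (fst x * P x) + d * (snd x * P x)) \<in> poly_space (Suc k)"
      by (intro poly_space_add poly_space_cmult poly_space_times_coordinate poly_space_Suc P)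
    then show ?thesis by (simp add: distrib_right mult.assoc)
  qed
  have "(\<lambda>x. (snd (aff z e f x)) ^ j) \<in> poly_space j"
  proof (induction j)
    case (Suc j)
    from aff[OF this, of "snd z" "snd e" "snd f"] show ?case by (simp add: snd_aff mult.commute)
  qed (simp add: poly_space_const)
  then show ?thesis
  proof (induction i)
    case (Suc i)
    from aff[OF Suc.IH[OF Suc.prems], of "fst z" "fst e" "fst f"] show ?case
      by (simp add: fst_aff mult.commute mult.left_commute)
  qed simp
qed

lemma poly_space_aff:
  assumes "P \<in> poly_space k"
  shows "(\<lambda>x. P (aff z e f x)) \<in> poly_space k"
proof -
  obtain c where P: "P = poly_fun k c" using assms by (auto simp: poly_space_iff)
  have "(\<lambda>x. \<Sum>q\<in>multi_indices k. c (fst q) (snd q) * ((fst (aff z e f x)) ^ fst q * (snd (aff z e f x)) ^ snd q)) \<in> poly_space k"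
    by (intro poly_space_sum poly_space_cmult finite_multi_indices poly_space_mono[OF poly_space_affine_powers])
      (auto simp: multi_indices_def)
  then show ?thesis by (simp add: P poly_fun_def split_def mult.assoc)
qed

section \<open>Degrees of freedom and interpolants under affine maps\<close>

text \<open>On the segment from \<open>x\<close> to \<open>y\<close> this is the uniqueness of a
  one-sided derivative. At a boundary point it determines the derivative in the directions pointing
  into the set.\<close>

lemma has_derivative_within_convex_unique:
  fixes u :: "'a :: real_normed_vector \<Rightarrow> real"
  assumes "convex T" "x \<in> T" "y \<in> T"
    and D: "(u has_derivative D) (at x within T)" "(u has_derivative D') (at x within T)"
  shows "D (y - x) = D' (y - x)"
proof -
  let ?p = "\<lambda>t::real. x + t *\<^sub>R (y - x)"
  have sub: "?p ` cbox 0 1 \<subseteq> T"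
  proof
    fix w assume "w \<in> ?p ` cbox 0 1"
    then obtain t where t: "0 \<le> t" "t \<le> 1" "w = (1 - t) *\<^sub>R x + t *\<^sub>R y" by (auto simp: algebra_simps)
    show "w \<in> T" unfolding t(3) by (rule convexD_alt[OF assms(1-3) t(1,2)])
  qed
  have "((\<lambda>t. u (?p t)) has_vector_derivative E (y - x)) (at 0 within cbox 0 1)"
    if "(u has_derivative E) (at x within T)" for E
  proof -
    have "(u has_derivative E) (at (?p 0) within ?p ` cbox 0 1)"
      using has_derivative_subset[OF that sub] by simp
    moreover have "(?p has_derivative (\<lambda>t. t *\<^sub>R (y - x))) (at 0 within cbox 0 1)"
      by (auto intro!: derivative_eq_intros)
    ultimately have "((\<lambda>t. u (?p t)) has_derivative (\<lambda>t. E (t *\<^sub>R (y - x)))) (at 0 within cbox 0 1)"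
      using has_derivative_in_compose by blast
    moreover have "E (t *\<^sub>R w) = t *\<^sub>R E w" for t w
      using has_derivative_linear[OF that] by (rule linear_scale)
    ultimately show ?thesis by (simp add: has_vector_derivative_def)
  qed
  from vector_derivative_unique_within_closed_interval[OF _ _ this[OF D(1)] this[OF D(2)]]
  show ?thesis by simp
qed

text \<open>The map \<open>G\<close>, inverse to the parametrisation \<open>F\<close> by the
  reference triangle, is a parameter with explicit columns, because their size must be bounded by
  means of quasi-uniformity.\<close>

locale affine_triangle =
  fixes a1 a2 a3 z' e' f' :: point
  assumes det: "det2 (a1 - a3) (a2 - a3) \<noteq> 0"
    and inv: "\<And>x. aff z' e' f' (aff a3 (a1 - a3) (a2 - a3) x) = x"
      "\<And>x. aff a3 (a1 - a3) (a2 - a3) (aff z' e' f' x) = x"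
    and e': "e' = (snd (a2 - a3) / det2 (a1 - a3) (a2 - a3), - snd (a1 - a3) / det2 (a1 - a3) (a2 - a3))"
    and f': "f' = (- fst (a2 - a3) / det2 (a1 - a3) (a2 - a3), fst (a1 - a3) / det2 (a1 - a3) (a2 - a3))"
    and det_inverse: "det2 e' f' = 1 / det2 (a1 - a3) (a2 - a3)"
begin

abbreviation "F \<equiv> aff a3 (a1 - a3) (a2 - a3)"
abbreviation "G \<equiv> aff z' e' f'"
abbreviation "T \<equiv> convex hull {a1, a2, a3}"
abbreviation "dG w \<equiv> fst w *\<^sub>R e' + snd w *\<^sub>R f'"

lemma F_eq: "F (s, t) = s *\<^sub>R a1 + t *\<^sub>R a2 + (1 - s - t) *\<^sub>R a3"
  by (simp add: prod_eq_iff fst_aff snd_aff algebra_simps)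

lemma triangle_eq: "T = G -` closed_ref_triangle"
proof (intro set_eqI iffI)
  fix x assume "x \<in> T"
  then obtain u v w where uvw: "x = u *\<^sub>R a1 + v *\<^sub>R a2 + w *\<^sub>R a3" "0 \<le> u" "0 \<le> v" "0 \<le> w" "u + v + w = 1"
    unfolding convex_hull_3 by blast
  have "w = 1 - u - v" using uvw(5) by simp
  then have "x = F (u, v)" unfolding uvw(1) F_eq by simp
  then have "G x = (u, v)" by (simp only: inv)
  then show "x \<in> G -` closed_ref_triangle" using uvw by (simp add: closed_ref_triangle_def)
next
  fix x assume x: "x \<in> G -` closed_ref_triangle"
  obtain s t where st: "G x = (s, t)" by (cases "G x")
  have "x = F (s, t)" using inv(2)[of x] by (simp only: st)
  moreover have "0 \<le> s" "0 \<le> t" "s + t \<le> 1" using x st by (auto simp: closed_ref_triangle_def)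
  ultimately show "x \<in> T" unfolding convex_hull_3 F_eq
    by (intro CollectI exI[of _ s] exI[of _ t] exI[of _ "1 - s - t"]) auto
qed

lemma interior_triangle: "interior T = G -` ref_triangle"
proof (rule interior_unique)
  have "ref_triangle \<subseteq> closed_ref_triangle" unfolding closure_ref_triangle[symmetric] by (rule closure_subset)
  then show "G -` ref_triangle \<subseteq> T" unfolding triangle_eq by blast
  show "open (G -` ref_triangle)" by (rule open_vimage_aff[OF open_ref_triangle])
next
  fix S assume S: "S \<subseteq> T" "open S"
  have int: "interior closed_ref_triangle = ref_triangle"
    unfolding closure_ref_triangle[symmetric] convex_interior_closure[OF convex_ref_triangle]
    by (rule interior_open[OF open_ref_triangle])
  have "F -` S \<subseteq> closed_ref_triangle"
  proof
    fix x assume "x \<in> F -` S"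
    then have "F x \<in> T" using S(1) by blast
    then show "x \<in> closed_ref_triangle" unfolding triangle_eq by (simp add: inv)
  qed
  from interior_maximal[OF this open_vimage_aff[OF S(2)]] have sub: "F -` S \<subseteq> ref_triangle" unfolding int .
  show "S \<subseteq> G -` ref_triangle"
  proof
    fix y assume "y \<in> S"
    then have "G y \<in> F -` S" by (simp add: inv)
    then show "y \<in> G -` ref_triangle" using sub by blast
  qed
qed

lemma F_vimage: "F -` interior T = ref_triangle"
  by (rule set_eqI) (simp only: vimage_eq inv interior_triangle)

lemma closure_interior_triangle: "T \<subseteq> closure (interior T)"
proof
  fix x assume "x \<in> T"
  then have "G x \<in> closure ref_triangle" unfolding triangle_eq closure_ref_triangle by simp
  then have "F (G x) \<in> F ` closure ref_triangle" by blast
  also have "\<dots> \<subseteq> closure (F ` ref_triangle)"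
    by (rule image_closure_subset[OF continuous_on_aff closed_closure closure_subset])
  also have "F ` ref_triangle \<subseteq> interior T" unfolding interior_triangle by (auto simp: inv)
  then have "closure (F ` ref_triangle) \<subseteq> closure (interior T)" by (rule closure_mono)
  finally show "x \<in> closure (interior T)" by (simp add: inv)
qed

lemma vertices: "F (1, 0) = a1" "F (0, 1) = a2" "F (0, 0) = a3"
  by (simp_all add: aff_def)

lemma G_vertices: "G a1 = (1, 0)" "G a2 = (0, 1)" "G a3 = (0, 0)"
  using inv(1)[of "(1, 0)"] inv(1)[of "(0, 1)"] inv(1)[of "(0, 0)"] unfolding vertices by simp_all

lemma dG_basis: "dG (s *\<^sub>R (a1 - a3) + t *\<^sub>R (a2 - a3)) = (s, t)"
proof -
  have "dG (s *\<^sub>R (a1 - a3) + t *\<^sub>R (a2 - a3)) = G (a3 + (s *\<^sub>R (a1 - a3) + t *\<^sub>R (a2 - a3))) - G a3"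
    by (simp add: aff_def algebra_simps)
  also have "a3 + (s *\<^sub>R (a1 - a3) + t *\<^sub>R (a2 - a3)) = F (s, t)" by (simp add: aff_def)
  finally show ?thesis by (simp only: inv G_vertices) simp
qed

lemma has_derivative_pullback:
  assumes g: "C1_ref g g1 g2" and u: "\<And>y. y \<in> T \<Longrightarrow> u y = g (G y)" and x: "x \<in> T"
  shows "(u has_derivative (\<lambda>w. fst (dG w) * g1 (G x) + snd (dG w) * g2 (G x))) (at x within T)"
proof -
  have "G ` T = closed_ref_triangle" unfolding triangle_eq by (rule surj_image_vimage_eq) (metis inv(1) surj_def)
  then have "(g has_derivative (\<lambda>h. fst h * g1 (G x) + snd h * g2 (G x))) (at (G x) within G ` T)"
    using g x unfolding C1_ref_def triangle_eq by auto
  from has_derivative_in_compose[OF has_derivative_aff this]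
  have "((\<lambda>y. g (G y)) has_derivative (\<lambda>w. fst (dG w) * g1 (G x) + snd (dG w) * g2 (G x))) (at x within T)" .
  note D = this
  show ?thesis
  proof (rule Deriv.has_derivative_transform[OF x])
    show "u y = g (G y)" if "y \<in> T" for y by (rule u[OF that])
  qed (rule D)
qed

text \<open>\<open>frechet_derivative\<close> is an arbitrary choice among the derivatives within
  the triangle. Any two of them agree on the vectors from \<open>x\<close> to the vertices, hence by
  linearity on the differences of these, which span the plane.\<close>

lemma dir_deriv_pullback:
  assumes g: "C1_ref g g1 g2" and u: "\<And>y. y \<in> T \<Longrightarrow> u y = g (G y)" and x: "x \<in> T"
  shows "dir_deriv T u x (s *\<^sub>R (a1 - a3) + t *\<^sub>R (a2 - a3)) = s * g1 (G x) + t * g2 (G x)"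
proof -
  let ?D = "\<lambda>w. fst (dG w) * g1 (G x) + snd (dG w) * g2 (G x)"
  let ?D' = "frechet_derivative u (at x within T)"
  have D: "(u has_derivative ?D) (at x within T)" by (rule has_derivative_pullback[OF g u x])
  have D': "(u has_derivative ?D') (at x within T)"
    using D unfolding frechet_derivative_works[symmetric] differentiable_def by blast
  have "a1 \<in> T" "a2 \<in> T" "a3 \<in> T" by (auto intro: hull_inc)
  note eq = has_derivative_within_convex_unique[OF convex_convex_hull x _ D' D]
  note lin = has_derivative_linear[OF D] and lin' = has_derivative_linear[OF D']
  have "?D' (a1 - a3) = ?D (a1 - a3)" "?D' (a2 - a3) = ?D (a2 - a3)"
    using linear_diff[OF lin', of "a1 - x" "a3 - x"] linear_diff[OF lin', of "a2 - x" "a3 - x"]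
      linear_diff[OF lin, of "a1 - x" "a3 - x"] linear_diff[OF lin, of "a2 - x" "a3 - x"]
      eq[OF \<open>a1 \<in> T\<close>] eq[OF \<open>a2 \<in> T\<close>] eq[OF \<open>a3 \<in> T\<close>] by simp_all
  then have "?D' (s *\<^sub>R (a1 - a3) + t *\<^sub>R (a2 - a3)) = ?D (s *\<^sub>R (a1 - a3) + t *\<^sub>R (a2 - a3))"
    by (simp only: linear_add[OF lin'] linear_add[OF lin] linear_scale[OF lin'] linear_scale[OF lin])
  also have "\<dots> = s * g1 (G x) + t * g2 (G x)" unfolding dG_basis by simp
  finally show ?thesis by (simp add: dir_deriv_def)
qed

end

text \<open>Only the derivatives along \<open>nbar\<close> are rescaled, this vector being \<kappa>
  times the image of \<open>(1/2, 1/2)\<close>.\<close>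

definition dof_weights :: "nat \<Rightarrow> real \<Rightarrow> real list" where
  "dof_weights k \<kappa> = (if k = 3 then [1, 1, 1, 1, 1, 1, 1, 1, 1, \<kappa>] else [1, 1, 1, 1, 1, 1, 1, 1, 1, 1, 1, 1, 1, \<kappa>, \<kappa>])"

lemma weighted_ref_dofs_eq_iff:
  assumes "\<kappa> \<noteq> 0"
  shows "map2 (*) (dof_weights k \<kappa>) (ref_dofs k g g1 g2) = map2 (*) (dof_weights k \<kappa>) (ref_dofs k h h1 h2)
    \<longleftrightarrow> ref_dofs k g g1 g2 = ref_dofs k h h1 h2"
  using assms by (auto simp: dof_weights_def ref_dofs_def)

context affine_triangle
begin

lemma avg_vertices:
  "avg [a1, a2] = F (1/2, 1/2)" "avg [a1, a3] = F (1/2, 0)" "avg [a2, a3] = F (0, 1/2)"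
  "avg [a1, a1, a3] = F (2/3, 0)" "avg [a2, a2, a3] = F (0, 2/3)" "avg [a1, a3, a3] = F (1/3, 0)"
  "avg [a2, a3, a3] = F (0, 1/3)" "avg [a1, a2, a3] = F (1/3, 1/3)"
  "avg [a1, a1, a2] = F (2/3, 1/3)" "avg [a1, a2, a2] = F (1/3, 2/3)"
  by (simp_all add: avg_def F_eq prod_eq_iff)

lemma dofs_pullback:
  assumes k: "k \<in> {3, 4}" and g: "C1_ref g g1 g2" and u: "\<And>y. y \<in> T \<Longrightarrow> u y = g (G y)"
    and nbar: "nbar a1 a2 = (\<kappa> / 2) *\<^sub>R (a1 - a3) + (\<kappa> / 2) *\<^sub>R (a2 - a3)"
  shows "dofs k a1 a2 a3 u = map2 (*) (dof_weights k \<kappa>) (ref_dofs k g g1 g2)"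
proof -
  have inT: "F (s, t) \<in> T" if "0 \<le> s" "0 \<le> t" "s + t \<le> 1" for s t
    unfolding triangle_eq using that by (simp only: vimage_eq inv) (simp add: closed_ref_triangle_def)
  have uF: "u (F (s, t)) = g (s, t)" if "0 \<le> s" "0 \<le> t" "s + t \<le> 1" for s t
    using u[OF inT[OF that]] by (simp only: inv)
  have dF: "dir_deriv T u (F (s, t)) (a *\<^sub>R (a1 - a3) + b *\<^sub>R (a2 - a3)) = a * g1 (s, t) + b * g2 (s, t)"
    if "0 \<le> s" "0 \<le> t" "s + t \<le> 1" for s t a b
    using dir_deriv_pullback[OF g u inT[OF that]] by (simp only: inv)
  have dirs: "a2 - a1 = (-1) *\<^sub>R (a1 - a3) + 1 *\<^sub>R (a2 - a3)" "a3 - a1 = (-1) *\<^sub>R (a1 - a3) + 0 *\<^sub>R (a2 - a3)"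
    "a1 - a2 = 1 *\<^sub>R (a1 - a3) + (-1) *\<^sub>R (a2 - a3)" "a3 - a2 = 0 *\<^sub>R (a1 - a3) + (-1) *\<^sub>R (a2 - a3)"
    by simp_all
  have uv: "u a1 = g (1, 0)" "u a2 = g (0, 1)" "u a3 = g (0, 0)"
    using uF[of 1 0] uF[of 0 1] uF[of 0 0] unfolding vertices by simp_all
  have dv: "dir_deriv T u a1 (a2 - a1) = g2 (1, 0) - g1 (1, 0)" "dir_deriv T u a1 (a3 - a1) = - g1 (1, 0)"
    "dir_deriv T u a2 (a1 - a2) = g1 (0, 1) - g2 (0, 1)" "dir_deriv T u a2 (a3 - a2) = - g2 (0, 1)"
    using dF[of 1 0 "-1" 1] dF[of 1 0 "-1" 0] dF[of 0 1 1 "-1"] dF[of 0 1 0 "-1"] unfolding vertices dirs[symmetric] by simp_all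
  have dn: "dir_deriv T u (F (s, t)) (nbar a1 a2) = \<kappa> * ((g1 (s, t) + g2 (s, t)) / 2)"
    if "0 \<le> s" "0 \<le> t" "s + t \<le> 1" for s t
    unfolding nbar dF[OF that] by (simp add: algebra_simps)
  have "k = 3 \<or> k = 4" using k by auto
  then show ?thesis
  proof
    assume k: "k = 3"
    show ?thesis
      unfolding k dofs_def dofs3_def Let_def avg_vertices if_P[OF refl] uv dv
      by (simp add: uF dn ref_dofs_def dof_weights_def)
  next
    assume k: "k = 4"
    have "(4::nat) \<noteq> 3" by simp
    show ?thesis
      unfolding k dofs_def dofs4_def Let_def avg_vertices if_not_P[OF \<open>(4::nat) \<noteq> 3\<close>] uv dv
      by (simp add: uF dn ref_dofs_def dof_weights_def)
  qed
qed

lemma C1_on_pullback: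
  assumes g: "C1_ref g g1 g2"
  shows "C1_on T (\<lambda>x. g (G x))"
proof -
  let ?d = "\<lambda>x. (fst e' * g1 (G x) + snd e' * g2 (G x), fst f' * g1 (G x) + snd f' * g2 (G x))"
  have "continuous_on T (\<lambda>x. g1 (G x))" "continuous_on T (\<lambda>x. g2 (G x))"
    using g unfolding C1_ref_def triangle_eq
    by (auto intro!: continuous_on_compose2[OF _ continuous_on_aff])
  then have "continuous_on T ?d" by (intro continuous_intros)
  moreover have "((\<lambda>x. g (G x)) has_derivative (\<lambda>w. ?d x \<bullet> w)) (at x within T)" if "x \<in> T" for x
    using has_derivative_pullback[OF g refl that]
    by (rule has_derivative_eq_rhs) (simp add: fun_eq_iff inner_prod_def algebra_simps)
  ultimately show ?thesis unfolding C1_on_def by blast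
qed

text \<open>Whatever representative is chosen, it is continuous and equals \<open>v\<close> almost
  everywhere on the interior. So it agrees with the pullback of \<open>g\<close> on the interior,
  and by continuity on the closed triangle.\<close>

lemma C1_representative_pullback:
  assumes g: "C1_ref g g1 g2" and ae: "AE x in lebesgue. x \<in> ref_triangle \<longrightarrow> v (F x) = g x" and x: "x \<in> T"
  shows "C1_representative T v x = g (G x)"
proof -
  let ?P = "\<lambda>u. C1_on T u \<and> (AE x in lebesgue_on (interior T). u x = v x)"
  note AEi = AE_lebesgue_on_iff[OF open_sets_lebesgue[OF open_interior]]
  have "det2 e' f' \<noteq> 0" using det by (simp add: det_inverse)
  from AE_lebesgue_aff[where z = z', OF this ae] have ae': "AE x in lebesgue. x \<in> interior T \<longrightarrow> v x = g (G x)"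
    unfolding interior_triangle by (rule AE_mp) (rule AE_I2, simp only: inv vimage_eq, simp)
  have "AE x in lebesgue_on (interior T). g (G x) = v x"
    unfolding AEi using ae' by (rule AE_mp) (rule AE_I2, simp)
  with C1_on_pullback[OF g] have "?P (\<lambda>x. g (G x))" by (rule conjI)
  then have rep: "?P (C1_representative T v)" unfolding C1_representative_def by (rule someI[of ?P])
  note u = rep[THEN conjunct1] rep[THEN conjunct2, unfolded AEi]
  have cont: "continuous_on T w" if w: "C1_on T w" for w
  proof -
    obtain d where d: "\<forall>x\<in>T. (w has_derivative (\<lambda>h. d x \<bullet> h)) (at x within T)"
      using w unfolding C1_on_def by blast
    show ?thesis by (rule has_derivative_continuous_on[where f' = "\<lambda>x h. d x \<bullet> h"]) (use d in blast)
  qed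
  note c = cont[OF u(1)] cont[OF C1_on_pullback[OF g]]
  have eq: "C1_representative T v y = g (G y)" if "y \<in> interior T" for y
  proof (rule AE_eq_imp_eq_on_open[OF open_interior continuous_on_subset[OF c(1) interior_subset] continuous_on_subset[OF c(2) interior_subset] _ that])
    show "AE x in lebesgue. x \<in> interior T \<longrightarrow> C1_representative T v x = g (G x)"
      using u(2) ae' by (rule AE_mp[OF _ AE_mp[OF _ AE_I2]]) simp
  qed
  have "closed T" by (intro compact_imp_closed compact_convex_hull) simp
  then have sub: "closure (interior T) \<subseteq> T" by (intro closure_minimal interior_subset)
  have "C1_representative T v x - g (G x) = 0"
    by (rule continuous_constant_on_closure[of "interior T" "\<lambda>x. C1_representative T v x - g (G x)" 0])
      (use x closure_interior_triangle eq in \<open>auto intro!: continuous_on_diff continuous_on_subset[OF c(1) sub] continuous_on_subset[OF c(2) sub]\<close>)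
  then show ?thesis by simp
qed

text \<open>The pulled back polynomial has the required degrees of freedom, since the weights are
  common to both sides. A competitor becomes a polynomial of the same degree on the reference
  triangle, where nonzero weights can be cancelled and unisolvence applies.\<close>

lemma interpolant_pullback:
  assumes k: "k \<in> {3, 4}" and g: "C1_ref g g1 g2" and ae: "AE x in lebesgue. x \<in> ref_triangle \<longrightarrow> v (F x) = g x"
    and nbar: "nbar a1 a2 = (\<kappa> / 2) *\<^sub>R (a1 - a3) + (\<kappa> / 2) *\<^sub>R (a2 - a3)" and \<kappa>: "\<kappa> \<noteq> 0"
    and c: "poly_dofs k c = ref_dofs k g g1 g2"
  shows "interpolant k a1 a2 a3 v = (\<lambda>x. poly_fun k c (G x))"
  unfolding interpolant_def
proof (rule the_equality)
  have d: "dofs k a1 a2 a3 (C1_representative T v) = map2 (*) (dof_weights k \<kappa>) (ref_dofs k g g1 g2)"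
    by (rule dofs_pullback[OF k g C1_representative_pullback[OF g ae] nbar])
  have P: "dofs k a1 a2 a3 (\<lambda>x. poly_fun k c' (G x)) = map2 (*) (dof_weights k \<kappa>) (poly_dofs k c')" for c'
    by (rule dofs_pullback[OF k C1_ref_poly refl nbar])
  show "(\<lambda>x. poly_fun k c (G x)) \<in> poly_space k \<and> dofs k a1 a2 a3 (\<lambda>x. poly_fun k c (G x)) = dofs k a1 a2 a3 (C1_representative T v)"
    unfolding d P c by (intro conjI poly_space_aff poly_fun_in_poly_space refl)
  fix Q assume Q: "Q \<in> poly_space k \<and> dofs k a1 a2 a3 Q = dofs k a1 a2 a3 (C1_representative T v)"
  then obtain c' where c': "(\<lambda>x. Q (F x)) = poly_fun k c'"
    using poly_space_aff[of Q k] unfolding poly_space_iff by blast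
  have QG: "Q = (\<lambda>x. poly_fun k c' (G x))" unfolding c'[symmetric] by (simp only: inv)
  have "dofs k a1 a2 a3 (\<lambda>x. poly_fun k c' (G x)) = dofs k a1 a2 a3 (C1_representative T v)"
    using Q unfolding QG by blast
  then have "poly_dofs k c' = poly_dofs k c"
    unfolding P d weighted_ref_dofs_eq_iff[OF \<kappa>] c .
  from poly_dofs_inj[OF k this] show "Q = (\<lambda>x. poly_fun k c (G x))" unfolding QG by simp
qed

end

section \<open>Full norms and embeddings under affine maps\<close>

lemma sobolev_norm_aff:
  assumes p: "1 \<le> p" and det: "det2 e f \<noteq> 0" and U: "open U"
  shows "\<exists>C\<ge>0. \<forall>v\<in>sobolev_space n p U. sobolev_norm n p (aff z e f -` U) (\<lambda>x. v (aff z e f x)) \<le> C * sobolev_norm n p U v"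
proof -
  define K where "K = \<bar>fst e\<bar> + \<bar>snd e\<bar> + \<bar>fst f\<bar> + \<bar>snd f\<bar>"
  have K: "\<bar>fst e\<bar> \<le> K" "\<bar>snd e\<bar> \<le> K" "\<bar>fst f\<bar> \<le> K" "\<bar>snd f\<bar> \<le> K" "0 \<le> K" by (auto simp: K_def)
  define c where "c l = real (l + 1) * 2 ^ (l + 1) * (2 * K) ^ l * \<bar>det2 e f\<bar> powr (- (1 / real_of_ereal p))" for l
  have c: "0 \<le> c l" for l using K(5) by (simp add: c_def)
  have "sobolev_norm n p (aff z e f -` U) (\<lambda>x. v (aff z e f x)) \<le> (\<Sum>l\<le>n. c l * real (l + 1)) * sobolev_norm n p U v"
    if v: "v \<in> sobolev_space n p U" for v
  proof -
    have "sobolev_norm n p (aff z e f -` U) (\<lambda>x. v (aff z e f x)) \<le> (\<Sum>l\<le>n. sobolev_seminorm l p (aff z e f -` U) (\<lambda>x. v (aff z e f x)))"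
      by (rule sobolev_norm_le_seminorms[OF p])
    also have "\<dots> \<le> (\<Sum>l\<le>n. c l * (real (l + 1) * sobolev_norm n p U v))"
    proof (rule sum_mono)
      fix l assume "l \<in> {..n}"
      then have l: "l \<le> n" by simp
      have "sobolev_seminorm l p (aff z e f -` U) (\<lambda>x. v (aff z e f x)) \<le> c l * sobolev_seminorm l p U v"
        unfolding c_def by (rule sobolev_seminorm_aff[OF p det U v l K(1-4)])
      also have "\<dots> \<le> c l * (real (l + 1) * sobolev_norm n p U v)"
        by (intro mult_left_mono sobolev_seminorm_le_norm p l c)
      finally show "sobolev_seminorm l p (aff z e f -` U) (\<lambda>x. v (aff z e f x)) \<le> c l * (real (l + 1) * sobolev_norm n p U v)" .
    qed
    also have "\<dots> = (\<Sum>l\<le>n. c l * real (l + 1)) * sobolev_norm n p U v"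
      by (simp only: sum_distrib_right mult.assoc)
    finally show ?thesis .
  qed
  moreover have "0 \<le> (\<Sum>l\<le>n. c l * real (l + 1))" by (intro sum_nonneg mult_nonneg_nonneg c) simp
  ultimately show ?thesis by blast
qed

text \<open>A function on the preimage is moved to \<open>U\<close>, embedded there and moved back.
  The constants depend on the map, which is harmless because a single triangle is treated in this
  way.\<close>

lemma sobolev_embedding_aff:
  assumes p: "1 \<le> p" and q: "1 \<le> q" and det: "det2 e f \<noteq> 0" and U: "open U" and emb: "sobolev_embedding n p m q U"
  shows "sobolev_embedding n p m q (aff z e f -` U)"
proof -
  obtain z' e' f' where inv: "\<And>x. aff z' e' f' (aff z e f x) = x" "\<And>x. aff z e f (aff z' e' f' x) = x"
    and det': "det2 e' f' = 1 / det2 e f"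
    using aff_inverse[OF det] by metis
  let ?W = "aff z e f -` U"
  have W: "open ?W" by (rule open_vimage_aff[OF U])
  have WU: "aff z' e' f' -` ?W = U" by (rule set_eqI) (simp only: vimage_eq inv)
  have d': "det2 e' f' \<noteq> 0" using det by (simp add: det')
  obtain c where c: "\<And>v. v \<in> sobolev_space n p U \<Longrightarrow> sobolev_norm m q U v \<le> c * sobolev_norm n p U v"
    and sub: "sobolev_space n p U \<subseteq> sobolev_space m q U"
    using emb unfolding sobolev_embedding_def by blast
  obtain C1 where C1: "0 \<le> C1" "\<And>v. v \<in> sobolev_space m q U \<Longrightarrow> sobolev_norm m q ?W (\<lambda>x. v (aff z e f x)) \<le> C1 * sobolev_norm m q U v"
    using sobolev_norm_aff[OF q det U, of m z] by blast
  obtain C2 where C2: "0 \<le> C2" "\<And>v. v \<in> sobolev_space n p ?W \<Longrightarrow> sobolev_norm n p U (\<lambda>x. v (aff z' e' f' x)) \<le> C2 * sobolev_norm n p ?W v"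
    using sobolev_norm_aff[OF p d' W, of n z'] unfolding WU by blast
  have "v \<in> sobolev_space m q ?W \<and> sobolev_norm m q ?W v \<le> C1 * (\<bar>c\<bar> * C2) * sobolev_norm n p ?W v"
    if v: "v \<in> sobolev_space n p ?W" for v
  proof -
    let ?w = "\<lambda>x. v (aff z' e' f' x)"
    have w: "?w \<in> sobolev_space n p U" using sobolev_space_aff[OF p d' W v, of z'] unfolding WU .
    then have wm: "?w \<in> sobolev_space m q U" using sub by blast
    have vw: "(\<lambda>x. ?w (aff z e f x)) = v" by (simp only: inv)
    have "v \<in> sobolev_space m q ?W" using sobolev_space_aff[OF q det U wm, of z] unfolding vw .
    have "sobolev_norm m q ?W v \<le> C1 * sobolev_norm m q U ?w" using C1(2)[OF wm] unfolding vw .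
    also have "\<dots> \<le> C1 * (c * sobolev_norm n p U ?w)" by (intro mult_left_mono c w C1)
    also have "\<dots> \<le> C1 * (\<bar>c\<bar> * (C2 * sobolev_norm n p ?W v))"
      using sobolev_norm_nonneg[OF p, of n U ?w] by (intro mult_left_mono mult_mono C2(2) v C1(1)) auto
    finally show ?thesis using \<open>v \<in> sobolev_space m q ?W\<close> by (simp add: mult.assoc)
  qed
  then show ?thesis unfolding sobolev_embedding_def by blast
qed

lemma powr_mul_square:
  assumes "0 < (c::real)" "0 < H"
  shows "(c * H\<^sup>2) powr r = c powr r * H powr (2 * r)"
proof -
  have "H\<^sup>2 = H powr 2" using assms by (simp add: powr_numeral)
  then have "(H\<^sup>2) powr r = H powr (2 * r)" by (simp only: powr_powr)
  then show ?thesis using assms by (simp add: powr_mult)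
qed

subsection \<open>The interpolation error\<close>

text \<open>For the exponent \<infinity> both sides are 0 by convention.\<close>

lemma two_over_exponent: "1 \<le> (q::ereal) \<Longrightarrow> real_of_ereal (2 / q) = 2 * (1 / real_of_ereal q)"
  by (cases rule: exponent_cases[of q]) (simp_all add: numeral_eq_ereal)

text \<open>Lower orders cost fewer negative powers of \<open>H\<close>. Since \<open>H\<close> is
  at most \<open>s\<close>, all of them are absorbed into \<open>H^(-m)\<close> at the price of
  \<open>(1 + s)^m\<close>.\<close>

lemma inverse_scale_power_le:
  fixes H K s :: real
  assumes H: "0 < H" "H \<le> s" and K: "0 \<le> K" and j: "j \<le> m"
  shows "(2 * (K / H)) ^ j \<le> (1 + 2 * K) ^ m * (1 + s) ^ m * H powr (- real m)"
proof -
  have a: "(2 * K) ^ j \<le> (1 + 2 * K) ^ m"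
    using power_mono[of "2 * K" "1 + 2 * K" j] power_increasing[OF j, of "1 + 2 * K"] K by simp
  have b: "H ^ (m - j) \<le> (1 + s) ^ m"
    by (rule order_trans[OF power_mono[of H "1 + s" "m - j"] power_increasing[of "m - j" m "1 + s"]]) (use H in auto)
  have "(1 / H) ^ j = H ^ (m - j) * (1 / H ^ m)"
    using H j by (simp add: power_diff power_one_over)
  then have "(2 * (K / H)) ^ j = (2 * K) ^ j * (H ^ (m - j) * (1 / H ^ m))"
    by (metis mult.assoc power_mult_distrib times_divide_eq_right mult.right_neutral)
  also have "\<dots> \<le> (1 + 2 * K) ^ m * ((1 + s) ^ m * (1 / H ^ m))"
    using H K by (intro mult_mono a b) auto
  also have "1 / H ^ m = H powr (- real m)"
    using H by (simp add: powr_minus powr_realpow divide_inverse)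
  finally show ?thesis by (simp add: mult.assoc)
qed

text \<open>\<open>H\<close> will be the diameter and \<open>s\<close> an upper bound for it. The
  ratio \<open>K / H\<close> bounds the inverse map and \<open>d H^2\<close> the determinant from
  below, with \<open>K\<close>, \<open>d\<close> and \<open>s\<close> common to the whole
  family.\<close>

definition regular_triangle ::
    "real \<Rightarrow> real \<Rightarrow> real \<Rightarrow> point \<Rightarrow> point \<Rightarrow> point \<Rightarrow> point \<Rightarrow> point \<Rightarrow> point \<Rightarrow> real \<Rightarrow> real \<Rightarrow> bool" where
  "regular_triangle K d s a1 a2 a3 z' e' f' \<kappa> H \<longleftrightarrow>
    affine_triangle a1 a2 a3 z' e' f' \<and> \<kappa> \<noteq> 0 \<and>
    nbar a1 a2 = (\<kappa> / 2) *\<^sub>R (a1 - a3) + (\<kappa> / 2) *\<^sub>R (a2 - a3) \<and> 0 < H \<and> H \<le> s \<and>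
    (\<bar>fst (a1 - a3)\<bar> \<le> H \<and> \<bar>snd (a1 - a3)\<bar> \<le> H \<and> \<bar>fst (a2 - a3)\<bar> \<le> H \<and> \<bar>snd (a2 - a3)\<bar> \<le> H) \<and>
    (\<bar>fst e'\<bar> \<le> K / H \<and> \<bar>snd e'\<bar> \<le> K / H \<and> \<bar>fst f'\<bar> \<le> K / H \<and> \<bar>snd f'\<bar> \<le> K / H) \<and>
    d * H\<^sup>2 \<le> \<bar>det2 (a1 - a3) (a2 - a3)\<bar> \<and> \<bar>det2 (a1 - a3) (a2 - a3)\<bar> \<le> 2 * H\<^sup>2"

text \<open>Going to the reference triangle yields \<open>H^(k + 1)\<close> from the
  \<open>k + 1\<close> derivatives and \<open>H^(-2/p)\<close> from the determinant; coming back
  yields \<open>H^(-m)\<close> and \<open>H^(2/q)\<close>. In between, the embedding is applied to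
  the error on the reference triangle.\<close>

lemma interpolation_error:
  assumes p: "1 \<le> p" and q: "1 \<le> q" and k: "k \<in> {3, 4}" and emb: "sobolev_embedding (Suc k) p m q ref_triangle"
    and K: "0 \<le> K" and d0: "0 < d0" and s: "0 \<le> s"
  shows "\<exists>C>0. \<forall>a1 a2 a3 z' e' f' \<kappa> H v. regular_triangle K d0 s a1 a2 a3 z' e' f' \<kappa> H \<longrightarrow>
    v \<in> sobolev_space (Suc k) p (interior (convex hull {a1, a2, a3})) \<longrightarrow>
    (\<lambda>x. v x - interpolant k a1 a2 a3 v x) \<in> sobolev_space m q (interior (convex hull {a1, a2, a3})) \<and>
    sobolev_norm m q (interior (convex hull {a1, a2, a3})) (\<lambda>x. v x - interpolant k a1 a2 a3 v x)
      \<le> C * H powr (real k + 1 - real m + real_of_ereal (2 / q) - real_of_ereal (2 / p))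
          * sobolev_norm (Suc k) p (interior (convex hull {a1, a2, a3})) v"
proof -
  let ?n = "Suc k" and ?R = ref_triangle
  define rp rq where "rp = 1 / real_of_ereal p" and "rq = 1 / real_of_ereal q"
  have r: "0 \<le> rp" "0 \<le> rq" using inverse_exponent_bounds(1)[OF p] inverse_exponent_bounds(1)[OF q] by (simp_all only: rp_def rq_def)
  obtain C2 where C2: "0 \<le> C2" "\<And>v. v \<in> sobolev_space ?n p ?R \<Longrightarrow> \<exists>g g1 g2 c. C1_ref g g1 g2 \<and>
    (AE x in lebesgue. x \<in> ?R \<longrightarrow> v x = g x) \<and> poly_dofs k c = ref_dofs k g g1 g2 \<and>
    (\<Sum>l\<le>?n. sobolev_seminorm l p ?R (\<lambda>x. v x - poly_fun k c x)) \<le> C2 * sobolev_seminorm ?n p ?R v"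
    using ref_interpolation[OF p k] by blast
  obtain c3' where c3': "\<And>v. v \<in> sobolev_space ?n p ?R \<Longrightarrow> sobolev_norm m q ?R v \<le> c3' * sobolev_norm ?n p ?R v"
    and sub: "sobolev_space ?n p ?R \<subseteq> sobolev_space m q ?R"
    using emb unfolding sobolev_embedding_def by blast
  define c3 where "c3 = \<bar>c3'\<bar>"
  define c1 where "c1 = real (?n + 1) * 2 ^ (?n + 1) * 2 ^ ?n * d0 powr (- rp) * real (?n + 1)"
  define c4 where "c4 = real (m + 1) * 2 ^ (m + 1) * ((1 + 2 * K) ^ m * (1 + s) ^ m) * 2 powr rq * real (m + 1)"
  define C where "C = real (m + 1) * c4 * (c3 * (C2 * c1))"
  have nn: "0 \<le> c1" "0 \<le> c3" "0 \<le> c4" using K s by (simp_all add: c1_def c3_def c4_def)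
  then have C: "0 \<le> C" using C2(1) by (simp add: C_def)
  have main: "(\<lambda>x. v x - interpolant k a1 a2 a3 v x) \<in> sobolev_space m q (interior (convex hull {a1, a2, a3})) \<and>
    sobolev_norm m q (interior (convex hull {a1, a2, a3})) (\<lambda>x. v x - interpolant k a1 a2 a3 v x)
      \<le> (C + 1) * H powr (real k + 1 - real m + real_of_ereal (2 / q) - real_of_ereal (2 / p))
          * sobolev_norm ?n p (interior (convex hull {a1, a2, a3})) v"
    if reg: "regular_triangle K d0 s a1 a2 a3 z' e' f' \<kappa> H"
      and v: "v \<in> sobolev_space ?n p (interior (convex hull {a1, a2, a3}))"
    for a1 a2 a3 z' e' f' :: point and \<kappa> H v
  proof -
    note reg' = reg[unfolded regular_triangle_def]
    note tri = reg'[THEN conjunct1] note reg' = reg'[THEN conjunct2]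
    note \<kappa> = reg'[THEN conjunct1] note reg' = reg'[THEN conjunct2]
    note nbar = reg'[THEN conjunct1] note reg' = reg'[THEN conjunct2]
    note H = reg'[THEN conjunct1] reg'[THEN conjunct2, THEN conjunct1] note reg' = reg'[THEN conjunct2, THEN conjunct2]
    note e = reg'[THEN conjunct1] note reg' = reg'[THEN conjunct2]
    note e' = reg'[THEN conjunct1] note reg' = reg'[THEN conjunct2]
    note D = reg'[THEN conjunct1] reg'[THEN conjunct2]
    interpret A: affine_triangle a1 a2 a3 z' e' f' by (rule tri)
    let ?F = "aff a3 (a1 - a3) (a2 - a3)" and ?G = "aff z' e' f'" and ?I = "interior (convex hull {a1, a2, a3})"
    define N where "N = sobolev_norm ?n p ?I v"
    have N: "0 \<le> N" unfolding N_def by (rule sobolev_norm_nonneg[OF p])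
    have D0: "0 < \<bar>det2 (a1 - a3) (a2 - a3)\<bar>" using A.det by simp
    define vh where "vh = (\<lambda>x. v (?F x))"
    have vh: "vh \<in> sobolev_space ?n p ?R"
      using sobolev_space_aff[OF p A.det open_interior v, of a3] unfolding A.F_vimage vh_def .
    obtain g g1 g2 c where g: "C1_ref g g1 g2" "AE x in lebesgue. x \<in> ?R \<longrightarrow> vh x = g x" "poly_dofs k c = ref_dofs k g g1 g2"
      and Ec: "(\<Sum>l\<le>?n. sobolev_seminorm l p ?R (\<lambda>x. vh x - poly_fun k c x)) \<le> C2 * sobolev_seminorm ?n p ?R vh"
      using C2(2)[OF vh] by blast
    have int: "interpolant k a1 a2 a3 v = (\<lambda>x. poly_fun k c (?G x))"
      by (rule A.interpolant_pullback[OF k g(1) g(2)[unfolded vh_def] nbar \<kappa> g(3)])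
    define w where "w = (\<lambda>x. vh x - poly_fun k c x)"
    have w: "w \<in> sobolev_space ?n p ?R" unfolding w_def by (rule sobolev_space_minus_poly[OF p vh])
    have wm: "w \<in> sobolev_space m q ?R" using w sub by blast
    have eq: "(\<lambda>x. v x - interpolant k a1 a2 a3 v x) = (\<lambda>x. w (?G x))"
      unfolding int w_def vh_def by (simp only: A.inv)
    have d': "det2 e' f' \<noteq> 0" using A.det by (simp add: A.det_inverse)
    note GR = A.interior_triangle[symmetric]
    have mem: "(\<lambda>x. w (?G x)) \<in> sobolev_space m q ?I"
      using sobolev_space_aff[OF q d' open_ref_triangle wm, of z'] unfolding GR .
    have S1: "sobolev_seminorm ?n p ?R vh \<le> c1 * H powr (real ?n - 2 * rp) * N"
    proof -
      have "sobolev_seminorm ?n p ?R vh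
        \<le> real (?n + 1) * 2 ^ (?n + 1) * (2 * H) ^ ?n * \<bar>det2 (a1 - a3) (a2 - a3)\<bar> powr (- rp) * sobolev_seminorm ?n p ?I v"
        using sobolev_seminorm_aff[OF p A.det open_interior v order_refl, of H a3] e
        unfolding A.F_vimage vh_def rp_def by blast
      also have "\<dots> \<le> real (?n + 1) * 2 ^ (?n + 1) * (2 ^ ?n * H powr real ?n) * (d0 powr (- rp) * H powr (2 * (- rp))) * (real (?n + 1) * N)"
      proof (intro mult_mono order_refl)
        show "(2 * H) ^ ?n \<le> 2 ^ ?n * H powr real ?n" using H by (simp only: power_mult_distrib powr_realpow order_refl)
        have "\<bar>det2 (a1 - a3) (a2 - a3)\<bar> powr (- rp) \<le> (d0 * H\<^sup>2) powr (- rp)"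
          using D(1) H d0 r by (intro powr_mono2') auto
        then show "\<bar>det2 (a1 - a3) (a2 - a3)\<bar> powr (- rp) \<le> d0 powr (- rp) * H powr (2 * (- rp))"
          unfolding powr_mul_square[OF d0 H(1)] .
        show "sobolev_seminorm ?n p ?I v \<le> real (?n + 1) * N"
          unfolding N_def by (rule sobolev_seminorm_le_norm[OF p order_refl])
      qed (use H in \<open>auto simp: sobolev_seminorm_nonneg\<close>)
      also have "\<dots> = c1 * (H powr real ?n * H powr (2 * (- rp))) * N" by (simp only: c1_def mult_ac)
      also have "H powr real ?n * H powr (2 * (- rp)) = H powr (real ?n - 2 * rp)" by (simp add: powr_add[symmetric])
      finally show ?thesis .
    qed
    have S3: "sobolev_norm m q ?R w \<le> c3 * (C2 * (c1 * H powr (real ?n - 2 * rp) * N))"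
    proof -
      have "sobolev_norm m q ?R w \<le> c3' * sobolev_norm ?n p ?R w" by (rule c3'[OF w])
      also have "\<dots> \<le> c3 * sobolev_norm ?n p ?R w"
        unfolding c3_def by (intro mult_right_mono sobolev_norm_nonneg[OF p]) simp
      also have "\<dots> \<le> c3 * (\<Sum>l\<le>?n. sobolev_seminorm l p ?R w)"
        by (intro mult_left_mono sobolev_norm_le_seminorms[OF p] nn)
      also have "\<dots> \<le> c3 * (C2 * sobolev_seminorm ?n p ?R vh)"
        using Ec unfolding w_def by (rule mult_left_mono[OF _ nn(2)])
      also have "\<dots> \<le> c3 * (C2 * (c1 * H powr (real ?n - 2 * rp) * N))"
        by (intro mult_left_mono S1 C2(1) nn)
      finally show ?thesis .
    qed
    have Nm: "0 \<le> sobolev_norm m q ?R w" by (rule sobolev_norm_nonneg[OF q])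
    have S4: "sobolev_seminorm j q ?I (\<lambda>x. w (?G x)) \<le> c4 * H powr (2 * rq - real m) * sobolev_norm m q ?R w" if j: "j \<in> {..m}" for j
    proof -
      have jm: "j \<le> m" using j by simp
      have "sobolev_seminorm j q ?I (\<lambda>x. w (?G x))
        \<le> real (j + 1) * 2 ^ (j + 1) * (2 * (K / H)) ^ j * \<bar>det2 e' f'\<bar> powr (- rq) * sobolev_seminorm j q ?R w"
        using sobolev_seminorm_aff[OF q d' open_ref_triangle wm jm, of "K / H" z'] e'
        unfolding GR rq_def by blast
      also have "\<dots> \<le> real (m + 1) * 2 ^ (m + 1) * ((1 + 2 * K) ^ m * (1 + s) ^ m * H powr (- real m)) * (2 powr rq * H powr (2 * rq)) * (real (m + 1) * sobolev_norm m q ?R w)"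
      proof (intro mult_mono)
        show "(2::real) ^ (j + 1) \<le> 2 ^ (m + 1)" using jm by (intro power_increasing) auto
        show "(2 * (K / H)) ^ j \<le> (1 + 2 * K) ^ m * (1 + s) ^ m * H powr (- real m)"
          by (rule inverse_scale_power_le[OF H K jm])
        have "\<bar>det2 e' f'\<bar> powr (- rq) = (\<bar>det2 (a1 - a3) (a2 - a3)\<bar> powr (-1)) powr (- rq)"
          using D0 by (simp add: A.det_inverse powr_minus divide_inverse abs_mult abs_inverse)
        also have "\<dots> = \<bar>det2 (a1 - a3) (a2 - a3)\<bar> powr rq" by (simp only: powr_powr) simp
        also have "\<dots> \<le> (2 * H\<^sup>2) powr rq" using D(2) r(2) by (intro powr_mono2) auto
        also have "\<dots> = 2 powr rq * H powr (2 * rq)" by (rule powr_mul_square[OF _ H(1)]) simp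
        finally show "\<bar>det2 e' f'\<bar> powr (- rq) \<le> 2 powr rq * H powr (2 * rq)" .
        have "sobolev_seminorm j q ?R w \<le> real (j + 1) * sobolev_norm m q ?R w" by (rule sobolev_seminorm_le_norm[OF q jm])
        also have "\<dots> \<le> real (m + 1) * sobolev_norm m q ?R w" using jm by (intro mult_right_mono Nm) simp
        finally show "sobolev_seminorm j q ?R w \<le> real (m + 1) * sobolev_norm m q ?R w" .
      qed (use H K s jm in \<open>auto simp: sobolev_seminorm_nonneg\<close>)
      also have "\<dots> = c4 * (H powr (2 * rq) * H powr (- real m)) * sobolev_norm m q ?R w" by (simp only: c4_def mult_ac)
      also have "H powr (2 * rq) * H powr (- real m) = H powr (2 * rq - real m)" by (simp add: powr_add[symmetric])
      finally show ?thesis .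
    qed
    have "sobolev_norm m q ?I (\<lambda>x. w (?G x)) \<le> (\<Sum>j\<le>m. sobolev_seminorm j q ?I (\<lambda>x. w (?G x)))"
      by (rule sobolev_norm_le_seminorms[OF q])
    also have "\<dots> \<le> (\<Sum>j\<le>m. c4 * H powr (2 * rq - real m) * sobolev_norm m q ?R w)" by (rule sum_mono[OF S4])
    also have "\<dots> = real (m + 1) * (c4 * H powr (2 * rq - real m) * sobolev_norm m q ?R w)" by simp
    also have "\<dots> \<le> real (m + 1) * (c4 * H powr (2 * rq - real m) * (c3 * (C2 * (c1 * H powr (real ?n - 2 * rp) * N))))"
      by (intro mult_left_mono S3 mult_nonneg_nonneg nn) auto
    also have "\<dots> = C * (H powr (2 * rq - real m) * H powr (real ?n - 2 * rp)) * N" by (simp only: C_def mult_ac)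
    also have "\<dots> \<le> (C + 1) * (H powr (2 * rq - real m) * H powr (real ?n - 2 * rp)) * N"
      using N by (intro mult_right_mono) auto
    also have "H powr (2 * rq - real m) * H powr (real ?n - 2 * rp) = H powr (real k + 1 - real m + real_of_ereal (2 / q) - real_of_ereal (2 / p))"
      unfolding two_over_exponent[OF p] two_over_exponent[OF q] rp_def rq_def
      by (simp only: powr_add[symmetric]) (simp add: algebra_simps)
    finally show ?thesis using mem unfolding eq N_def by blast
  qed
  \<comment> \<open>\<open>C\<close> may be 0, while the constant claimed is positive.\<close>
  have "0 < C + 1" using C by simp
  then show ?thesis using main by blast
qed

section \<open>Shape bounds from quasi-uniformity\<close>

text \<open>Along a horizontal radius of the disc the reference coordinates change by at most 1. As
  the edges at \<open>a3\<close> have opposite slopes, the vanishing vertical component forces both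
  contributions to the horizontal one to be \<open>r / 2\<close>.\<close>

lemma (in affine_triangle) edge_length_lower_bound:
  assumes s: "snd (a1 - a3) = s * fst (a1 - a3)" "snd (a2 - a3) = - s * fst (a2 - a3)" "s \<noteq> 0"
    and r: "0 < r" "cball x r \<subseteq> T"
  shows "r / 2 \<le> \<bar>fst (a1 - a3)\<bar>" "r / 2 \<le> \<bar>fst (a2 - a3)\<bar>"
proof -
  define y where "y = x + (r, 0)"
  have "x \<in> cball x r" "y \<in> cball x r" using r(1) by (simp_all add: y_def dist_norm norm_Pair)
  then have "x \<in> T" "y \<in> T" using r(2) by blast+
  then have c: "G x \<in> closed_ref_triangle" "G y \<in> closed_ref_triangle" unfolding triangle_eq by auto
  define \<alpha> \<beta> ds dt where "\<alpha> = fst (a1 - a3)" and "\<beta> = fst (a2 - a3)"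
    and "ds = fst (G y) - fst (G x)" and "dt = snd (G y) - snd (G x)"
  have b: "\<bar>ds\<bar> \<le> 1" "\<bar>dt\<bar> \<le> 1" using c by (auto simp: ds_def dt_def closed_ref_triangle_def)
  have "fst (F (G y)) - fst (F (G x)) = ds * \<alpha> + dt * \<beta>" "snd (F (G y)) - snd (F (G x)) = s * (ds * \<alpha> - dt * \<beta>)"
    unfolding fst_aff snd_aff s ds_def dt_def \<alpha>_def \<beta>_def by (simp_all add: algebra_simps)
  then have "ds * \<alpha> + dt * \<beta> = r" "s * (ds * \<alpha> - dt * \<beta>) = 0"
    unfolding inv by (simp_all add: y_def)
  then have h: "ds * \<alpha> = r / 2" "dt * \<beta> = r / 2" using s(3) by auto
  have "\<bar>ds * \<alpha>\<bar> \<le> 1 * \<bar>\<alpha>\<bar>" "\<bar>dt * \<beta>\<bar> \<le> 1 * \<bar>\<beta>\<bar>" unfolding abs_mult by (intro mult_right_mono b; simp)+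
  then have "r / 2 \<le> \<bar>\<alpha>\<bar>" "r / 2 \<le> \<bar>\<beta>\<bar>" using r(1) unfolding h by simp_all
  then show "r / 2 \<le> \<bar>fst (a1 - a3)\<bar>" "r / 2 \<le> \<bar>fst (a2 - a3)\<bar>" unfolding \<alpha>_def \<beta>_def .
qed

text \<open>The determinant is \<open>-2 s \<alpha> \<beta>\<close>, and the moduli of \<alpha> and
  \<beta> lie between \<open>\<rho> H / (2 \<sigma>)\<close> and \<open>H\<close>. This gives
  \<open>\<sigma> / \<rho>\<close> for the inverse map, whose entries have modulus
  \<open>1 / (2 |\<alpha>|)\<close> or \<open>1 / (2 |\<beta>|)\<close>, and
  \<open>(\<rho> / \<sigma>)^2 / 2\<close> for the determinant.\<close>

lemma admissible_bounds:
  assumes two: "two_type_I_edges T" and adm: "admissible_labelling T a1 a2 a3"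
    and \<sigma>: "0 < \<sigma>" and \<rho>: "0 < \<rho>" and h: "0 < h" "h < 1" and diam: "diameter T \<le> \<sigma> * h" and ball: "cball x (\<rho> * h) \<subseteq> T"
  shows "\<exists>z' e' f' \<kappa>. regular_triangle (\<sigma> / \<rho>) ((\<rho> / \<sigma>)\<^sup>2 / 2) \<sigma> a1 a2 a3 z' e' f' \<kappa> (diameter T)"
proof -
  have T: "T = convex hull {a1, a2, a3}" using adm by (simp add: admissible_labelling_def)
  define \<alpha> \<beta> H where "\<alpha> = fst (a1 - a3)" and "\<beta> = fst (a2 - a3)" and "H = diameter T"
  obtain s \<kappa> where s: "\<bar>s\<bar> = 1" "snd (a1 - a3) = s * \<alpha>" "snd (a2 - a3) = - s * \<beta>" and nz: "\<alpha> \<noteq> 0" "\<beta> \<noteq> 0"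
    and \<kappa>: "\<kappa> \<noteq> 0" "nbar a1 a2 = (\<kappa> / 2) *\<^sub>R (a1 - a3) + (\<kappa> / 2) *\<^sub>R (a2 - a3)"
    using admissible_geometry[OF two adm] unfolding \<alpha>_def \<beta>_def by blast
  have det: "det2 (a1 - a3) (a2 - a3) = - 2 * s * (\<alpha> * \<beta>)"
    unfolding det2_def s \<alpha>_def[symmetric] \<beta>_def[symmetric] by (simp add: algebra_simps)
  have absdet: "\<bar>det2 (a1 - a3) (a2 - a3)\<bar> = 2 * (\<bar>\<alpha>\<bar> * \<bar>\<beta>\<bar>)" unfolding det abs_mult using s(1) by simp
  have det0: "det2 (a1 - a3) (a2 - a3) \<noteq> 0" using absdet nz by auto
  obtain z' e' f' where inv: "\<And>x. aff z' e' f' (aff a3 (a1 - a3) (a2 - a3) x) = x" "\<And>x. aff a3 (a1 - a3) (a2 - a3) (aff z' e' f' x) = x"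
    "e' = (snd (a2 - a3) / det2 (a1 - a3) (a2 - a3), - snd (a1 - a3) / det2 (a1 - a3) (a2 - a3))"
    "f' = (- fst (a2 - a3) / det2 (a1 - a3) (a2 - a3), fst (a1 - a3) / det2 (a1 - a3) (a2 - a3))"
    "det2 e' f' = 1 / det2 (a1 - a3) (a2 - a3)"
    using aff_inverse[OF det0, of a3] by metis
  have tri: "affine_triangle a1 a2 a3 z' e' f'" using det0 inv by unfold_locales
  have bdd: "bounded T" unfolding T by (intro compact_imp_bounded compact_convex_hull) simp
  have inT: "a1 \<in> T" "a2 \<in> T" "a3 \<in> T" unfolding T by (auto intro: hull_inc)
  have up: "\<bar>\<alpha>\<bar> \<le> H" "\<bar>\<beta>\<bar> \<le> H"
    using diameter_bounded_bound[OF bdd inT(1,3)] diameter_bounded_bound[OF bdd inT(2,3)]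
      norm_fst_le[of "fst (a1 - a3)" "snd (a1 - a3)"] norm_fst_le[of "fst (a2 - a3)" "snd (a2 - a3)"]
    unfolding \<alpha>_def \<beta>_def H_def dist_norm prod.collapse by simp_all
  have H: "0 < H" using up(1) nz(1) by linarith
  have "H \<le> \<sigma> * 1" using diam h \<sigma> unfolding H_def by (intro order_trans[OF diam] mult_left_mono) auto
  then have Hs: "H \<le> \<sigma>" by simp
  have "s \<noteq> 0" using s(1) by auto
  note lo = affine_triangle.edge_length_lower_bound[OF tri s(2,3)[unfolded \<alpha>_def \<beta>_def] this mult_pos_pos[OF \<rho> h(1)] ball[unfolded T], folded \<alpha>_def \<beta>_def]
  have "\<rho> / \<sigma> * H \<le> \<rho> / \<sigma> * (\<sigma> * h)" using diam \<rho> \<sigma> unfolding H_def by (intro mult_left_mono) auto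
  then have "\<rho> / \<sigma> * H \<le> \<rho> * h" using \<sigma> by simp
  then have half: "\<rho> / \<sigma> * H / 2 \<le> \<rho> * h / 2" by (rule divide_right_mono) simp
  note lo' = order_trans[OF half lo(1)] order_trans[OF half lo(2)]
  have pos: "0 < \<rho> / \<sigma> * H / 2" using \<rho> \<sigma> H by simp
  have inv_le: "1 / (2 * t) \<le> \<sigma> / \<rho> / H" if "\<rho> / \<sigma> * H / 2 \<le> t" for t
  proof -
    have "1 / (2 * t) \<le> 1 / (2 * u)" if "u \<le> t" "0 < u" for t u :: real
      using that by (intro divide_left_mono mult_pos_pos) auto
    from this[OF that pos] have "1 / (2 * t) \<le> 1 / (2 * (\<rho> / \<sigma> * H / 2))" .
    also have "\<dots> = \<sigma> / \<rho> / H" using \<rho> \<sigma> H by simp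
    finally show ?thesis .
  qed
  have ent: "\<bar>\<beta> / det2 (a1 - a3) (a2 - a3)\<bar> = 1 / (2 * \<bar>\<alpha>\<bar>)" "\<bar>\<alpha> / det2 (a1 - a3) (a2 - a3)\<bar> = 1 / (2 * \<bar>\<beta>\<bar>)"
    unfolding abs_divide absdet using nz by simp_all
  have ent': "\<bar>fst e'\<bar> = 1 / (2 * \<bar>\<alpha>\<bar>)" "\<bar>snd e'\<bar> = 1 / (2 * \<bar>\<beta>\<bar>)" "\<bar>fst f'\<bar> = 1 / (2 * \<bar>\<alpha>\<bar>)" "\<bar>snd f'\<bar> = 1 / (2 * \<bar>\<beta>\<bar>)"
    unfolding inv(3,4) fst_conv snd_conv s(2,3) \<alpha>_def[symmetric] \<beta>_def[symmetric] ent[symmetric]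
    using s(1) by (simp_all add: abs_mult)
  have e': "\<bar>fst e'\<bar> \<le> \<sigma> / \<rho> / H" "\<bar>snd e'\<bar> \<le> \<sigma> / \<rho> / H" "\<bar>fst f'\<bar> \<le> \<sigma> / \<rho> / H" "\<bar>snd f'\<bar> \<le> \<sigma> / \<rho> / H"
    unfolding ent' by (intro inv_le lo')+
  have snds: "\<bar>snd (a1 - a3)\<bar> \<le> H" "\<bar>snd (a2 - a3)\<bar> \<le> H"
    unfolding s(2,3) abs_mult abs_minus_cancel s(1) using up by simp_all
  have "2 * ((\<rho> / \<sigma> * H / 2) * (\<rho> / \<sigma> * H / 2)) \<le> \<bar>det2 (a1 - a3) (a2 - a3)\<bar>"
    unfolding absdet using pos by (intro mult_left_mono mult_mono lo') auto
  then have D1: "(\<rho> / \<sigma>)\<^sup>2 / 2 * H\<^sup>2 \<le> \<bar>det2 (a1 - a3) (a2 - a3)\<bar>"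
    by (simp add: power2_eq_square mult_ac)
  have D2: "\<bar>det2 (a1 - a3) (a2 - a3)\<bar> \<le> 2 * H\<^sup>2"
    unfolding absdet power2_eq_square using H by (intro mult_left_mono mult_mono up) auto
  show ?thesis
    unfolding regular_triangle_def H_def[symmetric]
    by (intro exI[of _ z'] exI[of _ e'] exI[of _ f'] exI[of _ \<kappa>] conjI tri \<kappa> H Hs snds e' D1 D2
        up[unfolded \<alpha>_def \<beta>_def])
qed

text \<open>The embedding is assumed triangle by triangle, with a constant that may vary; one
  constant for all triangles is part of the conclusion. Membership of the error in the target space
  is asserted along with the bound, because the norm is meaningful only there.\<close>

theorem theorem3p13:
  fixes \<Omega> :: "point set" and \<T> :: "real \<Rightarrow> point set set"
    and k m :: nat and p q :: ereal
  assumes "open \<Omega>" "connected \<Omega>" "bounded \<Omega>" "\<Omega> \<noteq> {}"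
    and "\<And>h. h \<in> {0<..<1} \<Longrightarrow> triangulation_of \<Omega> (\<T> h)"
    and "quasi_uniform \<T>"
    and "\<And>h T. h \<in> {0<..<1} \<Longrightarrow> T \<in> \<T> h \<Longrightarrow> two_type_I_edges T"
    and "k \<in> {3, 4}"
    and "1 \<le> p" "1 \<le> q"
    and "\<And>h T. h \<in> {0<..<1} \<Longrightarrow> T \<in> \<T> h \<Longrightarrow> sobolev_embedding (k + 1) p m q (interior T)"
  shows "\<exists>C>0. \<forall>h\<in>{0<..<1}. \<forall>T\<in>\<T> h. \<forall>a1 a2 a3. admissible_labelling T a1 a2 a3 \<longrightarrow>
    (\<forall>v\<in>sobolev_space (k + 1) p (interior T).
       (\<lambda>x. v x - interpolant k a1 a2 a3 v x) \<in> sobolev_space m q (interior T) \<and>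
       sobolev_norm m q (interior T) (\<lambda>x. v x - interpolant k a1 a2 a3 v x)
         \<le> C * diameter T powr (real k + 1 - real m + real_of_ereal (2 / q) - real_of_ereal (2 / p))
             * sobolev_norm (k + 1) p (interior T) v)"
proof (cases "\<exists>h\<in>{0<..<1}. \<exists>T\<in>\<T> h. \<exists>a1 a2 a3. admissible_labelling T a1 a2 a3")
  \<comment> \<open>Without an admissibly labelled triangle the estimate is vacuous, and any
    positive constant will do.\<close>
  case False
  then show ?thesis by (intro exI[of _ 1]) auto
next
  case True
  then obtain h0 T0 b1 b2 b3 where T0: "h0 \<in> {0<..<1}" "T0 \<in> \<T> h0" "admissible_labelling T0 b1 b2 b3" by blast
  obtain \<sigma> \<rho> where pos: "0 < \<sigma>" "0 < \<rho>"
    and reg: "\<And>h T. h \<in> {0<..<1} \<Longrightarrow> T \<in> \<T> h \<Longrightarrow> diameter T \<le> \<sigma> * h \<and> (\<exists>x. cball x (\<rho> * h) \<subseteq> T)"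
    using assms(6) unfolding quasi_uniform_def by blast
  note p = assms(9) and q = assms(10)
  have bounds: "\<exists>z' e' f' \<kappa>. regular_triangle (\<sigma> / \<rho>) ((\<rho> / \<sigma>)\<^sup>2 / 2) \<sigma> a1 a2 a3 z' e' f' \<kappa> (diameter T)"
    if h: "h \<in> {0<..<1}" and T: "T \<in> \<T> h" and adm: "admissible_labelling T a1 a2 a3" for h T a1 a2 a3
  proof -
    obtain x where x: "cball x (\<rho> * h) \<subseteq> T" using reg[OF h T] by blast
    show ?thesis
      by (rule admissible_bounds[OF assms(7)[OF h T] adm pos _ _ _ x]) (use h reg[OF h T] in auto)
  qed
  obtain z0 e0 f0 where A0: "affine_triangle b1 b2 b3 z0 e0 f0"
    using bounds[OF T0] unfolding regular_triangle_def by blast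
  have T0_eq: "T0 = convex hull {b1, b2, b3}" using T0(3) by (simp add: admissible_labelling_def)
  \<comment> \<open>The embedding on the one triangle \<open>T0\<close> is moved to the reference
    triangle; its constant there serves for the whole family.\<close>
  have emb: "sobolev_embedding (Suc k) p m q ref_triangle"
    using sobolev_embedding_aff[OF p q affine_triangle.det[OF A0] open_interior assms(11)[OF T0(1,2)], of b3]
    unfolding T0_eq affine_triangle.F_vimage[OF A0] by simp
  have c: "0 \<le> \<sigma> / \<rho>" "0 < (\<rho> / \<sigma>)\<^sup>2 / 2" "0 \<le> \<sigma>" using pos by simp_all
  obtain C where C: "0 < C" "\<forall>a1 a2 a3 z' e' f' \<kappa> H v. regular_triangle (\<sigma> / \<rho>) ((\<rho> / \<sigma>)\<^sup>2 / 2) \<sigma> a1 a2 a3 z' e' f' \<kappa> H \<longrightarrow>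
    v \<in> sobolev_space (Suc k) p (interior (convex hull {a1, a2, a3})) \<longrightarrow>
    (\<lambda>x. v x - interpolant k a1 a2 a3 v x) \<in> sobolev_space m q (interior (convex hull {a1, a2, a3})) \<and>
    sobolev_norm m q (interior (convex hull {a1, a2, a3})) (\<lambda>x. v x - interpolant k a1 a2 a3 v x)
      \<le> C * H powr (real k + 1 - real m + real_of_ereal (2 / q) - real_of_ereal (2 / p))
          * sobolev_norm (Suc k) p (interior (convex hull {a1, a2, a3})) v"
    using interpolation_error[OF p q assms(8) emb c] by (elim exE conjE) (rule that)
  show ?thesis
  proof (intro exI[of _ C] conjI C(1) ballI allI impI)
    fix h T a1 a2 a3 v
    assume h: "h \<in> {0<..<1}" and T: "T \<in> \<T> h" and adm: "admissible_labelling T a1 a2 a3" and v: "v \<in> sobolev_space (k + 1) p (interior T)"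
    have T_eq: "T = convex hull {a1, a2, a3}" using adm by (simp add: admissible_labelling_def)
    obtain z' e' f' \<kappa> where b: "regular_triangle (\<sigma> / \<rho>) ((\<rho> / \<sigma>)\<^sup>2 / 2) \<sigma> a1 a2 a3 z' e' f' \<kappa> (diameter T)"
      using bounds[OF h T adm] by blast
    have "Suc k = k + 1" by simp
    note est = C(2)[rule_format, OF b v[unfolded T_eq, folded \<open>Suc k = k + 1\<close>], unfolded \<open>Suc k = k + 1\<close>, folded T_eq]
    show "(\<lambda>x. v x - interpolant k a1 a2 a3 v x) \<in> sobolev_space m q (interior T)"
      by (rule est[THEN conjunct1])
    show "sobolev_norm m q (interior T) (\<lambda>x. v x - interpolant k a1 a2 a3 v x)
         \<le> C * diameter T powr (real k + 1 - real m + real_of_ereal (2 / q) - real_of_ereal (2 / p))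
             * sobolev_norm (k + 1) p (interior T) v"
      by (rule est[THEN conjunct2])
  qed
qed

end
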